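(* Let $m\in\mathbb{N}$ and let $\xi,\zeta$ be Young functions such that the complementary function $\tilde\xi$ is a Young function having an upper type $r$ and a lower type $s$, with $1<s<r<2$, and such that $\tilde\xi^{-1}(\lambda)\zeta^{-1}(\lambda)(\log\lambda)^m\lesssim\lambda$ for all $\lambda\ge\lambda_0$, for some $\lambda_0\ge e$. Let $T$ be a linear operator bounded on $L^2(\mathbb{R}^n)$ with the representation $Tf(x)=\int K(x-y)f(y)\,dy$ for $f\in L^2$ with compact support and $x\notin\mathrm{supp}f$, whose kernel satisfies $K\in H_\zeta\cap H_{\xi,m}$. Assume there exist $p$ with $r<p<r'$ and Young functions $\eta,\varphi$ such that $\eta\in B_{p'}$ and $\eta^{-1}(\lambda)\varphi^{-1}(\lambda)\lesssim\tilde\xi^{-1}(\lambda)$ for $\lambda\ge\lambda_0$. Let $u$ be a nonnegative locally integrable function, $q=1+(p-1)/r$, $v\in\mathrm{RH}_\infty\cap A_q$, and $b\in\mathrm{BMO}$. Then there is $C>0$ such that \[ uv\left(\left\{x\in\mathbb{R}^n: \frac{|T_b^m(fv)(x)|}{v(x)}>t\right\}\right)\le C\int_{\mathbb{R}^n}\Phi_m\!\left(\|b\|_{\mathrm{BMO}}^m\frac{|f(x)|}{t}\right)M_{\varphi_p,\,v^{1-q'}}u(x)\,M(\Psi\circ v)(x)\,dx \] for every $t>0$ and every (bounded, compactly supported) $f$, where $\varphi_p(\lambda)=\varphi(\lambda^{1/p})$ and $\Psi$ is defined with these $p,q$.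
   Context: Here $uv(E)=\int_E uv$. Weights, cubes, $A_q$, $\mathrm{RH}_\infty$, BMO: $w\in A_q$ iff $\sup_Q(\frac1{|Q|}\int_Qw)(\frac1{|Q|}\int_Qw^{1-q'})^{q-1}<\infty$; $w\in\mathrm{RH}_\infty$ iff $\sup_Qw\le\frac{C}{|Q|}\int_Qw$; $\|b\|_{\mathrm{BMO}}=\sup_Q\frac1{|Q|}\int_Q|b-b_Q|$. Commutators: $T_b^0=T$, $T_b^kf=bT_b^{k-1}f-T_b^{k-1}(bf)$. A Young function is convex, strictly increasing, $\varphi(0)=0$, $\varphi(t)\to\infty$; its complementary function is $\tilde\varphi(t)=\sup_{s\ge0}(ts-\varphi(s))$. $\varphi$ has upper type $a$ if $\varphi(st)\le Cs^a\varphi(t)$ for all $s\ge1,t\ge0$, and lower type $a$ if the same holds for $0\le s\le1,t\ge0$. $\eta\in B_{p'}$ means $\int_c^\infty \frac{\eta(t)}{t^{p'}}\frac{dt}{t}<\infty$ for some $c>0$. Luxemburg averages: $\|f\|_{\varphi,Q,w}=\inf\{\lambda>0:\frac1{w(Q)}\int_Q\varphi(|f|/\lambda)w\le1\}$ (with $w=1$ written $\|f\|_{\varphi,Q}$, and the same definition over balls), $M_{\varphi,w}f(x)=\sup_{Q\ni x}\|f\|_{\varphi,Q,w}$, $M$ the Hardy–Littlewood maximal operator. $\|f\|_{\varphi,|x|\sim s}=\|f\mathcal{X}_{\{s<|x|\le2s\}}\|_{\varphi,B(0,2s)}$. $K\in H_{\varphi,m}$ ($m\ge0$) means there are $c\ge1$,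 $C>0$ with $\sum_{k=1}^\infty(2^kR)^nk^m\|K(\cdot-y)-K(\cdot)\|_{\varphi,|x|\sim2^kR}\le C$ for all $y\in\mathbb{R}^n$ and $R>c|y|$; $H_\varphi=H_{\varphi,0}$. $\Phi_m(\lambda)=\lambda(1+\log^+\lambda)^m$. For $p>q$, $\Psi(\lambda)=\lambda^{p'+1-q'}\mathcal{X}_{[0,1)}(\lambda)+\lambda^{p'}\mathcal{X}_{[1,\infty)}(\lambda)$. *)

theory Defs
  imports "HOL-Analysis.Analysis"
begin

definition is_cube :: "'a::euclidean_space set \<Rightarrow> bool" where
  "is_cube Q \<longleftrightarrow> (\<exists>x h. h > 0 \<and> Q = cbox x (x + h *\<^sub>R One))"

definition avg :: "'a::euclidean_space set \<Rightarrow> ('a \<Rightarrow> real) \<Rightarrow> ennreal" where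
  "avg Q g = (\<integral>\<^sup>+x\<in>Q. ennreal (g x) \<partial>lebesgue) / emeasure lebesgue Q"

definition locint :: "('a::euclidean_space \<Rightarrow> real) \<Rightarrow> bool" where
  "locint f \<longleftrightarrow> f \<in> borel_measurable lebesgue \<and> (\<forall>K. compact K \<longrightarrow> set_integrable lebesgue K f)"

definition weight :: "('a::euclidean_space \<Rightarrow> real) \<Rightarrow> bool" where
  "weight w \<longleftrightarrow> locint w \<and> (\<forall>x. 0 \<le> w x) \<and> (AE x in lebesgue. 0 < w x)"

definition Aq :: "real \<Rightarrow> ('a::euclidean_space \<Rightarrow> real) \<Rightarrow> bool" where
  "Aq q w \<longleftrightarrow> (\<exists>C. \<forall>Q. is_cube Q \<longrightarrow>
      avg Q w < \<infinity> \<and> avg Q (\<lambda>x. w x powr (1 - q/(q-1))) < \<infinity> \<and>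
      enn2real (avg Q w) * enn2real (avg Q (\<lambda>x. w x powr (1 - q/(q-1)))) powr (q - 1) \<le> C)"

definition RHinf :: "('a::euclidean_space \<Rightarrow> real) \<Rightarrow> bool" where
  "RHinf w \<longleftrightarrow> (\<exists>C::real. \<forall>Q. is_cube Q \<longrightarrow>
      (AE x in lebesgue. x \<in> Q \<longrightarrow> ennreal (w x) \<le> ennreal C * avg Q w))"

definition bmo_norm :: "('a::euclidean_space \<Rightarrow> real) \<Rightarrow> ennreal" where
  "bmo_norm b = (SUP Q\<in>{Q. is_cube Q}.
      avg Q (\<lambda>x. \<bar>b x - (LINT y:Q|lebesgue. b y) / measure lebesgue Q\<bar>))"

definition in_BMO :: "('a::euclidean_space \<Rightarrow> real) \<Rightarrow> bool" where
  "in_BMO b \<longleftrightarrow> locint b \<and> bmo_norm b < \<infinity>"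

definition young :: "(real \<Rightarrow> real) \<Rightarrow> bool" where
  "young \<phi> \<longleftrightarrow> convex_on {0..} \<phi> \<and> strict_mono_on {0..} \<phi> \<and> \<phi> 0 = 0 \<and> filterlim \<phi> at_top at_top"

definition ytilde :: "(real \<Rightarrow> real) \<Rightarrow> real \<Rightarrow> ereal" where
  "ytilde \<phi> t = (SUP s\<in>{0..}. ereal (t * s - \<phi> s))"

definition yinv :: "(real \<Rightarrow> real) \<Rightarrow> real \<Rightarrow> real" where
  "yinv \<phi> y = the_inv_into {0..} \<phi> y"

definition upper_type :: "(real \<Rightarrow> real) \<Rightarrow> real \<Rightarrow> bool" where
  "upper_type \<phi> a \<longleftrightarrow> (\<exists>C. \<forall>s t. 1 \<le> s \<longrightarrow> 0 \<le> t \<longrightarrow> \<phi> (s * t) \<le> C * s powr a * \<phi> t)"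

definition lower_type :: "(real \<Rightarrow> real) \<Rightarrow> real \<Rightarrow> bool" where
  "lower_type \<phi> a \<longleftrightarrow> (\<exists>C. \<forall>s t. 0 \<le> s \<longrightarrow> s \<le> 1 \<longrightarrow> 0 \<le> t \<longrightarrow> \<phi> (s * t) \<le> C * s powr a * \<phi> t)"

definition B_cond :: "real \<Rightarrow> (real \<Rightarrow> real) \<Rightarrow> bool" where
  "B_cond p \<eta> \<longleftrightarrow> (\<exists>c>0. (\<integral>\<^sup>+t\<in>{c..}. ennreal (\<eta> t / t powr p / t) \<partial>lborel) < \<infinity>)"

(* \<parallel>f\<parallel>_{\<phi>,E,w}; the normalisation 1/w(E) is moved to the right-hand side *)
definition lux :: "(real \<Rightarrow> real) \<Rightarrow> ('a::euclidean_space \<Rightarrow> real) \<Rightarrow> 'a set \<Rightarrow> ('a \<Rightarrow> real) \<Rightarrow> ennreal" where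
  "lux \<phi> w E f = (INF lam\<in>{lam::real. 0 < lam \<and>
       (\<integral>\<^sup>+x\<in>E. ennreal (\<phi> (\<bar>f x\<bar> / lam) * w x) \<partial>lebesgue) \<le> (\<integral>\<^sup>+x\<in>E. ennreal (w x) \<partial>lebesgue)}.
       ennreal lam)"

definition Mlux :: "(real \<Rightarrow> real) \<Rightarrow> ('a::euclidean_space \<Rightarrow> real) \<Rightarrow> ('a \<Rightarrow> real) \<Rightarrow> 'a \<Rightarrow> ennreal" where
  "Mlux \<phi> w f x = (SUP Q\<in>{Q. is_cube Q \<and> x \<in> Q}. lux \<phi> w Q f)"

definition Mmax :: "('a::euclidean_space \<Rightarrow> real) \<Rightarrow> 'a \<Rightarrow> ennreal" where
  "Mmax g x = (SUP Q\<in>{Q. is_cube Q \<and> x \<in> Q}. avg Q (\<lambda>y. \<bar>g y\<bar>))"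

definition lux_ann :: "(real \<Rightarrow> real) \<Rightarrow> real \<Rightarrow> ('a::euclidean_space \<Rightarrow> real) \<Rightarrow> ennreal" where
  "lux_ann \<phi> s f = lux \<phi> (\<lambda>_. 1) (ball 0 (2 * s))
       (\<lambda>x. indicator {x. s < norm x \<and> norm x \<le> 2 * s} x * f x)"

definition hormander :: "(real \<Rightarrow> real) \<Rightarrow> nat \<Rightarrow> ('a::euclidean_space \<Rightarrow> real) \<Rightarrow> bool" where
  "hormander \<phi> m K \<longleftrightarrow> (\<exists>c\<ge>1. \<exists>C>0. \<forall>y R. R > c * norm y \<longrightarrow>
      (\<Sum>k. ennreal ((2 ^ Suc k * R) ^ DIM('a) * real (Suc k) ^ m) *
             lux_ann \<phi> (2 ^ Suc k * R) (\<lambda>x. K (x - y) - K x)) \<le> ennreal C)"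

definition L2 :: "('a::euclidean_space \<Rightarrow> real) \<Rightarrow> bool" where
  "L2 f \<longleftrightarrow> f \<in> borel_measurable lebesgue \<and> integrable lebesgue (\<lambda>x. (f x)\<^sup>2)"

definition supp :: "('a::euclidean_space \<Rightarrow> real) \<Rightarrow> 'a set" where
  "supp f = closure {x. f x \<noteq> 0}"

fun comm :: "(('a \<Rightarrow> real) \<Rightarrow> ('a \<Rightarrow> real)) \<Rightarrow> ('a \<Rightarrow> real) \<Rightarrow> nat \<Rightarrow> ('a \<Rightarrow> real) \<Rightarrow> ('a \<Rightarrow> real)" where
  "comm T b 0 f = T f"
| "comm T b (Suc k) f = (\<lambda>x. b x * comm T b k f x - comm T b k (\<lambda>y. b y * f y) x)"

definition Phi :: "nat \<Rightarrow> real \<Rightarrow> real" where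
  "Phi m lam = lam * (1 + max 0 (ln lam)) ^ m"

definition Psi :: "real \<Rightarrow> real \<Rightarrow> real \<Rightarrow> real" where
  "Psi p q lam = (if lam < 1 then lam powr (p/(p-1) + 1 - q/(q-1)) else lam powr (p/(p-1)))"

end

theory Submission
 imports Defs
begin

text \<open>
Geometry is reduced to dyadic cells and their threefold dilates. The Hoermander condition of order \<open>m\<close>, paired with the exponential
integrability of BMO functions, controls kernel differences against \<open>\<bar>b - c\<bar>\<^sup>i u\<close> by a Luxemburg maximal function of \<open>u\<close>.

Strong bound: \<open>\<integral>\<bar>T\<^sub>b\<^sup>k F\<bar>\<^sup>p\<^sup>0 U \<le> C \<integral>\<bar>F\<bar>\<^sup>p\<^sup>0 (M U\<^sup>\<kappa>)\<^sup>1\<^sup>/\<^sup>\<kappa>\<close> for \<open>p0 > r\<close>, since the oscillation of \<open>T\<^sub>b\<^sup>k F\<close> is dominated by the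
\<open>L\<^sup>a\<close> maximal function (\<open>r < a < p0\<close>) of \<open>F\<close> and the lower commutators, and \<open>(M U\<^sup>\<kappa>)\<^sup>1\<^sup>/\<^sup>\<kappa>\<close> is an \<open>A\<^sub>1\<close> weight (Fefferman-Stein).

Weak bound: decompose \<open>f\<close> at height \<open>t\<close> relative to \<open>v dx\<close>. The good part is covered by the strong bound with \<open>U = u v\<^sup>1\<^sup>-\<^sup>p\<^sup>0\<close>, where
\<open>(1 - p0) \<kappa> = 1 - q'\<close> turns \<open>U\<^sup>\<kappa>\<close> into an average against the \<open>A\<^sub>1\<close> weight \<open>w = v\<^sup>1\<^sup>-\<^sup>q\<^sup>'\<close>. The bad part is expanded by the binomial formula:
the kernel controls its top-order term, induction on \<open>m\<close> the rest. Truncation and Fatou's lemma remove the boundedness of \<open>b\<close>.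
\<close>

text \<open>The obstacle is that \<open>u\<close> is arbitrary, so an average of \<open>f\<close>
  over a stopping cell cannot be traded against the maximal function of \<open>u\<close> unless the
  latter is constant there. Hence \<open>u\<close> is deleted from a union of dilated stopping
  cells: the deleted part is paid for by the stopping condition, and the maximal function of the
  remainder is constant on every stopping cell. Two exponents make the strong bound available. The
  lower type \<open>s > 1\<close> of \<open>\<xi>t\<close> and the \<open>B\<close> condition at
  \<open>p' = p / (p - 1)\<close> force \<open>\<phi>(x powr (1/p))\<close> to dominate a power
  \<open>\<kappa> > 1\<close>, and \<open>\<kappa>\<close> can be capped at \<open>r\<close>. Then
  \<open>p0\<close> is determined by \<open>(1 - p0) \<kappa> = 1 - q'\<close>, and
  \<open>p0 > r\<close> follows from \<open>p < r'\<close> and \<open>\<kappa> \<le> r\<close>. All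
  powers of a BMO oscillation are integrable, so pairing kernel, oscillation and weight comes down
  to \<open>\<xi>t(x y / C) \<le> \<theta>(x) + y^N + C\<close>. For
  \<open>\<theta>(x) = x^a\<close> with \<open>a > r\<close> this follows from the upper type
  \<open>r\<close> and yields the unweighted estimates; for
  \<open>\<theta>(x) = \<phi>(x powr (1/p))\<close> it yields the final one.\<close>

abbreviation "en == ennreal"
abbreviation "LM == borel_measurable lebesgue"
abbreviation "vol A == emeasure lebesgue A"
abbreviation "NI f == \<integral>\<^sup>+x. f x \<partial>lebesgue"
abbreviation "SI A f == \<integral>\<^sup>+x\<in>A. f x \<partial>lebesgue"
abbreviation "RI f == \<integral>\<^sup>+x. en (f x) \<partial>lebesgue"
abbreviation "RSI A f == \<integral>\<^sup>+x\<in>A. en (f x) \<partial>lebesgue"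

section \<open>Countable disjoint families and set integrals\<close>

text \<open>The sequence is padded with empty sets, so that finite and infinite families are treated
  alike by countable additivity.\<close>

lemma countable_disjoint_seq:
 assumes "countable S" "disjoint S"
 shows "EX Q::nat => 'a set. disjoint_family Q & (\<Union>n. Q n) = \<Union>S & (ALL n. Q n = {} | Q n : S)"
proof -
 obtain f :: "'a set => nat" where f: "inj_on f S"
  using assms(1) by (auto simp: countable_def)
 define Q where "Q n = (if n : f ` S then inv_into S f n else {})" for n
 have 1: "Q n = {} | Q n : S" for n
  by (auto simp: Q_def inv_into_into)
 have 2: "Q (f A) = A" if "A : S" for A
  using that f by (auto simp: Q_def)
 have "disjoint_family Q"
  unfolding disjoint_family_on_def
 proof (intro ballI impI)
  fix m n :: nat assume "m ~= n"
  show "Q m \<inter> Q n = {}"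
  proof (cases "m : f ` S & n : f ` S")
   case True
   then obtain A B where AB: "A : S" "B : S" "m = f A" "n = f B" by auto
   hence "A ~= B" using \<open>m ~= n\<close> by auto
   hence "A \<inter> B = {}" using assms(2) AB by (auto simp: disjoint_def)
   thus ?thesis using 2 AB by simp
  qed (auto simp: Q_def)
 qed
 moreover have "(\<Union>n. Q n) = \<Union>S"
  using 1 2 by blast
 ultimately show ?thesis using 1 by blast
qed

lemma set_nn_integral_mono_partition:
 assumes "countable S" "disjoint S" and S: "!!A. A : S ==> A : sets M"
  and [measurable]: "f : borel_measurable M" "g : borel_measurable M"
  and le: "!!A. A : S ==> (\<integral>\<^sup>+x\<in>A. f x \<partial>M) <= (\<integral>\<^sup>+x\<in>A. g x \<partial>M)"
 shows "(\<integral>\<^sup>+x\<in>\<Union>S. f x \<partial>M) <= (\<integral>\<^sup>+x\<in>\<Union>S. g x \<partial>M)"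
proof -
 obtain Q :: "nat => 'a set" where Q: "disjoint_family Q" "(\<Union>n. Q n) = \<Union>S" "!!n. Q n = {} | Q n : S"
  using countable_disjoint_seq[OF assms(1,2)] by blast
 have [measurable]: "Q n : sets M" for n using Q(3)[of n] S by auto
 have "(\<integral>\<^sup>+x\<in>Q n. f x \<partial>M) <= (\<integral>\<^sup>+x\<in>Q n. g x \<partial>M)" for n
  using Q(3)[of n] le by auto
 thus ?thesis
  unfolding Q(2)[symmetric]
  by (subst (1 2) nn_integral_disjoint_family) (auto intro!: suminf_le simp: Q(1))
qed

lemma set_nn_integral_UN_le:
 fixes B :: "nat => 'a set"
 assumes [measurable]: "f : borel_measurable M" "!!n. B n : sets M"
 shows "(\<integral>\<^sup>+x\<in>(\<Union>n. B n). f x \<partial>M) <= (\<Sum>n. \<integral>\<^sup>+x\<in>B n. f x \<partial>M)"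
proof -
 have "(\<integral>\<^sup>+x\<in>(\<Union>n. B n). f x \<partial>M) = emeasure (density M f) (\<Union>n. B n)"
  by (simp add: emeasure_density)
 also have "... <= (\<Sum>n. emeasure (density M f) (B n))"
  by (rule emeasure_subadditive_countably) (auto simp: assms)
 also have "... = (\<Sum>n. \<integral>\<^sup>+x\<in>B n. f x \<partial>M)"
  by (simp add: emeasure_density)
 finally show ?thesis .
qed

text \<open>The enlarged sets \<open>E A\<close> may overlap, hence subadditivity on the left;
  disjointness is used only on the right, where the integrals of \<open>g\<close> add up.\<close>

lemma set_nn_integral_Union_le_partition:
 assumes "countable S" "disjoint S" and S: "!!A. A : S ==> A : sets M"
  and [measurable]: "f : borel_measurable M" "g : borel_measurable M"
  and E: "!!A. A : S ==> E A : sets M"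
  and le: "!!A. A : S ==> (\<integral>\<^sup>+x\<in>E A. f x \<partial>M) <= (\<integral>\<^sup>+x\<in>A. g x \<partial>M)"
 shows "(\<integral>\<^sup>+x\<in>\<Union>(E ` S). f x \<partial>M) <= (\<integral>\<^sup>+x\<in>\<Union>S. g x \<partial>M)"
proof -
 obtain Q :: "nat => 'a set" where Q: "disjoint_family Q" "(\<Union>n. Q n) = \<Union>S" "!!n. Q n = {} | Q n : S"
  using countable_disjoint_seq[OF assms(1,2)] by blast
 define E' where "E' n = (if Q n : S then E (Q n) else {})" for n
 have [measurable]: "Q n : sets M" "E' n : sets M" for n using Q(3)[of n] S E by (auto simp: E'_def)
 let ?B = "\<Sum>n. \<integral>\<^sup>+x\<in>E' n. f x \<partial>M"
 have "(\<integral>\<^sup>+x\<in>E' n. f x \<partial>M) <= (\<integral>\<^sup>+x\<in>Q n. g x \<partial>M)" for n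
  using Q(3)[of n] le by (auto simp: E'_def)
 hence le': "?B <= (\<Sum>n. \<integral>\<^sup>+x\<in>Q n. g x \<partial>M)"
  by (intro suminf_le) auto
 let ?A = "\<Union>n. E' n"
 have ae: "x : ?A" if "x : E A" "A : S" "A ~= {}" for x A
 proof -
  from \<open>A ~= {}\<close> obtain z where "z : A" by auto
  with Q(2) that obtain n where n: "z : Q n" by blast
  hence "Q n : S" using Q(3) by auto
  hence "Q n = A" using \<open>z : A\<close> n that assms(2) by (auto simp: disjoint_def)
  thus ?thesis using that by (auto simp: E'_def intro!: exI[of _ n])
 qed
 have sub: "\<Union>(E ` S) <= ?A \<union> (if {} : S then E {} else {})"
 proof
  fix x assume "x : \<Union>(E ` S)"
  then obtain A where A: "A : S" "x : E A" by auto
  show "x : ?A \<union> (if {} : S then E {} else {})"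
  proof (cases "A = {}")
   case True thus ?thesis using A by auto
  next
   case False thus ?thesis using ae[OF A(2,1)] by auto
  qed
 qed
 let ?C = "if {} : S then E {} else {}"
 have m0: "?C : sets M" using E by auto
 \<comment> \<open>The empty set, if it belongs to \<open>S\<close>, cannot be located through one
   of its points; \<open>le\<close> shows that its enlargement carries no mass.\<close>
 have z: "(\<integral>\<^sup>+x\<in>(if {} : S then E {} else {}). f x \<partial>M) = 0"
  using le[of "{}"] by auto
 have "(\<integral>\<^sup>+x\<in>\<Union>(E ` S). f x \<partial>M) <= (\<integral>\<^sup>+x\<in>?A \<union> (if {} : S then E {} else {}). f x \<partial>M)"
  using sub by (intro nn_integral_mono) (auto simp: indicator_def)
 also have "... <= (\<integral>\<^sup>+x. f x * indicator ?A x + f x * indicator ?C x \<partial>M)"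
  by (intro nn_integral_mono) (auto simp: indicator_def)
 also have "... = (\<integral>\<^sup>+x\<in>(\<Union>n. E' n). f x \<partial>M)"
  using z m0 by (subst nn_integral_add) auto
 also have "... <= ?B"
  by (rule set_nn_integral_UN_le) auto
 also have "... <= (\<integral>\<^sup>+x\<in>\<Union>S. g x \<partial>M)"
  using le' unfolding Q(2)[symmetric]
  by (subst nn_integral_disjoint_family) (auto simp: Q(1))
 finally show ?thesis .
qed

section \<open>Dyadic cells and their threefold neighbourhoods\<close>

definition fl :: "int => 'a::euclidean_space => 'a => int" where
 "fl k x i = \<lfloor>2 powi k * (x \<bullet> i)\<rfloor>"

text \<open>Cells are classes of equal integer labels, so nestedness becomes a statement about
  \<open>div 2\<close>. The side length is \<open>2 powi (- k)\<close>: larger \<open>k\<close>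
  means finer cells, and \<open>k - 1\<close> is the parent scale.\<close>

definition cell :: "int => 'a::euclidean_space => 'a set" where
 "cell k x = {y. \<forall>i\<in>Basis. fl k y i = fl k x i}"

text \<open>The union of the \<open>3^n\<close> cells of scale \<open>k\<close> that touch the cell
  of \<open>x\<close> or equal it. It stands in for a concentric cube and, like the cell, depends on
  the centre only through its cell.\<close>

definition nbhd :: "int => 'a::euclidean_space => 'a set" where
 "nbhd k x = {y. \<forall>i\<in>Basis. \<bar>fl k y i - fl k x i\<bar> <= 1}"

lemma fl_half: "fl (k - 1) x i = fl k x i div 2"
proof -
 have "fl (k - 1) x i = \<lfloor>2 powi k * (x \<bullet> i) / real_of_int 2\<rfloor>"
  by (simp add: fl_def power_int_diff field_simps)
 also have "... = fl k x i div 2"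
  unfolding fl_def by (rule floor_divide_real_eq_div) simp
 finally show ?thesis .
qed

lemma in_cell_self [simp, intro]: "x : cell k x"
 by (simp add: cell_def)

lemma in_nbhd_self [simp, intro]: "x : nbhd k x"
 by (simp add: nbhd_def)

lemma cell_eq: "y : cell k x ==> cell k y = cell k x"
 by (auto simp: cell_def)

lemma nbhd_eq: "y : cell k x ==> nbhd k y = nbhd k x"
 by (auto simp: cell_def nbhd_def)

lemma nbhd_sym: "y : nbhd k x \<longleftrightarrow> x : nbhd k y"
 by (auto simp: nbhd_def abs_minus_commute)

lemma cell_subset_nbhd: "y : nbhd k x ==> cell k y <= nbhd k x"
 by (auto simp: cell_def nbhd_def)

lemma cell_le_nbhd: "cell k x <= nbhd k x"
 by (rule cell_subset_nbhd) simp

lemma cell_disjoint: "cell k x \<inter> cell k y ~= {} ==> cell k x = cell k y"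
 by (auto simp: cell_def)

lemma abs_div2_diff:
 fixes a b :: int
 assumes "\<bar>a - b\<bar> <= 2" shows "\<bar>a div 2 - b div 2\<bar> <= 1"
proof -
 have "a = 2 * (a div 2) + a mod 2" "0 <= a mod 2" "a mod 2 < 2"
  "b = 2 * (b div 2) + b mod 2" "0 <= b mod 2" "b mod 2 < 2" by auto
 thus ?thesis using assms by linarith
qed

lemma cell_antimono:
 assumes "j <= k" shows "cell k x <= cell j x"
 using assms
proof (induction j rule: int_le_induct)
 case (step j)
 have "cell j x <= cell (j - 1) x" by (auto simp: cell_def fl_half)
 with step show ?case by auto
qed simp

lemma nbhd_antimono:
 assumes "j <= k" shows "nbhd k x <= nbhd j x"
 using assms
proof (induction j rule: int_le_induct)
 case (step j)
 have "nbhd j x <= nbhd (j - 1) x"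
  unfolding nbhd_def fl_half by (fastforce intro: abs_div2_diff)
 with step show ?case by auto
qed simp

text \<open>Two neighbour steps change a label by at most two, and halving turns two into one. This
  replaces the engulfing property of balls.\<close>

lemma nbhd_nbhd: assumes "y : nbhd k x" shows "nbhd k y <= nbhd (k - 1) x"
proof
 fix z assume z: "z : nbhd k y"
 show "z : nbhd (k - 1) x"
  unfolding nbhd_def fl_half
 proof (intro CollectI ballI abs_div2_diff)
  fix i :: 'a assume "i : Basis"
  hence "\<bar>fl k y i - fl k x i\<bar> <= 1" "\<bar>fl k z i - fl k y i\<bar> <= 1" using assms z by (auto simp: nbhd_def)
  thus "\<bar>fl k z i - fl k x i\<bar> <= 2" by linarith
 qed
qed

lemma cell_nested: "y : cell k x ==> j <= k ==> cell j y = cell j x"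
 by (meson cell_antimono cell_eq subsetD)

lemma nbhd_nested: "y : cell k x ==> j <= k ==> nbhd j y = nbhd j x"
 by (meson cell_antimono nbhd_eq subsetD)

definition side :: "int => real" where "side k = 2 powi (- k)"

lemma side_pos [simp]: "0 < side k" by (simp add: side_def)
lemma side_nonneg [simp]: "0 <= side k" using side_pos[of k] by linarith

lemma side_diff: "side (k - j) = 2 powi j * side k"
proof -
 have "side (k - j) = 2 powi (j + - k)" by (simp add: side_def)
 also have "... = 2 powi j * 2 powi (- k)" by (subst power_int_add) auto
 finally show ?thesis by (simp add: side_def)
qed

lemma side_diff_1 [simp]: "side (k - 1) = 2 * side k"
 using side_diff[of k 1] by simp

lemma side_diff_nat: "side (k - int j) = 2 ^ j * side k"
 using side_diff[of k "int j"] by simp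

lemma fl_bounds:
 fixes x i :: "'a::euclidean_space"
 shows "of_int (fl k x i) * side k <= x \<bullet> i" "x \<bullet> i < (of_int (fl k x i) + 1) * side k"
proof -
 have p: "2 powi k * side k = 1" by (simp add: side_def power_int_minus)
 let ?A = "x \<bullet> i"
 have "of_int (fl k x i) <= 2 powi k * ?A" "2 powi k * ?A < of_int (fl k x i) + 1"
  unfolding fl_def by linarith+
 hence "of_int (fl k x i) * side k <= 2 powi k * ?A * side k"
  "2 powi k * ?A * side k < (of_int (fl k x i) + 1) * side k"
  by (auto intro!: mult_right_mono mult_strict_right_mono)
 moreover have "2 powi k * ?A * side k = x \<bullet> i" using p by (simp add: mult.commute mult.left_commute)
 ultimately show "of_int (fl k x i) * side k <= x \<bullet> i" "x \<bullet> i < (of_int (fl k x i) + 1) * side k" by auto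
qed

lemma fl_ge_iff:
 fixes x i :: "'a::euclidean_space"
 shows "z <= fl k x i \<longleftrightarrow> of_int z * side k <= x \<bullet> i"
proof
 assume "z <= fl k x i"
 hence "of_int z * side k <= of_int (fl k x i) * side k" by (intro mult_right_mono) auto
 with fl_bounds(1)[of k x i] show "of_int z * side k <= x \<bullet> i" by linarith
next
 assume "of_int z * side k <= x \<bullet> i"
 hence "of_int z * side k < (of_int (fl k x i) + 1) * side k" using fl_bounds(2)[where k=k and x=x and i=i] by linarith
 hence "real_of_int z < of_int (fl k x i) + 1" by (simp add: mult_less_cancel_right_pos)
 thus "z <= fl k x i" by linarith
qed

lemma fl_less_iff:
 fixes x i :: "'a::euclidean_space"
 shows "fl k x i < z \<longleftrightarrow> x \<bullet> i < of_int z * side k"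
 by (simp only: not_le[symmetric] fl_ge_iff)

definition hbox :: "'a::euclidean_space => real => 'a set" where
 "hbox a h = {y. \<forall>i\<in>Basis. a \<bullet> i <= y \<bullet> i & y \<bullet> i < a \<bullet> i + h}"

definition corner :: "int => 'a::euclidean_space => 'a" where
 "corner k x = (\<Sum>i\<in>Basis. (of_int (fl k x i) * side k) *\<^sub>R i)"

lemma corner_inner: "i : Basis ==> corner k x \<bullet> i = of_int (fl k x i) * side k"
 by (simp add: corner_def)

lemma cell_hbox: "cell k x = hbox (corner k x) (side k)"
proof -
 have "fl k y i = fl k x i \<longleftrightarrow> corner k x \<bullet> i <= y \<bullet> i & y \<bullet> i < corner k x \<bullet> i + side k" if "i : Basis" for y i
  using fl_ge_iff[of "fl k x i" k y i] fl_less_iff[of k y i "fl k x i + 1"] that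
  by (auto simp: corner_inner algebra_simps)
 thus ?thesis by (auto simp: cell_def hbox_def)
qed

lemma nbhd_hbox: "nbhd k x = hbox (corner k x - side k *\<^sub>R One) (3 * side k)"
proof -
 have "\<bar>fl k y i - fl k x i\<bar> <= 1 \<longleftrightarrow> (corner k x - side k *\<^sub>R One) \<bullet> i <= y \<bullet> i & y \<bullet> i < (corner k x - side k *\<^sub>R One) \<bullet> i + 3 * side k"
  if "i : Basis" for y i
  using fl_ge_iff[of "fl k x i - 1" k y i] fl_less_iff[of k y i "fl k x i + 2"] that
  by (auto simp: corner_inner algebra_simps)
 thus ?thesis by (auto simp: nbhd_def hbox_def)
qed

lemma hbox_borel [measurable]: "hbox a h : sets borel"
proof -
 have "hbox a h = (\<Inter>i\<in>Basis. {y. a \<bullet> i <= y \<bullet> i} \<inter> {y. y \<bullet> i < a \<bullet> i + h})"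
  by (auto simp: hbox_def)
 also have "... : sets borel"
  by (intro sets.finite_INT sets.Int borel_closed borel_open closed_halfspace_component_ge
    open_halfspace_component_lt) auto
 finally show ?thesis .
qed

lemma hbox_sub_cbox: "hbox a h <= cbox a (a + h *\<^sub>R One)"
proof
 fix y assume "y : hbox a h"
 thus "y : cbox a (a + h *\<^sub>R One)"
  by (simp add: hbox_def mem_box inner_add_left less_imp_le)
qed

lemma box_sub_hbox: "box a (a + h *\<^sub>R One) <= hbox a h"
 by (auto simp: hbox_def mem_box inner_add_left intro: less_imp_le)

text \<open>Links the half-open boxes of the grid with the closed cubes of the hypotheses: they
  differ by a part of the boundary, a null set.\<close>

lemma hbox_AE: "AE y in lebesgue. y : hbox a h \<longleftrightarrow> y : cbox a (a + h *\<^sub>R One)"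
proof -
 have "negligible (cbox a (a + h *\<^sub>R One) - box a (a + h *\<^sub>R One))"
  by (rule negligible_frontier_interval)
 hence "AE y in lebesgue. y ~: cbox a (a + h *\<^sub>R One) - box a (a + h *\<^sub>R One)"
  by (intro AE_not_in) (simp add: negligible_iff_null_sets)
 thus ?thesis
  by eventually_elim (use hbox_sub_cbox[of a h] box_sub_hbox[of a h] in auto)
qed

lemma emeasure_hbox: assumes "0 <= h"
 shows "vol (hbox a h :: 'a::euclidean_space set) = en (h ^ DIM('a))"
proof -
 have "vol (hbox a h) = vol (cbox a (a + h *\<^sub>R One))"
  by (rule emeasure_eq_AE[OF hbox_AE]) auto
 also have "... = en (h ^ DIM('a))"
  using assms by (simp add: emeasure_lborel_cbox_eq inner_add_left)
 finally show ?thesis .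
qed

lemma cell_borel [measurable]: "cell k x : sets borel" by (simp add: cell_hbox)
lemma nbhd_borel [measurable]: "nbhd k x : sets borel" by (simp add: nbhd_hbox)

lemma emeasure_cell: "vol (cell k x :: 'a::euclidean_space set) = en (side k ^ DIM('a))"
 unfolding cell_hbox by (rule emeasure_hbox) simp

lemma emeasure_nbhd: "vol (nbhd k x :: 'a::euclidean_space set) = en (3 ^ DIM('a) * side k ^ DIM('a))"
 unfolding nbhd_hbox by (subst emeasure_hbox) (auto simp: power_mult_distrib)

lemma countable_cells: "countable (range (cell k :: 'a::euclidean_space => 'a set))"
proof -
 define G :: "('a => int) => 'a set" where "G f = {y. \<forall>i\<in>Basis. fl k y i = f i}" for f
 have "range (cell k) <= G ` (Pi\<^sub>E Basis (%_. UNIV))"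
 proof
  fix A :: "'a set" assume "A : range (cell k)"
  then obtain x where "A = cell k x" by auto
  hence "A = G (restrict (fl k x) Basis)" by (auto simp: G_def cell_def)
  moreover have "restrict (fl k x) Basis : Pi\<^sub>E Basis (%_. UNIV)" by (simp)
  ultimately show "A : G ` (Pi\<^sub>E Basis (%_. UNIV))" by blast
 qed
 moreover have "countable (G ` (Pi\<^sub>E (Basis::'a set) (%_. UNIV :: int set)))"
  by (intro countable_image countable_PiE) auto
 ultimately show ?thesis by (rule countable_subset)
qed

lemma nbhd_cube: "is_cube (cbox (corner k x - side k *\<^sub>R One) (corner k x - side k *\<^sub>R One + (3 * side k) *\<^sub>R One))"
 unfolding is_cube_def by (rule exI, rule exI[of _ "3 * side k"]) simp

lemma cell_norm_le:
 fixes x y :: "'a::euclidean_space"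
 assumes "y : cell k x" shows "norm (y - x) <= DIM('a) * side k"
proof -
 have "\<bar>(y - x) \<bullet> i\<bar> <= side k" if i: "i : Basis" for i
 proof -
  have e: "fl k y i = fl k x i" using assms i by (auto simp: cell_def)
  have "of_int (fl k x i) * side k <= x \<bullet> i" "x \<bullet> i < (of_int (fl k x i) + 1) * side k"
   "of_int (fl k x i) * side k <= y \<bullet> i" "y \<bullet> i < (of_int (fl k x i) + 1) * side k"
   using fl_bounds[where k=k and x=x and i=i] fl_bounds[where k=k and x=y and i=i] e by auto
  thus ?thesis by (simp add: inner_diff_left algebra_simps abs_le_iff)
 qed
 hence "(\<Sum>i\<in>Basis. \<bar>(y - x) \<bullet> i\<bar>) <= (\<Sum>i\<in>(Basis::'a set). side k)"
  by (intro sum_mono) auto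
 with norm_le_l1[of "y - x"] show ?thesis by simp
qed

lemma nbhdI_norm:
 fixes x y :: "'a::euclidean_space"
 assumes "norm (y - x) <= side k" shows "y : nbhd k x"
 unfolding nbhd_def
proof (intro CollectI ballI)
 fix i :: 'a assume i: "i : Basis"
 have "\<bar>(y - x) \<bullet> i\<bar> <= side k" using Basis_le_norm[OF i, of "y - x"] assms by linarith
 hence a: "y \<bullet> i <= x \<bullet> i + side k" "x \<bullet> i <= y \<bullet> i + side k" by (auto simp: inner_diff_left abs_le_iff)
 have "fl k y i < fl k x i + 2"
  unfolding fl_less_iff using fl_bounds(2)[where k=k and x=x and i=i] a(1) by (simp add: algebra_simps)
 moreover have "fl k x i < fl k y i + 2"
  unfolding fl_less_iff using fl_bounds(2)[where k=k and x=y and i=i] a(2) by (simp add: algebra_simps)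
 ultimately show "\<bar>fl k y i - fl k x i\<bar> <= 1" by linarith
qed

lemma side_int: "side (int n) = (1/2) ^ n"
 by (simp add: side_def power_int_minus power_one_over inverse_eq_divide)

lemma side_small: assumes "e > 0" obtains n :: nat where "side (int n) < e"
 using real_arch_pow_inv[OF assms, of "1/2"] by (auto simp: side_int)

lemma side_mono: "j <= k ==> side k <= side j"
 by (simp add: side_def power_int_increasing)

lemma side_big: obtains k0 :: int where "!!k. k <= k0 ==> c < side k"
proof -
 obtain n :: nat where n: "c < 2 ^ n" using real_arch_pow[of 2 c] by auto
 have "c < side k" if "k <= - int n" for k
  using side_mono[OF that] n by (simp add: side_def)
 thus ?thesis using that by blast
qed

text \<open>There are countably many cells of one scale, so a preimage is a countable union of
  cells.\<close>

lemma measurable_cell_const: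
 fixes g :: "'a::euclidean_space => 'b::topological_space"
 assumes "!!x y. y : cell k x ==> g y = g x"
 shows "g : borel_measurable borel"
proof (rule measurableI)
 fix B :: "'b set"
 have "g -` B = \<Union>{A : range (cell k). EX x. A = cell k x & g x : B}"
  using assms by auto
 moreover have "... : sets borel"
  by (rule sets.countable_Union) (auto intro: countable_subset[OF _ countable_cells])
 ultimately show "g -` B \<inter> space borel : sets borel" by simp
qed auto

lemma cell_lebesgue [measurable]: "cell k x : sets lebesgue" using cell_borel by auto
lemma nbhd_lebesgue [measurable]: "nbhd k x : sets lebesgue" using nbhd_borel by auto

lemma borel_measurable_lebesgueI: "g : borel_measurable borel ==> g : LM"
 by (simp add: measurable_completion)

lemma RSI_le_lincomb:
 assumes [measurable]: "g : LM" "h : LM" "A : sets lebesgue" and cd: "0 <= c" "0 <= d"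
  and le: "AE y in lebesgue. y : A --> f y <= c * g y + d * h y"
 shows "RSI A f <= en c * RSI A g + en d * RSI A h"
proof -
 have "en (a + b) <= en a + en b" for a b by (cases "0 <= a"; cases "0 <= b") (auto simp: ennreal_neg intro: ennreal_leI)
 hence "RSI A f <= NI (%y. en c * (en (g y) * indicator A y) + en d * (en (h y) * indicator A y))"
  using cd by (intro nn_integral_mono_AE AE_mp[OF le AE_I2]) (auto simp: ennreal_mult'[symmetric] indicator_def intro: order_trans[OF ennreal_leI])
 also have "... = en c * RSI A g + en d * RSI A h"
  by (subst nn_integral_add) (auto simp: nn_integral_cmult)
 finally show ?thesis .
qed

lemma RSI_le_cmult:
 assumes "g : LM" "A : sets lebesgue" "0 <= c" "AE y in lebesgue. y : A --> f y <= c * g y"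
 shows "RSI A f <= en c * RSI A g"
 using RSI_le_lincomb[of g "%_. 0" A c 0 f] assms by simp

lemma exp_shift: "\<bar>d - c\<bar> <= C ==> 0 < e ==> exp (e * \<bar>b - c\<bar>) <= exp (e * C) * exp (e * \<bar>b - d\<bar>)" for b :: real
 unfolding exp_add[symmetric] distrib_left[symmetric] by (auto intro: mult_left_mono)

section \<open>Stopping cells and differentiation of integrals\<close>

text \<open>The maximal cells with property \<open>P\<close>, together with a chosen scale
  \<open>kk A\<close> and point \<open>xx A\<close> for each of them. Coarser means smaller index,
  so the failing ancestors are those with \<open>k < kk A\<close>.\<close>

definition stops :: "(int => 'a::euclidean_space => bool) => 'a set set => ('a set => int) => ('a set => 'a) => bool" where
 "stops P S kk xx \<longleftrightarrow> countable S & disjoint S & \<Union>S = {x. EX k. P k x} &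
   (\<forall>A\<in>S. A = cell (kk A) (xx A) & P (kk A) (xx A) & (\<forall>k<kk A. ~ P k (xx A))) &
   (ALL x k. P k x --> (\<exists>A\<in>S. x : A & kk A <= k))"

text \<open>As large cells at a point fail \<open>P\<close>, each point lying in some cell with
  \<open>P\<close> has a coarsest one, and coarsest cells are equal or disjoint by
  nestedness.\<close>

lemma stopping_cells:
 fixes P :: "int => 'a::euclidean_space => bool"
 assumes cong: "!!k x y. y : cell k x ==> P k y = P k x"
  and big: "!!x. EX k0. \<forall>k<k0. ~ P k x"
 shows "EX S kk xx. stops P S kk xx"
proof -
 define first where "first k x \<longleftrightarrow> P k x & (\<forall>j<k. ~ P j x)" for k x
 have ex: "\<exists>j\<le>k. first j x" if "P k x" for k x
 proof -
  obtain k0 where k0: "!!j. j < k0 ==> ~ P j x" using big by blast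
  with that have kk: "k0 <= k" by (meson not_le)
  \<comment> \<open>Scales are integers, so the least one is found by counting upwards from the
    barrier \<open>k0\<close>.\<close>
  define n where "n = (LEAST n. P (k0 + int n) x)"
  have pn: "P (k0 + int (nat (k - k0))) x" using kk that by simp
  have n: "P (k0 + int n) x" unfolding n_def by (rule LeastI[where P="%n. P (k0 + int n) x", OF pn])
  have n2: "n <= nat (k - k0)" unfolding n_def by (rule Least_le[where P="%n. P (k0 + int n) x", OF pn])
  have "~ P j x" if "j < k0 + int n" for j
  proof (cases "j < k0")
   case False
   hence "nat (j - k0) < n" using that by linarith
   hence "~ P (k0 + int (nat (j - k0))) x" unfolding n_def by (rule not_less_Least)
   thus ?thesis using False by simp
  qed (use k0 in auto)
  hence "first (k0 + int n) x" using n by (auto simp: first_def)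
  moreover have "k0 + int n <= k" using n2 kk by linarith
  ultimately show ?thesis by blast
 qed
 define S where "S = {cell k x |k x. first k x}"
 have "EX p. \<forall>A\<in>S. A = cell (fst (p A)) (snd (p A)) & first (fst (p A)) (snd (p A))"
 proof (rule bchoice, rule ballI)
  fix A assume "A : S"
  then obtain k x where "A = cell k x" "first k x" by (auto simp: S_def)
  thus "EX q. A = cell (fst q) (snd q) & first (fst q) (snd q)" by (intro exI[of _ "(k, x)"]) simp
 qed
 then obtain p where p: "!!A. A : S ==> A = cell (fst (p A)) (snd (p A)) & first (fst (p A)) (snd (p A))"
  by blast
 have fcong: "first k y = first k x" if "y : cell k x" for k x y
 proof -
  have "P j y = P j x" if "j <= k" for j
   using cell_antimono[OF that, of x] \<open>y : cell k x\<close> cong by blast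
  thus ?thesis by (auto simp: first_def)
 qed
 have uniq: "j = k" if "first j x" "first k x" for j k x
  using that unfolding first_def by (meson linorder_neqE)
 have cS: "countable S"
 proof (rule countable_subset)
  show "S <= (\<Union>k. range (cell k))" by (auto simp: S_def)
  show "countable (\<Union>k. range (cell k :: 'a => 'a set))" by (intro countable_UN countable_cells) auto
 qed
 have dS: "disjoint S"
 proof (rule disjointI)
  fix A B assume AB: "A : S" "B : S" "A ~= B"
  show "A \<inter> B = {}"
  proof (rule ccontr)
   assume "A \<inter> B ~= {}"
   then obtain z where z: "z : A" "z : B" by auto
   obtain k x where A: "A = cell k x" "first k x" using AB(1) by (auto simp: S_def)
   obtain j y where B: "B = cell j y" "first j y" using AB(2) by (auto simp: S_def)
   have "first k z" "first j z" using A B z fcong by auto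
   hence "j = k" using uniq by blast
   thus False using A B z AB(3) cell_eq by metis
  qed
 qed
 have US: "\<Union>S = {x. EX k. P k x}"
 proof (intro equalityI subsetI)
  fix x assume "x : \<Union>S"
  then obtain k y where "x : cell k y" "first k y" by (auto simp: S_def)
  thus "x : {x. EX k. P k x}" using cong by (auto simp: first_def)
 next
  fix x assume "x : {x. EX k. P k x}"
  then obtain k where "first k x" using ex by auto
  thus "x : \<Union>S" by (auto simp: S_def intro!: exI[of _ "cell k x"])
 qed
 have "stops P S (%A. fst (p A)) (%A. snd (p A))"
  unfolding stops_def
 proof (intro conjI cS dS US ballI allI impI)
  fix A assume A: "A : S"
  show "A = cell (fst (p A)) (snd (p A))" using p[OF A] by simp
  show "P (fst (p A)) (snd (p A))" using p[OF A] by (simp add: first_def)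
  show "~ P k (snd (p A))" if "k < fst (p A)" for k using p[OF A] that by (simp add: first_def)
 next
  fix x k assume "P k x"
  then obtain j where j: "j <= k" "first j x" using ex by blast
  hence A: "cell j x : S" by (auto simp: S_def)
  let ?A = "p (cell j x)"
  have "x : cell (fst ?A) (snd ?A)" using p[OF A] in_cell_self by blast
  from fcong[OF this] have "first (fst ?A) x" using p[OF A] by simp
  hence "fst ?A = j" using uniq j(2) by blast
  with A j(1) show "\<exists>A\<in>S. x : A & fst (p A) <= k" by (intro bexI[of _ "cell j x"]) auto
 qed
 thus ?thesis by blast
qed

lemma stopsD:
 assumes "stops P S kk xx"
 shows "countable S" "disjoint S" "\<Union>S = {x. EX k. P k x}"
  "!!A. A : S ==> A = cell (kk A) (xx A)" "!!A. A : S ==> P (kk A) (xx A)"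
  "!!A k. A : S ==> k < kk A ==> ~ P k (xx A)"
  "!!x k. P k x ==> \<exists>A\<in>S. x : A & kk A <= k"
  "!!A. A : S ==> A : sets lebesgue"
proof -
 show eq: "!!A. A : S ==> A = cell (kk A) (xx A)" using assms unfolding stops_def by blast
 show "!!A. A : S ==> A : sets lebesgue" using eq cell_lebesgue by metis
qed (use assms in \<open>auto simp: stops_def\<close>)

text \<open>A differentiation theorem. Let \<open>E\<close> be the set inside \<open>A\<close> where
  \<open>G < F\<close>. Disjoint dyadic cells inside an open superset of \<open>E\<close> cover
  \<open>E\<close>, so the integral of \<open>F\<close> over \<open>E\<close> is at most that of
  \<open>G\<close> over the superset, hence over \<open>E\<close> by outer regularity; this forces
  \<open>E\<close> to be null.\<close>

lemma AE_le_of_cell_integrals_le: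
 fixes F G :: "'a::euclidean_space => ennreal"
 assumes F [measurable]: "F : LM" and G [measurable]: "G : LM"
  and A [measurable]: "A : sets lebesgue"
  and Gfin: "!!R. SI (ball 0 R) G < \<infinity>"
  and le: "!!x k. x : A ==> SI (cell k x) F <= SI (cell k x) G"
 shows "AE x in lebesgue. x : A --> F x <= G x"
proof -
 have main: "AE x in lebesgue. ~ (x : A \<inter> ball 0 R & G x < F x)" for R
 proof -
  define E where "E = {x : A \<inter> ball 0 R. G x < F x}"
  have "E = A \<inter> ball 0 R \<inter> {x : space lebesgue. G x < F x}" by (auto simp: E_def)
  also have "... : sets lebesgue" by (intro sets.Int A borel_measurable_less G F) auto
  finally have E [measurable]: "E : sets lebesgue" .
  have EA: "E <= A" by (auto simp: E_def)
  have openle: "SI E F <= SI O' G" if O': "open O'" "E <= O'" for O'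
  proof -
   define P where "P k x \<longleftrightarrow> 0 <= k & cell k x <= O'" for k x
   have "P k y = P k x" if "y : cell k x" for k x y using cell_eq[OF that] by (simp add: P_def)
   moreover have "EX k0. \<forall>k<k0. ~ P k x" for x by (auto simp: P_def intro!: exI[of _ 0])
   ultimately obtain S kk xx where "stops P S kk xx"
    using stopping_cells[of P] by blast
   note S = stopsD[OF this]
   have US: "O' <= \<Union>S"
   proof
    fix x assume "x : O'"
    then obtain e where e: "e > 0" "ball x e <= O'" using O'(1) open_contains_ball by blast
    obtain n :: nat where n: "side (int n) < e / DIM('a)" using side_small[of "e / DIM('a)"] e by auto
    hence "DIM('a) * side (int n) < e" by (simp add: field_simps)
    hence "cell (int n) x <= ball x e"
     using cell_norm_le[of _ "int n" x] by (force simp: dist_norm norm_minus_commute)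
    hence "P (int n) x" using e by (auto simp: P_def)
    thus "x : \<Union>S" unfolding S(3) by blast
   qed
   \<comment> \<open>The integral comparison is assumed only at points of \<open>A\<close>, so cells
     that miss \<open>E\<close> are dropped.\<close>
   define S' where "S' = {B : S. B \<inter> E ~= {}}"
   have "countable S'" using S(1) by (rule countable_subset[rotated]) (auto simp: S'_def)
   have "disjoint S'" using S(2) by (auto simp: S'_def disjoint_def)
   have ES: "E <= \<Union>S'" using US O'(2) unfolding S'_def by blast
   have SO: "\<Union>S' <= O'" using S(4,5) by (force simp: S'_def P_def)
   have "SI E F <= SI (\<Union>S') F"
    using ES by (intro nn_integral_mono) (auto simp: indicator_def)
   also have "... <= SI (\<Union>S') G"
   proof (rule set_nn_integral_mono_partition)
    fix B assume B: "B : S'"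
    hence Bc: "B = cell (kk B) (xx B)" using S(4) by (auto simp: S'_def)
    thus "B : sets lebesgue" using cell_lebesgue by metis
    obtain z where z: "z : B" "z : E" using B by (auto simp: S'_def)
    hence "B = cell (kk B) z" using Bc cell_eq by metis
    thus "SI B F <= SI B G" using le[of z "kk B"] z EA by auto
   qed (use \<open>countable S'\<close> \<open>disjoint S'\<close> in auto)
   also have "... <= SI O' G"
    using SO by (intro nn_integral_mono) (auto simp: indicator_def)
   finally show ?thesis .
  qed
  let ?B = "%x. en ((1/2)^x)"
  have "EX U. open U & E <= U & vol (U - E) < ?B n" for n
   using sets_lebesgue_outer_open[OF E, of "(1/2)^n"] by (metis zero_less_divide_1_iff zero_less_numeral zero_less_power)
  then obtain U where U: "!!n. open (U n)" "!!n. E <= U n" "!!n. vol (U n - E) < ?B n"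
   by metis
  \<comment> \<open>Finite intersections make the open sets decrease and the ball keeps their
    \<open>G\<close>-mass finite, as continuity from above requires.\<close>
  define V where "V n = ball 0 R \<inter> (\<Inter>j\<le>n. U j)" for n
  have Vo: "open (V n)" for n unfolding V_def using U(1) by (intro open_Int open_INT) auto
  have VE: "E <= V n" for n using U(2) by (auto simp: V_def E_def)
  have [measurable]: "V n : sets lebesgue" for n using Vo by auto
  define \<mu> where "\<mu> = density lebesgue G"
  let ?C = "%x. emeasure \<mu> (V x)"
  have em: "?C n = SI (V n) G" for n
   unfolding \<mu>_def by (subst emeasure_density) auto
  have "SI (V n) G <= SI (ball 0 R) G" for n
   by (intro nn_integral_mono) (auto simp: indicator_def V_def)
  hence fin: "?C n ~= \<infinity>" for n using Gfin[of R] unfolding em by (metis infinity_ennreal_def leD)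
  let ?A = "\<Inter>n. V n"
  have "(INF n. ?C n) = emeasure \<mu> ?A"
  proof (rule INF_emeasure_decseq)
   show "range V <= sets \<mu>" unfolding \<mu>_def using Vo by auto
   show "decseq V" unfolding decseq_def V_def by auto
  qed (rule fin)
  moreover have "SI E F <= (INF n. ?C n)"
   unfolding em by (intro INF_greatest openle Vo VE)
  moreover have "emeasure \<mu> ?A = SI E G"
  proof -
   have nul: "vol (?A - E) = 0"
   proof -
    have "vol (?A - E) <= ?B n" for n
    proof -
     have "vol (?A - E) <= vol (U n - E)"
      using U(1) by (intro emeasure_mono) (auto simp: V_def)
     also have "... <= ?B n" using U(3)[of n] by simp
     finally show ?thesis .
    qed
    moreover have "(%n. ?B n) \<longlonglongrightarrow> en 0"
     by (intro tendsto_ennrealI LIMSEQ_realpow_zero) auto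
    ultimately have "vol (?A - E) <= en 0" by (intro LIMSEQ_le_const) auto
    thus ?thesis by simp
   qed
   have "AE x in lebesgue. x ~: ?A - E"
    by (rule AE_not_in) (auto intro!: null_setsI nul)
   hence "AE x in lebesgue. G x * indicator ?A x = G x * indicator E x"
    by eventually_elim (use VE in \<open>auto simp: indicator_def\<close>)
   thus ?thesis unfolding \<mu>_def
    by (subst emeasure_density) (auto intro!: nn_integral_cong_AE)
  qed
  ultimately have FG: "SI E F <= SI E G" by simp
  have Efin: "SI E G < \<infinity>"
  proof -
   have "SI E G <= SI (ball 0 R) G"
    by (intro nn_integral_mono) (auto simp: indicator_def E_def)
   thus ?thesis using Gfin[of R] by (rule le_less_trans)
  qed
  have "NI (%x. (F x - G x) * indicator E x) = NI (%x. F x * indicator E x - G x * indicator E x)"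
   by (intro nn_integral_cong) (auto simp: indicator_def)
  also have "... = SI E F - SI E G"
  proof (rule nn_integral_diff)
   show "AE x in lebesgue. G x * indicator E x <= F x * indicator E x"
    by (auto simp: indicator_def E_def)
  qed (use Efin in auto)
  also have "... = 0" using FG Efin by (intro diff_eq_0_ennreal) (auto intro: le_less_trans)
  finally have "AE x in lebesgue. (F x - G x) * indicator E x = 0"
   by (subst (asm) nn_integral_0_iff_AE) auto
  thus ?thesis
  proof eventually_elim
   case (elim x)
   show ?case
   proof
    assume x: "x : A \<inter> ball 0 R & G x < F x"
    hence "x : E" by (auto simp: E_def)
    hence "F x - G x = 0" using elim by simp
    hence "F x <= G x" by (simp add: diff_eq_0_iff_ennreal)
    thus False using x leD by blast
   qed
  qed
 qed
 have "AE x in lebesgue. ALL n::nat. ~ (x : A \<inter> ball 0 (real n) & G x < F x)"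
  unfolding AE_all_countable using main by blast
 thus ?thesis
 proof eventually_elim
  case (elim x)
  obtain n :: nat where "norm x < n" using reals_Archimedean2 by blast
  thus ?case using elim[rule_format, of n] by (auto simp: not_less)
 qed
qed

lemma set_nn_integral_nbhd_le:
 fixes F :: "'a::euclidean_space => ennreal"
 assumes [measurable]: "F : LM" "G : LM"
  and le: "!!y. y : nbhd k x ==> SI (cell k y) F <= SI (cell k y) G"
 shows "SI (nbhd k x) F <= SI (nbhd k x) G"
proof -
 have *: "nbhd k x = \<Union>(cell k ` nbhd k x)" using cell_subset_nbhd[of _ k x] by auto
 show ?thesis
  apply (subst (1 2) *)
 proof (rule set_nn_integral_mono_partition)
  show "countable (cell k ` nbhd k x)" by (rule countable_subset[OF _ countable_cells[of k]]) auto
  show "disjoint (cell k ` nbhd k x)"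
   unfolding disjoint_def using cell_disjoint by blast
 qed (use le in auto)
qed

section \<open>Layer-cake formulas\<close>

lemma ennreal_divide_le_iff:
 fixes a b c :: ennreal
 assumes "b ~= 0" "b ~= top" shows "a / b <= c \<longleftrightarrow> a <= c * b"
 using assms
 by (cases a; cases b; cases c)
   (auto simp: divide_ennreal ennreal_mult[symmetric] field_simps ennreal_top_mult ennreal_top_divide top_unique)

lemma sigma_finite_lebesgue: "sigma_finite_measure (lebesgue :: 'a::euclidean_space measure)"
proof
 show "EX A::'a set set. countable A & A <= sets lebesgue & \<Union>A = space lebesgue & (\<forall>a\<in>A. vol a ~= \<infinity>)"
 proof (intro exI[of _ "range (%n::nat. cbox (- (real n *\<^sub>R One)) (real n *\<^sub>R One))"] conjI)
  show "\<Union> (range (%n::nat. cbox (- (real n *\<^sub>R One)) (real n *\<^sub>R One :: 'a))) = space lebesgue"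
   using UN_box_eq_UNIV box_subset_cbox by (fastforce simp: )
 qed (auto simp: emeasure_lborel_cbox_eq)
qed

lemma pair_sigma_finite_lebesgue_lborel: "pair_sigma_finite (lebesgue :: 'a::euclidean_space measure) (lborel :: real measure)"
 by (simp add: pair_sigma_finite_def sigma_finite_lebesgue sigma_finite_lborel)

lemma pair_sigma_finite_lebesgue: "pair_sigma_finite (lebesgue :: 'a::euclidean_space measure) (lebesgue :: 'b::euclidean_space measure)"
 by (simp add: pair_sigma_finite_def sigma_finite_lebesgue)

text \<open>Tonelli for the region \<open>R l x\<close>. The relation is kept abstract because both
  \<open>l < h x\<close> and \<open>\<bar>F x\<bar> \<le> l\<close> occur later.\<close>

lemma nn_integral_level_sets:
 fixes Y :: "'a::euclidean_space => ennreal" and c :: "real => ennreal"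
 assumes [measurable]: "Y : LM" "c : borel_measurable borel"
  and R: "Measurable.pred (lebesgue \<Otimes>\<^sub>M lborel) (%(x, l). R l x)"
 shows "(\<integral>\<^sup>+l. c l * NI (%x. Y x * indicator {x. R l x} x) \<partial>lborel)
  = NI (%x. Y x * (\<integral>\<^sup>+l. c l * indicator {l. R l x} l \<partial>lborel))"
proof -
 interpret pair_sigma_finite "lebesgue :: 'a measure" "lborel :: real measure"
  by (rule pair_sigma_finite_lebesgue_lborel)
 have [measurable]: "{p : space (lebesgue \<Otimes>\<^sub>M lborel). R (snd p) (fst p)} : sets (lebesgue \<Otimes>\<^sub>M (lborel :: real measure))"
  using R by (simp add: pred_def case_prod_beta)
 have "(%p. c (snd p) * (Y (fst p) * indicator {p : space (lebesgue \<Otimes>\<^sub>M lborel). R (snd p) (fst p)} p))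
   : borel_measurable (lebesgue \<Otimes>\<^sub>M (lborel :: real measure))" by measurable
 hence m: "(%(x,l). c l * (Y x * indicator {x. R l x} x)) : borel_measurable (lebesgue \<Otimes>\<^sub>M (lborel :: real measure))"
  by (rule measurable_cong[THEN iffD1, rotated]) (auto simp: space_pair_measure indicator_def)
 have m1: "{x. R l x} : sets lebesgue" for l
 proof -
  have "(%x. (x, l)) : lebesgue \<rightarrow>\<^sub>M lebesgue \<Otimes>\<^sub>M lborel" by simp
  from measurable_compose[OF this R] show ?thesis by (simp add: pred_def)
 qed
 have m2: "{l. R l x} : sets borel" for x
 proof -
  have "(%l. (x, l)) : lborel \<rightarrow>\<^sub>M lebesgue \<Otimes>\<^sub>M lborel" by simp
  from measurable_compose[OF this R] show ?thesis by (simp add: pred_def)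
 qed
 have "(\<integral>\<^sup>+l. c l * NI (%x. Y x * indicator {x. R l x} x) \<partial>lborel)
  = (\<integral>\<^sup>+l. NI (%x. c l * (Y x * indicator {x. R l x} x)) \<partial>lborel)"
  using m1 by (intro nn_integral_cong) (subst nn_integral_cmult; simp)
 also have "... = NI (%x. (\<integral>\<^sup>+l. c l * (Y x * indicator {x. R l x} x) \<partial>lborel))"
  by (rule Fubini'[OF m])
 also have "... = NI (%x. (\<integral>\<^sup>+l. Y x * (c l * indicator {l. R l x} l) \<partial>lborel))"
  by (intro nn_integral_cong) (auto simp: indicator_def mult.commute)
 also have "... = NI (%x. Y x * (\<integral>\<^sup>+l. c l * indicator {l. R l x} l \<partial>lborel))"
  using m2 by (intro nn_integral_cong) (subst nn_integral_cmult; simp)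
 finally show ?thesis .
qed

lemma nn_integral_powr_0:
 assumes "a > 0" "c >= 0"
 shows "(\<integral>\<^sup>+l\<in>{0..c}. en (l powr (a - 1)) \<partial>lborel) = en (c powr a / a)"
proof -
 have "((%l. l powr (a - 1)) has_integral c powr a / a) {0..c}"
  using has_integral_powr_from_0[of "a - 1" c] assms by simp
 thus ?thesis by (rule nn_integral_has_integral_lebesgue'[rotated]) simp
qed

lemma nn_integral_powr_inf:
 assumes "a > 0" "c > 0"
 shows "(\<integral>\<^sup>+l\<in>{c..}. en (l powr (- a - 1)) \<partial>lborel) = en (c powr (- a) / a)"
proof -
 have "((%l. l powr (- a - 1)) has_integral - (c powr (- a)) / (- a)) {c..}"
  using has_integral_powr_to_inf[of "- a - 1" c] assms by simp
 hence "((%l. l powr (- a - 1)) has_integral c powr (- a) / a) {c..}" by simp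
 thus ?thesis by (rule nn_integral_has_integral_lebesgue'[rotated]) simp
qed

lemma nn_integral_powr_layer:
 fixes h :: "'a::euclidean_space => real" and Y :: "'a => ennreal"
 assumes [measurable]: "h : LM" "Y : LM"
  and "a > 0" and h0: "!!x. 0 <= h x"
 shows "(\<integral>\<^sup>+l\<in>{0..}. en (l powr (a - 1)) * SI {x. l < h x} Y \<partial>lborel)
  = NI (%x. Y x * en (h x powr a / a))"
proof -
 let ?A = "%x. \<integral>\<^sup>+l. (en (l powr (a - 1)) * indicator {0..} l) * indicator {l. l < h x} l \<partial>lborel"
 have "(\<integral>\<^sup>+l\<in>{0..}. en (l powr (a - 1)) * SI {x. l < h x} Y \<partial>lborel)
  = (\<integral>\<^sup>+l. (en (l powr (a - 1)) * indicator {0..} l) * NI (%x. Y x * indicator {x. l < h x} x) \<partial>lborel)"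
  by (intro nn_integral_cong) (auto simp: indicator_def)
 also have "... = NI (%x. Y x * (?A x))"
  by (rule nn_integral_level_sets) auto
 also have "... = NI (%x. Y x * en (h x powr a / a))"
 proof (intro nn_integral_cong arg_cong2[of _ _ _ _ "(*)"] refl, goal_cases)
  case (1 x)
  have "(?A x)
   = (\<integral>\<^sup>+l\<in>{0..h x}. en (l powr (a - 1)) \<partial>lborel)"
   by (rule nn_integral_cong_AE, rule AE_mp[OF AE_lborel_singleton[of "h x"]]) (auto simp: indicator_def)
  also have "... = en (h x powr a / a)" by (rule nn_integral_powr_0[OF \<open>a > 0\<close> h0])
  finally show ?case .
 qed
 finally show ?thesis .
qed

section \<open>Dyadic maximal functions and their weak bounds\<close>

definition Mcell :: "('a::euclidean_space => ennreal) => 'a => ennreal" where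
 "Mcell G x = (SUP k. SI (cell k x) G / vol (cell k x))"

text \<open>A Hardy-Littlewood maximal function over countably many sets per point: every ball
  containing \<open>x\<close> lies in some \<open>nbhd k x\<close> of comparable volume.\<close>

definition Mnbhd :: "('a::euclidean_space => ennreal) => 'a => ennreal" where
 "Mnbhd G x = (SUP k. SI (nbhd k x) G / vol (nbhd k x))"

lemma vol_facts [simp]:
 "vol (cell k x) ~= 0" "vol (cell k x) ~= top"
 "vol (nbhd k x) ~= 0" "vol (nbhd k x) ~= top"
 by (simp_all only: emeasure_cell emeasure_nbhd) (simp_all add: ennreal_eq_0_iff not_le)

lemma vol_nbhd: "vol (nbhd k x :: 'a::euclidean_space set) = en (3 ^ DIM('a)) * vol (cell k x)"
 by (simp only: emeasure_cell emeasure_nbhd) (simp add: ennreal_mult)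

lemma vol_cell_diff: "vol (cell (k - int j) x :: 'a::euclidean_space set) = en (2 ^ (j * DIM('a))) * vol (cell k (y::'a))"
 by (simp only: emeasure_cell side_diff_nat) (simp add: power_mult_distrib ennreal_mult power_mult)

lemma vol_cell_diff1: "vol (cell (k - 1) x :: 'a::euclidean_space set) = en (2 ^ DIM('a)) * vol (cell k (y::'a))"
 using vol_cell_diff[of k 1 x y] by simp

lemma Mcell_less_iff: "c < Mcell G x \<longleftrightarrow> (EX k. c * vol (cell k x) < SI (cell k x) G)"
 unfolding Mcell_def less_SUP_iff by (simp only: not_le[symmetric] ennreal_divide_le_iff[OF vol_facts(1,2)]) simp

lemma Mnbhd_less_iff: "c < Mnbhd G x \<longleftrightarrow> (EX k. c * vol (nbhd k x) < SI (nbhd k x) G)"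
 unfolding Mnbhd_def less_SUP_iff by (simp only: not_le[symmetric] ennreal_divide_le_iff[OF vol_facts(3,4)]) simp

lemma Mnbhd_le_iff: "Mnbhd G x <= c \<longleftrightarrow> (ALL k. SI (nbhd k x) G <= c * vol (nbhd k x))"
 using Mnbhd_less_iff[of c G x] by (meson not_le)

lemma Mcell_le_iff: "Mcell G x <= c \<longleftrightarrow> (ALL k. SI (cell k x) G <= c * vol (cell k x))"
 using Mcell_less_iff[of c G x] by (meson not_le)

lemma borel_measurable_Mcell [measurable]: "Mcell G : LM"
proof -
 have "(%x. SI (cell k x) G / vol (cell k x)) : borel_measurable borel" for k :: int
  by (rule measurable_cell_const[of k]) (simp add: cell_eq)
 hence "(%x. (SUP k. SI (cell k x) G / vol (cell k x))) : borel_measurable borel"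
  by (intro borel_measurable_SUP) auto
 thus ?thesis unfolding Mcell_def[abs_def] by (rule borel_measurable_lebesgueI)
qed

lemma borel_measurable_Mnbhd [measurable]: "Mnbhd G : LM"
proof -
 have "(%x. SI (nbhd k x) G / vol (nbhd k x)) : borel_measurable borel" for k :: int
  by (rule measurable_cell_const[of k]) (simp add: nbhd_eq)
 hence "(%x. (SUP k. SI (nbhd k x) G / vol (nbhd k x))) : borel_measurable borel"
  by (intro borel_measurable_SUP) auto
 thus ?thesis unfolding Mnbhd_def[abs_def] by (rule borel_measurable_lebesgueI)
qed

lemma sets_Mcell [measurable]: "{x. c < Mcell G x} : sets lebesgue"
proof -
 have "{x : space lebesgue. c < Mcell G x} : sets lebesgue" by measurable
 thus ?thesis by simp
qed

lemma sets_Mnbhd [measurable]: "{x. c < Mnbhd G x} : sets lebesgue"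
proof -
 have "{x : space lebesgue. c < Mnbhd G x} : sets lebesgue" by measurable
 thus ?thesis by simp
qed

definition hot :: "ennreal => ('a::euclidean_space => ennreal) => int => 'a => bool" where
 "hot c H k x \<longleftrightarrow> c * vol (cell k x) < SI (cell k x) H"

lemma hot_cong: "y : cell k x ==> hot c H k y = hot c H k x"
 by (simp add: hot_def cell_eq)

text \<open>The mean over a cell is at most the total mass divided by the volume, which tends to 0
  for large cells.\<close>

lemma hot_vanish:
 fixes H :: "'a::euclidean_space => ennreal"
 assumes "NI H < \<infinity>" "0 < c"
 shows "EX k0. \<forall>k<k0. ~ hot c H k (x::'a)"
proof -
 \<comment> \<open>The threshold may be infinite; a finite positive one below it suffices.\<close>
 have "\<exists>c'>0. en c' <= c" 
 proof (cases c)
  case (real r) thus ?thesis using assms(2) by (intro exI[of _ r]) auto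
 qed (auto intro: exI[of _ 1])
 then obtain c' where c': "c' > 0" "en c' <= c" by auto
 obtain h where h: "NI H = en h" "h >= 0" using assms(1) by (cases "NI H") auto
 \<comment> \<open>Sides of length at least 1 satisfy \<open>side \<le> side^n\<close>, which turns
   a bound on the side into one on the volume.\<close>
 obtain k0 where k0: "!!k. k <= k0 ==> max 1 (h / c') < side k" using side_big[of "max 1 (h/c')"] by blast
 have "~ hot c H k x" if "k < k0" for k
 proof -
  have s: "max 1 (h / c') < side k" using k0 that by auto
  hence "side k ^ 1 <= side k ^ DIM('a)" by (intro power_increasing) (auto simp: Suc_le_eq)
  hence "h / c' <= side k ^ DIM('a)" using s by simp
  hence "h <= c' * side k ^ DIM('a)" using c' by (simp add: field_simps)
  have "SI (cell k x) H <= NI H"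
   by (intro nn_integral_mono) (auto simp: indicator_def)
  also have "... <= en (c' * side k ^ DIM('a))" unfolding h(1) using \<open>h <= _\<close> by (rule ennreal_leI)
  also have "... = en c' * vol (cell k x)" using c' by (simp only: emeasure_cell) (simp add: ennreal_mult)
  also have "... <= c * vol (cell k x)" using c' by (intro mult_right_mono) auto
  finally show ?thesis by (simp add: hot_def not_less)
 qed
 thus ?thesis by blast
qed

lemma hot_stops:
 assumes "NI H < \<infinity>" "0 < c"
 shows "EX S kk xx. stops (hot c H) S kk xx"
 by (rule stopping_cells[OF hot_cong hot_vanish[OF assms]])

lemma stops_hot_Union: "stops (hot c H) S kk xx ==> \<Union>S = {x. c < Mcell H x}"
 using stopsD(3)[of "hot c H" S kk xx] by (simp add: Mcell_less_iff hot_def)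

text \<open>The stopping cells are disjoint and fill the level set exactly, hence the constant
  1.\<close>

lemma Mcell_weak:
 assumes [measurable]: "H : LM"
 assumes "NI H < \<infinity>" "0 < c"
 shows "c * emeasure lebesgue {x. c < Mcell H x} <= NI H"
proof -
 obtain S kk xx where "stops (hot c H) S kk xx" using hot_stops[OF assms(2,3)] by blast
 note S = stopsD[OF this] and U = stops_hot_Union[OF this]
 have mS: "\<Union>S : sets lebesgue" using S(1,8) by (intro sets.countable_Union) auto
 have "c * emeasure lebesgue {x. c < Mcell H x} = SI (\<Union>S) (%x. c)"
  unfolding U[symmetric] using mS by (subst nn_integral_cmult_indicator) auto
 also have "... <= SI (\<Union>S) H"
 proof (rule set_nn_integral_mono_partition[OF S(1,2)])
  fix A assume A: "A : S"
  show "A : sets lebesgue" by (rule S(8)[OF A])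
  have "c * vol A < SI A H"
   using S(5)[OF A] S(4)[OF A] by (simp add: hot_def)
  thus "SI A (%y. c) <= SI A H"
   using S(8)[OF A] by (subst nn_integral_cmult_indicator) auto
 qed auto
 also have "... <= NI H" by (intro nn_integral_mono) (auto simp: indicator_def)
 finally show ?thesis .
qed

text \<open>If no cell composing the neighbourhood were hot, its mean would be at most
  \<open>c\<close>. A hot one lies in a stopping cell of the same or a coarser scale, whose
  neighbourhood contains \<open>x\<close>.\<close>

lemma Mnbhd_sub_stops:
 assumes "stops (hot c H) S kk xx" "c ~= top" and [measurable]: "H : LM"
 shows "{x. c < Mnbhd H x} <= \<Union>((%A. nbhd (kk A) (xx A)) ` S)"
proof
 note S = stopsD[OF assms(1)]
 fix x assume "x : {x. c < Mnbhd H x}"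
 then obtain k where k: "c * vol (nbhd k x) < SI (nbhd k x) H"
  by (auto simp: Mnbhd_less_iff)
 have "\<exists>y\<in>nbhd k x. hot c H k y"
 proof (rule ccontr)
  assume "~ ?thesis"
  hence "SI (cell k y) H <= SI (cell k y) (%z. c)" if "y : nbhd k x" for y
   using that by (subst nn_integral_cmult_indicator) (auto simp: hot_def not_less)
  hence "SI (nbhd k x) H <= SI (nbhd k x) (%z. c)"
   by (intro set_nn_integral_nbhd_le) auto
  also have "... = c * vol (nbhd k x)" by (subst nn_integral_cmult_indicator) auto
  finally show False using k by simp
 qed
 then obtain y where y: "y : nbhd k x" "hot c H k y" by blast
 then obtain A where A: "A : S" "y : A" "kk A <= k" using S(7) by blast
 have "y : cell (kk A) (xx A)" using A S(4) by auto
 hence "nbhd (kk A) y = nbhd (kk A) (xx A)" by (rule nbhd_eq)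
 moreover have "x : nbhd (kk A) y" using nbhd_antimono[OF A(3), of y] y(1) nbhd_sym by blast
 ultimately show "x : \<Union>((%A. nbhd (kk A) (xx A)) ` S)" using A by blast
qed

text \<open>\<open>A\<^sub>1\<close> in dyadic form, required at every \<open>z\<close> and not just
  almost everywhere: the powers of \<open>Mnbhd\<close> used below satisfy it everywhere.\<close>

definition A1w :: "real => ('a::euclidean_space => ennreal) => bool" where
 "A1w C W \<longleftrightarrow> (ALL k x z. z : cell k x --> SI (nbhd k x) W <= en C * vol (cell k x) * W z)"

lemma A1w_one: "A1w (3 ^ DIM('a)) (%_::'a::euclidean_space. 1)"
 unfolding A1w_def by (auto simp: vol_nbhd mult_ac)

text \<open>On a stopping cell \<open>c \<bar>A\<bar>\<close> is below the mass of \<open>H\<close>,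
  and the \<open>A\<^sub>1\<close> condition bounds the \<open>W\<close>-mass of the neighbourhood
  by \<open>C \<bar>A\<bar> W(y)\<close> for every \<open>y\<close> in \<open>A\<close>. Integrating
  in \<open>y\<close> combines the two, and the volume of \<open>A\<close> cancels.\<close>

lemma Mnbhd_weak:
 assumes [measurable]: "H : LM" "W : LM"
 assumes fin: "NI H < \<infinity>" and c: "0 < c" "c ~= top" and A1: "A1w C W"
 shows "c * SI {x. c < Mnbhd H x} W <= en C * NI (%x. H x * W x)"
proof -
 obtain S kk xx where st: "stops (hot c H) S kk xx" using hot_stops[OF fin c(1)] by blast
 note S = stopsD[OF st]
 let ?E = "%A. nbhd (kk A) (xx A)"
 let ?A = "%x. c * W x"
 let ?B = "%x. en C * (H x * W x)"
 have "c * SI {x. c < Mnbhd H x} W = SI {x. c < Mnbhd H x} ?A"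
  by (subst nn_integral_cmult[symmetric]) (auto simp: mult_ac)
 also have "... <= SI (\<Union>(?E ` S)) ?A"
  using Mnbhd_sub_stops[OF st c(2)] by (intro nn_integral_mono) (auto simp: indicator_def)
 also have "... <= SI (\<Union>S) ?B"
 proof (rule set_nn_integral_Union_le_partition[OF S(1,2)])
  fix A assume A: "A : S"
  show mA [measurable]: "A : sets lebesgue" by (rule S(8)[OF A])
  show "?E A : sets lebesgue" by simp
  let ?w = "SI (?E A) W" and ?m = "vol (cell (kk A) (xx A))"
  have hot: "c * ?m < SI A H"
   using S(5)[OF A] S(4)[OF A] by (simp add: hot_def)
  have "?m * (c * ?w) = (c * ?m) * ?w" by (simp add: mult_ac)
  also have "... <= SI A H * ?w" using hot by (intro mult_right_mono) auto
  also have "... = NI (%y. H y * indicator A y * ?w)" by (subst nn_integral_multc) auto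
  also have "... <= NI (%y. ?m * (en C * (H y * W y) * indicator A y))"
  proof (rule nn_integral_mono, goal_cases)
   case (1 y)
   show ?case
   proof (cases "y : A")
    case True
    hence "y : cell (kk A) (xx A)" using S(4)[OF A] by auto
    hence "?w <= en C * ?m * W y" using A1 unfolding A1w_def by blast
    hence "H y * ?w <= H y * (en C * ?m * W y)" by (rule mult_left_mono) simp
    thus ?thesis using True by (simp add: mult_ac)
   qed auto
  qed
  also have "... = ?m * SI A (%y. en C * (H y * W y))" by (rule nn_integral_cmult) measurable
  finally have "c * ?w <= SI A (%y. en C * (H y * W y))"
   by (simp only: ennreal_mult_le_mult_iff[OF vol_facts(1,2)])
  moreover have "c * ?w = SI (?E A) ?A"
   by (subst nn_integral_cmult[symmetric]) (auto simp: mult_ac)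
  ultimately show "SI (?E A) ?A <= SI A (%y. en C * (H y * W y))" by simp
 qed auto
 also have "... <= NI ?B"
  by (intro nn_integral_mono) (auto simp: indicator_def)
 also have "... = en C * NI (%x. H x * W x)" by (rule nn_integral_cmult) measurable
 finally show ?thesis .
qed

lemma measure_cell: "measure lebesgue (cell k x :: 'a::euclidean_space set) = side k ^ DIM('a)"
 by (simp add: measure_def emeasure_cell del: emeasure_completion)

lemma measure_cell_pos [simp]: "0 < measure lebesgue (cell k (x::'a::euclidean_space))"
 unfolding measure_cell by simp

lemma emeasure_cell': "vol (cell k x) = en (measure lebesgue (cell k x))"
 unfolding measure_cell by (rule emeasure_cell)

lemma emeasure_nbhd': "vol (nbhd k x :: 'a::euclidean_space set) = en (3 ^ DIM('a) * measure lebesgue (cell k x))"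
 unfolding measure_cell by (rule emeasure_nbhd)

lemma Mnbhd_ge: "SI (nbhd k x) G <= Mnbhd G x * vol (nbhd k x)"
 using Mnbhd_le_iff[of G x "Mnbhd G x"] by simp

lemma Mnbhd_eq_0: assumes "NI H = 0" shows "Mnbhd H x = 0"
proof -
 have "SI (nbhd k x) H <= 0" for k
  unfolding assms[symmetric] by (intro nn_integral_mono) (auto simp: indicator_def)
 hence "Mnbhd H x <= 0" unfolding Mnbhd_le_iff by simp
 thus ?thesis by simp
qed

section \<open>Kolmogorov's inequality; powers of maximal functions as weights\<close>

text \<open>In the layer-cake integral the level set inside \<open>E\<close> has measure at most
  \<open>e\<close> and, by the weak bound, at most \<open>3^n h / l\<close>; each bound is used on
  the range of levels where it is integrable.\<close>

lemma Mnbhd_Kolmogorov: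
 fixes H :: "'a::euclidean_space => ennreal"
 assumes [measurable]: "H : LM" "E : sets lebesgue"
  and h: "NI H <= en h" "0 <= h" and e: "vol E = en e" "0 <= e"
  and a: "0 < a" "a < 1"
 shows "RSI E (%x. enn2real (Mnbhd H x) powr a) <= en ((1 + a * 3 ^ DIM('a) / (1 - a)) * (e powr (1 - a) * h powr a))"
proof -
 define m where "m x = enn2real (Mnbhd H x)" for x
 have [measurable]: "m : LM" unfolding m_def by measurable
 consider "e = 0" | "h = 0" | "e > 0" "h > 0" using e h by linarith
 thus ?thesis
 proof cases
  case 1
  hence "E : null_sets lebesgue" using e by (auto intro!: null_setsI)
  hence "RSI E (%x. enn2real (Mnbhd H x) powr a) = 0"
   by (rule nn_integral_null_set)
  thus ?thesis by simp
 next
  case 2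
  hence "NI H = 0" using h by simp
  thus ?thesis using a by (simp add: Mnbhd_eq_0)
 next
  case 3
  \<comment> \<open>The height at which \<open>e\<close> and \<open>h / l\<close> agree.\<close>
  define t where "t = h / e"
  have t: "t > 0" using 3 by (simp add: t_def)
  define c where "c l = en (l powr (a - 1)) * indicator {0..} l" for l :: real
  let ?A = "%y. SI {x. y < m x} (%x. indicator E x)"
  let ?C = "%x. en (3 ^ DIM('a) * h / x)"
  have wk: "?A l <= ?C l" if "l > 0" for l
  proof -
   have "?A l <= SI {x. en l < Mnbhd H x} (%x. 1)"
   proof (rule nn_integral_mono, goal_cases)
    case (1 x)
    have "en l < Mnbhd H x" if "l < m x"
     using that \<open>l > 0\<close> unfolding m_def by (cases "Mnbhd H x") (auto simp: ennreal_less_iff)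
    thus ?case
     by (auto simp: indicator_def)
   qed
   also have "... <= ?C l"
   proof -
    have "en l * SI {x. en l < Mnbhd H x} (%x. 1) <= en (3 ^ DIM('a)) * NI (%x. H x * 1)"
     using h \<open>l > 0\<close> by (intro Mnbhd_weak A1w_one) (auto intro: le_less_trans)
    also have "... <= en (3 ^ DIM('a)) * en h" using h by (intro mult_left_mono) auto
    also have "... = en l * ?C l"
     using \<open>l > 0\<close> h by (simp add: ennreal_mult[symmetric])
    finally show ?thesis using \<open>l > 0\<close> by (subst (asm) ennreal_mult_le_mult_iff) auto
   qed
   finally show ?thesis .
  qed
  have E1: "?A l <= en e" for l
  proof -
   have "?A l <= NI (%x. indicator E x)"
    by (intro nn_integral_mono) (auto simp: indicator_def)
   also have "... = en e" using e by simp
   finally show ?thesis .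
  qed
  let ?B = "%y. NI (%x. indicator E x * en (m x powr y / y))"
  let ?D = "en (3 ^ DIM('a) * h)"
  have "?B a
   = (\<integral>\<^sup>+l\<in>{0..}. en (l powr (a - 1)) * ?A l \<partial>lborel)"
   by (rule nn_integral_powr_layer[symmetric]) (use a in \<open>auto simp: m_def\<close>)
  also have "... <= (\<integral>\<^sup>+l. en e * (en (l powr (a - 1)) * indicator {0..t} l)
     + ?D * (en (l powr (- (1 - a) - 1)) * indicator {t..} l) \<partial>lborel)"
  proof (rule nn_integral_mono, goal_cases)
   case (1 l)
   let ?I = "?A l"
   consider "l < 0" | "0 <= l" "l <= t" | "t < l" by linarith
   thus ?case
   proof cases
    case 2
    hence "en (l powr (a - 1)) * ?I <= en (l powr (a - 1)) * en e" using E1 by (intro mult_left_mono) auto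
    thus ?thesis using 2 by (auto simp: indicator_def mult_ac intro: add_increasing2)
   next
    case 3
    hence "l > 0" using t by linarith
    hence "en (l powr (a - 1)) * ?I <= en (l powr (a - 1)) * ?C l" using wk by (intro mult_left_mono) auto
    also have "... = ?D * en (l powr (- (1 - a) - 1))"
     using \<open>l > 0\<close> h by (simp add: ennreal_mult[symmetric] powr_diff power2_eq_square mult_ac)
    finally show ?thesis using 3 \<open>l > 0\<close> by (auto simp: indicator_def)
   qed (auto simp: indicator_def)
  qed
  also have "... = en e * en (t powr a / a) + ?D * en (t powr (- (1 - a)) / (1 - a))"
   using nn_integral_powr_0[of a t] nn_integral_powr_inf[of "1 - a" t] t a
   by (subst nn_integral_add) (auto simp: nn_integral_cmult)
  also have "... = en (e * (t powr a / a) + 3 ^ DIM('a) * h * (t powr (- (1 - a)) / (1 - a)))"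
   using e h a by (simp add: ennreal_mult[symmetric] flip: ennreal_plus)
  also have "e * (t powr a / a) + 3 ^ DIM('a) * h * (t powr (- (1 - a)) / (1 - a)) = (1 + a * 3 ^ DIM('a) / (1 - a)) * (e powr (1 - a) * h powr a) / a"
  proof -
   have "e * t powr a = e powr (1 - a) * h powr a"
    using 3 by (simp add: t_def powr_divide powr_diff)
   moreover have "h * t powr (- (1 - a)) = e powr (1 - a) * h powr a"
    using 3 by (simp add: t_def powr_divide powr_diff powr_minus field_simps)
   ultimately show ?thesis using a by (simp add: field_simps) 
  qed
  finally have *: "?B a <= en ((1 + a * 3 ^ DIM('a) / (1 - a)) * (e powr (1 - a) * h powr a) / a)" .
  let ?E = "1 + a * 3 ^ DIM('a) / (1 - a)"
  have "RSI E (%x. enn2real (Mnbhd H x) powr a) = NI (%x. en a * (indicator E x * en (m x powr a / a)))"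
   using a by (intro nn_integral_cong) (auto simp: indicator_def m_def ennreal_mult[symmetric])
  also have "... = en a * ?B a"
   by (rule nn_integral_cmult) measurable
  also have "... <= en a * en (?E * (e powr (1 - a) * h powr a) / a)"
   using * by (rule mult_left_mono) simp
  also have "... = en (?E * (e powr (1 - a) * h powr a))"
   using a by (subst ennreal_mult[symmetric]) auto
  finally show ?thesis .
 qed
qed

text \<open>A quantitative \<open>A\<^sub>\<infinity>\<close> condition with exponent
  \<open>d\<close>: subsets of small relative volume have small relative weight. The good-lambda
  step uses the weight through this condition.\<close>

definition Ainf :: "real => real => ('a::euclidean_space => ennreal) => bool" where
 "Ainf d C W \<longleftrightarrow> (ALL k x E. E : sets lebesgue --> E <= cell k x -->
   (SI E W) <= en (C * (measure lebesgue E / measure lebesgue (cell k x)) powr d) * SI (cell k x) W)"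

text \<open>At scale \<open>k\<close> and finer ones only \<open>G\<close> near the cell is seen. At
  coarser scales the neighbourhood of \<open>z\<close> lies in the parent neighbourhood of
  \<open>y\<close>, of \<open>2^n\<close> times the volume.\<close>

lemma Mnbhd_split:
 fixes G :: "'a::euclidean_space => ennreal"
 assumes "y : cell k x" "z : nbhd k x"
 shows "Mnbhd G z <= Mnbhd (%w. G w * indicator (nbhd (k - 1) x) w) z + en (2 ^ DIM('a)) * Mnbhd G y"
 unfolding Mnbhd_le_iff
proof
 fix j
 let ?H = "%w. G w * indicator (nbhd (k - 1) x) w"
 let ?A = "Mnbhd ?H z + en (2 ^ DIM('a)) * Mnbhd G y"
 show "SI (nbhd j z) G <= ?A * vol (nbhd j z)"
 proof (cases "k <= j")
  case True
  have "nbhd j z <= nbhd (k - 1) x" using nbhd_antimono[OF True, of z] nbhd_nbhd[OF assms(2)] by blast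
  hence "SI (nbhd j z) G = SI (nbhd j z) ?H"
   by (intro nn_integral_cong) (auto simp: indicator_def)
  also have "... <= Mnbhd ?H z * vol (nbhd j z)" by (rule Mnbhd_ge)
  also have "... <= ?A * vol (nbhd j z)"
   by (intro mult_right_mono) auto
  finally show ?thesis .
 next
  case False
  hence jk: "j <= k" "j - 1 <= k" by auto
  have "z : nbhd j x" using nbhd_antimono[OF jk(1)] assms(2) by blast
  hence "nbhd j z <= nbhd (j - 1) x" by (rule nbhd_nbhd)
  also have "nbhd (j - 1) x = nbhd (j - 1) y" by (rule nbhd_nested[OF assms(1) jk(2), symmetric])
  finally have "SI (nbhd j z) G <= SI (nbhd (j - 1) y) G"
   by (intro nn_integral_mono) (auto simp: indicator_def)
  also have "... <= Mnbhd G y * vol (nbhd (j - 1) y)" by (rule Mnbhd_ge)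
  also have "... = en (2 ^ DIM('a)) * Mnbhd G y * vol (nbhd j z)"
   by (simp only: vol_nbhd vol_cell_diff1[of j y z]) (simp add: mult_ac)
  also have "... <= (Mnbhd ?H z + en (2 ^ DIM('a)) * Mnbhd G y) * vol (nbhd j z)"
   by (intro mult_right_mono) auto
  finally show ?thesis .
 qed
qed

lemma powr_add_le:
 fixes x y a :: real
 assumes "0 <= x" "0 <= y" "0 < a" "a <= 1"
 shows "(x + y) powr a <= x powr a + y powr a"
proof (cases "x + y = 0")
 case False
 hence s: "x + y > 0" using assms by linarith
 have "x / (x + y) <= (x / (x + y)) powr a" "y / (x + y) <= (y / (x + y)) powr a"
  using assms s powr_mono'[of a 1] by (auto simp: divide_le_eq_1 powr_one_gt_zero_iff)
 hence "1 <= (x / (x + y)) powr a + (y / (x + y)) powr a"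
  using s by (smt (verit) add_divide_distrib divide_self)
 also have "... = (x powr a + y powr a) / (x + y) powr a"
  using assms s by (simp add: powr_divide add_divide_distrib)
 finally show ?thesis using s by (simp add: field_simps)
qed (use assms in auto)

text \<open>The Coifman-Rochberg argument: Kolmogorov's inequality for the local part of
  \<open>G\<close>, while the rest of the maximal function is at most a multiple of its value at
  \<open>y\<close>. Keeping a general \<open>E\<close> prepares the \<open>A\<^sub>1\<close> and the
  \<open>A\<^sub>\<infinity>\<close> estimate at once.\<close>

lemma Mnbhd_powr_weight:
 fixes G :: "'a::euclidean_space => ennreal"
 assumes [measurable]: "G : LM" "E : sets lebesgue"
  and fin: "!!x. Mnbhd G x < \<infinity>" and a: "0 < a" "a < 1"
  and E: "E <= nbhd k x" and y: "y : cell k x"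
 shows "RSI E (%z. enn2real (Mnbhd G z) powr a)
  <= en (((1 + a * 3 ^ DIM('a) / (1 - a)) * 6 ^ DIM('a) + 6 ^ DIM('a)) * (measure lebesgue E powr (1 - a) * measure lebesgue (cell k x) powr a))
    * en (enn2real (Mnbhd G y) powr a)"
proof -
 define m where "m x = enn2real (Mnbhd G x)" for x
 have m: "Mnbhd G x = en (m x)" "0 <= m x" for x using fin[of x] by (auto simp: m_def)
 define H where "H w = G w * indicator (nbhd (k - 1) x) w" for w
 have [measurable]: "H : LM" unfolding H_def by measurable
 define c where "c = measure lebesgue (cell k x)"
 have c: "c > 0" unfolding c_def by (rule measure_cell_pos)
 define e where "e = measure lebesgue E"
 have "vol E <= vol (nbhd k x)" by (rule emeasure_mono[OF E]) simp
 hence le3: "vol E <= en (3 ^ DIM('a) * c)" by (simp only: emeasure_nbhd' c_def)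
 hence "vol E ~= top" by (rule neq_top_trans[OF ennreal_neq_top])
 hence e: "vol E = en e" by (simp add: e_def emeasure_eq_ennreal_measure)
 have e0: "0 <= e" "e <= 3 ^ DIM('a) * c" using le3 c unfolding e by (auto simp: e_def)
 \<comment> \<open>The parent neighbourhood has \<open>6^n = 3^n 2^n\<close> times the volume of the
   cell, so \<open>h\<close> bounds the mass of \<open>H\<close>.\<close>
 define h where "h = 6 ^ DIM('a) * c * m y"
 have h0: "0 <= h" using c m by (simp add: h_def)
 have nb: "nbhd (k - 1) x = nbhd (k - 1) y" by (rule nbhd_nested[OF y, symmetric]) simp
 have h: "NI H <= en h"
 proof -
  let ?H = "3 ^ DIM('a) * (2 ^ DIM('a) * c)"
  have "NI H <= Mnbhd G y * vol (nbhd (k - 1) y)"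
   unfolding H_def nb by (rule Mnbhd_ge)
  also have "... = en (m y) * (en (3 ^ DIM('a)) * (en (2 ^ DIM('a)) * en c))"
   by (simp only: m(1) vol_nbhd vol_cell_diff1[of k y x]) (simp only: emeasure_cell' c_def)
  also have "... = en (m y * ?H)"
   using c m by (simp add: ennreal_mult)
  also have "m y * ?H = h"
   by (simp add: h_def power_mult_distrib[symmetric] mult_ac)
  finally show ?thesis .
 qed
 have finH: "Mnbhd H z < \<infinity>" for z
 proof -
  have "Mnbhd H z <= Mnbhd G z" unfolding Mnbhd_le_iff
  proof
   fix j
   have "SI (nbhd j z) H <= SI (nbhd j z) G"
    by (intro nn_integral_mono) (auto simp: H_def indicator_def)
   thus "SI (nbhd j z) H <= Mnbhd G z * vol (nbhd j z)" using Mnbhd_ge order_trans by blast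
  qed
  thus ?thesis using fin by (rule le_less_trans)
 qed
 let ?A = "2 ^ DIM('a) * m y"
 let ?B = "%x. enn2real (Mnbhd H x)"
 have pw: "m z powr a <= ?B z powr a + ?A powr a" if "z : E" for z
 proof -
  have "Mnbhd G z <= Mnbhd H z + en (2 ^ DIM('a)) * Mnbhd G y"
   unfolding H_def using y that E by (intro Mnbhd_split) auto
  also have "... = en (?B z + 2 ^ DIM('a) * m y)"
   using finH[of z] m[of y] by (simp add: ennreal_mult ennreal_plus)
  finally have "m z <= ?B z + 2 ^ DIM('a) * m y"
   unfolding m using m[of y] by (subst (asm) ennreal_le_iff) auto
  hence "m z powr a <= (?B z + 2 ^ DIM('a) * m y) powr a"
   using m a by (intro powr_mono2) auto
  also have "... <= ?B z powr a + ?A powr a"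
   using m a by (intro powr_add_le) auto
  finally show ?thesis .
 qed
 let ?K = "(1 + a * 3 ^ DIM('a) / (1 - a))"
 have K: "?K >= 0" using a by simp
 have pa: "b powr a <= b" if "b >= 1" for b :: real using powr_mono[of a 1 b] that a by simp
 let ?C = "e powr (1 - a) * h powr a"
 let ?D = "?K * 6 ^ DIM('a) + 6 ^ DIM('a)"
 let ?E = "e powr (1 - a) * c powr a"
 have "RSI E (%z. m z powr a) <= NI (%z. en (?B z powr a) * indicator E z + en (?A powr a) * indicator E z)"
  using pw by (intro nn_integral_mono) (auto simp: indicator_def simp flip: ennreal_plus)
 also have "... = RSI E (%z. ?B z powr a) + en (?A powr a) * en e"
  by (subst nn_integral_add) (auto simp: nn_integral_cmult_indicator e simp del: emeasure_completion)
 also have "... <= en (?K * ?C) + en (?A powr a * e)"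
  using e0 a h h0 e by (intro add_mono Mnbhd_Kolmogorov) (auto simp: ennreal_mult)
 also have "... = en (?K * ?C + ?A powr a * e)"
  using K e0 h0 by (simp add: ennreal_plus)
 also have "... <= en (?D * ?E * m y powr a)"
 proof (rule ennreal_leI)
  let ?G = "c powr a * m y powr a"
  have "h powr a = (6 ^ DIM('a)) powr a * ?G"
   using c m by (simp add: h_def powr_mult)
  also have "... <= 6 ^ DIM('a) * ?G" by (intro mult_right_mono pa) auto
  finally have 1: "?K * ?C <= ?K * (e powr (1 - a) * (6 ^ DIM('a) * ?G))"
   using K by (intro mult_left_mono) auto
  let ?F = "3 ^ DIM('a) * c powr a"
  have "e = e powr (1 - a) * e powr a" using e0 by (cases "e = 0") (auto simp: powr_add[symmetric])
  also have "... <= e powr (1 - a) * ?F"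
  proof (intro mult_left_mono)
   have "e powr a <= (3 ^ DIM('a) * c) powr a" using e0 a by (intro powr_mono2) auto
   also have "... = (3 ^ DIM('a)) powr a * c powr a" using c by (simp add: powr_mult)
   also have "... <= 3 ^ DIM('a) * c powr a" by (intro mult_right_mono pa) auto
   finally show "e powr a <= 3 ^ DIM('a) * c powr a" .
  qed simp
  finally have e1: "e <= e powr (1 - a) * ?F" .
  have "?A powr a = (2 ^ DIM('a)) powr a * m y powr a" using m by (simp add: powr_mult)
  also have "... <= 2 ^ DIM('a) * m y powr a" by (intro mult_right_mono pa) auto
  finally have "?A powr a * e <= (2 ^ DIM('a) * m y powr a) * (e powr (1 - a) * ?F)"
   using e1 e0 by (intro mult_mono) auto
  also have "... = 6 ^ DIM('a) * (e powr (1 - a) * c powr a * m y powr a)"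
   by (simp add: power_mult_distrib[symmetric] mult_ac)
  finally show "?K * ?C + ?A powr a * e <= ?D * ?E * m y powr a"
   using 1 by (simp add: algebra_simps)
 qed
 also have "... = en (?D * ?E) * en (m y powr a)"
  using K by (subst ennreal_mult) auto
 finally show ?thesis unfolding m_def c_def e_def .
qed

text \<open>For the first condition take \<open>E\<close> to be the whole neighbourhood; for the
  second average over \<open>y\<close> in the cell. The constants depend on \<open>a\<close> and the
  dimension only, so they survive the truncation of weights made later.\<close>

lemma Mnbhd_powr_A1w:
 fixes G :: "'a::euclidean_space => ennreal"
 assumes a: "0 < a" "a < 1"
 shows "\<exists>C1>0. \<exists>C2>0. ALL G::'a => ennreal. G : LM --> (ALL x. Mnbhd G x < \<infinity>) -->
  A1w C1 (%x. en (enn2real (Mnbhd G x) powr a)) & Ainf (1 - a) C2 (%x. en (enn2real (Mnbhd G x) powr a))"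
proof -
 define K where "K = (1 + a * 3 ^ DIM('a) / (1 - a)) * 6 ^ DIM('a) + 6 ^ DIM('a)"
 have K: "K > 0" using a by (simp add: K_def add_pos_pos)
 let ?A = "%y. %x. en (enn2real (Mnbhd y x) powr a)"
 have "A1w (K * (3 ^ DIM('a)) powr (1 - a)) (?A G) & Ainf (1 - a) K (?A G)"
  if [measurable]: "G : LM" and fin: "ALL x. Mnbhd G x < \<infinity>" for G :: "'a => ennreal"
 proof
  define W where "W x = en (enn2real (Mnbhd G x) powr a)" for x
  have [measurable]: "W : LM" unfolding W_def by measurable
  have main: "SI E W <= en (K * (measure lebesgue E powr (1 - a) * measure lebesgue (cell k x) powr a)) * W y"
   if "E : sets lebesgue" "E <= nbhd k x" "y : cell k x" for E k x y
   unfolding W_def K_def using that fin a by (intro Mnbhd_powr_weight) auto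
  let ?B = "K * (3 ^ DIM('a)) powr (1 - a)"
  have "A1w ?B W"
   unfolding A1w_def
  proof (intro allI impI)
   fix k :: int and x z :: 'a assume z: "z : cell k x"
   let ?D = "measure lebesgue (cell k x)"
   define c where "c = ?D"
   have c: "c > 0" unfolding c_def by (rule measure_cell_pos)
   let ?E = "measure lebesgue (nbhd k x)"
   have n: "?E = 3 ^ DIM('a) * c"
    using c unfolding c_def by (simp add: measure_def emeasure_nbhd' del: emeasure_completion)
   have "SI (nbhd k x) W <= en (K * (?E powr (1 - a) * ?D powr a)) * W z"
    by (rule main) (use z in auto)
   also have "?E powr (1 - a) * ?D powr a = (3 ^ DIM('a)) powr (1 - a) * c"
    unfolding n c_def[symmetric] using c by (simp add: powr_mult powr_diff)
   also have "en (K * ((3 ^ DIM('a)) powr (1 - a) * c)) = en ?B * vol (cell k x)"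
    using K c unfolding emeasure_cell' c_def[symmetric] by (subst ennreal_mult[symmetric]) (auto simp: mult_ac)
   finally show "SI (nbhd k x) W <= en ?B * vol (cell k x) * W z" .
  qed
  thus "A1w ?B (?A G)" unfolding W_def .
  have "Ainf (1 - a) K W"
   unfolding Ainf_def
  proof (intro allI impI)
   fix k :: int and x :: 'a and E :: "'a set" assume E [measurable]: "E : sets lebesgue" and Ec: "E <= cell k x"
   define c where "c = measure lebesgue (cell k x)"
   have c: "c > 0" unfolding c_def by (rule measure_cell_pos)
   define e where "e = measure lebesgue E"
   let ?I = "SI E W"
   let ?C = "en (K * (e powr (1 - a) * c powr a))"
   have "vol (cell k x) * ?I = NI (%y. ?I * indicator (cell k x) y)"
    by (subst nn_integral_cmult_indicator) (auto simp: mult.commute)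
   also have "... <= NI (%y. ?C * (W y * indicator (cell k x) y))"
   proof (rule nn_integral_mono, goal_cases)
    case (1 y)
    have "?I <= ?C * W y" if "y : cell k x"
     unfolding e_def c_def using cell_le_nbhd Ec that by (intro main) auto
    thus ?case
     by (auto simp: indicator_def)
   qed
   also have "... = ?C * SI (cell k x) W"
    by (rule nn_integral_cmult) measurable
   also have "K * (e powr (1 - a) * c powr a) = c * (K * (e / c) powr (1 - a))"
    using c by (simp add: e_def powr_divide powr_diff field_simps)
   also have "en ... = vol (cell k x) * en (K * (e / c) powr (1 - a))"
    using c K unfolding emeasure_cell' c_def[symmetric] by (simp add: ennreal_mult)
   finally have "?I <= en (K * (e / c) powr (1 - a)) * SI (cell k x) W"
    by (simp only: mult.assoc ennreal_mult_le_mult_iff[OF vol_facts(1,2)])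
   thus "?I <= en (K * (measure lebesgue E / measure lebesgue (cell k x)) powr (1 - a)) * SI (cell k x) W"
    unfolding e_def c_def .
  qed
  thus "Ainf (1 - a) K (?A G)" unfolding W_def .
 qed
 moreover have "K * (3 ^ DIM('a)) powr (1 - a) > 0" using K by simp
 ultimately show ?thesis using K by blast
qed

section \<open>Good-lambda inequality and sharp functions\<close>

text \<open>Differentiation against constants: the comparison holds on each set where
  \<open>Mcell F\<close> is at most a given rational, and rationals separate values.\<close>

lemma AE_le_Mcell:
 fixes F :: "'a::euclidean_space => ennreal"
 assumes [measurable]: "F : LM"
 shows "AE x in lebesgue. F x <= Mcell F x"
proof -
 have "AE x in lebesgue. x : {x. Mcell F x <= en (real_of_rat q)} --> F x <= en (real_of_rat q)" for q :: rat
 proof (rule AE_le_of_cell_integrals_le[of F "%_. en (real_of_rat q)"])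
  have "{x : space lebesgue. Mcell F x <= en (real_of_rat q)} : sets lebesgue" by measurable
  thus "{x. Mcell F x <= en (real_of_rat q)} : sets lebesgue" by simp
  show "(\<integral>\<^sup>+x\<in>ball 0 R. en (real_of_rat q) \<partial>(lebesgue :: 'a measure)) < \<infinity>" for R
   by (subst nn_integral_cmult_indicator) (auto simp: ennreal_mult_less_top emeasure_lborel_ball_finite[unfolded infinity_ennreal_def])
  fix x k assume "x : {x. Mcell F x <= en (real_of_rat q)}"
  hence "SI (cell k x) F <= en (real_of_rat q) * vol (cell k x)"
   by (auto simp only: Mcell_le_iff mem_Collect_eq)
  thus "SI (cell k x) F <= RSI (cell k x) (%y. real_of_rat q)"
   by (subst nn_integral_cmult_indicator) auto
 qed auto
 hence "AE x in lebesgue. ALL q. Mcell F x <= en (real_of_rat q) --> F x <= en (real_of_rat q)"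
  unfolding AE_all_countable by simp
 thus ?thesis
 proof eventually_elim
  case (elim x)
  show ?case
  proof (rule ccontr)
   assume "~ ?thesis"
   then obtain q where q: "Mcell F x < en (real_of_rat q)" "en (real_of_rat q) < F x"
    using ennreal_rat_dense[of "Mcell F x" "F x"] by (auto simp: not_le)
   hence "F x <= en (real_of_rat q)" using elim less_imp_le by blast
   thus False using q(2) by simp
  qed
 qed
qed

text \<open>On a stopping cell at level \<open>l\<close> that has a point outside \<open>N\<close>,
  the oscillation over the parent is at most \<open>\<gamma> l\<close>. A mean of
  \<open>\<bar>f\<bar>\<close> above \<open>3 l\<close> then forces a mean of
  \<open>\<bar>f - c\<bar>\<close> above \<open>l\<close>; the weak bound makes this set a fraction
  \<open>2^n \<gamma>\<close> of the cell, which \<open>Ainf\<close> turns into a small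
  \<open>W\<close>-mass.\<close>

lemma good_lambda_step:
 fixes f :: "'a::euclidean_space => real" and G W :: "'a => ennreal"
 defines "F == %x. en \<bar>f x\<bar>"
 assumes [measurable]: "f : LM" "G : LM" "W : LM"
  and van: "!!x. EX k0. \<forall>k<k0. ~ hot (en l) F k x"
  and sharp: "!!x k r. 0 < r ==> Mnbhd G x <= en (r powr a) ==> EX c. RSI (cell k x) (%y. \<bar>f y - c\<bar>) <= en (C3 * r) * vol (cell k x)"
  and Ai: "Ainf d C2 W" and pos: "0 < d" "0 < C3" "0 < C2" "0 < \<gamma>" "\<gamma> <= 1" "0 < l"
 shows "SI {x. en (3 * l) < Mcell F x} W <= SI {x. en ((\<gamma> * l / C3) powr a) < Mnbhd G x} W
   + en (C2 * (2 ^ DIM('a) * \<gamma>) powr d) * SI {x. en l < Mcell F x} W"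
proof -
 have [measurable]: "F : LM" unfolding F_def by measurable
 let ?H = "en (3 * l)"
 define E where "E = {x. ?H < Mcell F x}"
 define N where "N = {x. en ((\<gamma> * l / C3) powr a) < Mnbhd G x}"
 have [measurable]: "E : sets lebesgue" "N : sets lebesgue" unfolding E_def N_def by (rule sets_Mcell, rule sets_Mnbhd)
 obtain S kk xx where "stops (hot (en l) F) S kk xx"
  using stopping_cells[of "hot (en l) F", OF hot_cong van] by blast
 note S = stopsD[OF this] and US = stops_hot_Union[OF this]
 let ?t = "en (C2 * (2 ^ DIM('a) * \<gamma>) powr d)"
 have mUS [measurable]: "\<Union>S : sets lebesgue" using S(1,8) by (intro sets.countable_Union) auto
 have EU: "E <= \<Union>S"
 proof
  fix x assume "x : E"
  moreover have "en l <= ?H" using pos by (intro ennreal_leI) auto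
  ultimately show "x : \<Union>S" unfolding US E_def by (auto intro: le_less_trans)
 qed
 let ?A = "%x. W x * indicator (E - N) x"
 let ?G = "%x. ?t * W x"
 have "SI (\<Union>S) ?A <= SI (\<Union>S) ?G"
 proof (rule set_nn_integral_mono_partition[OF S(1,2)])
  fix A assume A: "A : S"
  show mA [measurable]: "A : sets lebesgue" by (rule S(8)[OF A])
  define k where "k = kk A"
  have Ac: "A = cell k (xx A)" unfolding k_def by (rule S(4)[OF A])
  show "SI A ?A <= SI A ?G"
  proof (cases "A <= N")
   case True
   hence "SI A ?A = (\<integral>\<^sup>+x. 0 \<partial>(lebesgue :: 'a measure))"
    by (intro nn_integral_cong) (auto simp: indicator_def)
   thus ?thesis by simp
  next
   case False
   then obtain x where x: "x : A" "x ~: N" by auto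
   hence Acx: "A = cell k x" using Ac cell_eq by metis
   have nothot: "~ hot (en l) F j x" if "j < k" for j
   proof -
    have "x : cell j (xx A)" using cell_antimono[of j k "xx A"] that x(1) Ac by auto
    thus ?thesis using S(6)[OF A, of j] that hot_cong unfolding k_def by metis
   qed
   \<comment> \<open>Oscillation is measured on the parent, which is not hot by the maximality of
     the stopping cell.\<close>
   let ?B = "cell (k - 1) x"
   let ?C = "%x. RSI ?B (%y. \<bar>f y - x\<bar>)"
   obtain c where c: "?C c <= en (C3 * (\<gamma> * l / C3)) * vol ?B"
    using sharp[of "\<gamma> * l / C3" x "k - 1"] x(2) pos unfolding N_def by (auto simp: not_less)
   define v where "v = measure lebesgue ?B"
   have v: "v > 0" "vol ?B = en v" unfolding v_def by (rule measure_cell_pos, rule emeasure_cell')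
   let ?F = "en (\<gamma> * l * v)"
   have c': "?C c <= ?F"
    using c pos v unfolding v(2) by (simp add: ennreal_mult)
   have F1: "SI ?B F <= en (l * v)"
    using nothot[of "k - 1"] pos v unfolding hot_def v(2) by (simp add: not_less ennreal_mult)
   \<comment> \<open>The mean of \<open>\<bar>f\<bar>\<close> over the parent is at most
     \<open>l\<close>, and the oscillation adds at most \<open>\<gamma> l \<le> l\<close>.\<close>
   have cl: "\<bar>c\<bar> <= 2 * l"
   proof -
    have "en (\<bar>c\<bar> * v) = RSI ?B (%y. \<bar>c\<bar>)"
     by (subst nn_integral_cmult_indicator) (use v in \<open>auto simp: ennreal_mult simp del: emeasure_completion\<close>)
    also have "... <= NI (%y. F y * indicator ?B y + en \<bar>f y - c\<bar> * indicator ?B y)"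
     by (intro nn_integral_mono) (auto simp: indicator_def F_def simp flip: ennreal_plus)
    also have "... = SI ?B F + ?C c"
     by (rule nn_integral_add) measurable
    also have "... <= en (l * v) + ?F" by (intro add_mono F1 c')
    also have "... = en ((l + \<gamma> * l) * v)" using pos v by (simp add: ennreal_plus[symmetric] algebra_simps del: ennreal_plus)
    finally have "\<bar>c\<bar> * v <= (l + \<gamma> * l) * v" using pos v by (subst (asm) ennreal_le_iff) auto
    hence "\<bar>c\<bar> <= l + \<gamma> * l" using v by simp
    also have "\<gamma> * l <= 1 * l" using pos by (intro mult_right_mono) auto
    finally show ?thesis by simp
   qed
   define H where "H y = en \<bar>f y - c\<bar> * indicator A y" for y
   have [measurable]: "H : LM" unfolding H_def by measurable
   have Asub: "A <= cell (k - 1) x" unfolding Acx by (rule cell_antimono) simp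
   have Hint: "NI H <= ?F"
   proof -
    have "NI H <= ?C c"
     using Asub by (intro nn_integral_mono) (auto simp: H_def indicator_def)
    thus ?thesis using c' by (rule order_trans)
   qed
   have EH: "E \<inter> A <= {y. en l < Mcell H y}"
   proof
    fix y assume y: "y : E \<inter> A"
    then obtain j where j: "?H * vol (cell j y) < SI (cell j y) F"
     unfolding E_def by (auto simp: Mcell_less_iff simp del: emeasure_completion)
    define u where "u = measure lebesgue (cell j y)"
    have u: "u > 0" "vol (cell j y) = en u" unfolding u_def by (rule measure_cell_pos, rule emeasure_cell')
    have yc: "y : cell k x" using y Acx by auto
    \<comment> \<open>Cells around \<open>y\<close> coarser than \<open>A\<close> are also cells
      around \<open>x\<close> and have mean at most \<open>l\<close>; the mean above
      \<open>3 l\<close> is thus attained inside \<open>A\<close>.\<close>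
    have jk: "k <= j"
    proof (rule ccontr)
     assume "~ k <= j"
     hence jk: "j < k" by simp
     hence "cell j y = cell j x" using cell_nested[OF yc, of j] by simp
     hence "SI (cell j y) F <= en l * vol (cell j y)"
      using nothot[OF jk] by (simp add: hot_def not_less)
     also have "... <= ?H * vol (cell j y)" using pos by (intro mult_right_mono ennreal_leI) auto
     finally show False using j by simp
    qed
    have jA: "cell j y <= A" using cell_antimono[OF jk, of y] cell_eq[OF yc] Acx by auto
    let ?I = "en (3 * l * u)"
    let ?J = "%x. SI (cell j y) x"
    have "?I < ?J F"
     using j u pos unfolding u(2) by (simp add: ennreal_mult)
    also have "... <= NI (%z. H z * indicator (cell j y) z + en (2 * l) * indicator (cell j y) z)"
    proof (intro nn_integral_mono, goal_cases)
     case (1 z)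
     have "\<bar>f z\<bar> <= \<bar>f z - c\<bar> + 2 * l" using cl by linarith
     hence "en \<bar>f z\<bar> <= en (\<bar>f z - c\<bar> + 2 * l)" by (rule ennreal_leI)
     also have "... = en \<bar>f z - c\<bar> + en (2 * l)" using pos by (intro ennreal_plus) auto
     finally show ?case
      using jA by (auto simp: indicator_def H_def F_def)
    qed
    also have "... = ?J H + en (2 * l) * en u"
     by (subst nn_integral_add) (auto simp: nn_integral_cmult_indicator u(2) simp del: emeasure_completion)
    finally have *: "?I < ?J H + en (2 * l * u)"
     using pos u by (simp add: ennreal_mult)
    have "en (l * u) < ?J H"
    proof (rule ccontr)
     assume "~ ?thesis"
     hence "?J H + en (2 * l * u) <= en (l * u) + en (2 * l * u)"
      by (intro add_right_mono) (simp add: not_less)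
     also have "... = ?I" using pos u by (simp add: ennreal_plus[symmetric] del: ennreal_plus)
     finally show False using * by simp
    qed
    thus "y : {y. en l < Mcell H y}"
     using pos u(1) unfolding Mcell_less_iff mem_Collect_eq by (intro exI[of _ j]) (simp only: u(2), simp add: ennreal_mult)
   qed
   let ?D = "measure lebesgue (E \<inter> A)"
   have "en l * vol (E \<inter> A) <= en l * emeasure lebesgue {y. en l < Mcell H y}"
    using EH by (intro mult_left_mono emeasure_mono) auto
   also have "... <= NI H"
    using Hint pos by (intro Mcell_weak) (auto intro: le_less_trans)
   also have "... <= en l * en (\<gamma> * v)" using Hint pos v by (simp add: ennreal_mult[symmetric] mult_ac)
   finally have EAm: "vol (E \<inter> A) <= en (\<gamma> * v)"
    using pos by (subst (asm) ennreal_mult_le_mult_iff) auto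
   hence mE: "?D <= \<gamma> * v"
    using pos v unfolding measure_def by (intro enn2real_leI) auto
   let ?E = "measure lebesgue (cell k x)"
   have vv: "v = 2 ^ DIM('a) * ?E"
    unfolding v_def measure_cell by (simp add: power_mult_distrib)
   have "?D / ?E <= 2 ^ DIM('a) * \<gamma>"
    using mE measure_cell_pos[of k x] unfolding vv by (simp add: divide_le_eq mult_ac)
   hence pw: "(?D / ?E) powr d <= (2 ^ DIM('a) * \<gamma>) powr d"
    using pos by (intro powr_mono2) auto
   have "SI A ?A <= SI (E \<inter> A) W"
    by (intro nn_integral_mono) (auto simp: indicator_def)
   also have "... <= en (C2 * (?D / ?E) powr d) * SI (cell k x) W"
    using Ai unfolding Ainf_def by (rule allE[of _ k]) (use Acx in auto)
   also have "... <= ?t * SI A W"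
    unfolding Acx[symmetric] using pw pos Acx by (intro mult_right_mono ennreal_leI mult_left_mono) auto
   also have "... = SI A ?G"
    by (subst nn_integral_cmult[symmetric]) (auto simp: mult_ac)
   finally show ?thesis .
  qed
 qed auto
 also have "... = ?t * SI {x. en l < Mcell F x} W"
  unfolding US[symmetric] by (subst nn_integral_cmult[symmetric]) (auto simp: mult_ac)
 finally have *: "SI (\<Union>S) ?A <= ..." .
 have "SI E W <= NI (%x. W x * indicator N x + W x * indicator (E - N) x * indicator (\<Union>S) x)"
  using EU by (intro nn_integral_mono) (auto simp: indicator_def)
 also have "... = SI N W + SI (\<Union>S) ?A"
  by (rule nn_integral_add) measurable
 also have "... <= SI N W + ?t * SI {x. en l < Mcell F x} W"
  using * by (rule add_left_mono)
 finally show ?thesis unfolding E_def N_def .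
qed

text \<open>In the application \<open>f\<close> is known to be in \<open>L\<^sup>a\<close> but not
  in \<open>L\<^sup>1\<close>. This passes from hot cells of \<open>\<bar>f\<bar>\<close> to hot
  cells of \<open>\<bar>f\<bar> powr a\<close>, which disappear at large scales.\<close>

lemma hot_powr:
 fixes f :: "'a::euclidean_space => real"
 assumes [measurable]: "f : LM" and a: "a >= 1" and l: "l > 0"
  and h: "hot (en l) (%x. en \<bar>f x\<bar>) k x"
 shows "hot (en ((l/2) powr a)) (%x. en (\<bar>f x\<bar> powr a)) k x"
proof -
 define v where "v = measure lebesgue (cell k x)"
 have v: "v > 0" "vol (cell k x) = en v" unfolding v_def by (rule measure_cell_pos, rule emeasure_cell')
 let ?P = "RSI (cell k x) (%y. \<bar>f y\<bar> powr a)"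
 define e where "e = l / 2"
 have e: "e > 0" using l by (simp add: e_def)
 \<comment> \<open>Values up to half the level are harmless; above it, \<open>t\<close> is
   controlled by its \<open>a\<close>-th power.\<close>
 have pt: "t <= e + e powr (1 - a) * t powr a" if "t >= 0" for t
 proof (cases "t <= e")
  case False
  hence t: "t > 0" using e by linarith
  have "t = t powr (1 - a) * t powr a" using t by (simp add: powr_add[symmetric])
  also have "... <= e powr (1 - a) * t powr a" using False e t a by (intro mult_right_mono powr_mono2') auto
  finally show ?thesis using e by linarith
 qed (use e in \<open>auto intro: add_increasing2\<close>)
 let ?A = "en (e powr (1 - a))"
 let ?B = "%x. en (x * v)"
 have "?B l < RSI (cell k x) (%y. \<bar>f y\<bar>)"
  using h l v unfolding hot_def v(2) by (simp add: ennreal_mult)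
 also have "... <= NI (%y. en e * indicator (cell k x) y + ?A * (en (\<bar>f y\<bar> powr a) * indicator (cell k x) y))"
  using pt e by (intro nn_integral_mono) (auto simp: indicator_def ennreal_mult[symmetric] simp flip: ennreal_plus)
 also have "... = ?B e + ?A * ?P"
  using e v by (subst nn_integral_add) (auto simp: nn_integral_cmult_indicator nn_integral_cmult v(2) ennreal_mult simp del: emeasure_completion)
 finally have *: "?B l < ?B e + ?A * ?P" .
 show ?thesis
 proof (rule ccontr)
  assume "~ ?thesis"
  hence "?P <= en (e powr a * v)" using v unfolding hot_def v(2) e_def by (simp add: not_less ennreal_mult)
  hence "?B e + ?A * ?P <= ?B e + ?A * en (e powr a * v)"
   by (intro add_left_mono mult_left_mono) auto
  also have "... = en (e * v + e powr (1 - a) * e powr a * v)" using e v by (simp add: ennreal_mult[symmetric] ennreal_plus[symmetric] mult_ac del: ennreal_plus)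
  also have "e * v + e powr (1 - a) * e powr a * v = l * v" using e by (simp add: powr_add[symmetric] e_def)
  finally show False using * by simp
 qed
qed

text \<open>Values of \<open>g\<close> up to \<open>\<mu> / 2\<close> contribute at most
  \<open>\<mu> / 2\<close> to any mean, so the weak bound may be applied to the large values alone.
  This makes the later integration in the level converge.\<close>

lemma Mnbhd_weak_trunc:
 fixes g :: "'a::euclidean_space => real"
 assumes [measurable]: "g : LM" "W : LM"
  and g0: "!!x. 0 <= g x" and fin: "RI g < \<infinity>" and A1: "A1w C W" and mu: "\<mu> > 0" and C: "C >= 0"
 shows "SI {x. en \<mu> < Mnbhd (%x. en (g x)) x} W
   <= en (2 * C / \<mu>) * SI {x. \<mu> < 2 * g x} (%x. en (g x) * W x)"
proof -
 define H where "H x = en (g x) * indicator {x. \<mu> < 2 * g x} x" for x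
 have ms: "{x. \<mu> < 2 * g x} : sets lebesgue"
 proof -
  have "{x : space lebesgue. \<mu> < 2 * g x} : sets lebesgue" by measurable
  thus ?thesis by simp
 qed
 have [measurable]: "H : LM" unfolding H_def using ms by measurable
 let ?A = "en (\<mu> / 2)"
 let ?C = "%x. Mnbhd (%x. en (g x)) x"
 have sub: "{x. en \<mu> < ?C x} <= {x. ?A < Mnbhd H x}"
 proof
  fix x assume "x : {x. en \<mu> < ?C x}"
  then obtain k where k: "en \<mu> * vol (nbhd k x) < RSI (nbhd k x) g"
   by (auto simp: Mnbhd_less_iff simp del: emeasure_completion)
  let ?B = "vol (nbhd k x)"
  let ?D = "SI (nbhd k x) H"
  have "RSI (nbhd k x) g <= NI (%y. H y * indicator (nbhd k x) y + ?A * indicator (nbhd k x) y)"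
   by (intro nn_integral_mono) (auto simp: indicator_def H_def intro!: ennreal_leI)
  also have "... = ?D + ?A * ?B"
   by (subst nn_integral_add) (auto simp: nn_integral_cmult_indicator simp del: emeasure_completion)
  finally have *: "en \<mu> * ?B < ?D + ?A * ?B"
   using k by simp
  have "?A * ?B < ?D"
  proof (rule ccontr)
   assume "~ ?thesis"
   hence "?D + ?A * ?B <= ?A * ?B + ?A * ?B"
    by (intro add_right_mono) (simp add: not_less)
   also have "... = en \<mu> * ?B"
    using mu by (simp add: distrib_right[symmetric] ennreal_plus[symmetric] del: ennreal_plus)
   finally show False using * by simp
  qed
  thus "x : {x. ?A < Mnbhd H x}" unfolding Mnbhd_less_iff by blast
 qed
 have "NI H <= RI g"
  by (intro nn_integral_mono) (auto simp: indicator_def H_def)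
 hence Hfin: "NI H < \<infinity>" using fin by (rule le_less_trans)
 have "?A * SI {x. en \<mu> < ?C x} W <= ?A * SI {x. ?A < Mnbhd H x} W"
  using sub by (intro mult_left_mono nn_integral_mono) (auto simp: indicator_def)
 also have "... <= en C * NI (%x. H x * W x)"
  using Hfin mu A1 by (intro Mnbhd_weak) auto
 also have "NI (%x. H x * W x) = SI {x. \<mu> < 2 * g x} (%x. en (g x) * W x)"
  by (intro nn_integral_cong) (auto simp: H_def indicator_def)
 also have "en C * ... = ?A * (en (2 * C / \<mu>) * ...)"
  using mu C by (simp add: mult.assoc[symmetric] ennreal_mult[symmetric])
 finally show ?thesis using mu by (subst (asm) ennreal_mult_le_mult_iff) auto
qed

lemma borel_measurable_level_integral:
 fixes W h :: "'a::euclidean_space => ennreal"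
 assumes [measurable]: "W : LM" "h : LM"
 shows "(%l::real. SI {x. en l < h x} W) : borel_measurable borel"
proof -
 interpret sigma_finite_measure "lebesgue :: 'a measure" by (rule sigma_finite_lebesgue)
 let ?A = "borel \<Otimes>\<^sub>M lebesgue"
 have "{p : space (borel \<Otimes>\<^sub>M lebesgue). en (fst p) < h (snd p)} : sets ?A" (is "?S : _")
  by measurable
 hence "(%p. W (snd p) * indicator ?S p) : borel_measurable ?A" by measurable
 hence "(%(l, x). W x * indicator {x. en l < h x} x) : borel_measurable (borel \<Otimes>\<^sub>M (lebesgue :: 'a measure))"
  by (rule measurable_cong[THEN iffD1, rotated]) (auto simp: space_pair_measure indicator_def)
 thus ?thesis by (rule borel_measurable_nn_integral)
qed

text \<open>Finiteness of \<open>x\<close> permits the subtraction of \<open>x / 2\<close>.\<close>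

lemma ennreal_absorb_half:
 fixes x a :: ennreal
 assumes "x <= a + en t * x" "t <= 1/2" "x < top"
 shows "x <= 2 * a"
proof (cases a)
 case (real r)
 obtain y where y: "x = en y" "y >= 0" using assms(3) by (cases x) auto
 have "en y <= en r + en (1/2) * en y"
  using assms(1) unfolding y real(2) by (rule order_trans) (intro add_mono mult_right_mono ennreal_leI assms; simp)
 also have "... = en r + en ((1/2) * y)" using y by (subst ennreal_mult) auto
 also have "... = en (r + (1/2) * y)" using real y by (subst ennreal_plus) auto
 finally have "y <= r + (1/2) * y" using real y by (subst (asm) ennreal_le_iff) auto
 hence "y <= 2 * r" by simp
 hence "x <= en (2 * r)" unfolding y by (rule ennreal_leI)
 thus ?thesis using real by (simp add: ennreal_mult)
qed (simp add: ennreal_mult_top)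

lemma nn_integral_Ici_le:
 fixes \<phi> :: "real => ennreal"
 assumes [measurable]: "\<phi> : borel_measurable borel" and le: "!!n::nat. (\<integral>\<^sup>+l\<in>{0..real n}. \<phi> l \<partial>lborel) <= M"
 shows "(\<integral>\<^sup>+l\<in>{0..}. \<phi> l \<partial>lborel) <= M"
proof -
 have "(%n::nat. \<phi> l * indicator {0..real n} l) \<longlonglongrightarrow> \<phi> l * indicator {0..} l" for l
 proof (rule tendsto_eventually)
  obtain N :: nat where "l <= real N" using real_arch_simple by blast
  thus "\<forall>\<^sub>F n in sequentially. \<phi> l * indicator {0..real n} l = \<phi> l * indicator {0..} l"
   unfolding eventually_sequentially by (intro exI[of _ N]) (auto simp: indicator_def)
 qed
 hence "(\<integral>\<^sup>+l\<in>{0..}. \<phi> l \<partial>lborel) = (\<integral>\<^sup>+l. liminf (%n::nat. \<phi> l * indicator {0..real n} l) \<partial>lborel)"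
  by (intro nn_integral_cong) (metis lim_imp_Liminf sequentially_bot)
 also have "... <= liminf (%n::nat. \<integral>\<^sup>+l\<in>{0..real n}. \<phi> l \<partial>lborel)"
  by (rule nn_integral_liminf) measurable
 also have "... <= M" using le by (intro Liminf_le) auto
 finally show ?thesis .
qed

text \<open>The strong bound for \<open>Mnbhd g\<close> in layer-cake form. The levels are
  \<open>(c l) powr a\<close> to match the good-lambda inequality, in which \<open>Mnbhd g\<close>
  controls an \<open>a\<close>-th power.\<close>

lemma Mnbhd_layer:
 fixes g :: "'a::euclidean_space => real"
 assumes [measurable]: "g : LM" "W : LM"
  and g0: "!!x. 0 <= g x" and fin: "RI g < \<infinity>" and A1: "A1w C W" and C: "C >= 0"
  and a: "a > 0" "p > a" and c: "c > 0"
 shows "(\<integral>\<^sup>+l\<in>{0..}. en (l powr (p - 1)) * SI {x. en ((c * l) powr a) < Mnbhd (%x. en (g x)) x} W \<partial>lborel)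
  <= en (2 * C * (1 / c) powr p * 2 powr ((p - a) / a) / (p - a)) * NI (%x. en (g x powr (p / a)) * W x)"
proof -
 \<comment> \<open>Chosen so that the condition \<open>(c l) powr a < 2 g\<close> reads
   \<open>l < h\<close>.\<close>
 define h where "h x = (1/c) * (2 * g x) powr (1/a)" for x
 have [measurable]: "h : LM" unfolding h_def by measurable
 have h0: "0 <= h x" for x using c by (simp add: h_def)
 have lh: "(c * l) powr a < 2 * g x \<longleftrightarrow> l < h x" if "l > 0" for l x
 proof -
  have "(c * l) powr a < 2 * g x \<longleftrightarrow> c * l < (2 * g x) powr (1/a)"
  proof
   assume "(c * l) powr a < 2 * g x"
   hence "((c * l) powr a) powr (1/a) < (2 * g x) powr (1/a)" using a by (intro powr_less_mono2) auto
   thus "c * l < (2 * g x) powr (1/a)" using a c that by (simp add: powr_powr)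
  next
   assume "c * l < (2 * g x) powr (1/a)"
   hence "(c * l) powr a < ((2 * g x) powr (1/a)) powr a" using a c that by (intro powr_less_mono2) auto
   thus "(c * l) powr a < 2 * g x" using a g0[of x] by (simp add: powr_powr)
  qed
  thus ?thesis using c by (simp add: h_def field_simps)
 qed
 let ?A = "%x. en (g x) * W x"
 let ?B = "%y. SI {x. en ((c * y) powr a) < Mnbhd (%x. en (g x)) x} W"
 let ?C = "en (2 * C * (1/c) powr a)"
 let ?E = "%y. SI {x. y < h x} ?A"
 have "(\<integral>\<^sup>+l\<in>{0..}. en (l powr (p - 1)) * ?B l \<partial>lborel)
  <= (\<integral>\<^sup>+l. ?C * (en (l powr (p - a - 1)) * ?E l * indicator {0..} l) \<partial>lborel)"
 proof (rule nn_integral_mono, goal_cases)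
  case (1 l)
  consider "l < 0" | "l = 0" | "l > 0" by linarith
  thus ?case
  proof cases
   case 3
   let ?D = "2 * C / ((c * l) powr a)"
   have "?B l
    <= en ?D * SI {x. (c * l) powr a < 2 * g x} ?A"
    using 3 c by (intro Mnbhd_weak_trunc g0 fin A1 C) auto
   also have "{x. (c * l) powr a < 2 * g x} = {x. l < h x}" using lh[OF 3] by auto
   finally have "en (l powr (p - 1)) * ?B l
    <= en (l powr (p - 1)) * (en ?D * ?E l)"
    by (rule mult_left_mono) simp
   also have "... = en (l powr (p - 1) * ?D) * ?E l"
    using C by (subst ennreal_mult) (auto simp: mult.assoc)
   also have "l powr (p - 1) * ?D = 2 * C * (1/c) powr a * l powr (p - a - 1)"
    using 3 c by (simp add: powr_mult powr_diff powr_divide powr_add field_simps)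
   also have "en ... = ?C * en (l powr (p - a - 1))"
    using C by (subst ennreal_mult) auto
   finally show ?thesis using 3 by (simp add: mult.assoc)
  qed auto
 qed
 also have "... = ?C * (\<integral>\<^sup>+l\<in>{0..}. en (l powr (p - a - 1)) * ?E l \<partial>lborel)"
 proof (rule nn_integral_cmult)
  have [measurable]: "(%l::real. SI {x. en l < en (h x)} ?A) : borel_measurable borel"
   by (rule borel_measurable_level_integral) measurable
  have "(%l. en (l powr (p - a - 1)) * SI {x. en l < en (h x)} ?A * indicator {0..} l) : borel_measurable lborel"
   by measurable
  thus "(%l. en (l powr (p - a - 1)) * ?E l * indicator {0..} l) : borel_measurable lborel"
   by (rule measurable_cong[THEN iffD1, rotated]) (auto simp: indicator_def ennreal_less_iff)
 qed
 also have "(\<integral>\<^sup>+l\<in>{0..}. en (l powr (p - a - 1)) * ?E l \<partial>lborel)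
   = NI (%x. en (g x) * W x * en (h x powr (p - a) / (p - a)))"
  using a h0 by (intro nn_integral_powr_layer) auto
 also have "... = NI (%x. en ((1/c) powr (p - a) * 2 powr ((p - a) / a) / (p - a)) * (en (g x powr (p / a)) * W x))"
 proof (rule nn_integral_cong, goal_cases)
  case (1 x)
  have "g x * (h x powr (p - a) / (p - a)) = (1/c) powr (p - a) * 2 powr ((p - a) / a) / (p - a) * g x powr (p / a)"
  proof (cases "g x = 0")
   case False
   hence g: "g x > 0" using g0[of x] by simp
   have "h x powr (p - a) = (1/c) powr (p - a) * (2 powr ((p - a) / a) * g x powr ((p - a) / a))"
   proof -
    have "h x powr (p - a) = (1/c) powr (p - a) * ((2 * g x) powr (1/a)) powr (p - a)"
     unfolding h_def by (rule powr_mult)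
    also have "((2 * g x) powr (1/a)) powr (p - a) = (2 * g x) powr ((p - a) / a)" by (simp add: powr_powr)
    also have "... = 2 powr ((p - a) / a) * g x powr ((p - a) / a)" by (rule powr_mult)
    finally show ?thesis .
   qed
   moreover have "g x * g x powr ((p - a) / a) = g x powr (1 + (p - a) / a)" using g by (simp add: powr_add)
   moreover have "1 + (p - a) / a = p / a" using a by (simp add: field_simps)
   ultimately show ?thesis by (simp add: mult_ac)
  qed simp
  hence "en (g x) * en (h x powr (p - a) / (p - a)) = en ((1/c) powr (p - a) * 2 powr ((p - a) / a) / (p - a)) * en (g x powr (p / a))"
   using g0[of x] a by (simp add: ennreal_mult[symmetric])
  thus ?case
   by (simp add: mult_ac)
 qed
 also have "... = en ((1/c) powr (p - a) * 2 powr ((p - a) / a) / (p - a)) * NI (%x. en (g x powr (p / a)) * W x)"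
  by (rule nn_integral_cmult) measurable
 also have "?C * ... = en (2 * C * (1/c) powr a * ((1/c) powr (p - a) * 2 powr ((p - a) / a) / (p - a))) * NI (%x. en (g x powr (p / a)) * W x)"
  using C a by (subst ennreal_mult[of "2 * C * (1/c) powr a"]) (auto simp: mult.assoc)
 also have "2 * C * (1/c) powr a * ((1/c) powr (p - a) * 2 powr ((p - a) / a) / (p - a)) = 2 * C * (1 / c) powr p * 2 powr ((p - a) / a) / (p - a)"
  by (simp add: powr_add[symmetric])
 finally show ?thesis .
qed

text \<open>The Fefferman--Stein inequality, with the sharp function dominated by \<open>(Mnbhd g)\<close> to the power \<open>1/a\<close>.\<close>

lemma Fefferman_Stein:
 fixes C1 C2 C3 a p d :: real
 assumes pos: "0 < C1" "0 < C2" "0 < C3" "1 <= a" "a < p" "0 < d"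
 shows "\<exists>K>0. \<forall>(f::'a::euclidean_space => real) g W B. f : LM --> g : LM -->
   W : LM --> (ALL x. 0 <= g x) --> RI g < \<infinity> -->
   (RI (%x. \<bar>f x\<bar> powr a)) < \<infinity> --> A1w C1 W --> Ainf d C2 W --> (ALL x. W x <= en B) -->
   (ALL x k r. 0 < r --> Mnbhd (%x. en (g x)) x <= en (r powr a) -->
    (EX c. RSI (cell k x) (%y. \<bar>f y - c\<bar>) <= en (C3 * r) * vol (cell k x))) -->
   (NI (%x. en (\<bar>f x\<bar> powr p) * W x)) <= en K * NI (%x. en (g x powr (p / a)) * W x)"
proof -
 let ?I = "1 / (2 * 3 powr p * C2)"
 \<comment> \<open>Small enough that the loss \<open>3 powr p\<close> from the dilated level, times
   the good-lambda factor, is at most 1/2; at most 1 as the good-lambda step requires.\<close>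
 define \<gamma> where "\<gamma> = min 1 (?I powr (1/d) / 2 ^ DIM('a))"
 have ga: "0 < \<gamma>" "\<gamma> <= 1" using pos by (auto simp: \<gamma>_def)
 define t where "t = C2 * (2 ^ DIM('a) * \<gamma>) powr d"
 have t0: "0 <= t" using pos by (simp add: t_def)
 have t: "3 powr p * t <= 1/2"
 proof -
  have "2 ^ DIM('a) * \<gamma> <= 2 ^ DIM('a) * (?I powr (1/d) / 2 ^ DIM('a))"
   unfolding \<gamma>_def by (intro mult_left_mono) auto
  hence "2 ^ DIM('a) * \<gamma> <= ?I powr (1/d)" by simp
  hence "(2 ^ DIM('a) * \<gamma>) powr d <= (?I powr (1/d)) powr d"
   using pos ga by (intro powr_mono2) auto
  also have "... = 1 / (2 * 3 powr p * C2)" using pos by (simp add: powr_powr)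
  finally show ?thesis using pos unfolding t_def by (simp add: field_simps)
 qed
 define c where "c = \<gamma> / C3"
 have c: "c > 0" using ga pos by (simp add: c_def)
 define K1 where "K1 = 2 * C1 * (1 / c) powr p * 2 powr ((p - a) / a) / (p - a)"
 have K1: "K1 > 0" using pos c by (simp add: K1_def)
 define K where "K = p * (2 * 3 powr p * K1)"
 have K: "K > 0" using pos K1 by (simp add: K_def)
 have "NI (%x. en (\<bar>f x\<bar> powr p) * W x) <= en K * NI (%x. en (g x powr (p / a)) * W x)"
  if [measurable]: "f : LM" "g : LM" "W : LM"
   and g0: "ALL x. 0 <= g x" and gfin: "RI g < \<infinity>"
   and ffin: "RI (%x. \<bar>f x\<bar> powr a) < \<infinity>" and A1: "A1w C1 W" and Ai: "Ainf d C2 W"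
   and WB: "ALL x. W x <= en B"
   and sharp: "ALL x k r. 0 < r --> Mnbhd (%x. en (g x)) x <= en (r powr a) -->
    (EX c. RSI (cell k x) (%y. \<bar>f y - c\<bar>) <= en (C3 * r) * vol (cell k x))"
  for f g :: "'a => real" and W B
 proof -
  define F where "F x = en \<bar>f x\<bar>" for x
  have [measurable]: "F : LM" unfolding F_def by measurable
  define w where "w l = SI {x. en l < Mcell F x} W" for l
  have [measurable]: "w : borel_measurable borel" unfolding w_def by (rule borel_measurable_level_integral) measurable
  define V where "V l = SI {x. en ((c * l) powr a) < Mnbhd (%x. en (g x)) x} W" for l
  have [measurable]: "V : borel_measurable borel"
  proof -
   have "(%l::real. SI {x. en l < Mnbhd (%x. en (g x)) x} W) : borel_measurable borel"
    by (rule borel_measurable_level_integral) measurable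
   moreover have "(%l. (c * l) powr a) : borel_measurable borel" by measurable
   ultimately show ?thesis unfolding V_def[abs_def] by (rule measurable_compose[rotated])
  qed
  define J where "J = (\<integral>\<^sup>+l\<in>{0..}. en (l powr (p - 1)) * V l \<partial>lborel)"
  define R where "R = NI (%x. en (g x powr (p / a)) * W x)"
  have J: "J <= en K1 * R" unfolding J_def K1_def R_def V_def
   using g0 gfin A1 pos c by (intro Mnbhd_layer) auto
  have step: "w (3 * l) <= V l + en t * w l" if l: "l > 0" for l
  proof -
   have van: "EX k0. \<forall>k<k0. ~ hot (en l) (%x. en \<bar>f x\<bar>) k x" for x
   proof -
    obtain k0 where "\<forall>k<k0. ~ hot (en ((l/2) powr a)) (%x. en (\<bar>f x\<bar> powr a)) k x"
     using hot_vanish[OF ffin, of "en ((l/2) powr a)" x] l by auto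
    thus ?thesis using hot_powr[of f a l _ x] pos l by (intro exI[of _ k0]) auto
   qed
   have cl: "c * l = \<gamma> * l / C3" by (simp add: c_def)
   show ?thesis unfolding w_def F_def t_def cl V_def
    by (rule good_lambda_step[OF _ _ _ van _ Ai]) (use sharp pos ga l in auto)
  qed
  \<comment> \<open>Cutting the levels at \<open>L\<close> keeps the quantity finite, so that it can
    be absorbed; the resulting bound does not depend on \<open>L\<close>.\<close>
  define I where "I L = (\<integral>\<^sup>+l\<in>{0..L}. en (l powr (p - 1)) * w l \<partial>lborel)" for L
  have Ifin: "I L < top" if L: "L >= 0" for L
  proof -
   let ?H = "RI (%x. \<bar>f x\<bar> powr a)"
   obtain M where M: "?H = en M" "M >= 0"
    using ffin by (cases "?H") auto
   \<comment> \<open>A priori decay in the level. It uses the bound \<open>B\<close> on the weight,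
     which enters no constant of the conclusion.\<close>
   have wl: "w l <= en (\<bar>B\<bar> * (M * 2 powr a * l powr (- a)))" if l: "l > 0" for l
   proof -
    let ?K = "en ((l/2) powr a)"
    let ?M = "%x. en (\<bar>f x\<bar> powr a)"
    define E where "E = {x. ?K < Mcell ?M x}"
    have mE [measurable]: "E : sets lebesgue" unfolding E_def by (rule sets_Mcell)
    let ?L = "en (M / (l/2) powr a)"
    have "?K * vol E <= ?H"
     unfolding E_def using ffin l by (intro Mcell_weak) auto
    also have "... = ?K * ?L"
     using l M by (simp add: ennreal_mult[symmetric])
    finally have em: "vol E <= ?L"
     using l by (subst (asm) ennreal_mult_le_mult_iff) auto
    have "{x. en l < Mcell F x} <= E"
    proof
     fix x assume "x : {x. en l < Mcell F x}"
     then obtain k where "hot (en l) (%x. en \<bar>f x\<bar>) k x"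
      unfolding F_def Mcell_less_iff hot_def by blast
     hence "hot (?K) ?M k x"
      using l pos by (intro hot_powr) auto
     thus "x : E" unfolding E_def Mcell_less_iff hot_def by blast
    qed
    hence "w l <= NI (%x. en \<bar>B\<bar> * indicator E x)"
     unfolding w_def using WB by (intro nn_integral_mono) (auto simp: indicator_def intro: order_trans ennreal_leI)
    also have "... = en \<bar>B\<bar> * vol E" by (rule nn_integral_cmult_indicator) measurable
    also have "... <= en \<bar>B\<bar> * ?L" by (intro mult_left_mono em) auto
    also have "... = en (\<bar>B\<bar> * (M * 2 powr a * l powr (- a)))"
     using l M by (simp add: ennreal_mult[symmetric] powr_divide powr_minus field_simps)
    finally show ?thesis .
   qed
   let ?E = "\<bar>B\<bar> * (M * 2 powr a)"
   have "I L <= (\<integral>\<^sup>+l. en ?E * (en (l powr (p - a - 1)) * indicator {0..L} l) \<partial>lborel)"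
    unfolding I_def
   proof (rule nn_integral_mono, goal_cases)
    case (1 l)
    show ?case
    proof (cases "l > 0")
     case True
     let ?F = "\<bar>B\<bar> * (M * 2 powr a * l powr (- a))"
     have "en (l powr (p - 1)) * w l <= en (l powr (p - 1)) * en ?F"
      using wl[OF True] by (rule mult_left_mono) simp
     also have "... = en (l powr (p - 1) * ?F)"
      using M by (simp add: ennreal_mult)
     also have "l powr (p - 1) * ?F = ?E * l powr (p - a - 1)"
      using True by (simp add: powr_diff powr_minus powr_add field_simps)
     also have "en ... = en ?E * en (l powr (p - a - 1))"
      using M by (subst ennreal_mult) auto
     finally show ?thesis by (auto simp: indicator_def)
    next
     case False
     hence "l = 0 | l < 0" by linarith
     thus ?thesis by (auto simp: indicator_def)
    qed
   qed
   also have "... = en ?E * en (L powr (p - a) / (p - a))"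
    using nn_integral_powr_0[of "p - a" L] pos L by (subst nn_integral_cmult) auto
   also have "... < top" by (simp add: ennreal_mult_less_top)
   finally show ?thesis .
  qed
  let ?D = "en (2 * 3 powr p * K1)"
  have Ibound: "I L <= ?D * R" if L: "L >= 0" for L
  proof -
   let ?B = "en (3 powr (p - 1))"
   let ?J = "%x. en ((3 * x) powr (p - 1))"
   \<comment> \<open>Substituting \<open>3 l\<close> for the level brings in the left-hand side of
     the good-lambda inequality.\<close>
   have "I L <= I (3 * L)" unfolding I_def using L by (intro nn_integral_mono) (auto simp: indicator_def)
   also have "... = 3 * (\<integral>\<^sup>+l. ?J l * w (3 * l) * indicator {0..3 * L} (3 * l) \<partial>lborel)"
    unfolding I_def by (subst nn_integral_real_affine[where c=3 and t=0]) auto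
   also have "... <= 3 * (\<integral>\<^sup>+l. ?B * (en (l powr (p - 1)) * V l * indicator {0..} l
      + en t * (en (l powr (p - 1)) * w l * indicator {0..L} l)) \<partial>lborel)"
   proof (intro mult_left_mono nn_integral_mono, goal_cases)
    case (1 l)
    consider "l <= 0" | "0 < l" "l <= L" | "L < l" by linarith
    thus ?case
    proof cases
     case 1
     hence "l = 0 | l < 0" by linarith
     thus ?thesis by (auto simp: indicator_def)
    next
     case 2
     let ?N = "en (l powr (p - 1))"
     have "?J l * w (3 * l) <= ?J l * (V l + en t * w l)"
      using step[OF 2(1)] by (rule mult_left_mono) simp
     also have "... = ?B * (?N * V l + en t * (?N * w l))"
     proof -
      have E: "?J l = ?B * ?N"
       using 2 by (simp add: powr_mult ennreal_mult)
      show ?thesis unfolding E by (simp add: distrib_left mult_ac)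
     qed
     finally show ?thesis using 2 by simp
    qed auto
   qed auto
   also have "... = 3 * (?B * (J + en t * I L))"
   proof -
    have "(\<integral>\<^sup>+l. en (l powr (p - 1)) * V l * indicator {0..} l + en t * (en (l powr (p - 1)) * w l * indicator {0..L} l) \<partial>lborel) = J + en t * I L"
     unfolding J_def I_def by (subst nn_integral_add) (auto simp: nn_integral_cmult)
    thus ?thesis by (subst nn_integral_cmult) auto
   qed
   also have "... = en (3 powr p) * J + en (3 powr p * t) * I L"
   proof -
    have "3 * ?B = en (3 powr p)"
    proof -
     have "3 * ?B = en (3 * 3 powr (p - 1))" by (simp add: ennreal_mult)
     also have "3 * 3 powr (p - 1) = 3 powr p" by (simp add: powr_diff)
     finally show ?thesis .
    qed
    moreover have "en (3 powr p * t) = en (3 powr p) * en t" using t0 by (simp add: ennreal_mult)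
    ultimately show ?thesis by (simp add: mult.assoc[symmetric] distrib_left)
   qed
   finally have "I L <= 2 * (en (3 powr p) * J)" using t Ifin[OF L] by (rule ennreal_absorb_half)
   also have "... <= 2 * (en (3 powr p) * (en K1 * R))" by (intro mult_left_mono J) auto
   also have "... = ?D * R" using K1 by (simp add: ennreal_mult mult.assoc)
   finally show ?thesis .
  qed
  let ?A = "\<integral>\<^sup>+l\<in>{0..}. en (l powr (p - 1)) * w l \<partial>lborel"
  have "?A <= ?D * R"
   by (rule nn_integral_Ici_le) (use Ibound in \<open>auto simp: I_def\<close>)
  hence all: "en p * ?A <= en p * (?D * R)"
   by (rule mult_left_mono) simp
  let ?C = "NI (%x. en (\<bar>f x\<bar> powr p) * W x)"
  let ?G = "%x. en (\<bar>f x\<bar> powr p / p)"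
  have "?C = NI (%x. en p * (W x * ?G x))"
  proof (rule nn_integral_cong, goal_cases)
   case (1 x)
   have "en (\<bar>f x\<bar> powr p) = en p * ?G x"
    using pos by (subst ennreal_mult[symmetric]) auto
   thus ?case by (simp add: mult_ac)
  qed
  also have "... = en p * NI (%x. W x * ?G x)"
   by (rule nn_integral_cmult) measurable
  also have "NI (%x. W x * ?G x) = (\<integral>\<^sup>+l\<in>{0..}. en (l powr (p - 1)) * SI {x. l < \<bar>f x\<bar>} W \<partial>lborel)"
   using pos by (intro nn_integral_powr_layer[symmetric]) auto
  finally have eq: "?C = en p * (\<integral>\<^sup>+l\<in>{0..}. en (l powr (p - 1)) * SI {x. l < \<bar>f x\<bar>} W \<partial>lborel)" .
  have "(\<integral>\<^sup>+l\<in>{0..}. en (l powr (p - 1)) * SI {x. l < \<bar>f x\<bar>} W \<partial>lborel) <= ?A"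
  proof (rule nn_integral_mono, goal_cases)
   case (1 l)
   have "SI {x. l < \<bar>f x\<bar>} W <= w l" if "l >= 0"
    unfolding w_def
   proof (rule nn_integral_mono_AE, rule AE_mp[OF AE_le_Mcell[of F]], measurable, intro AE_I2 impI)
    fix x assume "F x <= Mcell F x"
    hence "en l < Mcell F x" if "l < \<bar>f x\<bar>"
     using that \<open>l >= 0\<close> unfolding F_def by (intro less_le_trans[OF _ \<open>F x <= Mcell F x\<close>[unfolded F_def]]) (auto simp: ennreal_less_iff)
    thus "W x * indicator {x. l < \<bar>f x\<bar>} x <= W x * indicator {x. en l < Mcell F x} x"
     by (auto simp: indicator_def)
   qed
   thus ?case
    by (auto simp: indicator_def intro!: mult_left_mono)
  qed
  hence "?C <= en p * ?A"
   unfolding eq by (rule mult_left_mono) simp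
  also note all
  also have "en p * (?D * R) = en K * R"
   using pos K1 by (simp add: K_def ennreal_mult mult.assoc)
  finally show ?thesis unfolding R_def .
 qed
 thus ?thesis using K by blast
qed

section \<open>Mean oscillation and the John-Nirenberg inequality\<close>

text \<open>Boundedness of \<open>b\<close> is qualitative: it makes a priori quantities finite,
  while the constants of the final estimates depend on \<open>\<beta>\<close> and not on the bound.
  All truncations of a BMO function satisfy this with one \<open>\<beta>\<close>.\<close>

definition bmo_bd :: "real => ('a::euclidean_space => real) => bool" where
 "bmo_bd \<beta> b \<longleftrightarrow> b : LM & (EX M. ALL x. \<bar>b x\<bar> <= M) &
   (ALL k x. EX c. RSI (nbhd k x) (%y. \<bar>b y - c\<bar>) <= en \<beta> * vol (nbhd k x))"

text \<open>Any near-minimiser of the oscillation serves in place of the mean value.\<close>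

definition mid :: "real => ('a::euclidean_space => real) => int => 'a => real" where
 "mid \<beta> b k x = (SOME c. RSI (nbhd k x) (%y. \<bar>b y - c\<bar>) <= en \<beta> * vol (nbhd k x))"

lemma bmo_bd_meas: "bmo_bd \<beta> b ==> b : LM"
 by (simp add: bmo_bd_def)

lemma mid_osc:
 assumes "bmo_bd \<beta> b"
 shows "RSI (nbhd k x) (%y. \<bar>b y - mid \<beta> b k x\<bar>) <= en \<beta> * vol (nbhd k x)"
 unfolding mid_def by (rule someI_ex) (use assms in \<open>auto simp: bmo_bd_def\<close>)

lemma mid_eq: "y : cell k x ==> mid \<beta> b k y = mid \<beta> b k x"
 by (simp add: mid_def nbhd_eq)

lemma mean_diff_le:
 fixes b :: "'a::euclidean_space => real"
 assumes [measurable]: "b : LM" "A : sets lebesgue"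
  and v: "vol A = en v" "v > 0"
  and 1: "RSI A (%y. \<bar>b y - c1\<bar>) <= en (s1 * v)" "0 <= s1"
  and 2: "RSI A (%y. \<bar>b y - c2\<bar>) <= en (s2 * v)" "0 <= s2"
 shows "\<bar>c1 - c2\<bar> <= s1 + s2"
proof -
 have "en (\<bar>c1 - c2\<bar> * v) = RSI A (%y. \<bar>c1 - c2\<bar>)"
  by (subst nn_integral_cmult_indicator) (use v in \<open>auto simp: ennreal_mult simp del: emeasure_completion\<close>)
 also have "... <= NI (%y. en \<bar>b y - c1\<bar> * indicator A y + en \<bar>b y - c2\<bar> * indicator A y)"
  by (intro nn_integral_mono) (auto simp: indicator_def simp flip: ennreal_plus)
 also have "... = RSI A (%y. \<bar>b y - c1\<bar>) + RSI A (%y. \<bar>b y - c2\<bar>)"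
  by (rule nn_integral_add) measurable
 also have "... <= en (s1 * v) + en (s2 * v)" by (intro add_mono 1 2)
 also have "... = en ((s1 + s2) * v)" using v 1(2) 2(2) by (simp add: ennreal_plus[symmetric] algebra_simps del: ennreal_plus)
 finally have "\<bar>c1 - c2\<bar> * v <= (s1 + s2) * v" using v 1(2) 2(2) by (subst (asm) ennreal_le_iff) auto
 thus ?thesis using v by simp
qed

lemma emeasure_nbhd_real: obtains v where "v > 0" "vol (nbhd k (x::'a::euclidean_space)) = en v"
 "vol (nbhd (k - 1) x) = en (2 ^ DIM('a) * v)" "vol (cell k x) = en (v / 3 ^ DIM('a))"
proof
 let ?v = "3 ^ DIM('a) * side k ^ DIM('a)"
 show "?v > 0" by simp
 show "vol (nbhd k x) = en ?v" by (rule emeasure_nbhd)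
 show "vol (nbhd (k - 1) x) = en (2 ^ DIM('a) * ?v)"
  by (simp only: emeasure_nbhd) (simp add: power_mult_distrib mult_ac)
 show "vol (cell k x) = en (?v / 3 ^ DIM('a))" by (simp only: emeasure_cell) simp
qed

lemma set_nn_integral_subset: "A <= B ==> (\<integral>\<^sup>+y\<in>A. f y \<partial>M) <= (\<integral>\<^sup>+y\<in>B. f y \<partial>M)"
 by (intro nn_integral_mono) (auto simp: indicator_def)

text \<open>Both constants approximate \<open>b\<close> on the smaller neighbourhood, whose volume
  is \<open>2^-n\<close> times that of the larger one.\<close>

lemma mid_diff_step:
 fixes b :: "'a::euclidean_space => real"
 assumes b: "bmo_bd \<beta> b" "0 <= \<beta>" and sub: "nbhd k y <= nbhd (k - 1) x"
 shows "\<bar>mid \<beta> b k y - mid \<beta> b (k - 1) x\<bar> <= (1 + 2 ^ DIM('a)) * \<beta>"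
proof -
 obtain v where v: "v > 0" "vol (nbhd k y) = en v" by (rule emeasure_nbhd_real)
 have v': "vol (nbhd (k - 1) x) = en (2 ^ DIM('a) * v)"
  using v(2) by (simp only: vol_nbhd vol_cell_diff1[of k x y]) (metis (no_types) ennreal_mult' mult.left_commute zero_le_numeral zero_le_power)
 have "\<bar>mid \<beta> b k y - mid \<beta> b (k - 1) x\<bar> <= \<beta> + 2 ^ DIM('a) * \<beta>"
 proof (rule mean_diff_le[OF bmo_bd_meas[OF b(1)] nbhd_lebesgue v(2) v(1)])
  show "RSI (nbhd k y) (%z. \<bar>b z - mid \<beta> b k y\<bar>) <= en (\<beta> * v)"
   using mid_osc[OF b(1), of k y] b(2) v unfolding v(2) by (simp add: ennreal_mult)
  let ?A = "%z. \<bar>b z - mid \<beta> b (k - 1) x\<bar>"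
  let ?B = "en (2 ^ DIM('a) * \<beta> * v)"
  have "RSI (nbhd k y) ?A <= RSI (nbhd (k - 1) x) ?A"
   by (rule set_nn_integral_subset[OF sub])
  also have "... <= en \<beta> * en (2 ^ DIM('a) * v)" unfolding v'[symmetric] by (rule mid_osc[OF b(1)])
  also have "... = ?B" using b(2) v by (simp add: ennreal_mult[symmetric] mult_ac)
  finally show "RSI (nbhd k y) ?A <= ?B" .
 qed (use b in auto)
 thus ?thesis by (simp add: algebra_simps)
qed

text \<open>Telescoping over the ancestors: the centres drift at most linearly in the number of
  scales. The factor \<open>k^m\<close> in the Hoermander condition pays for this growth.\<close>

lemma mid_diff_nat:
 fixes b :: "'a::euclidean_space => real"
 assumes b: "bmo_bd \<beta> b" "0 <= \<beta>"
 shows "\<bar>mid \<beta> b k x - mid \<beta> b (k - int j) x\<bar> <= real j * ((1 + 2 ^ DIM('a)) * \<beta>)"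
proof (induction j)
 case (Suc j)
 have "\<bar>mid \<beta> b (k - int j) x - mid \<beta> b (k - int j - 1) x\<bar> <= (1 + 2 ^ DIM('a)) * \<beta>"
  by (rule mid_diff_step[OF b nbhd_antimono]) simp
 moreover have "k - int (Suc j) = k - int j - 1" by simp
 ultimately show ?case using Suc by (simp add: algebra_simps)
qed simp

lemma mid_diff_nbhd:
 fixes b :: "'a::euclidean_space => real"
 assumes b: "bmo_bd \<beta> b" "0 <= \<beta>" and y: "y : nbhd k x"
 shows "\<bar>mid \<beta> b k y - mid \<beta> b k x\<bar> <= 2 * ((1 + 2 ^ DIM('a)) * \<beta>)"
proof -
 have "\<bar>mid \<beta> b k y - mid \<beta> b (k - 1) x\<bar> <= (1 + 2 ^ DIM('a)) * \<beta>"
  by (rule mid_diff_step[OF b nbhd_nbhd[OF y]])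
 moreover have "\<bar>mid \<beta> b k x - mid \<beta> b (k - 1) x\<bar> <= (1 + 2 ^ DIM('a)) * \<beta>"
  by (rule mid_diff_step[OF b nbhd_antimono]) simp
 ultimately show ?thesis by linarith
qed

lemma mid_bounded:
 fixes b :: "'a::euclidean_space => real"
 assumes b: "bmo_bd \<beta> b" "0 <= \<beta>" and M: "!!x. \<bar>b x\<bar> <= M"
 shows "\<bar>mid \<beta> b k x\<bar> <= \<beta> + M"
proof -
 obtain v where v: "v > 0" "vol (nbhd k x) = en v" by (rule emeasure_nbhd_real)
 have M0: "0 <= M" using M[of undefined] by linarith
 have "\<bar>mid \<beta> b k x - 0\<bar> <= \<beta> + M"
 proof (rule mean_diff_le[OF bmo_bd_meas[OF b(1)] nbhd_lebesgue v(2) v(1)])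
  show "RSI (nbhd k x) (%z. \<bar>b z - mid \<beta> b k x\<bar>) <= en (\<beta> * v)"
   using mid_osc[OF b(1), of k x] b(2) v unfolding v(2) by (simp add: ennreal_mult)
  let ?A = "RSI (nbhd k x) (%z. \<bar>b z - 0\<bar>)"
  have "?A <= SI (nbhd k x) (%z. en M)"
   using M by (intro nn_integral_mono) (auto simp: indicator_def intro!: ennreal_leI)
  also have "... = en (M * v)" using v M0 by (subst nn_integral_cmult_indicator) (auto simp: ennreal_mult simp del: emeasure_completion)
  finally show "?A <= en (M * v)" .
 qed (use b M0 in auto)
 thus ?thesis by simp
qed

text \<open>Let \<open>X\<close> be the supremum of the exponential means over all cells; it is
  finite because \<open>b\<close> is bounded. Stopping at height \<open>\<theta>\<close> leaves
  cells that fill at most half of the volume, on each of which the centre has moved by at most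
  \<open>C1\<close>. This yields \<open>X \<le> exp(\<epsilon> \<theta>) + 3/4 X\<close>.\<close>

lemma John_Nirenberg_cell:
 fixes \<beta> :: real
 assumes \<beta>: "\<beta> > 0"
 shows "\<exists>\<epsilon>>0. \<exists>A>0. \<forall>(b::'a::euclidean_space => real) k x. bmo_bd \<beta> b -->
   (RSI (cell k x) (%y. exp (\<epsilon> * \<bar>b y - mid \<beta> b k x\<bar>))) <= en A * vol (cell k x)"
proof -
 \<comment> \<open>Twice the bound \<open>3^n \<beta>\<close> for the mean oscillation over a cell,
   so that the stopping cells fill at most half of it.\<close>
 define \<theta> where "\<theta> = 2 * (3 ^ DIM('a) * \<beta>)"
 define C1 where "C1 = 3 ^ DIM('a) * \<beta> + 2 ^ DIM('a) * \<theta>"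
 \<comment> \<open>Makes \<open>exp (\<epsilon> C1) = 3/2\<close>; with the volume factor 1/2 the
   contraction is 3/4.\<close>
 define \<epsilon> where "\<epsilon> = ln (3/2) / C1"
 have l: "\<theta> > 0" using \<beta> by (simp add: \<theta>_def)
 have C1: "C1 > 0" using \<beta> l by (simp add: C1_def add_pos_pos)
 have e: "\<epsilon> > 0" using C1 by (simp add: \<epsilon>_def)
 have eC: "exp (\<epsilon> * C1) = 3/2" using C1 by (simp add: \<epsilon>_def)
 let ?A = "exp (\<epsilon> * \<theta>)"
 let ?L = "en (4 * ?A)"
 have "RSI (cell k x) (%y. exp (\<epsilon> * \<bar>b y - mid \<beta> b k x\<bar>)) <= ?L * vol (cell k x)"
  if b: "bmo_bd \<beta> b" for b :: "'a => real" and k x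
 proof -
  note [measurable] = bmo_bd_meas[OF b]
  obtain M where M: "!!x. \<bar>b x\<bar> <= M" using b by (auto simp: bmo_bd_def)
  define I where "I k x = RSI (cell k x) (%y. exp (\<epsilon> * \<bar>b y - mid \<beta> b k x\<bar>))" for k x
  define X where "X = (SUP p. I (fst p) (snd p) / vol (cell (fst p) (snd p)))"
  have IX: "I k x <= X * vol (cell k x)" for k x
  proof -
   have "I k x / vol (cell k x) <= X" unfolding X_def by (rule SUP_upper2[of "(k,x)"]) auto
   thus ?thesis by (simp only: ennreal_divide_le_iff[OF vol_facts(1,2)])
  qed
  have Xfin: "X < top"
  proof -
   let ?F = "exp (\<epsilon> * (\<beta> + 2 * M))"
   have "X <= en (?F)" unfolding X_def
   proof (rule SUP_least, goal_cases)
    case (1 p)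
    have "I (fst p) (snd p) <= RSI (cell (fst p) (snd p)) (%y. ?F)"
     unfolding I_def
    proof (intro nn_integral_mono mult_right_mono ennreal_leI, goal_cases)
     case (1 y)
     have "\<bar>b y - mid \<beta> b (fst p) (snd p)\<bar> <= \<beta> + 2 * M"
      using M[of y] mid_bounded[OF b _ M, of "fst p" "snd p"] \<beta> by linarith
     thus ?case using e by simp
    qed auto
    also have "... = en (?F) * vol (cell (fst p) (snd p))"
     by (subst nn_integral_cmult_indicator) auto
    finally show ?case
     by (simp only: ennreal_divide_le_iff[OF vol_facts(1,2)])
   qed
   thus ?thesis by (rule le_less_trans) simp
  qed
  have main: "I k x <= (en (?A) + en (3/4) * X) * vol (cell k x)" for k x
  proof -
   define D where "D = cell k x"
   define c where "c = mid \<beta> b k x"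
   define d where "d = measure lebesgue D"
   have d: "d > 0" "vol D = en d" unfolding d_def D_def by (rule measure_cell_pos, rule emeasure_cell')
   define H where "H y = en \<bar>b y - c\<bar> * indicator D y" for y
   have [measurable]: "D : sets lebesgue" unfolding D_def by simp
   have [measurable]: "H : LM" unfolding H_def by measurable
   let ?E = "%x. en (3 ^ DIM('a) * \<beta> * x)"
   have Hint: "NI H <= ?E d"
   proof -
    have "NI H <= RSI (nbhd k x) (%y. \<bar>b y - c\<bar>)"
     unfolding H_def D_def by (rule set_nn_integral_subset[OF cell_le_nbhd])
    also have "... <= en \<beta> * vol (nbhd k x)" unfolding c_def by (rule mid_osc[OF b])
    also have "... = ?E d"
     unfolding vol_nbhd D_def[symmetric] d(2) using d(1) \<beta> by (simp add: ennreal_mult[symmetric] mult_ac)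
    finally show ?thesis .
   qed
   have Hfin: "NI H < \<infinity>" using Hint by (rule le_less_trans) simp
   let ?C = "en \<theta>"
   obtain S kk xx where st: "stops (hot (?C) H) S kk xx" using hot_stops[OF Hfin, of "?C"] l by auto
   note S = stopsD[OF st] and US = stops_hot_Union[OF st]
   define Om where "Om = \<Union>S"
   have [measurable]: "Om : sets lebesgue" unfolding Om_def US by (rule sets_Mcell)
   have Om2: "vol Om <= en (d / 2)"
   proof -
    have "?C * vol Om <= NI H"
     unfolding Om_def US using Hfin l by (intro Mcell_weak) auto
    also have "... <= ?C * en (d / 2)" using Hint l d(1) by (subst ennreal_mult[symmetric]) (auto simp: \<theta>_def mult.assoc)
    finally show ?thesis using l by (subst (asm) ennreal_mult_le_mult_iff) auto
   qed
   let ?H = "%y. \<bar>b y - c\<bar>"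
   let ?K = "en (2 ^ DIM('a) * \<theta>)"
   have inD: "A <= D & RSI A ?H <= ?K * vol A" if A: "A : S" for A
   proof -
    define j where "j = kk A" define z where "z = xx A"
    have Ac: "A = cell j z" and hot: "hot (?C) H j z" and par: "~ hot (?C) H (j - 1) z"
     using S(4,5)[OF A] S(6)[OF A, of "kk A - 1"] by (auto simp: j_def z_def)
    have "A \<inter> D ~= {}"
    proof
     assume "A \<inter> D = {}"
     hence "SI A H = (\<integral>\<^sup>+y. 0 \<partial>(lebesgue::'a measure))"
      by (intro nn_integral_cong) (auto simp: H_def indicator_def)
     thus False using hot by (simp add: hot_def Ac)
    qed
    then obtain y where y: "y : cell j z" "y : cell k x" using Ac D_def by auto
    \<comment> \<open>A cell containing \<open>D\<close> has too small a mean to be hot, so stopping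
      cells are proper subcells and even their parents lie in \<open>D\<close>.\<close>
    have jk: "k < j"
    proof (rule ccontr)
     assume "~ k < j"
     hence "j <= k" by simp
     have "?C * vol (cell j z) < SI (cell j z) H" using hot by (simp add: hot_def)
     also have "... <= NI H" by (intro nn_integral_mono) (auto simp: indicator_def)
     also have "... <= en (\<theta> * d)" using Hint by (rule order_trans) (use \<beta> d in \<open>auto simp: \<theta>_def intro!: ennreal_leI\<close>)
     also have "... = ?C * vol (cell k y)" using l d cell_eq[OF y(2)] by (simp add: ennreal_mult D_def del: emeasure_completion)
     also have "... <= ?C * vol (cell j y)" by (intro mult_left_mono emeasure_mono cell_antimono \<open>j <= k\<close>) auto
     also have "cell j y = cell j z" by (rule cell_eq[OF y(1)])
     finally show False by simp
    qed
    let ?J = "cell (j - 1) z"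
    have sub: "?J <= D"
    proof -
     have "?J = cell (j - 1) y" using cell_nested[OF y(1), of "j - 1"] by simp
     also have "... <= cell k y" using jk by (intro cell_antimono) auto
     also have "... = D" unfolding D_def by (rule cell_eq[OF y(2)])
     finally show ?thesis .
    qed
    have sub1: "A <= ?J" unfolding Ac by (rule cell_antimono) simp
    have "RSI A ?H <= SI (?J) H"
     using sub sub1 by (intro nn_integral_mono) (auto simp: indicator_def H_def)
    also have "... <= ?C * vol (?J)" using par by (simp add: hot_def not_less)
    also have "... = ?K * vol A"
     unfolding vol_cell_diff1[of j z z] Ac using l by (simp add: ennreal_mult mult_ac)
    finally show ?thesis using sub sub1 by auto
   qed
   let ?B = "%x. exp (\<epsilon> * \<bar>b x - c\<bar>)"
   let ?G = "%x. RSI x (%y. ?B y)"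
   let ?I = "%y. en (3/2) * X"
   have cell_le: "?G A <= SI A ?I" if A: "A : S" for A
   proof -
    define j where "j = kk A" define z where "z = xx A"
    have Ac: "A = cell j z" using S(4)[OF A] by (simp add: j_def z_def)
    define a where "a = measure lebesgue A"
    have a: "a > 0" "vol A = en a" unfolding a_def Ac by (rule measure_cell_pos, rule emeasure_cell')
    have mA: "A : sets lebesgue" by (rule S(8)[OF A])
    \<comment> \<open>Both numbers are close to \<open>b\<close> on \<open>A\<close>: one by the
      choice of the centre, the other because the parent of \<open>A\<close> is not hot.\<close>
    have "\<bar>mid \<beta> b j z - c\<bar> <= 3 ^ DIM('a) * \<beta> + 2 ^ DIM('a) * \<theta>"
    proof (rule mean_diff_le[OF bmo_bd_meas[OF b] mA a(2,1)])
     let ?D = "%y. \<bar>b y - mid \<beta> b j z\<bar>"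
     have "RSI A ?D <= RSI (nbhd j z) ?D"
      unfolding Ac by (rule set_nn_integral_subset[OF cell_le_nbhd])
     also have "... <= en \<beta> * vol (nbhd j z)" by (rule mid_osc[OF b])
     also have "... = ?E a"
      unfolding vol_nbhd Ac[symmetric] a(2) using a(1) \<beta> by (simp add: ennreal_mult[symmetric] mult_ac)
     finally show "RSI A ?D <= ?E a" .
     show "RSI A ?H <= en (2 ^ DIM('a) * \<theta> * a)"
      using inD[OF A] l a by (simp add: ennreal_mult del: emeasure_completion)
    qed (use \<beta> l in auto)
    hence mc: "\<bar>mid \<beta> b j z - c\<bar> <= C1" by (simp add: C1_def)
    have "?G A <= en (3/2) * RSI A (%y. exp (\<epsilon> * \<bar>b y - mid \<beta> b j z\<bar>))"
     using mA exp_shift[OF mc e] by (intro RSI_le_cmult AE_I2) (auto simp: eC)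
    also have "... = en (3/2) * I j z" unfolding I_def Ac ..
    also have "... <= en (3/2) * (X * vol A)" unfolding Ac by (intro mult_left_mono IX) auto
    also have "... = SI A ?I" using mA by (subst nn_integral_cmult_indicator) (auto simp: mult_ac)
    finally show ?thesis .
   qed
   have "?G Om <= SI Om ?I"
    unfolding Om_def using S(8) cell_le by (intro set_nn_integral_mono_partition[OF S(1,2)]) auto
   also have "... = en (3/2) * X * vol Om" by (subst nn_integral_cmult_indicator) auto
   also have "... <= en (3/2) * X * en (d / 2)" by (intro mult_left_mono Om2) auto
   also have "... = en (3/2) * en (1/2 * d) * X" by (simp add: mult_ac)
   also have "en (3/2) * en (1/2 * d) = en (3/4) * en d" by (subst (1 2) ennreal_mult[symmetric]) (use d(1) in auto)
   finally have part1: "?G Om <= en (3/4) * en d * X" .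
   have "I k x <= NI (%y. en (?A) * indicator D y + en (?B y) * indicator Om y)"
    unfolding I_def D_def[symmetric] c_def[symmetric]
   proof (rule nn_integral_mono_AE, rule AE_mp[OF AE_le_Mcell[of H]], measurable, intro AE_I2 impI)
    fix y assume y: "H y <= Mcell H y"
    show "en (?B y) * indicator D y <= en (?A) * indicator D y + en (?B y) * indicator Om y"
    proof (cases "y : D & y ~: Om")
     case True
     hence "Mcell H y <= ?C" unfolding Om_def US by (simp add: not_less)
     with y have "H y <= ?C" by (rule order_trans)
     hence "\<bar>b y - c\<bar> <= \<theta>" using True l by (simp add: H_def)
     hence "?B y <= ?A" using e by simp
     thus ?thesis using True by (auto simp: indicator_def intro!: ennreal_leI)
    qed (auto simp: indicator_def)
   qed
   also have "... = en (?A) * en d + ?G Om"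
    by (subst nn_integral_add) (auto simp: nn_integral_cmult_indicator d(2) simp del: emeasure_completion)
   also have "... <= en (?A) * en d + en (3/4) * en d * X" by (intro add_left_mono part1)
   also have "... = (en (?A) + en (3/4) * X) * vol (cell k x)"
    unfolding D_def[symmetric] d(2) by (simp add: distrib_right distrib_left mult_ac)
   finally show ?thesis .
  qed
  have "X <= en (?A) + en (3/4) * X" unfolding X_def
   by (rule SUP_least) (use main in \<open>simp only: ennreal_divide_le_iff[OF vol_facts(1,2)] X_def\<close>)
  moreover obtain y where y: "X = en y" "y >= 0" using Xfin by (cases X) auto
  moreover have "en (3/4) * en y = en (3/4 * y)" using y by (intro ennreal_mult[symmetric]) auto
  ultimately have "en y <= en (?A) + en (3/4 * y)" by metis
  also have "... = en (?A + 3/4 * y)" using y by (subst ennreal_plus) auto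
  finally have "en y <= en (?A + 3/4 * y)" .
  hence "y <= ?A + 3/4 * y" using y by (subst (asm) ennreal_le_iff) auto
  hence "X <= ?L" unfolding y(1) by (intro ennreal_leI) simp
  hence "X * vol (cell k x) <= ?L * vol (cell k x)" by (rule mult_right_mono) simp
  with IX[of k x] show ?thesis unfolding I_def by (rule order_trans)
 qed
 moreover have "4 * ?A > 0" by simp
 ultimately show ?thesis using e by blast
qed

text \<open>Centres of touching cells differ by a fixed amount, which costs only a constant factor
  in the exponential.\<close>

lemma John_Nirenberg:
 fixes \<beta> :: real
 assumes \<beta>: "\<beta> > 0"
 shows "\<exists>\<epsilon>>0. \<exists>A>0. \<forall>(b::'a::euclidean_space => real) k x. bmo_bd \<beta> b -->
   (RSI (nbhd k x) (%y. exp (\<epsilon> * \<bar>b y - mid \<beta> b k x\<bar>))) <= en A * vol (nbhd k x)"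
proof -
 obtain \<epsilon> A where e: "\<epsilon> > 0" and A: "A > 0" and JN: "!!(b::'a => real) k x. bmo_bd \<beta> b ==>
   (RSI (cell k x) (%y. exp (\<epsilon> * \<bar>b y - mid \<beta> b k x\<bar>))) <= en A * vol (cell k x)"
  using John_Nirenberg_cell[OF \<beta>, where 'a='a] by blast
 define C where "C = 2 * ((1 + 2 ^ DIM('a)) * \<beta>)"
 let ?A = "exp (\<epsilon> * C)"
 have "RSI (nbhd k x) (%y. exp (\<epsilon> * \<bar>b y - mid \<beta> b k x\<bar>)) <= en (?A * A) * vol (nbhd k x)"
  if b: "bmo_bd \<beta> b" for b :: "'a => real" and k x
 proof -
  note [measurable] = bmo_bd_meas[OF b]
  let ?B = "%y. exp (\<epsilon> * \<bar>b y - mid \<beta> b k x\<bar>)"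
  have "RSI (nbhd k x) (%y. ?B y) <= RSI (nbhd k x) (%y. ?A * A)"
  proof (rule set_nn_integral_nbhd_le)
   fix y assume y: "y : nbhd k x"
   have "\<bar>mid \<beta> b k y - mid \<beta> b k x\<bar> <= C" using mid_diff_nbhd[OF b _ y] \<beta> unfolding C_def by linarith
   from exp_shift[OF this e]
   have "RSI (cell k y) (%z. ?B z) <= en (?A) * RSI (cell k y) (%z. exp (\<epsilon> * \<bar>b z - mid \<beta> b k y\<bar>))"
    by (intro RSI_le_cmult AE_I2) auto
   also have "... <= en (?A) * (en A * vol (cell k y))" by (intro mult_left_mono JN b) auto
   also have "... = RSI (cell k y) (%z. ?A * A)"
    using A by (subst nn_integral_cmult_indicator) (auto simp: ennreal_mult mult_ac)
   finally show "RSI (cell k y) (%z. ?B z) <= RSI (cell k y) (%z. ?A * A)" .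
  qed auto
  also have "... = en (?A * A) * vol (nbhd k x)" by (subst nn_integral_cmult_indicator) auto
  finally show ?thesis .
 qed
 moreover have "?A * A > 0" using A by simp
 ultimately show ?thesis using e by blast
qed

lemma powr_le_exp:
 fixes N \<epsilon> :: real
 assumes "\<epsilon> > 0" "N > 0" shows "\<exists>C>0. \<forall>t\<ge>0. (1 + t) powr N <= C * exp (\<epsilon> * t)"
proof -
 define n where "n = nat \<lceil>N\<rceil>"
 have n: "N <= real n" unfolding n_def by linarith
 have "(1 + t) powr N <= fact n / \<epsilon> ^ n * exp \<epsilon> * exp (\<epsilon> * t)" if "t >= 0" for t
 proof -
  let ?A = "\<epsilon> * (1 + t)"
  have "(1 + t) powr N <= (1 + t) powr real n" using n that by (intro powr_mono) auto
  also have "... = (1 + t) ^ n" using that by (simp add: powr_realpow)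
  also have "... = fact n / \<epsilon> ^ n * (?A ^ n / fact n)" using assms by (simp add: power_mult_distrib)
  also have "... <= fact n / \<epsilon> ^ n * exp ?A"
  proof (intro mult_left_mono)
   have "(\<Sum>i\<in>{n}. inverse (fact i) * ?A ^ i) <= (\<Sum>i. inverse (fact i) * ?A ^ i)"
    using assms that by (intro sum_le_suminf summable_exp) auto
   thus "?A ^ n / fact n <= exp ?A" by (simp add: exp_def field_simps)
  qed (use assms in auto)
  also have "... = fact n / \<epsilon> ^ n * exp \<epsilon> * exp (\<epsilon> * t)" by (simp add: exp_add[symmetric] algebra_simps)
  finally show ?thesis .
 qed
 moreover have "fact n / \<epsilon> ^ n * exp \<epsilon> > 0" using assms by simp
 ultimately show ?thesis by blast
qed

text \<open>Powers of \<open>1 + \<bar>b - mid\<bar>\<close> increase with the exponent, so one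
  large \<open>N\<close> serves all lower orders.\<close>

lemma John_Nirenberg_powr:
 assumes \<beta>: "\<beta> > 0" and N: "N > 0"
 shows "\<exists>A>0. \<forall>(b::'a::euclidean_space => real) k x. bmo_bd \<beta> b -->
   (RSI (nbhd k x) (%y. (1 + \<bar>b y - mid \<beta> b k x\<bar>) powr N)) <= en A * vol (nbhd k x)"
proof -
 obtain \<epsilon> A where e: "\<epsilon> > 0" and A: "A > 0" and JN: "!!(b::'a => real) k x. bmo_bd \<beta> b ==>
   (RSI (nbhd k x) (%y. exp (\<epsilon> * \<bar>b y - mid \<beta> b k x\<bar>))) <= en A * vol (nbhd k x)"
  using John_Nirenberg[OF \<beta>, where 'a='a] by blast
 obtain C where C: "C > 0" "!!t. t >= 0 ==> (1 + t) powr N <= C * exp (\<epsilon> * t)" using powr_le_exp[OF e N] by blast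
 have "RSI (nbhd k x) (%y. (1 + \<bar>b y - mid \<beta> b k x\<bar>) powr N) <= en (C * A) * vol (nbhd k x)"
  if b: "bmo_bd \<beta> b" for b :: "'a => real" and k x
 proof -
  note [measurable] = bmo_bd_meas[OF b]
  let ?A = "%y. exp (\<epsilon> * \<bar>b y - mid \<beta> b k x\<bar>)"
  have "RSI (nbhd k x) (%y. (1 + \<bar>b y - mid \<beta> b k x\<bar>) powr N) <= NI (%y. en C * (en (?A y) * indicator (nbhd k x) y))"
   using C by (intro nn_integral_mono) (auto simp: indicator_def ennreal_mult[symmetric] intro!: ennreal_leI)
  also have "... = en C * RSI (nbhd k x) (%y. ?A y)"
   by (rule nn_integral_cmult) measurable
  also have "... <= en C * (en A * vol (nbhd k x))" by (intro mult_left_mono JN b) auto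
  also have "... = en (C * A) * vol (nbhd k x)" using C A by (simp add: ennreal_mult mult_ac)
  finally show ?thesis .
 qed
 thus ?thesis using C A by (intro exI[of _ "C * A"]) auto
qed

section \<open>Square integrable functions and the algebra of commutators\<close>

lemma L2_iff: "L2 f \<longleftrightarrow> f : LM & RI (%x. (f x)^2) < \<infinity>"
 unfolding L2_def by (auto simp: integrable_iff_bounded)

lemma L2_meas: "L2 f ==> f : LM"
 by (simp add: L2_def)

lemma L2_finite: "L2 f ==> RI (%x. (f x)^2) < \<infinity>"
 by (simp add: L2_iff)

lemma L2_dominated:
 assumes "L2 g" "f : LM" "!!x. \<bar>f x\<bar> <= c * \<bar>g x\<bar>"
 shows "L2 f"
 unfolding L2_iff
proof (intro conjI assms(2))
 note [measurable] = L2_meas[OF assms(1)]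
 let ?A = "%x. (f x)^2"
 have "\<bar>f x\<bar>\<^sup>2 <= (c * \<bar>g x\<bar>)^2" for x using assms(3)[of x] by (intro power_mono) auto
 hence "RSI UNIV ?A <= en (c\<^sup>2) * RSI UNIV (%x. (g x)^2)" by (intro RSI_le_cmult AE_I2) (auto simp: power_mult_distrib)
 hence "RI ?A <= en (c\<^sup>2) * RI (%x. (g x)^2)" by simp
 also have "... < \<infinity>" using L2_finite[OF assms(1)] by (simp add: ennreal_mult_less_top)
 finally show "RI ?A < \<infinity>" .
qed

lemma L2_add:
 assumes "L2 f" "L2 g" shows "L2 (%x. a * f x + c * g x)"
proof -
 note [measurable] = L2_meas[OF assms(1)] L2_meas[OF assms(2)]
 let ?A = "%x. en (2 * x\<^sup>2)"
 let ?B = "%x. (a * f x + c * g x)^2"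
 have "(a * f x + c * g x)^2 <= 2 * a\<^sup>2 * (f x)^2 + 2 * c\<^sup>2 * (g x)^2" for x
  using zero_le_power2[of "a * f x - c * g x"] by (simp add: power2_eq_square algebra_simps)
 hence "RSI UNIV ?B <= ?A a * RSI UNIV (%x. (f x)^2) + ?A c * RSI UNIV (%x. (g x)^2)"
  by (intro RSI_le_lincomb AE_I2) auto
 hence "RI ?B <= ?A a * RI (%x. (f x)^2) + ?A c * RI (%x. (g x)^2)" by simp
 also have "... < \<infinity>" using assms by (simp add: ennreal_mult_less_top L2_iff)
 finally show ?thesis unfolding L2_iff by simp
qed

lemma L2_zero: "L2 (%x. 0)" by (simp add: L2_def)

lemma L2_indicator: "L2 f ==> A : sets lebesgue ==> L2 (%x. indicator A x * f x)"
 by (rule L2_dominated[of f _ 1]) (auto simp: indicator_def dest: L2_meas)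

lemma L2_sum: "finite I ==> (!!i. i : I ==> L2 (f i)) ==> L2 (%x. \<Sum>i\<in>I. f i x)"
proof (induction I rule: finite_induct)
 case (insert i I)
 thus ?case using L2_add[of "f i" "%x. \<Sum>i\<in>I. f i x" 1 1] by simp
qed (simp add: L2_zero)

definition bdm :: "('a::euclidean_space => real) => bool" where
 "bdm b \<longleftrightarrow> b : LM & (EX M. ALL x. \<bar>b x\<bar> <= M)"

lemma bdmE: assumes "bdm b" obtains M where "M > 0" "!!x. \<bar>b x\<bar> <= M"
proof -
 obtain M where "ALL x. \<bar>b x\<bar> <= M" using assms by (auto simp: bdm_def)
 thus ?thesis by (intro that[of "\<bar>M\<bar> + 1"]) (auto intro: order_trans[of _ M])
qed

lemma bdm_meas: "bdm b ==> b : LM" by (simp add: bdm_def)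

lemma bdm_const: "bdm (%x. c)" by (auto simp: bdm_def)

lemma bdm_mult: assumes "bdm b" "bdm c" shows "bdm (%x. b x * c x)"
proof -
 obtain M N where "!!x. \<bar>b x\<bar> <= M" "!!x. \<bar>c x\<bar> <= N" "M > 0" "N > 0" using assms bdmE by metis
 hence "\<bar>b x * c x\<bar> <= M * N" for x unfolding abs_mult by (intro mult_mono) (auto intro: less_imp_le)
 thus ?thesis using bdm_meas[OF assms(1)] bdm_meas[OF assms(2)] unfolding bdm_def by auto
qed

lemma bdm_diff: assumes "bdm b" "bdm c" shows "bdm (%x. b x - c x)"
proof -
 obtain M N where M: "!!x. \<bar>b x\<bar> <= M" and N: "!!x. \<bar>c x\<bar> <= N" using assms bdmE by metis
 have "\<bar>b x - c x\<bar> <= M + N" for x using M[of x] N[of x] by linarith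
 thus ?thesis using bdm_meas[OF assms(1)] bdm_meas[OF assms(2)] unfolding bdm_def by auto
qed

lemma bdm_power: "bdm b ==> bdm (%x. b x ^ k)"
proof (induction k)
 case (Suc k) thus ?case using bdm_mult[of b "%x. b x ^ k"] by simp
qed (simp add: bdm_const)

lemma L2_mult_bdm: assumes "bdm b" "L2 f" shows "L2 (%x. b x * f x)"
proof -
 obtain M where "!!x. \<bar>b x\<bar> <= M" using assms bdmE by metis
 thus ?thesis using bdm_meas[OF assms(1)] L2_meas[OF assms(2)]
  by (intro L2_dominated[OF assms(2), of _ M]) (auto simp: abs_mult intro: mult_right_mono)
qed

lemma sum_binomial_Suc:
 fixes a :: "nat => real"
 shows "(\<Sum>k\<le>Suc m. real (Suc m choose k) * a k) = (\<Sum>k\<le>m. real (m choose k) * a (Suc k)) + (\<Sum>k\<le>m. real (m choose k) * a k)"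
proof -
 let ?A = "\<Sum>k\<le>m. real (m choose Suc k) * a (Suc k)"
 let ?B = "\<Sum>k\<le>m. real (Suc m choose Suc k) * a (Suc k)"
 let ?C = "\<Sum>k\<le>Suc m. real (Suc m choose k) * a k"
 let ?D = "\<Sum>k\<le>m. real (m choose k) * a (Suc k)"
 have "?C = a 0 + ?B"
  by (subst sum.atMost_Suc_shift) simp
 also have "?B = ?D + ?A"
  by (simp add: sum.distrib[symmetric] algebra_simps)
 finally have "?C = ?D + (a 0 + ?A)" by simp
 also have "a 0 + ?A = (\<Sum>k\<le>Suc m. real (m choose k) * a k)"
  by (subst sum.atMost_Suc_shift) simp
 also have "... = (\<Sum>k\<le>m. real (m choose k) * a k)" by simp
 finally show ?thesis .
qed

lemma comm_right_mult: "comm T b k (%y. b y * f y) x = b x * comm T b k f x - comm T b (Suc k) f x"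
 by simp

text \<open>Iterates the definition of the next commutator. For \<open>i = 0\<close> and
  \<open>b\<close> recentred it expresses the top commutator through \<open>T\<close> of
  \<open>b^k f\<close> and lower commutators, with the powers of \<open>b\<close> outside.\<close>

lemma comm_power_right:
 "comm T b i (%y. b y ^ k * f y) x = (\<Sum>j\<le>k. real (k choose j) * ((-1) ^ j * b x ^ (k - j) * comm T b (i + j) f x))"
proof (induction k arbitrary: f)
 case (Suc k)
 let ?A = "%y. (-1) ^ y * b x ^ (Suc k - y) * comm T b (i + y) f x"
 have "comm T b i (%y. b y ^ Suc k * f y) x = comm T b i (%y. b y ^ k * (b y * f y)) x" by (simp add: mult_ac)
 also have "... = (\<Sum>j\<le>k. real (k choose j) * ((-1) ^ j * b x ^ (k - j) * comm T b (i + j) (%y. b y * f y) x))" by (rule Suc.IH)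
 also have "... = (\<Sum>j\<le>k. real (k choose j) * ((-1) ^ Suc j * b x ^ (Suc k - Suc j) * comm T b (i + Suc j) f x)
    + real (k choose j) * (?A j))"
  by (intro sum.cong refl) (simp only: comm_right_mult, simp add: algebra_simps Suc_diff_le del: comm.simps(2))
 also have "... = (\<Sum>j\<le>Suc k. real (Suc k choose j) * (?A j))"
  by (subst sum_binomial_Suc) (simp only: sum.distrib)
 finally show ?case .
qed simp

text \<open>The dual expansion, with the powers of \<open>b\<close> inside; it is used on the single
  pieces of the bad part.\<close>

lemma comm_power_left:
 "b x ^ m * comm T b i f x = (\<Sum>k\<le>m. real (m choose k) * comm T b (i + k) (%y. b y ^ (m - k) * f y) x)"
proof (induction m arbitrary: i f)
 case (Suc m)
 let ?A = "%z. comm T b (i + z) (%y. b y ^ (Suc m - z) * f y) x"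
 let ?B = "%x. %y. b y ^ (m - x) * (b y * f y)"
 let ?C = "%x. real (m choose x)"
 have "b x ^ Suc m * comm T b i f x = b x ^ m * comm T b (Suc i) f x + b x ^ m * comm T b i (%y. b y * f y) x"
  by (simp add: algebra_simps)
 also have "... = (\<Sum>k\<le>m. ?C k * comm T b (Suc i + k) (%y. b y ^ (m - k) * f y) x)
   + (\<Sum>k\<le>m. ?C k * comm T b (i + k) (?B k) x)"
  by (simp only: Suc.IH)
 also have "... = (\<Sum>k\<le>m. ?C k * comm T b (i + Suc k) (%y. b y ^ (Suc m - Suc k) * f y) x)
   + (\<Sum>k\<le>m. ?C k * ?A k)"
 proof (intro arg_cong2[of _ _ _ _ "(+)"] sum.cong refl)
  fix k assume "k : {..m}"
  hence "(?B k) = (%y. b y ^ (Suc m - k) * f y)"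
   by (auto simp: Suc_diff_le)
  thus "?C k * comm T b (i + k) (?B k) x = ?C k * ?A k" by simp
 qed (simp del: comm.simps)
 also have "... = (\<Sum>k\<le>Suc m. real (Suc m choose k) * ?A k)"
  by (subst sum_binomial_Suc) simp
 finally show ?case .
qed simp

text \<open>Reduces the commutator to finitely many values of \<open>T\<close>, the form suited to
  limits in \<open>b\<close>.\<close>

lemma comm_expansion:
 "comm T b k f x = (\<Sum>j\<le>k. real (k choose j) * ((-1) ^ j * b x ^ (k - j) * T (%y. b y ^ j * f y) x))"
proof (induction k arbitrary: f)
 case (Suc k)
 let ?A = "%z. (-1) ^ z * b x ^ (Suc k - z) * T (%y. b y ^ z * f y) x"
 have "comm T b (Suc k) f x = b x * comm T b k f x - comm T b k (%y. b y * f y) x" by simp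
 also have "... = b x * (\<Sum>j\<le>k. real (k choose j) * ((-1) ^ j * b x ^ (k - j) * T (%y. b y ^ j * f y) x))
    - (\<Sum>j\<le>k. real (k choose j) * ((-1) ^ j * b x ^ (k - j) * T (%y. b y ^ j * (b y * f y)) x))"
  by (simp only: Suc.IH)
 also have "... = (\<Sum>j\<le>k. real (k choose j) * ((-1) ^ Suc j * b x ^ (Suc k - Suc j) * T (%y. b y ^ Suc j * f y) x))
    + (\<Sum>j\<le>k. real (k choose j) * (?A j))"
 proof -
  have "(%y. b y ^ j * (b y * f y)) = (%y. b y ^ Suc j * f y)" for j by (auto simp: mult_ac)
  thus ?thesis
   by (simp add: sum_distrib_left sum_negf Suc_diff_le mult_ac)
 qed
 also have "... = (\<Sum>j\<le>Suc k. real (Suc k choose j) * (?A j))"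
  by (subst sum_binomial_Suc) simp
 finally show ?case .
qed simp

text \<open>Linearity holds almost everywhere only, so identities between commutators of different
  functions come with null sets of their own.\<close>

locale L2_op =
 fixes T :: "('a::euclidean_space => real) => ('a => real)" and CT :: real
 assumes CT: "CT > 0"
  and T_L2: "L2 f ==> L2 (T f)"
  and T_norm: "L2 f ==> RI (%x. (T f x)^2) <= en CT * RI (%x. (f x)^2)"
  and T_lin: "L2 f ==> L2 g ==> AE x in lebesgue. T (%y. a * f y + c * g y) x = a * T f x + c * T g x"
begin

lemma T_AE_cong:
 assumes "L2 f" "L2 g" "AE x in lebesgue. f x = g x"
 shows "AE x in lebesgue. T f x = T g x"
proof -
 define d where "d y = 1 * f y + (-1) * g y" for y
 have d: "L2 d" unfolding d_def by (rule L2_add[OF assms(1,2)])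
 have "RI (%x. (d x)^2) = (\<integral>\<^sup>+x. 0 \<partial>(lebesgue :: 'a measure))"
  by (rule nn_integral_cong_AE) (use assms(3) in \<open>auto simp: d_def\<close>)
 hence "RI (%x. (T d x)^2) = 0" using T_norm[OF d] by simp
 hence "AE x in lebesgue. T d x = 0"
  using L2_meas[OF T_L2[OF d]] by (subst (asm) nn_integral_0_iff_AE) auto
 moreover have "AE x in lebesgue. T d x = 1 * T f x + (-1) * T g x" unfolding d_def by (rule T_lin[OF assms(1,2)])
 ultimately show ?thesis by eventually_elim auto
qed

lemma L2_comm: "bdm b ==> L2 f ==> L2 (comm T b k f)"
proof (induction k arbitrary: f)
 case (Suc k)
 have "L2 (%x. 1 * (b x * comm T b k f x) + (-1) * comm T b k (%y. b y * f y) x)"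
  by (intro L2_add L2_mult_bdm Suc) 
 thus ?case by simp
qed (simp add: T_L2)

lemma comm_lin:
 assumes "bdm b" "L2 f" "L2 g"
 shows "AE x in lebesgue. comm T b k (%y. a * f y + c * g y) x = a * comm T b k f x + c * comm T b k g x"
 using assms(2,3)
proof (induction k arbitrary: f g)
 case (Suc k)
 let ?A = "%y. b y * (a * f y + c * g y)"
 have "?A = (%y. a * (b y * f y) + c * (b y * g y))" by (auto simp: algebra_simps)
 hence "AE x in lebesgue. comm T b k ?A x = a * comm T b k (%y. b y * f y) x + c * comm T b k (%y. b y * g y) x"
  using Suc.IH[OF L2_mult_bdm[OF assms(1) Suc.prems(1)] L2_mult_bdm[OF assms(1) Suc.prems(2)]] by simp
 with Suc.IH[OF Suc.prems] show ?case by eventually_elim (simp add: algebra_simps)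
qed (simp add: T_lin)

lemma comm_norm:
 assumes "bdm b"
 shows "\<exists>C>0. ALL f. L2 f --> RI (%x. (comm T b k f x)^2) <= en C * RI (%x. (f x)^2)"
proof (induction k)
 case 0 thus ?case using T_norm CT by auto
next
 case (Suc k)
 then obtain C where C: "C > 0" and IH: "!!f. L2 f ==> RI (%x. (comm T b k f x)^2) <= en C * RI (%x. (f x)^2)" by blast
 obtain M where M: "M > 0" "!!x. \<bar>b x\<bar> <= M" using bdmE[OF assms] by blast
 have bM: "(b x)^2 <= M\<^sup>2" for x using M(2)[of x] by (rule abs_le_square_iff[THEN iffD1, of _ M, simplified abs_of_pos[OF M(1)]])
 let ?E = "%y. RI (%x. (comm T b (Suc k) y x)^2)"
 have "?E f <= en (4 * M\<^sup>2 * C) * RI (%x. (f x)^2)" if f: "L2 f" for f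
 proof -
  let ?B = "%y. b y * f y"
  have bf: "L2 ?B" by (rule L2_mult_bdm[OF assms f])
  note [measurable] = L2_meas[OF L2_comm[OF assms f, of k]] L2_meas[OF L2_comm[OF assms bf, of k]] L2_meas[OF f]
  let ?A = "en (2 * M\<^sup>2)"
  have "?E f <= NI (%x. ?A * en ((comm T b k f x)^2) + en 2 * en ((comm T b k ?B x)^2))"
  proof (rule nn_integral_mono, goal_cases)
   case (1 x)
   let ?a = "comm T b k f x" and ?c = "comm T b k ?B x"
   have "(b x * ?a - ?c)^2 <= 2 * ((b x)^2 * ?a\<^sup>2) + 2 * ?c\<^sup>2"
    using zero_le_power2[of "b x * ?a + ?c"] by (simp add: power2_eq_square algebra_simps)
   also have "... <= 2 * (M\<^sup>2 * ?a\<^sup>2) + 2 * ?c\<^sup>2" using bM[of x] by (intro add_right_mono mult_left_mono mult_right_mono) auto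
   finally show ?case
    by (subst (1 2) ennreal_mult[symmetric]) (auto simp flip: ennreal_plus intro!: ennreal_leI)
  qed
  also have "... = ?A * RI (%x. (comm T b k f x)^2) + en 2 * RI (%x. (comm T b k ?B x)^2)"
   by (subst nn_integral_add) (auto simp: nn_integral_cmult simp del: comm.simps)
  also have "... <= ?A * (en C * RI (%x. (f x)^2)) + en 2 * (en C * RI (%x. (b x * f x)^2))"
   by (intro add_mono mult_left_mono IH f bf) auto
  also have "... <= ?A * (en C * RI (%x. (f x)^2)) + en 2 * (en C * (en (M\<^sup>2) * RI (%x. (f x)^2)))"
  proof (intro add_left_mono mult_left_mono)
   let ?C = "en (M\<^sup>2)"
   let ?D = "RI (%x. (b x * f x)^2)"
   have "?D <= NI (%x. ?C * en ((f x)^2))"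
    using bM by (intro nn_integral_mono) (auto simp: power_mult_distrib ennreal_mult[symmetric] intro!: ennreal_leI mult_right_mono)
   also have "... = ?C * RI (%x. (f x)^2)" by (rule nn_integral_cmult) measurable
   finally show "?D <= ?C * RI (%x. (f x)^2)" .
  qed auto
  also have "... = (?A * en C + en 2 * (en C * en (M\<^sup>2))) * RI (%x. (f x)^2)"
   by (simp only: distrib_right mult.assoc)
  also have "?A * en C + en 2 * (en C * en (M\<^sup>2)) = en (2 * M\<^sup>2 * C + 2 * (C * M\<^sup>2))"
   using C by (simp only: ennreal_mult[symmetric] ennreal_plus[symmetric] zero_le_power2 zero_le_mult_iff zero_le_numeral less_imp_le simp_thms mult_nonneg_nonneg)
  also have "2 * M\<^sup>2 * C + 2 * (C * M\<^sup>2) = 4 * M\<^sup>2 * C" by simp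
  finally show ?thesis .
 qed
 moreover have "4 * M\<^sup>2 * C > 0" using C M by simp
 ultimately show ?case by blast
qed

text \<open>Multiplication by a constant commutes with \<open>T\<close>; hence \<open>b\<close> can
  be recentred separately on each cell.\<close>

lemma comm_shift:
 assumes "bdm b" "L2 f"
 shows "AE x in lebesgue. comm T (%x. b x - c) k f x = comm T b k f x"
 using assms(2)
proof (induction k arbitrary: f)
 case (Suc k)
 have bc: "bdm (%x. b x - c)" by (intro bdm_diff assms bdm_const)
 have "(%y. (b y - c) * f y) = (%y. 1 * (b y * f y) + (- c) * f y)" by (auto simp: algebra_simps)
 hence "AE x in lebesgue. comm T b k (%y. (b y - c) * f y) x = 1 * comm T b k (%y. b y * f y) x + (- c) * comm T b k f x"
  using comm_lin[OF assms(1) L2_mult_bdm[OF assms(1) Suc.prems] Suc.prems, of k 1 "- c"] by simp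
 with Suc.IH[OF Suc.prems] Suc.IH[OF L2_mult_bdm[OF bc Suc.prems]] show ?case
  by eventually_elim (simp add: algebra_simps)
qed simp

lemma comm_sum:
 assumes "bdm b" "finite I" "!!i. i : I ==> L2 (f i)"
 shows "AE x in lebesgue. comm T b k (%y. \<Sum>i\<in>I. f i y) x = (\<Sum>i\<in>I. comm T b k (f i) x)"
 using assms(2,3)
proof (induction I rule: finite_induct)
 case empty
 have "AE x in lebesgue. comm T b k (%y. 0 * 0 + 0 * 0) x = 0 * comm T b k (%_. 0) x + 0 * comm T b k (%_. 0) x"
  using comm_lin[OF assms(1) L2_zero L2_zero, of k 0 0] by simp
 thus ?case by simp
next
 case (insert i I)
 let ?A = "%y. \<Sum>i\<in>I. f i y"
 have "AE x in lebesgue. comm T b k (%y. 1 * f i y + 1 * (\<Sum>i\<in>I. f i y)) x = 1 * comm T b k (f i) x + 1 * comm T b k ?A x"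
  using insert by (intro comm_lin assms(1) L2_sum) auto
 moreover have "AE x in lebesgue. comm T b k ?A x = (\<Sum>i\<in>I. comm T b k (f i) x)"
  using insert by auto
 ultimately show ?case using insert.hyps by (auto elim: AE_mp)
qed

end

text \<open>The error tends to 0 in \<open>L\<^sup>2\<close> but need not do so pointwise. Truncated
  subtraction turns the inequality into a bound for the square integral of \<open>F - S\<close>,
  which must then vanish.\<close>

lemma AE_le_of_L2_error:
 fixes F S :: "'a => ennreal" and E :: "nat => 'a => real"
 assumes [measurable]: "F : borel_measurable M" "S : borel_measurable M"
  and le: "!!N. AE x in M. F x <= S x + en (E N x)"
  and fin: "!!x. F x < top"
  and E: "(%N. \<integral>\<^sup>+x. en ((E N x)^2) \<partial>M) \<longlonglongrightarrow> 0"
 shows "AE x in M. F x <= S x"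
proof -
 let ?A = "\<integral>\<^sup>+x. (F x - S x)^2 \<partial>M"
 have "?A <= (\<integral>\<^sup>+x. en ((E N x)^2) \<partial>M)" for N
 proof (rule nn_integral_mono_AE, use le[of N] in eventually_elim)
  fix x assume "F x <= S x + en (E N x)"
  hence "F x - S x <= en (E N x)" using fin[of x] by (auto simp: ennreal_minus_le_iff)
  hence "F x - S x <= en \<bar>E N x\<bar>" by (rule order_trans) (auto intro: ennreal_leI)
  hence "(F x - S x)^2 <= (en \<bar>E N x\<bar>)^2" by (intro power_mono_ennreal)
  thus "(F x - S x)^2 <= en ((E N x)^2)" by (simp add: ennreal_power)
 qed
 hence "?A <= 0" by (intro LIMSEQ_le_const[OF E]) auto
 hence "?A = 0" by simp
 hence "AE x in M. (F x - S x)^2 = 0" by (subst (asm) nn_integral_0_iff_AE) auto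
 thus ?thesis by eventually_elim (auto simp: diff_eq_0_iff_ennreal)
qed

lemma L2_tail_tendsto_0:
 fixes Q :: "nat => 'a::euclidean_space set"
 assumes H: "L2 H" and Q [measurable]: "!!n. Q n : sets lebesgue" and z: "!!x. x ~: (\<Union>n. Q n) ==> H x = 0"
 shows "(%N. RI (%x. (indicator (- (\<Union>n<N. Q n)) x * H x)^2)) \<longlonglongrightarrow> 0"
proof -
 note [measurable] = L2_meas[OF H]
 have "(%N. RI (%x. (indicator (- (\<Union>n<N. Q n)) x * H x)^2)) \<longlonglongrightarrow> (\<integral>\<^sup>+x. 0 \<partial>(lebesgue :: 'a measure))"
 proof (rule nn_integral_dominated_convergence[where w = "%x. en ((H x)^2)"])
  show "RI (%x. (H x)^2) < \<infinity>" by (rule L2_finite[OF H])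
  show "!!j. AE x in lebesgue. en ((indicator (- (\<Union>n<j. Q n)) x * H x)^2) <= en ((H x)^2)"
   by (auto simp: indicator_def)
  show "AE x in lebesgue. (%i. en ((indicator (- (\<Union>n<i. Q n)) x * H x)^2)) \<longlonglongrightarrow> 0"
  proof (rule AE_I2, rule tendsto_eventually, goal_cases)
   case (1 x)
   show ?case
   proof (cases "x : (\<Union>n. Q n)")
    case True
    then obtain n where "x : Q n" by auto
    thus ?thesis unfolding eventually_sequentially by (intro exI[of _ "Suc n"]) (auto simp: indicator_def)
   qed (simp add: z)
  qed
 qed auto
 thus ?thesis by simp
qed

context L2_op begin

text \<open>On one piece, \<open>(b - c n)^m T\<close> expands into commutators of order up to
  \<open>m\<close>. Solving for order \<open>m\<close> and summing over the pieces reassembles the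
  lower terms into commutators of the whole function \<open>(b - cf)^(m - k) h\<close>. The
  countable sum is cut at \<open>N\<close>, and the tails are small in
  \<open>L\<^sup>2\<close>.\<close>

lemma comm_decomp:
 fixes Q :: "nat => 'a set"
 assumes b: "bdm b" and h: "L2 h" and cf: "bdm cf"
  and Q [measurable]: "!!n. Q n : sets lebesgue" and dis: "disjoint_family Q"
  and z: "!!x. x ~: (\<Union>n. Q n) ==> h x = 0" and cQ: "!!n y. y : Q n ==> cf y = c n"
 shows "AE x in lebesgue. en \<bar>comm T b m h x\<bar> <=
   (\<Sum>n. en (\<bar>b x - c n\<bar> ^ m * \<bar>T (%y. indicator (Q n) y * h y) x\<bar>))
   + en (\<Sum>k<m. real (m choose k) * \<bar>comm T b k (%y. (b y - cf y) ^ (m - k) * h y) x\<bar>)"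
proof (rule AE_le_of_L2_error)
 define H where "H k y = (b y - cf y) ^ (m - k) * h y" for k y
 have H: "L2 (H k)" for k unfolding H_def by (intro L2_mult_bdm bdm_power bdm_diff b cf h)
 have H0: "x ~: (\<Union>n. Q n) ==> H k x = 0" for k x using z by (simp add: H_def)
 define g where "g n k y = indicator (Q n) y * H k y" for n k y
 have g: "L2 (g n k)" for n k unfolding g_def by (rule L2_indicator[OF H Q])
 have mU: "- (\<Union>n<N. Q n) : sets lebesgue" for N
  using sets.compl_sets[of "\<Union>n<N. Q n" lebesgue] by (simp add: Compl_eq_Diff_UNIV)
 define R where "R N k y = indicator (- (\<Union>n<N. Q n)) y * H k y" for N k y
 have R: "L2 (R N k)" for N k unfolding R_def by (rule L2_indicator[OF H mU])
 let ?A = "%x. real (m choose x)"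
 define E where "E N x = (\<Sum>k\<le>m. ?A k * \<bar>comm T b k (R N k) x\<bar>)" for N x
 note [measurable] = L2_meas[OF L2_comm[OF b h]] L2_meas[OF L2_comm[OF b H]] L2_meas[OF T_L2[OF g]] bdm_meas[OF b] L2_meas[OF L2_comm[OF b R]] L2_meas[OF H]
 have hg: "(%y. indicator (Q n) y * h y) = g n m" for n by (rule ext) (simp add: g_def H_def)
 show "(%x. en \<bar>comm T b m h x\<bar>) : LM" by measurable
 let ?F = "%x. \<Sum>n. en (\<bar>b x - c n\<bar> ^ m * \<bar>T (%y. indicator (Q n) y * h y) x\<bar>)"
 let ?G = "%x. en (\<Sum>k<m. ?A k * \<bar>comm T b k (%y. (b y - cf y) ^ (m - k) * h y) x\<bar>)"
 show "(%x. (?F x)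
   + ?G x) : LM"
  unfolding hg H_def[symmetric] by measurable
 show "en \<bar>comm T b m h x\<bar> < top" for x by simp
 let ?M = "%y. RI (%x. (E y x)^2)"
 show "(%N. ?M N) \<longlonglongrightarrow> 0"
 proof -
  obtain CC where CC: "!!k. CC k > 0" "!!k f. L2 f ==> RI (%x. (comm T b k f x)^2) <= en (CC k) * RI (%x. (f x)^2)"
   using comm_norm[OF b] by metis
  let ?C = "%x. en (real (Suc m) * (?A x)^2 * CC x)"
  let ?Q = "%y. \<Sum>k\<le>m. ?C k * RI (%x. (R y k x)^2)"
  have bound: "?M N <= (?Q N)" for N
  proof -
   let ?E = "%x. en (real (Suc m) * (?A x)^2)"
   let ?N = "%x. \<Sum>k\<le>m. ?E k * en ((comm T b k (R N k) x)^2)"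
   have "?M N <= NI (%x. (?N x))"
   proof (rule nn_integral_mono, goal_cases)
    case (1 x)
    let ?I = "\<Sum>k\<le>m. real (Suc m) * (?A k)^2 * (comm T b k (R N k) x)^2"
    have "(E N x)^2 <= (\<Sum>k\<le>m. (?A k * \<bar>comm T b k (R N k) x\<bar>)^2) * real (card {..m})"
     unfolding E_def by (rule sum_squared_le_sum_of_squares)
    also have "... = ?I"
     by (simp add: sum_distrib_left power_mult_distrib mult_ac del: comm.simps)
    finally have "en ((E N x)^2) <= en ?I" by (rule ennreal_leI)
    also have "... = (?N x)"
     by (subst sum_ennreal[symmetric]) (auto simp: ennreal_mult simp del: comm.simps intro!: sum.cong)
    finally show ?case .
   qed
   also have "... = (\<Sum>k\<le>m. ?E k * RI (%x. (comm T b k (R N k) x)^2))"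
    by (subst nn_integral_sum) (auto simp: nn_integral_cmult simp del: comm.simps)
   also have "... <= (\<Sum>k\<le>m. ?E k * (en (CC k) * RI (%x. (R N k x)^2)))"
    by (intro sum_mono mult_left_mono CC R) auto
   also have "... = (?Q N)"
    using CC(1) by (intro sum.cong refl) (subst ennreal_mult[of "_ * _" "CC _"], auto simp: mult.assoc less_imp_le)
   finally show ?thesis .
  qed
  let ?J = "%N. \<Sum>k\<le>m. ?C k * RI (%x. (R N k x)^2)"
  have "?J \<longlonglongrightarrow> (\<Sum>k\<le>m. ?C k * 0)"
   unfolding R_def by (intro tendsto_sum ennreal_tendsto_cmult L2_tail_tendsto_0 H Q H0) auto
  hence "?J \<longlonglongrightarrow> 0" by simp
  from tendsto_const this show ?thesis
   by (rule tendsto_sandwich[rotated 2]) (rule always_eventually, rule allI, rule zero_le, rule always_eventually, rule allI, rule bound)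
 qed
 fix N
 have split: "f = (%y. 1 * (\<Sum>n<N. indicator (Q n) y * f y) + 1 * (indicator (- (\<Union>n<N. Q n)) y * f y))" for f :: "'a => real"
 proof (rule ext, goal_cases)
  case (1 y)
  have "(\<Sum>n<N. indicator (Q n) y :: real) = indicator (\<Union>n<N. Q n) y"
  proof (cases "\<exists>n0<N. y : Q n0")
   case True
   then obtain n0 where n0: "n0 < N" "y : Q n0" by auto
   have "indicator (Q n) y = (if n = n0 then 1 else 0 :: real)" for n
   proof (cases "n = n0")
    case False
    hence "Q n \<inter> Q n0 = {}" by (rule disjoint_family_onD[OF dis UNIV_I UNIV_I])
    hence "y ~: Q n" using n0(2) by blast
    thus ?thesis using False by simp
   qed (use n0(2) in simp)
   hence "(\<Sum>n<N. indicator (Q n) y :: real) = (\<Sum>n<N. if n = n0 then 1 else 0)" by simp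
   also have "... = 1" using n0(1) by simp
   finally show ?thesis using n0 by (auto simp: indicator_def)
  next
   case False
   thus ?thesis by (auto simp: indicator_def intro!: sum.neutral)
  qed
  hence s2: "(\<Sum>n<N. indicator (Q n) y * f y) = indicator (\<Union>n<N. Q n) y * f y"
   by (simp only: sum_distrib_right[symmetric])
  show ?case
   unfolding s2 indicator_compl by (simp only: left_diff_distrib) simp
 qed
 have parts: "AE x in lebesgue. comm T b k (H k') x = (\<Sum>n<N. comm T b k (g n k') x) + comm T b k (R N k') x" for k k'
 proof -
  let ?K = "%y. 1 * (\<Sum>n<N. g n k' y) + 1 * R N k' y"
  let ?U = "%y. \<Sum>n<N. g n k' y"
  have "AE x in lebesgue. comm T b k ?K x = 1 * comm T b k ?U x + 1 * comm T b k (R N k') x"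
   by (intro comm_lin b L2_sum g R) auto
  moreover have "AE x in lebesgue. comm T b k ?U x = (\<Sum>n<N. comm T b k (g n k') x)"
   by (intro comm_sum b g) auto
  moreover have "?K = H k'"
   using split[of "H k'"] by (simp add: g_def R_def)
  ultimately show ?thesis by (auto elim: AE_mp)
 qed
 \<comment> \<open>The left expansion for \<open>b - c n\<close> at order 0; the shift does not
   change the commutators.\<close>
 have cellid: "AE x in lebesgue. comm T b m (g n m) x = (b x - c n) ^ m * T (g n m) x - (\<Sum>k<m. ?A k * comm T b k (g n k) x)" for n
 proof -
  have fe: "(%y. (b y - c n) ^ (m - k) * g n m y) = g n k" for k
   using cQ by (auto simp: g_def H_def indicator_def)
  have "AE x in lebesgue. \<forall>k\<in>{..m}. comm T (%x. b x - c n) k (g n k) x = comm T b k (g n k) x"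
   by (rule AE_finite_allI) (auto intro: comm_shift b g simp del: comm.simps)
  thus ?thesis
  proof eventually_elim
   case (elim x)
   have "(b x - c n) ^ m * T (g n m) x = (\<Sum>k\<le>m. ?A k * comm T (%x. b x - c n) k (g n k) x)"
    using comm_power_left[of "%x. b x - c n" x m T 0 "g n m"] by (simp add: fe)
   also have "... = (\<Sum>k\<le>m. ?A k * comm T b k (g n k) x)" using elim by (intro sum.cong) auto
   also have "... = (\<Sum>k<m. ?A k * comm T b k (g n k) x) + comm T b m (g n m) x"
    by (simp add: lessThan_Suc_atMost[symmetric] del: comm.simps)
   finally show ?case by simp
  qed
 qed
 have a1: "AE x in lebesgue. \<forall>k\<in>{..m}. comm T b k (H k) x = (\<Sum>n<N. comm T b k (g n k) x) + comm T b k (R N k) x"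
  by (rule AE_finite_allI) (auto intro: parts simp del: comm.simps)
 have a2: "AE x in lebesgue. \<forall>n\<in>{..<N}. comm T b m (g n m) x = (b x - c n) ^ m * T (g n m) x - (\<Sum>k<m. ?A k * comm T b k (g n k) x)"
  by (rule AE_finite_allI) (auto intro: cellid simp del: comm.simps)
 show "AE x in lebesgue. en \<bar>comm T b m h x\<bar> <=
   (?F x)
   + ?G x + en (E N x)"
  using a1 a2
 proof eventually_elim
  case (elim x)
  let ?B = "\<Sum>n<N. \<bar>b x - c n\<bar> ^ m * \<bar>T (g n m) x\<bar>"
  let ?H = "\<Sum>k<m. ?A k * \<bar>comm T b k (H k) x\<bar>"
  have hm: "h = H m" by (simp add: H_def fun_eq_iff)
  let ?D = "%y. \<Sum>n<N. \<Sum>k<m. ?A k * comm T b k (g n k) x"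
  let ?O = "\<Sum>n<N. (b x - c n) ^ m * T (g n m) x"
  let ?P = "%y. \<Sum>n<N. comm T b y (g n y) x"
  let ?R = "\<Sum>k<m. ?A k * comm T b k (H k) x"
  let ?S = "%y. comm T b y (R N y) x"
  have "comm T b m h x = (?P m) + ?S m" using elim(1) hm by auto
  also have "(?P m) = ?O - (?D N)"
   using elim(2) by (simp add: sum_subtractf del: comm.simps)
  \<comment> \<open>For each order \<open>k\<close>, the sum over the pieces is the commutator of
    the whole minus that of the tail.\<close>
  also have "(?D N) = (\<Sum>k<m. ?A k * (?P k))"
   by (subst sum.swap) (simp add: sum_distrib_left del: comm.simps)
  also have "... = ?R - (\<Sum>k<m. ?A k * ?S k)"
   unfolding sum_subtractf[symmetric] by (intro sum.cong refl) (use elim(1) in \<open>simp add: algebra_simps del: comm.simps\<close>)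
  finally have eq: "comm T b m h x = ?O - ?R + (\<Sum>k\<le>m. ?A k * ?S k)"
   by (simp add: lessThan_Suc_atMost[symmetric] del: comm.simps)
  let ?L = "%y. en (\<bar>b x - c y\<bar> ^ m * \<bar>T (g y m) x\<bar>)"
  have "\<bar>\<Sum>n<N. (b x - c n) ^ m * T (g n m) x\<bar> <= ?B"
   by (rule order_trans[OF sum_abs]) (simp add: abs_mult power_abs)
  moreover have "\<bar>\<Sum>k<m. ?A k * comm T b k (H k) x\<bar> <= ?H"
   by (rule order_trans[OF sum_abs]) (simp add: abs_mult del: comm.simps)
  moreover have "\<bar>\<Sum>k\<le>m. ?A k * ?S k\<bar> <= E N x"
   unfolding E_def by (rule order_trans[OF sum_abs]) (simp add: abs_mult del: comm.simps)
  ultimately have "\<bar>comm T b m h x\<bar> <= ?B + ?H + E N x" unfolding eq by linarith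
  hence "en \<bar>comm T b m h x\<bar> <= en (?B + ?H + E N x)" by (rule ennreal_leI)
  also have "... = en ?B + en ?H + en (E N x)"
   by (subst ennreal_plus, (auto intro!: add_nonneg_nonneg sum_nonneg simp: E_def simp del: comm.simps)[2], subst ennreal_plus) (auto intro!: sum_nonneg simp del: comm.simps)
  also have "en ?B = (\<Sum>n<N. ?L n)"
   by (rule sum_ennreal[symmetric]) auto
  also have "... + en ?H + en (E N x) <= (\<Sum>n. ?L n) + en ?H + en (E N x)"
   by (intro add_right_mono sum_le_suminf) auto
  finally show ?case unfolding hg H_def[symmetric] .
 qed
qed

end

section \<open>Young functions and kernel differences paired with BMO\<close>

lemma young_mono:
 assumes "young \<phi>" "0 <= x" "x <= y" shows "\<phi> x <= \<phi> y"
proof (cases "x = y")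
 case False
 have "strict_mono_on {0..} \<phi>" using assms(1) by (simp add: young_def)
 from strict_mono_onD[OF this, of x y] show ?thesis using assms False by simp
qed simp

lemma young_0: "young \<phi> ==> \<phi> 0 = 0" by (simp add: young_def)

lemma young_nonneg: "young \<phi> ==> 0 <= x ==> 0 <= \<phi> x"
 using young_mono[of \<phi> 0 x] young_0[of \<phi>] by simp

lemma young_max_measurable: "young \<phi> ==> (%x. \<phi> (max 0 x)) : borel_measurable borel"
 by (rule borel_measurable_mono, rule monoI, rule young_mono) auto

lemma young_measurable:
 assumes "young \<phi>" "f : borel_measurable M" "!!x. 0 <= f x"
 shows "(%x. \<phi> (f x)) : borel_measurable M"
proof -
 have "(%x. \<phi> (max 0 (f x))) : borel_measurable M"
  by (rule measurable_compose[OF assms(2) young_max_measurable[OF assms(1)]])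
 thus ?thesis using assms(3) by (simp add: max_def)
qed

text \<open>Young's inequality on each annulus with a free scale \<open>l\<close>; the infimum over
  \<open>l\<close> is the Luxemburg norm in the Hoermander sum. The rescaling of \<open>H\<close> by
  \<open>(k + 1)^m\<close> is affordable because the sum carries that factor.\<close>

lemma hormander_tail:
 fixes K :: "'a::euclidean_space => real"
 assumes K [measurable]: "K : borel_measurable borel" and hor: "hormander \<xi> m K" and young: "young \<xi>" "young \<xi>t"
  and yi: "!!s t. 0 <= s ==> 0 <= t ==> t * s <= \<xi> s + \<xi>t t"
 shows "\<exists>c\<ge>1. \<exists>C>0. \<forall>y R \<Lambda> C0 H. R > c * norm y --> \<Lambda> > 0 --> C0 >= 0 --> H : LM --> (ALL x. 0 <= H x) -->
   (ALL k::nat. RSI (ball 0 (2 ^ (k + 2) * R)) (%x. \<xi>t (H x / (real (Suc k) ^ m * \<Lambda>))) <= en C0 * vol (ball 0 (2 ^ (k + 2) * R) :: 'a set)) -->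
   (RSI {x. 2 * R < norm x} (%x. \<bar>K (x - y) - K x\<bar> * H x)) <= en (C * (1 + C0) * \<Lambda>)"
proof -
 obtain c C where c: "c >= 1" and C: "C > 0" and hr: "!!y R. R > c * norm y ==>
   (\<Sum>k. en ((2 ^ Suc k * R) ^ DIM('a) * real (Suc k) ^ m) * lux_ann \<xi> (2 ^ Suc k * R) (%x. K (x - y) - K x)) <= en C"
  using hor unfolding hormander_def by blast
 define V where "V = unit_ball_vol (real DIM('a))"
 have V: "V > 0" unfolding V_def by simp
 have KK [measurable]: "(%x. K (x - y) - K x) : LM" for y
  by (rule borel_measurable_lebesgueI) measurable
 have "RSI {x. 2 * R < norm x} (%x. \<bar>K (x - y) - K x\<bar> * H x) <= en (2 ^ DIM('a) * V * C * (1 + C0) * \<Lambda>)"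
  if R: "R > c * norm y" and L: "\<Lambda> > 0" and C0: "C0 >= 0" and H [measurable]: "H : LM" and H0: "ALL x. 0 <= H x" and
   ave: "ALL k::nat. RSI (ball 0 (2 ^ (k + 2) * R)) (%x. \<xi>t (H x / (real (Suc k) ^ m * \<Lambda>))) <= en C0 * vol (ball 0 (2 ^ (k + 2) * R) :: 'a set)"
  for y :: 'a and R \<Lambda> C0 H
 proof -
  have R0: "R > 0" using R c by (smt (verit) mult_nonneg_nonneg norm_ge_zero)
  \<comment> \<open>With indices from 0 the annuli start at \<open>s 0 = 2 R\<close>, hence the
    region \<open>2 R < norm x\<close>.\<close>
  define s where "s k = 2 ^ Suc k * R" for k :: nat
  have s0: "s k > 0" for k using R0 by (simp add: s_def)
  have s2: "2 ^ (k + 2) * R = 2 * s k" for k by (simp add: s_def)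
  define An where "An k = {x::'a. s k < norm x & norm x <= 2 * s k}" for k
  have An [measurable]: "An k : sets lebesgue" for k
  proof -
   have "An k = {x : space borel. s k < norm x & norm x <= 2 * s k}" by (auto simp: An_def)
   also have "... : sets borel" by measurable
   finally show ?thesis by auto
  qed
  define d where "d x = K (x - y) - K x" for x
  have [measurable]: "d : LM" unfolding d_def by (rule KK)
  let ?E = "\<Union>k. An k"
  have cover: "{x. 2 * R < norm x} <= ?E"
  proof
   fix x :: 'a assume x: "x : {x. 2 * R < norm x}"
   obtain N :: nat where "norm x / R < 2 ^ N" using real_arch_pow[of 2 "norm x / R"] by auto
   hence "norm x < 2 ^ N * R" using R0 by (simp add: field_simps)
   also have "... <= 2 * s N" using R0 by (simp add: s_def)
   finally have ex: "norm x <= 2 * s N" by simp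
   define k where "k = (LEAST k. norm x <= 2 * s k)"
   have k: "norm x <= 2 * s k" unfolding k_def by (rule LeastI[of _ N]) (rule ex)
   have "s k < norm x"
   proof (cases k)
    case 0 thus ?thesis using x by (simp add: s_def)
   next
    case (Suc j)
    hence "~ norm x <= 2 * s j" unfolding k_def by (metis lessI not_less_Least)
    thus ?thesis using Suc by (simp add: s_def)
   qed
   thus "x : ?E" using k by (auto simp: An_def)
  qed
  let ?A = "%x. \<bar>d x\<bar> * H x"
  let ?B = "2 ^ DIM('a) * V * (1 + C0) * \<Lambda>"
  let ?C = "%x. en ((s x) ^ DIM('a) * real (Suc x) ^ m)"
  have ann: "RSI (An k) ?A <= en ?B * (?C k * lux_ann \<xi> (s k) d)" for k
  proof -
   define B where "B = (ball 0 (2 * s k) :: 'a set)"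
   define bv where "bv = V * (2 * s k) ^ DIM('a)"
   have bv: "vol B = en bv" "bv > 0"
    using s0[of k] V unfolding B_def bv_def V_def by (simp_all add: emeasure_ball)
   have [measurable]: "B : sets lebesgue" by (simp add: B_def)
   define M where "M = real (Suc k) ^ m * \<Lambda>"
   have M: "M > 0" using L by (simp add: M_def)
   define D where "D x = indicator (An k) x * d x" for x
   have [measurable]: "D : LM" unfolding D_def by measurable
   have lux: "lux_ann \<xi> (s k) d = lux \<xi> (%_. 1) B D"
    unfolding lux_ann_def B_def D_def An_def ..
   have one: "RSI (An k) ?A <= en l * en (M * (1 + C0) * bv)"
    if l: "0 < l" and le: "RSI B (%x. \<xi> (\<bar>D x\<bar> / l) * 1) <= SI B (%x. en 1)" for l
   proof -
    have m1: "(%x. en (\<xi> (\<bar>D x\<bar> / l))) : LM"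
     using l by (intro measurable_compose[OF _ measurable_ennreal] young_measurable[OF young(1)]) auto
    have m2: "(%x. en (\<xi>t (H x / M))) : LM"
     using M H0 by (intro measurable_compose[OF _ measurable_ennreal] young_measurable[OF young(2)]) auto
    have "RSI (An k) ?A <= NI (%x. en (l * M) * (en (\<xi> (\<bar>D x\<bar> / l)) * indicator B x + en (\<xi>t (H x / M)) * indicator B x))"
    proof (rule nn_integral_mono_AE)
     \<comment> \<open>The annulus contains its outer sphere, the open ball does not.\<close>
     have "AE x in lebesgue. x ~: sphere (0::'a) (2 * s k)"
      using negligible_sphere[of "0::'a" "2 * s k"] by (intro AE_not_in) (simp add: negligible_iff_null_sets)
     thus "AE x in lebesgue. en (\<bar>d x\<bar> * H x) * indicator (An k) x <= en (l * M) * (en (\<xi> (\<bar>D x\<bar> / l)) * indicator B x + en (\<xi>t (H x / M)) * indicator B x)"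
     proof eventually_elim
      case (elim x)
      show ?case
      proof (cases "x : An k")
       case True
       hence xB: "x : B" using elim by (auto simp: An_def B_def)
       have Dx: "D x = d x" using True by (simp add: D_def)
       let ?D = "%y. \<xi> (\<bar>d x\<bar> / y)"
       have "\<bar>d x\<bar> * H x = l * M * (H x / M * (\<bar>d x\<bar> / l))" using l M by simp
       also have "... <= l * M * (?D l + \<xi>t (H x / M))"
        using l M H0 by (intro mult_left_mono yi) auto
       finally have "en (\<bar>d x\<bar> * H x) <= en (l * M * (?D l + \<xi>t (H x / M)))" by (rule ennreal_leI)
       also have "... = en (l * M) * (en (?D l) + en (\<xi>t (H x / M)))"
       proof -
        have "0 <= ?D l" using l by (intro young_nonneg[OF young(1)]) auto
        moreover have "0 <= \<xi>t (H x / M)" using M H0 by (intro young_nonneg[OF young(2)]) auto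
        ultimately show ?thesis using l M by (simp add: ennreal_mult ennreal_plus)
       qed
       finally show ?thesis using True xB Dx by simp
      qed simp
     qed
    qed
    also have "... = en (l * M) * (RSI B (%x. \<xi> (\<bar>D x\<bar> / l)) + RSI B (%x. \<xi>t (H x / M)))"
     using m1 m2 by (subst nn_integral_cmult, measurable, subst nn_integral_add) auto
    also have "... <= en (l * M) * (en bv + en C0 * en bv)"
    proof (intro mult_left_mono add_mono)
     show "RSI B (%x. \<xi> (\<bar>D x\<bar> / l)) <= en bv" using le by (simp add: bv(1) del: emeasure_completion)
     show "RSI B (%x. \<xi>t (H x / M)) <= en C0 * en bv"
      using ave[rule_format, of k] unfolding s2 B_def[symmetric] M_def[symmetric] bv(1) .
    qed auto
    also have "... = en (l * M) * en ((1 + C0) * bv)" using C0 bv(2) by (simp add: ennreal_mult distrib_right ennreal_plus)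
    also have "... = en l * en (M * (1 + C0) * bv)" using l M C0 bv(2) by (simp add: ennreal_mult mult_ac)
    finally show ?thesis .
   qed
   let ?Z = "en (M * (1 + C0) * bv)"
   have Z: "?Z ~= 0" "?Z ~= top" using M C0 bv(2) by auto
   \<comment> \<open>Dividing first turns the bound for each admissible \<open>l\<close> into a
     lower bound for the infimum.\<close>
   have "RSI (An k) ?A / ?Z <= lux_ann \<xi> (s k) d"
    unfolding lux lux_def
    by (rule INF_greatest) (use one in \<open>auto simp only: mem_Collect_eq ennreal_divide_le_iff[OF Z]\<close>)
   hence "RSI (An k) ?A <= lux_ann \<xi> (s k) d * ?Z"
    by (simp only: ennreal_divide_le_iff[OF Z])
   also have "M * (1 + C0) * bv = ?B * ((s k) ^ DIM('a) * real (Suc k) ^ m)"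
    by (simp add: M_def bv_def power_mult_distrib)
   also have "lux_ann \<xi> (s k) d * en ... = en ?B * (?C k * lux_ann \<xi> (s k) d)"
    using V C0 L s0[of k] by (subst ennreal_mult) (auto simp: mult_ac)
   finally show ?thesis .
  qed
  have "RSI {x. 2 * R < norm x} ?A <= RSI ?E ?A"
   by (rule set_nn_integral_subset[OF cover])
  also have "... <= (\<Sum>k. RSI (An k) ?A)" by (rule set_nn_integral_UN_le) auto
  also have "... <= (\<Sum>k. en ?B * (?C k * lux_ann \<xi> (s k) d))"
   by (intro suminf_le ann) auto
  also have "... = en ?B * (\<Sum>k. ?C k * lux_ann \<xi> (s k) d)"
   by (rule ennreal_suminf_cmult)
  also have "... <= en ?B * en C"
   using hr[OF R] unfolding s_def d_def by (intro mult_left_mono) auto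
  also have "... = en (2 ^ DIM('a) * V * C * (1 + C0) * \<Lambda>)" using V C0 L C by (simp add: ennreal_mult[symmetric] mult_ac)
  finally show ?thesis unfolding d_def .
 qed
 moreover have "2 ^ DIM('a) * V * C > 0" using V C by simp
 ultimately show ?thesis using c by (intro exI[of _ c] conjI exI[of _ "2 ^ DIM('a) * V * C"]) blast+
qed

text \<open>The sign covers translation and reflection, that is, differences of
  \<open>K (z - y)\<close> as well as of \<open>K (y - z)\<close>.\<close>

lemma affine_lebesgue:
 fixes x :: "'a::euclidean_space" and \<sigma> :: real
 assumes "\<sigma> = 1 | \<sigma> = -1"
 shows measurable_affine_lebesgue: "(%X. x + \<sigma> *\<^sub>R X) : lebesgue \<rightarrow>\<^sub>M lebesgue"
  and nn_integral_affine_lebesgue: "f : LM ==> NI (%X. f (x + \<sigma> *\<^sub>R X)) = NI f"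
proof -
 have eq: "x + (\<Sum>j\<in>Basis. (\<sigma> * (X \<bullet> j)) *\<^sub>R j) = x + \<sigma> *\<^sub>R X" for X :: 'a
  by (simp add: scaleR_scaleR[symmetric] scaleR_sum_right[symmetric] euclidean_representation del: scaleR_scaleR)
 have s: "\<sigma> ~= 0" "\<bar>\<sigma>\<bar> = 1" using assms by auto
 let ?A = "%X. x + \<sigma> *\<^sub>R X"
 show m: "?A : lebesgue \<rightarrow>\<^sub>M lebesgue"
  using lebesgue_affine_measurable[of "%_. \<sigma>" x] s(1) unfolding eq by simp
 have leb: "(lebesgue :: 'a measure) = density (distr lebesgue lebesgue ?A) (%_. 1)"
  using lebesgue_affine_euclidean[of "%_. \<sigma>" x] s unfolding eq by simp
 let ?B = "%y. NI (%X. y (x + \<sigma> *\<^sub>R X))"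
 show "?B f = NI f" if f: "f : LM"
 proof -
  have "NI f = (\<integral>\<^sup>+z. f z \<partial>density (distr lebesgue lebesgue ?A) (%_. 1))"
   using leb by simp
  also have "... = (\<integral>\<^sup>+z. f z \<partial>distr lebesgue lebesgue ?A)"
   by (simp add: density_1)
  also have "... = ?B f" by (rule nn_integral_distr[OF m]) (use f in simp)
  finally show ?thesis by simp
 qed
qed

text \<open>Encodes that \<open>\<theta>\<close>-means of \<open>u\<close> may be paired with powers
  of a BMO oscillation: the latter has all moments, so the power \<open>N\<close> is
  arbitrary.\<close>

definition submult :: "(real => real) => (real => real) => bool" where
 "submult \<xi>t \<theta> \<longleftrightarrow> (ALL x y. 0 <= x --> x <= y --> 0 <= \<theta> x & \<theta> x <= \<theta> y) &
   (\<exists>C>0. \<exists>N>0. \<forall>x\<ge>0. \<forall>y\<ge>0. \<xi>t (x * y / C) <= \<theta> x + y powr N + C)"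

lemma mono_pos_measurable:
 fixes \<theta> :: "real => real"
 assumes mono: "!!x y. 0 <= x ==> x <= y ==> \<theta> x <= \<theta> y" and f: "f : borel_measurable M" "!!x. 0 <= f x"
 shows "(%x. \<theta> (f x)) : borel_measurable M"
proof -
 have "(%x. \<theta> (max 0 x)) : borel_measurable borel"
  by (rule borel_measurable_mono, rule monoI, rule mono) auto
 from measurable_compose[OF f(1) this] show ?thesis using f(2) by (simp add: max_def)
qed

text \<open>The case \<open>\<sigma> = 1\<close> serves functions with mean zero on a cell,
  \<open>\<sigma> = -1\<close> the oscillation of \<open>T h\<close> over a cell far from
  \<open>h\<close>. The means of \<open>\<theta> (u / \<Lambda>)\<close> are controlled over all
  ancestors of the cell, since the complement of a neighbourhood meets every larger scale.\<close>

definition kernel_bd :: "('a::euclidean_space => real) => real => nat => nat => (real => real) => real => bool" where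
 "kernel_bd K \<beta> m J \<theta> C \<longleftrightarrow> (\<forall>\<sigma> b u \<Lambda> A0 l x y i. (\<sigma> = 1 | \<sigma> = -1) --> bmo_bd \<beta> b --> u : LM --> (ALL z. 0 <= u z) -->
   \<Lambda> > 0 --> A0 >= 0 --> y : cell l x --> i <= m -->
   (\<forall>j\<le>l. RSI (nbhd j x) (%z. \<theta> (u z / \<Lambda>)) <= en A0 * vol (nbhd j x)) -->
   RSI (- nbhd (l - int J) x) (%z. \<bar>K (\<sigma> *\<^sub>R (z - y)) - K (\<sigma> *\<^sub>R (z - x))\<bar> * (\<bar>b z - mid \<beta> b l x\<bar> ^ i * u z)) <= en (C * (1 + A0) * \<Lambda>))"

lemmas kernel_bdD = kernel_bd_def[THEN iffD1, rule_format]

text \<open>On the \<open>k\<close>-th annulus \<open>b\<close> is compared with its centre at that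
  scale. The drift of the centres is linear in \<open>k\<close>, so order \<open>i \<le> m\<close>
  costs at most a multiple of \<open>(k + 1)^m\<close>, which the Hoermander condition of order
  \<open>m\<close> allows; the remaining oscillation is handled by John-Nirenberg through
  \<open>submult\<close>.\<close>

lemma kernel_bmo:
 fixes K :: "'a::euclidean_space => real"
 assumes K [measurable]: "K : borel_measurable borel" and hor: "hormander \<xi> m K" and young: "young \<xi>" "young \<xi>t"
  and yi: "!!s t. 0 <= s ==> 0 <= t ==> t * s <= \<xi> s + \<xi>t t" and \<beta>: "\<beta> > 0"
 shows "\<exists>J\<ge>1. \<forall>\<theta>. submult \<xi>t \<theta> --> (\<exists>C>0. kernel_bd K \<beta> m J \<theta> C)"
proof -
 obtain c C where c: "c >= 1" and C: "C > 0" and ht: "!!y R \<Lambda> C0 H. R > c * norm y ==> \<Lambda> > 0 ==> C0 >= 0 ==> H : LM ==> (ALL x. 0 <= H x) ==>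
   (ALL k::nat. RSI (ball 0 (2 ^ (k + 2) * R)) (%x. \<xi>t (H x / (real (Suc k) ^ m * \<Lambda>))) <= en C0 * vol (ball 0 (2 ^ (k + 2) * R) :: 'a set)) ==>
   (RSI {x. 2 * R < norm x} (%x. \<bar>K (x - y) - K x\<bar> * H x)) <= en (C * (1 + C0) * \<Lambda>)"
  using hormander_tail[OF K hor young yi] by blast
 \<comment> \<open>Then \<open>R = 2^J' side l\<close> exceeds \<open>c\<close> times the distance
   of any point of the cell from \<open>x\<close>.\<close>
 obtain J' :: nat where J': "c * DIM('a) < 2 ^ J'" using real_arch_pow[of 2 "c * DIM('a)"] by auto
 \<comment> \<open>One more scale, because the tail estimate starts at radius
   \<open>2 R\<close>.\<close>
 define J where "J = J' + 1"
 define V where "V = unit_ball_vol (real DIM('a))"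
 have V: "V > 0" unfolding V_def by simp
 define q where "q = 3 ^ DIM('a) / V"
 have q: "q > 0" using V by (simp add: q_def)
 define \<beta>' where "\<beta>' = (1 + 2 ^ DIM('a)) * \<beta>"
 have \<beta>': "\<beta>' > 0" using \<beta> unfolding \<beta>'_def by (intro mult_pos_pos add_pos_pos) auto
 \<comment> \<open>Makes \<open>(k + 1) D\<close> dominate 1 plus the drift of the centre over
   \<open>J' + k + 2\<close> scales.\<close>
 define D where "D = 1 + real (J' + 2) * \<beta>'"
 have D: "D >= 1" using \<beta>' by (simp add: D_def)
 have "\<exists>C>0. kernel_bd K \<beta> m J \<theta> C"
  if sm: "submult \<xi>t \<theta>" for \<theta>
 proof -
  have mono: "!!x y. 0 <= x ==> x <= y ==> \<theta> x <= \<theta> y" and \<theta>0: "!!x. 0 <= x ==> 0 <= \<theta> x"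
   using conjunct1[OF sm[unfolded submult_def]] by blast+
  obtain Ct N where Ct: "Ct > 0" and N: "N > 0" and th: "!!x y. 0 <= x ==> 0 <= y ==> \<xi>t (x * y / Ct) <= \<theta> x + y powr N + Ct"
   using conjunct2[OF sm[unfolded submult_def]] by auto
  define N' where "N' = real (m + 1) * N"
  have N': "N' > 0" using N by (simp add: N'_def)
  obtain AJ where AJ: "AJ > 0" and JN: "!!(b::'a => real) k x. bmo_bd \<beta> b ==>
    (RSI (nbhd k x) (%y. (1 + \<bar>b y - mid \<beta> b k x\<bar>) powr N')) <= en AJ * vol (nbhd k x)"
   using John_Nirenberg_powr[OF \<beta> N', where 'a='a] by blast
  define S where "S = AJ + Ct"
  have S: "S > 0" using AJ Ct by (simp add: S_def)
  let ?H = "1 + q * (1 + S)"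
  define CC where "CC = C * ?H * (D ^ m * Ct)"
  have CC: "CC > 0" using C q S D Ct by (simp add: CC_def add_pos_pos)
  have "RSI (- nbhd (l - int J) x) (%z. \<bar>K (\<sigma> *\<^sub>R (z - y)) - K (\<sigma> *\<^sub>R (z - x))\<bar> * (\<bar>b z - mid \<beta> b l x\<bar> ^ i * u z)) <= en (CC * (1 + A0) * \<Lambda>)"
   if \<sigma>: "\<sigma> = 1 | \<sigma> = -1" and b: "bmo_bd \<beta> b" and u [measurable]: "u : LM" and u0: "ALL z. 0 <= u z" and L: "\<Lambda> > 0" and A0: "A0 >= 0"
    and y: "y : cell l x" and i: "i <= m"
    and ave: "\<forall>j\<le>l. RSI (nbhd j x) (%z. \<theta> (u z / \<Lambda>)) <= en A0 * vol (nbhd j x)"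
   for \<sigma> :: real and b u :: "'a => real" and \<Lambda> A0 l x y i
  proof -
   note [measurable] = bmo_bd_meas[OF b]
   define c0 where "c0 = mid \<beta> b l x"
   define R where "R = 2 ^ J' * side l"
   have R: "R > 0" by (simp add: R_def)
   define G where "G z = \<bar>b z - c0\<bar> ^ i * u z" for z
   have G0: "0 <= G z" for z using u0 by (simp add: G_def)
   have [measurable]: "G : LM" unfolding G_def by measurable
   have aff [measurable]: "(%X. x + \<sigma> *\<^sub>R X) : lebesgue \<rightarrow>\<^sub>M lebesgue" by (rule measurable_affine_lebesgue[OF \<sigma>])
   define y' where "y' = \<sigma> *\<^sub>R (y - x)"
   have ny: "norm y' = norm (y - x)" using \<sigma> by (auto simp: y'_def norm_minus_commute)
   have Ry: "R > c * norm y'"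
   proof -
    have "c * norm y' <= c * (DIM('a) * side l)" unfolding ny using cell_norm_le[OF y] c by (intro mult_left_mono) auto
    also have "... = (c * DIM('a)) * side l" by simp
    also have "... < 2 ^ J' * side l" using J' by (intro mult_strict_right_mono) auto
    finally show ?thesis by (simp add: R_def)
   qed
   define L' where "L' = D ^ m * Ct * \<Lambda>"
   have L': "L' > 0" using D Ct L by (simp add: L'_def)
   define C0 where "C0 = (A0 + S) * q"
   have C0: "C0 >= 0" using A0 S q by (simp add: C0_def)
   let ?D = "%y. x + \<sigma> *\<^sub>R y"
   have key: "RSI (ball 0 (2 ^ (k + 2) * R)) (%X. \<xi>t (G (?D X) / (real (Suc k) ^ m * L'))) <= en C0 * vol (ball 0 (2 ^ (k + 2) * R) :: 'a set)" for k :: nat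
   proof -
    define n where "n = J' + k + 2"
    define j where "j = l - int n"
    have jl: "j <= l" by (simp add: j_def)
    have rho: "2 ^ (k + 2) * R = side j" unfolding j_def side_diff_nat R_def n_def by (simp add: power_add)
    define M where "M = real (Suc k) ^ m * L'"
    have M: "M > 0" using L' by (simp add: M_def)
    define d where "d = mid \<beta> b j x"
    let ?E = "%x. \<xi>t (G x / M)"
    have gm: "(%z. en (?E z)) : LM"
     using M G0 by (intro measurable_compose[OF _ measurable_ennreal] young_measurable[OF young(2)]) auto
    let ?A = "%x. \<theta> (u x / \<Lambda>)"
    have "RSI (ball 0 (side j)) (%X. \<xi>t (G (?D X) / M)) = NI (%X. (%z. en (?E z) * indicator (ball x (side j)) z) (?D X))"
     using \<sigma> by (intro nn_integral_cong) (auto simp: indicator_def dist_norm)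
    also have "... = RSI (ball x (side j)) (%z. ?E z)"
     using gm by (intro nn_integral_affine_lebesgue[OF \<sigma>] borel_measurable_times_ennreal borel_measurable_indicator) auto
    also have "... <= RSI (nbhd j x) (%z. ?E z)"
     by (rule set_nn_integral_subset) (auto intro!: nbhdI_norm simp: dist_norm norm_minus_commute)
    also have "... <= NI (%z. en (?A z) * indicator (nbhd j x) z + (en ((1 + \<bar>b z - d\<bar>) powr N') * indicator (nbhd j x) z + en Ct * indicator (nbhd j x) z))"
    proof (rule nn_integral_mono, goal_cases)
     case (1 z)
     define B where "B = 1 + \<bar>b z - d\<bar>"
     have B1: "B >= 1" by (simp add: B_def)
     have mm: "\<bar>c0 - d\<bar> <= real n * \<beta>'"
      unfolding c0_def d_def j_def \<beta>'_def using \<beta> by (intro mid_diff_nat[OF b]) auto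
     let ?C = "%x. real (Suc k) * x"
     have "\<bar>b z - c0\<bar> <= \<bar>b z - d\<bar> + real n * \<beta>'" using mm by linarith
     also have "... <= B * (1 + real n * \<beta>')" using \<beta>' by (simp add: B_def algebra_simps)
     also have "... <= B * (?C D)"
     proof (intro mult_left_mono)
      have "real n <= real (Suc k) * real (J' + 2)" by (simp add: n_def algebra_simps)
      hence "real n * \<beta>' <= real (Suc k) * real (J' + 2) * \<beta>'" using \<beta>' by (intro mult_right_mono) auto
      thus "1 + real n * \<beta>' <= real (Suc k) * D" by (simp add: D_def algebra_simps)
     qed (use B1 in auto)
     finally have "\<bar>b z - c0\<bar> ^ i <= (B * (?C D)) ^ i" by (intro power_mono) auto
     also have "... <= (B * (?C D)) ^ m"
     proof (rule power_increasing[OF i])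
      have "1 * (1 * 1) <= B * (?C D)" using B1 D by (intro mult_mono) auto
      thus "1 <= B * (?C D)" by simp
     qed
     finally have "G z <= (B * (?C D)) ^ m * u z" unfolding G_def using u0 by (intro mult_right_mono) auto
     hence "G z / M <= (B * (?C D)) ^ m * u z / M" using M by (intro divide_right_mono) auto
     also have "... = (u z / \<Lambda>) * B ^ m / Ct"
     proof -
      have pm: "(B * (?C D)) ^ m = B ^ m * (real (Suc k) ^ m * D ^ m)" by (simp only: power_mult_distrib)
      show ?thesis unfolding M_def L'_def pm using L Ct D by (simp add: field_simps del: of_nat_Suc)
     qed
     finally have "?E z <= \<xi>t ((u z / \<Lambda>) * B ^ m / Ct)" using G0 M by (intro young_mono[OF young(2)]) auto
     also have "... <= ?A z + (B ^ m) powr N + Ct" using u0 L B1 by (intro th) auto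
     also have "(B ^ m) powr N <= B powr N'"
     proof -
      have "(B ^ m) powr N = B powr (real m * N)" using B1 by (simp add: powr_realpow[symmetric] powr_powr)
      also have "... <= B powr N'" using B1 N by (intro powr_mono) (auto simp: N'_def)
      finally show ?thesis .
     qed
     finally have "?E z <= ?A z + (B powr N' + Ct)" by simp
     hence "en (?E z) <= en (?A z + (B powr N' + Ct))" by (rule ennreal_leI)
     also have "... = en (?A z) + (en (B powr N') + en Ct)"
      using \<theta>0[of "u z / \<Lambda>"] u0 L Ct by (simp add: ennreal_plus)
     finally show ?case
      by (auto simp: indicator_def B_def)
    qed
    also have "... = RSI (nbhd j x) (%z. ?A z) + (RSI (nbhd j x) (%z. (1 + \<bar>b z - d\<bar>) powr N') + en Ct * vol (nbhd j x))"
    proof -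
     have "(%z. ?A z) : LM"
     proof (rule mono_pos_measurable[of \<theta> "%z. u z / \<Lambda>" lebesgue])
      show "(%z. u z / \<Lambda>) : LM" by measurable
      show "0 <= u z / \<Lambda>" for z using u0 L by simp
     qed (rule mono)
     hence t1: "(%z. en (?A z)) : LM" by measurable
     show ?thesis
      using t1 by (subst nn_integral_add, measurable, subst nn_integral_add) (auto simp: nn_integral_cmult_indicator simp del: emeasure_completion)
    qed
    also have "... <= en A0 * vol (nbhd j x) + (en AJ * vol (nbhd j x) + en Ct * vol (nbhd j x))"
     using ave jl JN[OF b, of j x] unfolding d_def by (intro add_mono) auto
    also have "... = en (A0 + S) * vol (nbhd j x)"
     using A0 AJ Ct by (simp add: S_def ennreal_plus distrib_right add.assoc)
    also have "... = en (A0 + S) * en (3 ^ DIM('a) * side j ^ DIM('a))" by (simp only: emeasure_nbhd)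
    also have "... = en ((A0 + S) * (3 ^ DIM('a) * side j ^ DIM('a)))" using A0 S by (intro ennreal_mult[symmetric]) auto
    also have "(A0 + S) * (3 ^ DIM('a) * side j ^ DIM('a)) = C0 * (V * side j ^ DIM('a))" using V by (simp add: C0_def q_def)
    also have "en ... = en C0 * en (V * side j ^ DIM('a))" using C0 V by (intro ennreal_mult) auto
    also have "en (V * side j ^ DIM('a)) = vol (ball 0 (side j) :: 'a set)"
     unfolding V_def by (simp add: emeasure_ball)
    finally show ?thesis unfolding rho M_def .
   qed
   let ?B = "%z. en (\<bar>K (\<sigma> *\<^sub>R (z - y)) - K (\<sigma> *\<^sub>R (z - x))\<bar> * G z) * indicator (- nbhd (l - int J) x) z"
   let ?G = "nbhd (l - int J) x"
   have "RSI (- ?G) (%z. \<bar>K (\<sigma> *\<^sub>R (z - y)) - K (\<sigma> *\<^sub>R (z - x))\<bar> * G z)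
    = NI (%X. ?B (?D X))"
   proof (rule nn_integral_affine_lebesgue[OF \<sigma>, symmetric])
    have k1: "(%z. K (\<sigma> *\<^sub>R (z - w))) : LM" for w
     by (rule borel_measurable_lebesgueI) measurable
    have "- ?G : sets lebesgue" using sets.compl_sets[OF nbhd_lebesgue] by (simp add: Compl_eq_Diff_UNIV)
    with k1[of y] k1[of x] show "?B : LM"
     by measurable
   qed
   also have "... <= RSI {X. 2 * R < norm X} (%X. \<bar>K (X - y') - K X\<bar> * G (?D X))"
   proof (rule nn_integral_mono, goal_cases)
    case (1 X)
    have ss: "\<sigma> * \<sigma> = 1" using \<sigma> by auto
    have e1: "\<sigma> *\<^sub>R (x + \<sigma> *\<^sub>R X - y) = X - y'" unfolding y'_def by (simp add: algebra_simps ss)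
    let ?F = "x + \<sigma> *\<^sub>R X - x"
    have e2: "\<sigma> *\<^sub>R ?F = X" by (simp add: ss)
    have e3: "2 * R < norm X" if "x + \<sigma> *\<^sub>R X : - ?G"
    proof (rule ccontr)
     assume "~ 2 * R < norm X"
     moreover have "2 * R = side (l - int J)" unfolding side_diff_nat R_def J_def by simp
     moreover have "norm ?F = norm X" using \<sigma> by auto
     ultimately have "norm ?F <= side (l - int J)" by linarith
     hence "x + \<sigma> *\<^sub>R X : ?G" by (rule nbhdI_norm)
     thus False using that by simp
    qed
    show ?case
     unfolding e1 e2 using e3 by (auto simp: indicator_def)
   qed
   also have "... <= en (C * (1 + C0) * L')"
    using key G0 by (intro ht Ry L' C0) auto
   also have "... <= en (CC * (1 + A0) * \<Lambda>)"
   proof (rule ennreal_leI)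
    have "1 + C0 <= ?H * (1 + A0)"
     using q S A0 unfolding C0_def by (simp add: algebra_simps)
    hence "C * (1 + C0) * L' <= C * (?H * (1 + A0)) * L'" using C L' by (intro mult_right_mono mult_left_mono) auto
    thus "C * (1 + C0) * L' <= CC * (1 + A0) * \<Lambda>" by (simp add: CC_def L'_def mult_ac)
   qed
   finally show ?thesis unfolding G_def c0_def .
  qed
  thus ?thesis using CC unfolding kernel_bd_def by blast
 qed
 moreover have "J >= 1" by (simp add: J_def)
 ultimately show ?thesis by (intro exI[of _ J] conjI) auto
qed

section \<open>The functions \<open>Phi\<close>\<close>

lemma Phi_nonneg: "0 <= x ==> 0 <= Phi k x" by (simp add: Phi_def)

lemma Phi_mono: "0 <= x ==> x <= y ==> Phi k x <= Phi k y"
proof -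
 assume x: "0 <= x" "x <= y"
 have "max 0 (ln x) <= max 0 (ln y)"
 proof (cases "x = 0")
  case False
  hence "ln x <= ln y" using x by (subst ln_le_cancel_iff) auto
  thus ?thesis by simp
 qed simp
 thus "Phi k x <= Phi k y" unfolding Phi_def using x by (intro mult_mono power_mono) auto
qed

lemma Phi_ge: "0 <= x ==> x <= Phi k x"
proof -
 assume x: "0 <= x"
 have "x * 1 <= x * (1 + max 0 (ln x)) ^ k" using x by (intro mult_left_mono one_le_power) auto
 thus ?thesis by (simp add: Phi_def)
qed

lemma Phi_measurable:
 assumes [measurable]: "f : borel_measurable M" shows "(%x. Phi k (f x)) : borel_measurable M"
proof -
 have [measurable]: "(%x. max 0 (ln (f x))) : borel_measurable M"
  by (intro borel_measurable_max borel_measurable_ln borel_measurable_const assms)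
 show ?thesis unfolding Phi_def by measurable
qed

lemma Phi_scale:
 assumes "a >= 1" shows "\<exists>C>0. \<forall>x\<ge>0. Phi k (a * x) <= C * Phi k x"
proof -
 have "Phi k (a * x) <= (a * (1 + ln a) ^ k) * Phi k x" if "x >= 0" for x
 proof (cases "x = 0")
  case False
  hence x: "x > 0" using that by simp
  let ?A = "max 0 (ln (a * x))"
  let ?B = "1 + max 0 (ln x)"
  have "?A <= ln a + max 0 (ln x)" using x assms by (auto simp: ln_mult)
  moreover have "0 <= ln a" using assms by simp
  moreover have "0 <= ln a * max 0 (ln x)" using assms by simp
  moreover have "(1 + ln a) * ?B = 1 + ln a + max 0 (ln x) + ln a * max 0 (ln x)" by (simp only: distrib_left distrib_right mult_1_left mult_1_right add.assoc)
  ultimately have "1 + ?A <= (1 + ln a) * ?B" by linarith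
  hence "(1 + ?A) ^ k <= ((1 + ln a) * ?B) ^ k" by (intro power_mono) auto
  hence "a * x * (1 + ?A) ^ k <= a * x * ((1 + ln a) * ?B) ^ k" using x assms by (intro mult_left_mono) auto
  thus ?thesis by (simp add: Phi_def power_mult_distrib mult_ac)
 qed (simp add: Phi_def)
 moreover have "a * (1 + ln a) ^ k > 0" using assms by (intro mult_pos_pos zero_less_power add_pos_nonneg) auto
 ultimately show ?thesis by blast
qed

text \<open>Put \<open>Y = 1 + y\<close> and \<open>L = 1 + ln (max x 1)\<close>. If
  \<open>Y \<le> A L\<close>, the factor \<open>y^(m - k)\<close> is converted into the
  \<open>m - k\<close> logarithms by which \<open>Phi m\<close> exceeds \<open>Phi k\<close>;
  otherwise \<open>x\<close> is at most \<open>exp (\<epsilon> Y / 2)\<close> and the exponential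
  absorbs everything.\<close>

lemma Phi_exp_Young:
 fixes c c' \<epsilon> :: real
 assumes km: "k < m" and c: "c >= 0" "c' >= 0" "\<epsilon> > 0"
 shows "\<exists>C>0. \<forall>x\<ge>0. \<forall>y\<ge>0. Phi k (c * y ^ (m - k) * (x + c')) <= C * (Phi m x + exp (\<epsilon> * y))"
proof -
 define d where "d = m - k"
 have dk: "d + k = m" using km by (simp add: d_def)
 define c1 where "c1 = c * (1 + c') + 1"
 have c1: "c1 >= 1" "c * (1 + c') <= c1" using c by (simp_all add: c1_def)
 have lc: "ln c1 >= 0" using c1 by simp
 \<comment> \<open>At least \<open>2 / \<epsilon>\<close>, so that
   \<open>exp (Y / A) \<le> exp (\<epsilon> Y / 2)\<close>.\<close>
 define A where "A = max 1 (2 / \<epsilon>)"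
 have A: "A >= 1" "2 / \<epsilon> <= A" by (simp_all add: A_def)
 \<comment> \<open>Collects the coefficients in \<open>1 + ln Z \<le> E L\<close> and in
   \<open>1 + ln Z \<le> E Y\<close>, one for each regime.\<close>
 define E where "E = 2 + ln c1 + real d * A + 1"
 have E: "E >= 1" using lc A by (simp add: E_def add_increasing)
 let ?A = "%x. exp (\<epsilon> / 2 * x)"
 obtain P where P: "P > 0" "!!t. t >= 0 ==> (1 + t) powr (real m + 1) <= P * ?A t"
  using powr_le_exp[of "\<epsilon> / 2" "real m + 1"] c by auto
 let ?C = "exp (\<epsilon> / 2)"
 define C where "C = c1 * A ^ d * E ^ k + c1 * E ^ k * (P * ?C) + 1"
 have C: "C > 0" using c1 A E P by (simp add: C_def add_nonneg_pos)
 have "Phi k (c * y ^ (m - k) * (x + c')) <= C * (Phi m x + exp (\<epsilon> * y))" if x: "x >= 0" and y: "y >= 0" for x y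
 proof -
  define s where "s = max x 1"
  have s: "s >= 1" "x <= s" by (simp_all add: s_def)
  define L where "L = 1 + ln s"
  have L: "L >= 1" using s by (simp add: L_def)
  define Y where "Y = 1 + y"
  have Y: "Y >= 1" using y by (simp add: Y_def)
  define Z where "Z = c1 * Y ^ d * s"
  have Yd: "Y ^ d >= 1" using Y by simp
  have Z1: "Z >= 1"
  proof -
   have "1 * 1 * 1 <= c1 * Y ^ d * s" using c1 Yd s by (intro mult_mono) auto
   thus ?thesis by (simp add: Z_def)
  qed
  have le: "c * y ^ (m - k) * (x + c') <= Z"
  proof -
   have "c' <= c' * s" using mult_left_mono[OF s(1) c(2)] by simp
   hence "x + c' <= (1 + c') * s" using s by (simp add: distrib_right)
   hence "c * y ^ d * (x + c') <= c * Y ^ d * ((1 + c') * s)"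
    using c y x by (intro mult_mono mult_left_mono power_mono) (auto simp: Y_def)
   also have "... = (c * (1 + c')) * (Y ^ d * s)" by simp
   also have "... <= c1 * (Y ^ d * s)" using c1 Yd s by (intro mult_right_mono) auto
   finally show ?thesis by (simp add: Z_def d_def mult_ac)
  qed
  let ?B = "exp (\<epsilon> * y)"
  have "Phi k (c * y ^ (m - k) * (x + c')) <= Phi k Z" using le c y x by (intro Phi_mono) auto
  also have "... = Z * (1 + ln Z) ^ k" using Z1 by (simp add: Phi_def)
  also have "... <= C * (Phi m x + ?B)"
  proof -
   have lnZ: "ln Z = ln c1 + real d * ln Y + ln s"
    using c1 Y s by (simp add: Z_def ln_mult ln_realpow)
   have lnY: "ln Y <= Y" using Y ln_le_minus_one[of Y] by simp
   show ?thesis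
   proof (cases "Y <= A * L")
    case True
    have "real d * ln Y <= real d * (A * L)" using lnY True by (intro mult_left_mono) auto
    moreover have "ln c1 <= ln c1 * L" using mult_left_mono[OF L lc] by simp
    moreover have "1 + ln s <= 3 * L" using L by (simp add: L_def[symmetric])
    ultimately have "1 + ln Z <= E * L" unfolding lnZ E_def by (simp add: algebra_simps)
    moreover have "0 <= 1 + ln Z" using Z1 by (simp add: add_nonneg_nonneg)
    ultimately have "(1 + ln Z) ^ k <= (E * L) ^ k" by (intro power_mono)
    moreover have "Z <= c1 * (A * L) ^ d * s" unfolding Z_def using True Y c1 s by (intro mult_right_mono mult_left_mono power_mono) auto
    ultimately have "Z * (1 + ln Z) ^ k <= (c1 * (A * L) ^ d * s) * (E * L) ^ k"
     using Z1 L A c1 s \<open>0 <= 1 + ln Z\<close> by (intro mult_mono) auto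
    also have "... = (c1 * A ^ d * E ^ k) * (s * L ^ m)"
     by (simp add: power_mult_distrib dk[symmetric] power_add mult_ac)
    also have "... <= (c1 * A ^ d * E ^ k) * (Phi m x + ?B)"
    proof (intro mult_left_mono)
     show "s * L ^ m <= Phi m x + ?B"
     proof (cases "x >= 1")
      case True thus ?thesis by (simp add: s_def L_def Phi_def)
     next
      case False
      hence "s * L ^ m = 1" by (simp add: s_def L_def)
      moreover have "1 <= ?B" using c y by simp
      ultimately show ?thesis using Phi_nonneg[OF x, of m] by linarith
     qed
    qed (use c1 A E in auto)
    also have "... <= C * (Phi m x + ?B)"
     using c1 A E P Phi_nonneg[OF x, of m] unfolding C_def by (intro mult_right_mono) (auto intro!: add_nonneg_nonneg)
    finally show ?thesis .
   next
    case False
    hence "L < Y / A" using A by (simp add: field_simps)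
    hence lns: "ln s < Y / A" by (simp add: L_def)
    have YA: "Y / A <= Y" using A Y by (simp add: field_simps)
    have "s = exp (ln s)" using s by simp
    also have "... <= exp (Y / A)" using lns by simp
    also have "... <= ?A Y"
    proof -
     have "Y / A <= Y / (2 / \<epsilon>)" using A c Y by (intro divide_left_mono) auto
     thus ?thesis by (simp add: mult.commute)
    qed
    finally have sexp: "s <= ?A Y" .
    have "real d * ln Y <= real d * Y" using lnY by (intro mult_left_mono) auto
    also have "... <= real d * A * Y" using mult_left_mono[OF A(1), of "real d"] Y by (intro mult_right_mono) auto
    finally have "real d * ln Y <= real d * A * Y" .
    moreover have "ln c1 <= ln c1 * Y" using mult_left_mono[OF Y lc] by simp
    ultimately have "1 + ln Z <= E * Y" unfolding lnZ E_def using lns YA Y by (simp add: algebra_simps)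
    moreover have "0 <= 1 + ln Z" using Z1 by (simp add: add_nonneg_nonneg)
    ultimately have "(1 + ln Z) ^ k <= (E * Y) ^ k" by (intro power_mono)
    moreover have "Z <= c1 * Y ^ d * ?A Y" unfolding Z_def using sexp c1 Yd by (intro mult_left_mono) auto
    ultimately have "Z * (1 + ln Z) ^ k <= (c1 * Y ^ d * ?A Y) * (E * Y) ^ k"
     using Z1 c1 Y \<open>0 <= 1 + ln Z\<close> by (intro mult_mono) auto
    also have "... = c1 * E ^ k * (Y ^ m * ?A Y)"
     by (simp add: power_mult_distrib dk[symmetric] power_add mult_ac)
    also have "... <= c1 * E ^ k * (P * ?A y * ?A Y)"
    proof (intro mult_left_mono mult_right_mono)
     have "Y ^ m = Y powr real m" using Y by (simp add: powr_realpow)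
     also have "... <= Y powr (real m + 1)" using Y by (intro powr_mono) auto
     also have "... <= P * ?A y" unfolding Y_def by (rule P(2)[OF y])
     finally show "Y ^ m <= P * ?A y" .
    qed (use c1 E in auto)
    also have "?A Y = ?C * ?A y" by (simp add: Y_def exp_add[symmetric] algebra_simps)
    also have "c1 * E ^ k * (P * ?A y * (?C * ?A y)) = (c1 * E ^ k * (P * ?C)) * ?B"
    proof -
     have "?A y * ?A y = ?B" by (simp add: exp_add[symmetric])
     thus ?thesis by (simp add: mult_ac)
    qed
    also have "... <= C * (Phi m x + ?B)"
     using c1 A E P Phi_nonneg[OF x, of m] unfolding C_def by (intro mult_mono) (auto intro!: add_nonneg_nonneg)
    finally show ?thesis .
   qed
  qed
  finally show ?thesis .
 qed
 thus ?thesis using C by blast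
qed

section \<open>The integral representation away from the support\<close>

definition LB :: "('a::euclidean_space => real) => bool" where
 "LB f \<longleftrightarrow> L2 f & (EX R. ALL x. R < norm x --> f x = 0)"

lemma LB_L2: "LB f ==> L2 f" by (simp add: LB_def)

lemma LB_integral:
 assumes "LB f" shows "RI (%x. \<bar>f x\<bar>) < \<infinity>"
proof -
 obtain R where R: "!!x. R < norm x ==> f x = 0" using assms by (auto simp: LB_def)
 note [measurable] = L2_meas[OF LB_L2[OF assms]]
 have [measurable]: "cball 0 R : sets lebesgue" by simp
 have "RI (%x. \<bar>f x\<bar>) <= NI (%x. 1 * indicator (cball 0 R) x + en ((f x)^2))"
 proof (rule nn_integral_mono, goal_cases)
  case (1 x)
  have "\<bar>f x\<bar> <= 1 + (f x)^2"
  proof -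
   have "2 * \<bar>f x\<bar> <= 1 + \<bar>f x\<bar>\<^sup>2" using zero_le_power2[of "1 - \<bar>f x\<bar>"] by (simp add: power2_eq_square algebra_simps)
   thus ?thesis by simp
  qed
  hence "en \<bar>f x\<bar> <= en (1 + (f x)^2)" by (rule ennreal_leI)
  also have "... = 1 + en ((f x)^2)" by (subst ennreal_plus) auto
  finally have le: "en \<bar>f x\<bar> <= 1 + en ((f x)^2)" .
  show ?case
  proof (cases "norm x <= R")
   case True thus ?thesis using le by simp
  next
   case False thus ?thesis using R[of x] by simp
  qed
 qed
 also have "... = 1 * vol (cball 0 R :: 'a set) + RI (%x. (f x)^2)"
  by (subst nn_integral_add) (auto simp: nn_integral_cmult_indicator)
 also have "... < \<infinity>"
  using L2_finite[OF LB_L2[OF assms]] emeasure_lborel_cball_finite[of "0::'a" R] by (simp add: emeasure_completion)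
 finally show ?thesis .
qed

lemma LB_dominated:
 assumes "LB g" "f : LM" "!!x. \<bar>f x\<bar> <= c * \<bar>g x\<bar>"
 shows "LB f"
proof -
 obtain R where R: "!!x. R < norm x ==> g x = 0" using assms by (auto simp: LB_def)
 have "f x = 0" if "R < norm x" for x using assms(3)[of x] R[OF that] by simp
 thus ?thesis using L2_dominated[OF LB_L2[OF assms(1)] assms(2,3)] by (auto simp: LB_def)
qed

lemma LB_indicator: "LB f ==> A : sets lebesgue ==> LB (%x. indicator A x * f x)"
proof (rule LB_dominated[of f _ 1])
 assume "LB f" and [measurable]: "A : sets lebesgue"
 note [measurable] = L2_meas[OF LB_L2[OF \<open>LB f\<close>]]
 show "(%x. indicator A x * f x) : LM" by measurable
qed (auto simp: indicator_def)

lemma LB_mult_bdm: assumes "bdm b" "LB f" shows "LB (%x. b x * f x)"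
proof -
 obtain M where "!!x. \<bar>b x\<bar> <= M" using assms bdmE by metis
 thus ?thesis using bdm_meas[OF assms(1)] L2_meas[OF LB_L2[OF assms(2)]]
  by (intro LB_dominated[OF assms(2), of _ M]) (auto simp: abs_mult intro: mult_right_mono)
qed

lemma LB_diff: assumes "LB f" "LB g" shows "LB (%x. f x - g x)"
proof -
 obtain R R' where R: "!!x. R < norm x ==> f x = 0" "!!x. R' < norm x ==> g x = 0" using assms unfolding LB_def by metis
 have "L2 (%x. 1 * f x + (-1) * g x)" by (intro L2_add LB_L2 assms)
 thus ?thesis unfolding LB_def using R by (auto intro!: exI[of _ "max R R'"])
qed

lemma measurable_fst_leb: "(%p. fst p) : (lebesgue :: 'a::euclidean_space measure) \<Otimes>\<^sub>M (lebesgue :: 'b::euclidean_space measure) \<rightarrow>\<^sub>M borel"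
 by (rule measurable_compose[OF measurable_fst borel_measurable_lebesgueI[OF measurable_ident_sets[OF refl]]])

lemma measurable_snd_leb: "(%p. snd p) : (lebesgue :: 'a::euclidean_space measure) \<Otimes>\<^sub>M (lebesgue :: 'b::euclidean_space measure) \<rightarrow>\<^sub>M borel"
 by (rule measurable_compose[OF measurable_snd borel_measurable_lebesgueI[OF measurable_ident_sets[OF refl]]])

lemma compl_nbhd [measurable]: "- nbhd k x : sets lebesgue"
 using sets.compl_sets[OF nbhd_lebesgue] by (simp add: Compl_eq_Diff_UNIV)

lemma notin_closure_cell: assumes "z ~: nbhd l x" shows "z ~: closure (cell l x)"
proof
 assume "z : closure (cell l x)"
 then obtain y where y: "y : cell l x" "dist y z < side l" unfolding closure_approachable using side_pos by blast
 hence "z : nbhd l y" by (intro nbhdI_norm) (simp add: dist_norm norm_minus_commute)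
 thus False using assms nbhd_eq[OF y(1)] by simp
qed

text \<open>A Borel kernel makes \<open>K (z - y)\<close> jointly measurable, as Tonelli's theorem
  requires; the given kernel is replaced by a Borel representative at the end.\<close>

locale czo = L2_op +
 fixes K :: "'a::euclidean_space => real"
 assumes K_borel [measurable]: "K : borel_measurable borel"
  and T_rep: "LB f ==> AE x in lebesgue. x ~: supp f --> integrable lebesgue (%y. K (x - y) * f y) & T f x = (LINT y|lebesgue. K (x - y) * f y)"
begin

lemma K_diff_meas: "(%p. K (fst p - snd p)) : borel_measurable (lebesgue \<Otimes>\<^sub>M (lebesgue :: 'a measure))"
 using measurable_fst_leb[where 'a='a and 'b='a] measurable_snd_leb[where 'a='a and 'b='a] by measurable

text \<open>As \<open>h\<close> has mean zero, the constant \<open>K (z - x0)\<close> may be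
  subtracted under the integral.\<close>

lemma T_far:
 assumes h: "LB h" and cell: "!!y. y ~: cell l x0 ==> h y = 0" and h0: "(LINT y|lebesgue. h y) = 0"
 shows "AE z in lebesgue. z ~: nbhd l x0 --> en \<bar>T h z\<bar> <= RI (%y. \<bar>K (z - y) - K (z - x0)\<bar> * \<bar>h y\<bar>)"
 using T_rep[OF h]
proof eventually_elim
 case (elim z)
 show ?case
 proof
  assume z: "z ~: nbhd l x0"
  let ?C = "LINT y|lebesgue. K (z - y) * h y"
  have "supp h <= closure (cell l x0)" unfolding supp_def using cell by (intro closure_mono) auto
  hence "z ~: supp h" using notin_closure_cell[OF z] by auto
  hence i: "integrable lebesgue (%y. K (z - y) * h y)" and T: "T h z = ?C" using elim by auto
  have ih: "integrable lebesgue h"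
   using LB_integral[OF h] L2_meas[OF LB_L2[OF h]] by (simp add: integrable_iff_bounded)
  have i2: "integrable lebesgue (%y. K (z - x0) * h y)" using ih by simp
  let ?A = "LINT y|lebesgue. K (z - y) * h y - K (z - x0) * h y"
  let ?B = "RI (%y. \<bar>K (z - y) - K (z - x0)\<bar> * \<bar>h y\<bar>)"
  have "T h z = ?C - (LINT y|lebesgue. K (z - x0) * h y)" using T h0 by simp
  also have "... = ?A" by (rule Bochner_Integration.integral_diff[symmetric, OF i i2])
  finally have "en \<bar>T h z\<bar> = en (norm ?A)" by simp
  also have "... <= RI (%y. norm (K (z - y) * h y - K (z - x0) * h y))"
   by (rule integral_norm_bound_ennreal[OF Bochner_Integration.integrable_diff[OF i i2]])
  also have "... = ?B"
   by (simp add: left_diff_distrib[symmetric] abs_mult)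
  finally show "en \<bar>T h z\<bar> <= ?B" .
 qed
qed

lemma T_far_integral:
 assumes h: "LB h" and cell: "!!y. y ~: cell l x0 ==> h y = 0" and h0: "(LINT y|lebesgue. h y) = 0"
  and G [measurable]: "G : LM" and G0: "!!z. 0 <= G z" and j: "j <= l"
  and bd: "!!y. y : cell l x0 ==> RSI (- nbhd j x0) (%z. \<bar>K (z - y) - K (z - x0)\<bar> * G z) <= B"
 shows "RSI (- nbhd j x0) (%z. \<bar>T h z\<bar> * G z) <= B * RI (%y. \<bar>h y\<bar>)"
proof -
 interpret pair_sigma_finite "lebesgue :: 'a measure" "lebesgue :: 'a measure" by (rule pair_sigma_finite_lebesgue)
 note [measurable] = L2_meas[OF LB_L2[OF h]]
 have Kz [measurable]: "(%z. K (z - y)) : LM" for y by (rule borel_measurable_lebesgueI) measurable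
 have Kz' [measurable]: "(%y. K (z - y)) : LM" for z by (rule borel_measurable_lebesgueI) measurable
 let ?B = "%x. RI (%y. \<bar>K (x - y) - K (x - x0)\<bar> * \<bar>h y\<bar>)"
 have far: "AE z in lebesgue. z ~: nbhd l x0 --> en \<bar>T h z\<bar> <= ?B z"
  by (rule T_far[OF h _ h0]) (rule cell)
 let ?A = "%x. en (G x) * indicator (- nbhd j x0) x"
 have "RSI (- nbhd j x0) (%z. \<bar>T h z\<bar> * G z)
  <= NI (%z. NI (%y. en (\<bar>K (z - y) - K (z - x0)\<bar> * \<bar>h y\<bar>) * (?A z)))"
 proof (rule nn_integral_mono_AE, use far in eventually_elim)
  case z: (elim z)
  show ?case
  proof (cases "z : nbhd j x0")
   case False
   hence "z ~: nbhd l x0" using nbhd_antimono[OF j, of x0] by auto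
   hence "en \<bar>T h z\<bar> * en (G z) <= ?B z * en (G z)"
    using z by (intro mult_right_mono) auto
   also have "... = NI (%y. en (\<bar>K (z - y) - K (z - x0)\<bar> * \<bar>h y\<bar>) * en (G z))"
    by (rule nn_integral_multc[symmetric]) measurable
   finally show ?thesis using False G0[of z] by (simp add: ennreal_mult)
  qed simp
 qed
 also have "... = NI (%y. NI (%z. en (\<bar>K (z - y) - K (z - x0)\<bar> * \<bar>h y\<bar>) * (?A z)))"
 proof (rule Fubini'[symmetric])
  have k2: "(%p. K (fst p - x0)) : borel_measurable (lebesgue \<Otimes>\<^sub>M (lebesgue :: 'a measure))"
   using measurable_fst_leb[where 'a='a and 'b='a] by measurable
  have "(%p. en (\<bar>K (fst p - snd p) - K (fst p - x0)\<bar> * \<bar>h (snd p)\<bar>) * (en (G (fst p)) * indicator (- nbhd j x0) (fst p))) : borel_measurable (lebesgue \<Otimes>\<^sub>M (lebesgue :: 'a measure))"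
   using K_diff_meas k2 by measurable
  thus "(%(z, y). en (\<bar>K (z - y) - K (z - x0)\<bar> * \<bar>h y\<bar>) * (?A z)) : borel_measurable (lebesgue \<Otimes>\<^sub>M (lebesgue :: 'a measure))"
   by (simp add: case_prod_beta)
 qed
 also have "... <= NI (%y. B * en \<bar>h y\<bar>)"
 proof (rule nn_integral_mono, goal_cases)
  case (1 y)
  show ?case
  proof (cases "y : cell l x0")
   case True
   have "NI (%z. en (\<bar>K (z - y) - K (z - x0)\<bar> * \<bar>h y\<bar>) * (?A z))
     = NI (%z. en (\<bar>K (z - y) - K (z - x0)\<bar> * G z) * indicator (- nbhd j x0) z * en \<bar>h y\<bar>)"
    using G0 by (intro nn_integral_cong) (simp add: ennreal_mult mult_ac)
   also have "... = RSI (- nbhd j x0) (%z. \<bar>K (z - y) - K (z - x0)\<bar> * G z) * en \<bar>h y\<bar>"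
    by (rule nn_integral_multc) measurable
   also have "... <= B * en \<bar>h y\<bar>" by (intro mult_right_mono bd True) auto
   finally show ?thesis .
  qed (simp add: cell)
 qed
 also have "... = B * RI (%y. \<bar>h y\<bar>)" by (rule nn_integral_cmult) measurable
 finally show ?thesis .
qed

end

section \<open>The Calderon-Zygmund decomposition relative to \<open>v dx\<close>\<close>

lemma measurable_piecewise:
 fixes c :: "'a set => real"
 assumes S: "countable S" "!!A. A : S ==> A : sets M"
  and g: "!!A x. A : S ==> x : A ==> g x = c A" "!!x. x ~: \<Union>S ==> g x = 0"
 shows "g : borel_measurable M"
proof (rule measurable_piecewise_restrict[of "insert (space M - \<Union>S) S"])
 have "\<Union>S : sets M" using S by (intro sets.countable_Union) auto
 thus "B \<inter> space M : sets M" if "B : insert (space M - \<Union>S) S" for B using that S by auto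
 show "g : borel_measurable (restrict_space M B)" if "B : insert (space M - \<Union>S) S" for B
  by (rule measurable_cong[THEN iffD1, rotated], rule measurable_const[of "if B : S then c B else 0"])
   (use that g in \<open>auto simp: space_restrict_space\<close>)
qed (use S in auto)

definition cz_hot :: "('a::euclidean_space => real) => ('a => real) => real => int => 'a => bool" where
 "cz_hot v f t k x \<longleftrightarrow> en t * RSI (cell k x) v < RSI (cell k x) (%y. \<bar>f y * v y\<bar>)"

text \<open>An axiomatic form of the weak bound. \<open>UU\<close> is the class of admissible
  \<open>u\<close> and \<open>NN\<close> its maximal operator. The assumptions list what the
  decomposition uses: \<open>v\<close> is doubling and locally in \<open>L\<^sup>2\<close>, BMO is
  exponentially integrable against \<open>v\<close>, and \<open>NN\<close> is constant on a cell
  that \<open>u\<close> stays away from, controls the mass near a cell, and satisfies a kernel bound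
  and a strong bound. The locale is instantiated twice, once with \<open>v = 1\<close> and
  \<open>NN = 1\<close> for the unweighted weak bound on which the strong bound rests.\<close>

locale czw = czo +
 fixes v :: "'a::euclidean_space => real" and m J :: nat and p0 \<beta> \<epsilon> Cv Ce Ct Ck Cs :: real
  and UU :: "('a => real) set" and NN :: "('a => real) => 'a => ennreal"
 assumes pars: "1 < p0" "0 < \<beta>" "0 < \<epsilon>" "1 <= Cv" "0 < Ce" "0 < Ct" "0 < Ck" "0 < Cs"
  and v_meas [measurable]: "v : LM" and v_nonneg: "!!x. 0 <= v x" and v_pos: "AE x in lebesgue. 0 < v x"
  and v_L2: "!!R. RSI (ball 0 R) (%x. (v x)^2) < \<infinity>"
  and v_cell: "!!k x. 0 < RSI (cell k x) v"
  and v_par: "!!k x. RSI (cell (k - 1) x) v <= en Cv * RSI (cell k x) v"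
  and v_big: "!!R M. M < \<infinity> ==> EX k0. \<forall>k<k0. ALL x. norm x <= R --> M < RSI (cell k x) v"
  and v_exp: "!!b k x. bmo_bd \<beta> b ==> SI (cell k x) (%y. en (exp (\<epsilon> * \<bar>b y - mid \<beta> b k x\<bar>)) * en (v y)) <= en Ce * RSI (cell k x) v"
  and u_meas: "!!u. u : UU ==> u : LM" and u_nonneg: "!!u x. u : UU ==> 0 <= u x"
  and u_res: "!!u E. u : UU ==> E : sets lebesgue ==> (%x. indicator E x * u x) : UU"
  and N_meas: "!!u. u : UU ==> NN u : LM"
  and N_mono: "!!u E x. u : UU ==> E : sets lebesgue ==> NN (%x. indicator E x * u x) x <= NN u x"
  and N_const: "!!u l x y z. u : UU ==> (!!w. w : nbhd (l - int J) x ==> u w = 0) ==> y : cell l x ==> z : cell l x ==> NN u y = NN u z"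
  and N_tent: "!!u l x z. u : UU ==> z : cell l x ==>
    (RSI (nbhd (l - int J) x) (%w. u w * v w)) <= en Ct * RSI (cell l x) v * NN u z"
  and N_ker: "!!u b i l x y z. u : UU ==> bmo_bd \<beta> b ==> i <= m ==> y : cell l x ==> z : cell l x ==>
    (RSI (- nbhd (l - int J) x) (%w. \<bar>K (w - y) - K (w - x)\<bar> * (\<bar>b w - mid \<beta> b l x\<bar> ^ i * u w))) <= en Ck * NN u z"
  and N_strong: "!!u b i F. u : UU ==> bmo_bd \<beta> b ==> i <= m ==> LB F ==>
    (RI (%x. \<bar>comm T b i F x\<bar> powr p0 * (u x * v x powr (1 - p0))))
    <= en Cs * NI (%x. en (\<bar>F x\<bar> powr p0 * v x powr (1 - p0)) * NN u x)"
begin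

lemma v_ball_finite: "RSI (ball 0 R) v < \<infinity>"
proof -
 have [measurable]: "ball 0 R : sets (lebesgue :: 'a measure)" by simp
 have "v x <= 1 * 1 + 1 * (v x)^2" for x using zero_le_power2[of "1 - v x"] v_nonneg[of x] by (simp add: power2_eq_square algebra_simps)
 hence "RSI (ball 0 R) v <= en 1 * RSI (ball (0::'a) R) (%_. 1) + en 1 * RSI (ball 0 R) (%x. (v x)^2)"
  by (intro RSI_le_lincomb AE_I2) auto
 also have "... < \<infinity>" using v_L2[of R] emeasure_lborel_ball_finite[of "0::'a" R] by simp
 finally show ?thesis .
qed

lemma v_cell_finite: "RSI (cell k x) v < \<infinity>"
proof -
 have "cell k x <= ball 0 (norm x + DIM('a) * side k + 1)"
 proof
  fix y assume "y : cell k x"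
  hence "norm (y - x) <= DIM('a) * side k" by (rule cell_norm_le)
  thus "y : ball 0 (norm x + DIM('a) * side k + 1)" using norm_triangle_ineq2[of y x] by simp
 qed
 thus ?thesis using v_ball_finite by (rule le_less_trans[OF set_nn_integral_subset])
qed

end

locale czd = czw +
 fixes b u f :: "'a::euclidean_space => real" and t :: real
 assumes b: "bmo_bd \<beta> b" and u: "u : UU" and f [measurable]: "f : LM" and F: "LB (%y. f y * v y)" and t: "0 < t"
begin

abbreviation "mu A == RSI A v"
abbreviation "Fa A == RSI A (%y. \<bar>f y * v y\<bar>)"

lemma bdm_b: "bdm b" using b by (simp add: bmo_bd_def bdm_def)

text \<open>A hot cell must meet the bounded support of \<open>f v\<close>, and large cells near the
  support carry too much \<open>v\<close>-mass. Thus stopping cells exist and their union is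
  bounded.\<close>

lemma hot_bound: "EX k0 R. ALL k x. cz_hot v f t k x --> k0 <= k & norm x <= R + DIM('a) * side k0"
proof -
 obtain R where R: "!!x. R < norm x ==> f x * v x = 0" using F by (auto simp: LB_def)
 let ?A = "RI (%x. \<bar>f x * v x\<bar>)"
 obtain M where M: "?A = en M" "M >= 0"
  using LB_integral[OF F] by (cases "?A") auto
 let ?B = "en (M / t)"
 obtain k0 where k0: "!!k x. k < k0 ==> norm x <= R ==> ?B < mu (cell k x)"
  using v_big[of "?B" R] by auto
 have "k0 <= k & norm x <= R + DIM('a) * side k0" if h: "cz_hot v f t k x" for k x
 proof -
  have "\<exists>y\<in>cell k x. norm y <= R"
  proof (rule ccontr)
   assume "~ ?thesis"
   hence "Fa (cell k x) = (\<integral>\<^sup>+y. 0 \<partial>(lebesgue :: 'a measure))"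
    using R by (intro nn_integral_cong) (auto simp: indicator_def not_le)
   thus False using h by (simp add: cz_hot_def)
  qed
  then obtain y where y: "y : cell k x" "norm y <= R" by auto
  have "k0 <= k"
  proof (rule ccontr)
   assume "~ k0 <= k"
   hence "?B < mu (cell k y)" using k0 y(2) by auto
   hence "en t * ?B <= en t * mu (cell k y)" by (intro mult_left_mono) auto
   also have "... < Fa (cell k x)" using h cell_eq[OF y(1)] by (simp add: cz_hot_def)
   also have "... <= ?A" by (intro nn_integral_mono) (auto simp: indicator_def)
   also have "... = en t * ?B" using M t by (simp add: ennreal_mult[symmetric])
   finally show False by simp
  qed
  moreover have "norm x <= R + DIM('a) * side k0"
  proof -
   have "norm (y - x) <= DIM('a) * side k" by (rule cell_norm_le[OF y(1)])
   also have "... <= DIM('a) * side k0" using \<open>k0 <= k\<close> by (intro mult_left_mono side_mono) auto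
   finally show ?thesis using norm_triangle_ineq2[of x y] y(2) by (simp add: norm_minus_commute)
  qed
  ultimately show ?thesis by blast
 qed
 thus ?thesis by blast
qed

lemma hot_stops_ex: "EX S kk xx. stops (cz_hot v f t) S kk xx"
proof (rule stopping_cells)
 show "cz_hot v f t k y = cz_hot v f t k x" if "y : cell k x" for k x y using cell_eq[OF that] by (simp add: cz_hot_def)
 show "EX k0. \<forall>k<k0. ~ cz_hot v f t k x" for x using hot_bound by (meson not_le)
qed

end

locale czs = czd +
 fixes S kk xx assumes st: "stops (cz_hot v f t) S kk xx"
begin

definition "Om = \<Union>S"
definition "Os = \<Union>((%A. nbhd (kk A - int J) (xx A)) ` S)"
definition "us = (%x. indicator (- Os) x * u x)"
definition "cof x = (THE A. A : S & x : A)"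
text \<open>The mean of \<open>f\<close> with respect to \<open>v dx\<close>, so that it is
  \<open>h v\<close>, not \<open>h\<close>, that has Lebesgue mean zero on each stopping
  cell.\<close>

definition "av A = (\<integral>y\<in>A. f y * v y \<partial>lebesgue) / enn2real (mu A)"
definition "aa x = (if x : Om then av (cof x) else 0)"
text \<open>The local centres of \<open>b\<close>, collected into one bounded function; the value 0
  off \<open>Om\<close> is harmless as \<open>h\<close> vanishes there.\<close>

definition "cf x = (if x : Om then mid \<beta> b (kk (cof x)) (xx (cof x)) else 0)"
definition "h x = indicator Om x * (f x - aa x)"
definition "g x = f x - h x"

lemmas stD = stopsD[OF st]

lemma S_cell: "A : S ==> A = cell (kk A) (xx A)" by (rule stD(4))
lemma cof_eq: assumes "A : S" "x : A" shows "cof x = A"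
 unfolding cof_def
proof (rule the_equality)
 fix B assume B: "B : S & x : B"
 thus "B = A" using stD(2) assms by (auto simp: disjoint_def)
qed (use assms in auto)

lemma Om_meas [measurable]: "Om : sets lebesgue" unfolding Om_def using stD(1,8) by (intro sets.countable_Union) auto

lemma Os_meas [measurable]: "Os : sets lebesgue" unfolding Os_def using stD(1) by (intro sets.countable_Union countable_image) auto

lemma mOs_meas [measurable]: "- Os : sets lebesgue" using sets.compl_sets[OF Os_meas] by (simp add: Compl_eq_Diff_UNIV)

lemma us: "us : UU" unfolding us_def by (rule u_res[OF u mOs_meas])

lemma us_meas [measurable]: "us : LM" by (rule u_meas[OF us])
lemma us_nonneg: "0 <= us x" by (rule u_nonneg[OF us])
lemma us_zero: "A : S ==> w : nbhd (kk A - int J) (xx A) ==> us w = 0"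
 unfolding us_def by (subst indicator_simps(2)) (auto simp: Os_def)

lemma Nus_le: "NN us x <= NN u x" unfolding us_def by (rule N_mono[OF u mOs_meas])

lemma Nus_meas [measurable]: "NN us : LM" by (rule N_meas[OF us])
lemma Nu_meas [measurable]: "NN u : LM" by (rule N_meas[OF u])

lemma Nus_const: assumes "A : S" "y : A" shows "NN us y = NN us (xx A)"
 by (rule N_const[OF us, of "kk A" "xx A"]) (use us_zero[OF assms(1)] S_cell[OF assms(1)] assms(2) in auto)

lemma aa_meas [measurable]: "aa : LM"
 by (rule measurable_piecewise[OF stD(1), of _ _ av]) (auto simp: aa_def Om_def cof_eq stD(8))

lemma cf_meas: "cf : LM"
 by (rule measurable_piecewise[OF stD(1), of _ _ "%A. mid \<beta> b (kk A) (xx A)"]) (auto simp: cf_def Om_def cof_eq stD(8))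

lemma cf_bdm: "bdm cf"
proof -
 obtain M where M: "!!x. \<bar>b x\<bar> <= M" using b by (auto simp: bmo_bd_def)
 have "\<bar>cf x\<bar> <= \<beta> + M" for x
  using mid_bounded[OF b _ M, of "kk (cof x)" "xx (cof x)"] pars M[of x] by (auto simp: cf_def)
 thus ?thesis using cf_meas unfolding bdm_def by blast
qed

lemma h_meas [measurable]: "h : LM" unfolding h_def by measurable
lemma g_meas [measurable]: "g : LM" unfolding g_def by measurable

lemma mu_S: assumes "A : S" shows "0 < mu A & mu A < \<infinity>"
 using v_cell[of "kk A" "xx A"] v_cell_finite[of "kk A" "xx A"] S_cell[OF assms] by simp

lemma hotS: assumes "A : S" shows "en t * mu A < Fa A"
 using stD(5)[OF assms] S_cell[OF assms] unfolding cz_hot_def by simp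

text \<open>The parent is not hot, and its \<open>v\<close>-mass is at most \<open>Cv\<close> times
  that of the cell.\<close>

lemma FaS: assumes A: "A : S" shows "Fa A <= en (t * Cv) * mu A"
proof -
 have "Fa A <= Fa (cell (kk A - 1) (xx A))"
  using S_cell[OF A] cell_antimono[of "kk A - 1" "kk A" "xx A"] by (intro set_nn_integral_subset) auto
 also have "... <= en t * mu (cell (kk A - 1) (xx A))" using stD(6)[OF A, of "kk A - 1"] by (simp add: cz_hot_def not_less)
 also have "... <= en t * (en Cv * mu (cell (kk A) (xx A)))" by (intro mult_left_mono v_par) auto
 also have "... = en (t * Cv) * mu A" using t pars S_cell[OF A] by (simp add: ennreal_mult mult.assoc)
 finally show ?thesis .
qed

lemma F_int: "integrable lebesgue (%y. f y * v y)"
 using LB_integral[OF F] by (simp add: integrable_iff_bounded)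

lemma v_int: assumes A: "A : S" shows "set_integrable lebesgue A v" "(\<integral>y\<in>A. v y \<partial>lebesgue) = enn2real (mu A)"
proof -
 have mA [measurable]: "A : sets lebesgue" by (rule stD(8)[OF A])
 have "RI (%x. norm (indicator A x *\<^sub>R v x)) = mu A"
  using v_nonneg by (intro nn_integral_cong) (auto simp: indicator_def)
 thus "set_integrable lebesgue A v" unfolding set_integrable_def integrable_iff_bounded using mu_S[OF A] by simp
 let ?A = "\<integral>y\<in>A. v y \<partial>lebesgue"
 let ?B = "RI (%x. indicator A x *\<^sub>R v x)"
 have "?A = enn2real (?B)"
  unfolding set_lebesgue_integral_def using v_nonneg by (intro integral_eq_nn_integral) auto
 also have "?B = mu A"
  by (intro nn_integral_cong) (auto simp: indicator_def)
 finally show "?A = enn2real (mu A)" .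
qed

lemma av_mu: assumes A: "A : S" shows "en \<bar>av A\<bar> * mu A <= Fa A"
proof -
 have mA [measurable]: "A : sets lebesgue" by (rule stD(8)[OF A])
 obtain r where r: "mu A = en r" "r > 0" using mu_S[OF A] by (cases "mu A") auto
 have "en (\<bar>av A\<bar>) * mu A = en (\<bar>\<integral>y\<in>A. f y * v y \<partial>lebesgue\<bar> / r) * en r" using r by (simp add: av_def)
 also have "... = en (norm (LINT y|lebesgue. indicator A y *\<^sub>R (f y * v y)))"
  using r by (subst ennreal_mult[symmetric]) (auto simp: set_lebesgue_integral_def)
 also have "... <= RI (%y. norm (indicator A y *\<^sub>R (f y * v y)))"
  by (rule integral_norm_bound_ennreal[OF integrable_mult_indicator[OF mA F_int]])
 also have "... = Fa A" by (intro nn_integral_cong) (auto simp: indicator_def)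
 finally show ?thesis .
qed

lemma av_le: assumes A: "A : S" shows "\<bar>av A\<bar> <= Cv * t"
proof -
 obtain r where r: "mu A = en r" "r > 0" using mu_S[OF A] by (cases "mu A") auto
 have "en (\<bar>av A\<bar> * r) = en \<bar>av A\<bar> * mu A" using r by (simp add: ennreal_mult)
 also have "... <= en (t * Cv) * mu A" using av_mu[OF A] FaS[OF A] by (rule order_trans)
 also have "... = en (t * Cv * r)" using r t pars by (simp add: ennreal_mult)
 finally have "\<bar>av A\<bar> * r <= t * Cv * r" using r t pars by (subst (asm) ennreal_le_iff) auto
 thus ?thesis using r by (simp add: mult_ac)
qed

lemma aa_le: "\<bar>aa x\<bar> <= Cv * t"
proof (cases "x : Om")
 case True
 then obtain A where "A : S" "x : A" by (auto simp: Om_def)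
 thus ?thesis using av_le cof_eq True by (auto simp: aa_def)
qed (use t pars in \<open>simp add: aa_def\<close>)

lemma h_le: "\<bar>h x\<bar> <= \<bar>f x\<bar> + Cv * t"
 using aa_le[of x] by (auto simp: h_def indicator_def)

text \<open>The averaged part is at most \<open>Cv t\<close> times \<open>v\<close> on a bounded
  set, where \<open>v\<close> is square integrable.\<close>

lemma hv_LB: "LB (%x. h x * v x)"
proof -
 obtain k0 R where R: "!!k x. cz_hot v f t k x ==> norm x <= R + DIM('a) * side k0" using hot_bound by blast
 define R' where "R' = R + DIM('a) * side k0 + 1"
 have Om: "Om <= ball 0 R'"
 proof
  fix x assume "x : Om"
  then obtain k where "cz_hot v f t k x" using stD(3) by (auto simp: Om_def)
  from R[OF this] show "x : ball 0 R'" by (simp add: R'_def)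
 qed
 have [measurable]: "ball 0 R' : sets (lebesgue :: 'a measure)" by simp
 have "LB (%x. indicator (ball 0 R') x * v x)"
 proof -
  have "RI (%x. (indicator (ball 0 R') x * v x)^2) = RSI (ball 0 R') (%x. (v x)^2)"
   by (intro nn_integral_cong) (auto simp: indicator_def)
  also have "... < \<infinity>" by (rule v_L2)
  finally have "L2 (%x. indicator (ball 0 R') x * v x)" unfolding L2_iff by simp
  thus ?thesis unfolding LB_def by (auto intro!: exI[of _ R'])
 qed
 hence 2: "LB (%x. indicator Om x * (aa x * v x))"
 proof (rule LB_dominated[where c = "Cv * t"])
  fix x
  show "\<bar>indicator Om x * (aa x * v x)\<bar> <= Cv * t * \<bar>indicator (ball 0 R') x * v x\<bar>"
   using Om aa_le[of x] v_nonneg[of x] pars t by (auto simp: indicator_def abs_mult intro: mult_right_mono)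
 qed measurable
 have "LB (%x. indicator Om x * (f x * v x) - indicator Om x * (aa x * v x))"
  by (intro LB_diff 2 LB_indicator F Om_meas)
 thus ?thesis by (simp add: h_def algebra_simps)
qed

lemma gv_LB: "LB (%x. g x * v x)"
 using LB_diff[OF F hv_LB] by (simp add: g_def algebra_simps)

lemma h_off: "x ~: Om ==> h x = 0" by (simp add: h_def)

lemma hv_mean: assumes A: "A : S" shows "(LINT y|lebesgue. indicator A y * (h y * v y)) = 0"
proof -
 have mA [measurable]: "A : sets lebesgue" by (rule stD(8)[OF A])
 obtain r where r: "mu A = en r" "r > 0" using mu_S[OF A] by (cases "mu A") auto
 have i1: "integrable lebesgue (%y. indicator A y *\<^sub>R (f y * v y))" by (rule integrable_mult_indicator[OF mA F_int])
 let ?C = "%x. indicator A x *\<^sub>R v x"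
 have i2: "integrable lebesgue (%y. av A * (?C y))" using v_int(1)[OF A] by (auto simp: set_integrable_def)
 let ?A = "LINT y|lebesgue. av A * (?C y)"
 let ?B = "LINT y|lebesgue. indicator A y *\<^sub>R (f y * v y)"
 have "indicator A y * (h y * v y) = indicator A y *\<^sub>R (f y * v y) - av A * (?C y)" for y
  using A cof_eq[OF A, of y] by (auto simp: indicator_def h_def aa_def Om_def algebra_simps)
 hence "(LINT y|lebesgue. indicator A y * (h y * v y)) = ?B - ?A"
  using i1 i2 by (simp add: Bochner_Integration.integral_diff)
 also have "?A = av A * r"
  using v_int(2)[OF A] r unfolding set_lebesgue_integral_def by simp
 also have "av A * r = ?B" using r by (simp add: av_def set_lebesgue_integral_def)
 finally show ?thesis by simp
qed

lemma hv_abs: assumes A: "A : S" shows "RSI A (%y. \<bar>h y * v y\<bar>) <= 2 * Fa A"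
proof -
 have mA [measurable]: "A : sets lebesgue" by (rule stD(8)[OF A])
 have "\<bar>h y * v y\<bar> <= 1 * \<bar>f y * v y\<bar> + \<bar>av A\<bar> * v y" if y: "y : A" for y
 proof -
  have "h y = f y - av A" using A y cof_eq[OF A y] by (auto simp: h_def aa_def Om_def)
  thus ?thesis using v_nonneg[of y] mult_right_mono[OF abs_triangle_ineq4[of "f y" "av A"] v_nonneg[of y]] by (simp add: abs_mult distrib_right)
 qed
 hence "RSI A (%y. \<bar>h y * v y\<bar>) <= en 1 * Fa A + en \<bar>av A\<bar> * mu A"
  using stD(8)[OF A] by (intro RSI_le_lincomb AE_I2) auto
 also have "... = Fa A + en \<bar>av A\<bar> * mu A" by simp
 also have "... <= Fa A + Fa A" by (intro add_left_mono av_mu A)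
 finally show ?thesis by (simp add: mult_2)
qed

text \<open>No cell around a point off \<open>Om\<close> is hot, so differentiation gives
  \<open>\<bar>f\<bar> v \<le> t v\<close> there, and \<open>v\<close> is positive almost
  everywhere.\<close>

lemma f_le_off: "AE x in lebesgue. x ~: Om --> \<bar>f x\<bar> <= t"
proof -
 have "AE x in lebesgue. x : - Om --> en \<bar>f x * v x\<bar> <= en (t * v x)"
 proof (rule AE_le_of_cell_integrals_le)
  show "- Om : sets lebesgue" using sets.compl_sets[OF Om_meas] by (simp add: Compl_eq_Diff_UNIV)
  have [measurable]: "ball 0 R : sets (lebesgue :: 'a measure)" for R by simp
  have eq: "RSI A (%x. t * v x) = en t * mu A" if [measurable]: "A : sets lebesgue" for A
   using t v_nonneg by (subst nn_integral_cmult[symmetric]) (auto simp: ennreal_mult mult.assoc)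
  show "RSI (ball 0 R) (%x. t * v x) < \<infinity>" for R
   using v_ball_finite[of R] by (subst eq) (auto simp: ennreal_mult_less_top)
  fix x k assume "x : - Om"
  hence "~ cz_hot v f t k x" using stD(3) by (auto simp: Om_def)
  thus "RSI (cell k x) (%y. \<bar>f y * v y\<bar>) <= RSI (cell k x) (%y. t * v y)"
   by (subst eq) (auto simp: cz_hot_def not_less)
 qed auto
 with v_pos show ?thesis
 proof eventually_elim
  case (elim x)
  show ?case
  proof
   assume "x ~: Om"
   hence "en \<bar>f x * v x\<bar> <= en (t * v x)" using elim by auto
   hence "\<bar>f x\<bar> * v x <= t * v x" using elim(1) t by (subst (asm) ennreal_le_iff) (auto simp: abs_mult)
   thus "\<bar>f x\<bar> <= t" using elim(1) by simp
  qed
 qed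
qed

end

lemma sets_less_lebesgue:
 fixes f g :: "'a::euclidean_space => real"
 assumes [measurable]: "f : LM" "g : LM"
 shows "{x. f x < g x} : sets lebesgue"
proof -
 have "{x : space lebesgue. f x < g x} : sets lebesgue" by measurable
 thus ?thesis by simp
qed

context czs begin

lemma comm_meas: "LB F' ==> comm T b k F' : LM"
 by (rule L2_meas[OF L2_comm[OF bdm_b LB_L2]])

text \<open>The price of deleting \<open>u\<close>: each stopping cell satisfies
  \<open>t mu(A) < Fa A\<close>, and the \<open>uv\<close>-mass of its dilate is at most
  \<open>Ct mu(A)\<close> times \<open>NN u\<close> at any point of \<open>A\<close>.\<close>

lemma tent: "RSI Os (%x. u x * v x) <= en (Ct / t) * NI (%x. en \<bar>f x * v x\<bar> * NN u x)"
proof -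
 note [measurable] = u_meas[OF u]
 let ?A = "%x. en \<bar>f x * v x\<bar> * NN u x"
 let ?B = "en (Ct / t)"
 have "RSI Os (%x. u x * v x) <= SI Om (%x. ?B * (?A x))"
  unfolding Os_def Om_def
 proof (rule set_nn_integral_Union_le_partition[OF stD(1,2)])
  fix A assume A: "A : S"
  show mA [measurable]: "A : sets lebesgue" by (rule stD(8)[OF A])
  let ?w = "RSI (nbhd (kk A - int J) (xx A)) (%x. u x * v x)"
  have "mu A * (en t * ?w) = (en t * mu A) * ?w" by (simp add: mult_ac)
  also have "... <= Fa A * ?w" using hotS[OF A] by (intro mult_right_mono) auto
  also have "... = NI (%y. en \<bar>f y * v y\<bar> * indicator A y * ?w)" by (subst nn_integral_multc) auto
  also have "... <= NI (%y. mu A * (en Ct * (?A y) * indicator A y))"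
  proof (rule nn_integral_mono, goal_cases)
   case (1 y)
   show ?case
   proof (cases "y : A")
    case True
    hence "?w <= en Ct * mu (cell (kk A) (xx A)) * NN u y" using S_cell[OF A] by (intro N_tent[OF u]) auto
    hence "?w <= en Ct * mu A * NN u y" using S_cell[OF A] by simp
    hence "en \<bar>f y * v y\<bar> * ?w <= en \<bar>f y * v y\<bar> * (en Ct * mu A * NN u y)" by (rule mult_left_mono) simp
    thus ?thesis using True by (simp add: mult_ac)
   qed auto
  qed
  also have "... = mu A * SI A (%y. en Ct * (?A y))" by (rule nn_integral_cmult) measurable
  finally have "en t * ?w <= SI A (%y. en Ct * (?A y))"
   using mu_S[OF A] by (subst (asm) ennreal_mult_le_mult_iff) auto
  also have "... = NI (%y. en t * (?B * (?A y) * indicator A y))"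
  proof (rule nn_integral_cong, goal_cases)
   case (1 y)
   have "en Ct = en t * ?B" using t pars by (subst ennreal_mult[symmetric]) auto
   thus ?case
    by (simp add: mult_ac)
  qed
  also have "... = en t * SI A (%y. ?B * (?A y))"
   by (rule nn_integral_cmult) measurable
  finally show "?w <= SI A (%y. ?B * (?A y))"
   using t by (subst (asm) ennreal_mult_le_mult_iff) auto
 qed auto
 also have "... <= NI (%x. ?B * (?A x))"
  by (intro nn_integral_mono) (auto simp: indicator_def)
 also have "... = ?B * NI (%x. en \<bar>f x * v x\<bar> * NN u x)" by (rule nn_integral_cmult) measurable
 finally show ?thesis .
qed

lemma cell_const:
 assumes A: "A : S" and [measurable]: "q : LM"
 shows "SI A (%x. q x * NN us x) = SI A q * NN us (xx A)"
proof -
 have [measurable]: "A : sets lebesgue" by (rule stD(8)[OF A])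
 have "SI A (%x. q x * NN us x) = NI (%x. (q x * indicator A x) * NN us (xx A))"
  using Nus_const[OF A] by (intro nn_integral_cong) (auto simp: indicator_def)
 also have "... = SI A q * NN us (xx A)" by (rule nn_integral_multc) measurable
 finally show ?thesis .
qed

text \<open>Here the constancy of \<open>NN us\<close> on stopping cells is used: inequalities
  between integrals over cells survive multiplication by it.\<close>

lemma le_on_Om:
 assumes [measurable]: "q : LM" "r : LM"
  and le: "!!A. A : S ==> SI A q <= SI A r"
 shows "SI Om (%x. q x * NN us x) <= SI Om (%x. r x * NN us x)"
 unfolding Om_def
proof (rule set_nn_integral_mono_partition[OF stD(1,2)])
 fix A assume A: "A : S"
 show "A : sets lebesgue" by (rule stD(8)[OF A])
 show "SI A (%x. q x * NN us x) <= SI A (%x. r x * NN us x)"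
  using le[OF A] by (simp add: cell_const[OF A] mult_right_mono)
qed auto

text \<open>On a stopping cell \<open>g\<close> is the constant \<open>av A\<close>, whose mass
  against \<open>v\<close> is at most that of \<open>f\<close>; off \<open>Om\<close> nothing
  changes.\<close>

lemma gN: "NI (%x. en \<bar>g x * v x\<bar> * NN us x) <= NI (%x. en \<bar>f x * v x\<bar> * NN us x)"
proof -
 have mc [measurable]: "- Om : sets lebesgue" using sets.compl_sets[OF Om_meas] by (simp add: Compl_eq_Diff_UNIV)
 let ?C = "%y. %x. y x * NN us x"
 have split: "NI (?C q) = SI (- Om) (?C q) + SI Om (?C q)"
  if [measurable]: "q : LM" for q
  by (subst nn_integral_add[symmetric]) (auto intro!: nn_integral_cong simp: indicator_def)
 let ?A = "%y. %x. en \<bar>y x * v x\<bar> * NN us x"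
 have "SI Om (?A g) <= SI Om (?A f)"
 proof (rule le_on_Om)
  fix A assume A: "A : S"
  have [measurable]: "A : sets lebesgue" by (rule stD(8)[OF A])
  let ?B = "%y. RSI A (%x. \<bar>y x * v x\<bar>)"
  have "?B g = NI (%x. en \<bar>av A\<bar> * (en (v x) * indicator A x))"
  proof (rule nn_integral_cong, goal_cases)
   case (1 x)
   show ?case
   proof (cases "x : A")
    case True
    hence "g x = av A" using A cof_eq[OF A True] by (auto simp: g_def h_def aa_def Om_def)
    thus ?thesis using True v_nonneg[of x] by (simp add: abs_mult ennreal_mult)
   qed simp
  qed
  also have "... = en \<bar>av A\<bar> * mu A" by (rule nn_integral_cmult) measurable
  also have "... <= Fa A" by (rule av_mu[OF A])
  finally show "?B g <= ?B f" .
 qed auto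
 moreover have "SI (- Om) (?A g) = SI (- Om) (?A f)"
  by (intro nn_integral_cong) (auto simp: indicator_def g_def h_def)
 ultimately show ?thesis by (subst (1 2) split) (auto intro: add_left_mono)
qed

lemma g_le: "AE x in lebesgue. \<bar>g x\<bar> <= Cv * t"
 using f_le_off
proof eventually_elim
 case (elim x)
 show ?case
 proof (cases "x : Om")
  case True
  hence "g x = aa x" by (simp add: g_def h_def)
  thus ?thesis using aa_le by simp
 next
  case False
  hence "\<bar>g x\<bar> <= t" using elim by (simp add: g_def h_def)
  also have "t <= Cv * t" using pars t by simp
  finally show ?thesis .
 qed
qed

text \<open>Chebyshev's inequality at exponent \<open>p0\<close>; the bound
  \<open>\<bar>g\<bar> \<le> Cv t\<close> lowers the power \<open>p0\<close> of \<open>g\<close> to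
  1, and the powers of \<open>t\<close> combine to \<open>1 / t\<close>.\<close>

lemma good:
 assumes k: "k <= m"
 shows "RSI {x. t / 2 * v x < \<bar>comm T b k (%y. g y * v y) x\<bar>} (%x. us x * v x)
  <= en (2 powr p0 * Cs * Cv powr (p0 - 1) / t) * NI (%x. en \<bar>f x * v x\<bar> * NN us x)"
proof -
 let ?c = "comm T b k (%y. g y * v y)"
 note [measurable] = comm_meas[OF gv_LB, of k]
 let ?A = "en ((2 / t) powr p0)"
 let ?C = "%x. \<bar>?c x\<bar>"
 have "RSI {x. t / 2 * v x < (?C x)} (%x. us x * v x)
  <= NI (%x. ?A * en ((?C x) powr p0 * (us x * v x powr (1 - p0))))"
 proof (rule nn_integral_mono_AE, use v_pos in eventually_elim)
  case v: (elim x)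
  have "us x * v x <= (2 / t) powr p0 * ((?C x) powr p0 * (us x * v x powr (1 - p0)))" if l: "t / 2 * v x < (?C x)"
  proof -
   have "1 = (2 / t) powr p0 * (t / 2 * v x) powr p0 * v x powr (- p0)"
    using t v by (simp add: powr_mult powr_divide powr_minus field_simps)
   also have "... <= (2 / t) powr p0 * (?C x) powr p0 * v x powr (- p0)"
    using t v l pars by (intro mult_right_mono mult_left_mono powr_mono2) auto
   finally have "us x * v x * 1 <= us x * v x * ((2 / t) powr p0 * (?C x) powr p0 * v x powr (- p0))"
    using us_nonneg[of x] v by (intro mult_left_mono) auto
   also have "... = (2 / t) powr p0 * ((?C x) powr p0 * (us x * (v x * v x powr (- p0))))" by (simp only: mult_ac)
   also have "v x * v x powr (- p0) = v x powr (1 - p0)" using v by (simp add: powr_diff powr_minus field_simps)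
   finally show ?thesis by simp
  qed
  thus ?case
   by (subst ennreal_mult[symmetric]) (auto simp: indicator_def us_nonneg simp del: comm.simps intro!: ennreal_leI)
 qed
 also have "... = ?A * RI (%x. (?C x) powr p0 * (us x * v x powr (1 - p0)))"
  by (rule nn_integral_cmult) measurable
 also have "... <= ?A * (en Cs * NI (%x. en (\<bar>g x * v x\<bar> powr p0 * v x powr (1 - p0)) * NN us x))"
  by (intro mult_left_mono N_strong us b k gv_LB) auto
 also have "... <= ?A * (en Cs * (en ((Cv * t) powr (p0 - 1)) * NI (%x. en \<bar>g x * v x\<bar> * NN us x)))"
 proof (intro mult_left_mono)
  let ?B = "en ((Cv * t) powr (p0 - 1))"
  have "NI (%x. en (\<bar>g x * v x\<bar> powr p0 * v x powr (1 - p0)) * NN us x) <= NI (%x. ?B * (en \<bar>g x * v x\<bar> * NN us x))"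
  proof (rule nn_integral_mono_AE, use v_pos g_le in eventually_elim)
   fix x assume v: "0 < v x" and gl: "\<bar>g x\<bar> <= Cv * t"
   have "\<bar>g x * v x\<bar> powr p0 * v x powr (1 - p0) <= (Cv * t) powr (p0 - 1) * \<bar>g x * v x\<bar>"
   proof (cases "g x = 0")
    case False
    have "\<bar>g x * v x\<bar> powr p0 * v x powr (1 - p0) = \<bar>g x\<bar> powr p0 * (v x powr p0 * v x powr (1 - p0))"
     using v by (simp add: abs_mult powr_mult)
    also have "v x powr p0 * v x powr (1 - p0) = v x" using v by (simp add: powr_add[symmetric])
    also have "\<bar>g x\<bar> powr p0 = \<bar>g x\<bar> powr (p0 - 1) * \<bar>g x\<bar>" using False by (simp add: powr_diff)
    also have "\<bar>g x\<bar> powr (p0 - 1) * \<bar>g x\<bar> * v x <= (Cv * t) powr (p0 - 1) * \<bar>g x\<bar> * v x"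
     using gl v pars by (intro mult_right_mono powr_mono2) auto
    finally show ?thesis using v by (simp add: abs_mult mult_ac)
   qed simp
   hence "en (\<bar>g x * v x\<bar> powr p0 * v x powr (1 - p0)) <= ?B * en \<bar>g x * v x\<bar>"
    by (subst ennreal_mult[symmetric]) (auto intro!: ennreal_leI)
   thus "en (\<bar>g x * v x\<bar> powr p0 * v x powr (1 - p0)) * NN us x <= ?B * (en \<bar>g x * v x\<bar> * NN us x)"
    unfolding mult.assoc[symmetric] by (rule mult_right_mono) simp
  qed
  also have "... = ?B * NI (%x. en \<bar>g x * v x\<bar> * NN us x)"
   by (rule nn_integral_cmult) measurable
  finally show "NI (%x. en (\<bar>g x * v x\<bar> powr p0 * v x powr (1 - p0)) * NN us x) <= ..." .
 qed auto
 also have "... <= ?A * (en Cs * (en ((Cv * t) powr (p0 - 1)) * NI (%x. en \<bar>f x * v x\<bar> * NN us x)))"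
  by (intro mult_left_mono gN) auto
 also have "... = en ((2 / t) powr p0 * (Cs * (Cv * t) powr (p0 - 1))) * NI (%x. en \<bar>f x * v x\<bar> * NN us x)"
  using pars by (simp add: ennreal_mult mult.assoc)
 also have "(2 / t) powr p0 * (Cs * (Cv * t) powr (p0 - 1)) = 2 powr p0 * Cs * Cv powr (p0 - 1) / t"
  using t pars by (simp add: powr_mult powr_divide powr_diff field_simps)
 finally show ?thesis .
qed

text \<open>\<open>us\<close> vanishes near the cell, so only the far region counts; there the mean
  zero of \<open>h v\<close> produces kernel differences, and \<open>N_ker\<close> absorbs the
  factor \<open>\<bar>b - mid\<bar>^k\<close>.\<close>

lemma bad_cell:
 assumes A: "A : S" and k: "k <= m"
 shows "NI (%z. en (\<bar>b z - mid \<beta> b (kk A) (xx A)\<bar> ^ k * \<bar>T (%y. indicator A y * (h y * v y)) z\<bar>) * en (us z))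
   <= en (2 * Ck) * SI A (%x. en \<bar>f x * v x\<bar> * NN us x)"
proof -
 define hA where "hA y = indicator A y * (h y * v y)" for y
 have [measurable]: "A : sets lebesgue" by (rule stD(8)[OF A])
 have hA: "LB hA" unfolding hA_def by (rule LB_indicator[OF hv_LB]) measurable
 note [measurable] = bmo_bd_meas[OF b] L2_meas[OF T_L2[OF LB_L2[OF hA]]]
 define G where "G z = \<bar>b z - mid \<beta> b (kk A) (xx A)\<bar> ^ k * us z" for z
 have "NI (%z. en (\<bar>b z - mid \<beta> b (kk A) (xx A)\<bar> ^ k * \<bar>T hA z\<bar>) * en (us z))
  = RSI (- nbhd (kk A - int J) (xx A)) (%z. \<bar>T hA z\<bar> * G z)"
 proof (rule nn_integral_cong, goal_cases)
  case (1 z)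
  show ?case
   using us_zero[OF A, of z] us_nonneg[of z] by (auto simp: G_def indicator_def ennreal_mult[symmetric] mult_ac)
 qed
 also have "... <= (en Ck * NN us (xx A)) * RI (%y. \<bar>hA y\<bar>)"
 proof (rule T_far_integral[OF hA, of "kk A"])
  show "!!y. y ~: cell (kk A) (xx A) ==> hA y = 0" using S_cell[OF A] by (simp add: hA_def)
  show "(LINT y|lebesgue. hA y) = 0" unfolding hA_def by (rule hv_mean[OF A])
  show "G : LM" unfolding G_def by measurable
  show "!!z. 0 <= G z" using us_nonneg by (simp add: G_def)
  show "kk A - int J <= kk A" by simp
  fix y assume y: "y : cell (kk A) (xx A)"
  show "RSI (- nbhd (kk A - int J) (xx A)) (%z. \<bar>K (z - y) - K (z - xx A)\<bar> * G z) <= en Ck * NN us (xx A)"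
   unfolding G_def by (rule N_ker[OF us b k y]) simp
 qed
 also have "RI (%y. \<bar>hA y\<bar>) = RSI A (%y. \<bar>h y * v y\<bar>)"
  by (intro nn_integral_cong) (auto simp: hA_def indicator_def)
 also have "(en Ck * NN us (xx A)) * ... <= (en Ck * NN us (xx A)) * (2 * Fa A)"
  by (intro mult_left_mono hv_abs[OF A]) auto
 also have "... = en (2 * Ck) * (Fa A * NN us (xx A))" using pars by (simp add: ennreal_mult mult_ac)
 also have "Fa A * NN us (xx A) = SI A (%x. en \<bar>f x * v x\<bar> * NN us x)"
  by (rule cell_const[OF A, symmetric]) measurable
 finally show ?thesis unfolding hA_def .
qed

text \<open>The arguments of the lower commutators left over by the binomial expansion.\<close>

definition "fj k j y = (b y - cf y) ^ (k - j) * h y"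

lemma fjv_LB: "LB (%y. fj k j y * v y)"
proof -
 have "LB (%y. (b y - cf y) ^ (k - j) * (h y * v y))"
  by (intro LB_mult_bdm bdm_power bdm_diff bdm_b cf_bdm hv_LB)
 thus ?thesis by (simp add: fj_def mult.assoc)
qed

lemma fj_meas [measurable]: "fj k j : LM"
proof -
 note [measurable] = bdm_meas[OF bdm_b] cf_meas
 show ?thesis unfolding fj_def[abs_def] by measurable
qed

text \<open>\<open>Phi_exp_Young\<close> splits off from the factor
  \<open>\<bar>b - cf\<bar>^(k - j)\<close> an exponential, integrable against \<open>v\<close> on
  the cell, and extra logarithms of \<open>f\<close>. The exponential part costs a multiple of
  \<open>mu A\<close>, which is at most the integral of \<open>Phi k (\<bar>f\<bar> / t) v\<close>
  over \<open>A\<close> because \<open>A\<close> is hot.\<close>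

lemma bad_Phi:
 assumes c: "c >= 0" and P: "0 < P" and Young: "!!x y. 0 <= x ==> 0 <= y ==> Phi j (c * y ^ (k - j) * (x + Cv)) <= P * (Phi k x + exp (\<epsilon> * y))"
 shows "NI (%x. en (Phi j (c * (\<bar>fj k j x\<bar> / t)) * v x) * NN us x)
   <= en (P * (1 + Ce)) * NI (%x. en (Phi k (\<bar>f x\<bar> / t) * v x) * NN us x)"
proof -
 note [measurable] = bdm_meas[OF bdm_b] cf_meas
 have Pm [measurable]: "(%x. Phi j (c * (\<bar>fj k j x\<bar> / t))) : LM" "(%x. Phi k (\<bar>f x\<bar> / t)) : LM"
  by (rule Phi_measurable, measurable)+
 let ?E = "%y. %x. en (Phi j (c * (\<bar>fj k j x\<bar> / y)) * v x) * NN us x"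
 let ?G = "%x. en (x * (1 + Ce))"
 have "NI (?E t) = SI Om (?E t)"
  by (intro nn_integral_cong) (auto simp: indicator_def fj_def h_off Phi_def)
 also have "... <= SI Om (%x. (?G P * en (Phi k (\<bar>f x\<bar> / t) * v x)) * NN us x)"
 proof (rule le_on_Om)
  fix A assume A: "A : S"
  have [measurable]: "A : sets lebesgue" by (rule stD(8)[OF A])
  define d where "d = mid \<beta> b (kk A) (xx A)"
  let ?I = "RSI A (%x. Phi k (\<bar>f x\<bar> / t) * v x)"
  have muI: "mu A <= ?I"
  proof -
   have "en t * mu A <= Fa A" using hotS[OF A] by simp
   also have "... <= NI (%x. en t * (en (Phi k (\<bar>f x\<bar> / t) * v x) * indicator A x))"
   proof (rule nn_integral_mono, goal_cases)
    case (1 x)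
    let ?D = "Phi k (\<bar>f x\<bar> / t)"
    have "\<bar>f x\<bar> / t <= ?D" using t by (intro Phi_ge) auto
    hence "t * (\<bar>f x\<bar> / t * v x) <= t * (?D * v x)" using t v_nonneg[of x] by (intro mult_left_mono mult_right_mono) auto
    hence "en \<bar>f x * v x\<bar> <= en (t * (?D * v x))" using t v_nonneg[of x] by (intro ennreal_leI) (simp add: abs_mult)
    also have "... = en t * en (?D * v x)" using t v_nonneg[of x] by (intro ennreal_mult mult_nonneg_nonneg Phi_nonneg) auto
    finally show ?case
     by (auto simp: indicator_def)
   qed
   also have "... = en t * ?I" by (rule nn_integral_cmult) measurable
   finally show ?thesis using t by (subst (asm) ennreal_mult_le_mult_iff) auto
  qed
  let ?A = "%x. exp (\<epsilon> * \<bar>b x - d\<bar>)"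
  let ?B = "%x. Phi k (\<bar>f x\<bar> / t)"
  let ?C = "%x. Phi j (c * (\<bar>fj k j x\<bar> / t))"
  let ?H = "%x. en (?B x * v x)"
  let ?J = "RSI A (%x. ?C x * v x)"
  have "?J
   <= NI (%x. en P * (?H x * indicator A x + en (?A x) * en (v x) * indicator A x))"
  proof (rule nn_integral_mono, goal_cases)
   case (1 x)
   show ?case
   proof (cases "x : A")
    case True
    hence cfx: "cf x = d" using A cof_eq[OF A True] by (auto simp: cf_def Om_def d_def)
    have "\<bar>h x\<bar> / t <= \<bar>f x\<bar> / t + Cv" using h_le[of x] t by (simp add: field_simps)
    hence "c * \<bar>b x - d\<bar> ^ (k - j) * (\<bar>h x\<bar> / t) <= c * \<bar>b x - d\<bar> ^ (k - j) * (\<bar>f x\<bar> / t + Cv)" using c by (intro mult_left_mono) auto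
    moreover have "c * (\<bar>fj k j x\<bar> / t) = c * \<bar>b x - d\<bar> ^ (k - j) * (\<bar>h x\<bar> / t)" by (simp add: fj_def cfx abs_mult power_abs)
    ultimately have "?C x <= Phi j (c * \<bar>b x - d\<bar> ^ (k - j) * (\<bar>f x\<bar> / t + Cv))"
     using c t by (intro Phi_mono) auto
    also have "... <= P * (?B x + ?A x)" using t by (intro Young) auto
    finally have "?C x * v x <= P * (?B x + ?A x) * v x"
     using v_nonneg[of x] by (intro mult_right_mono) auto
    also have "... = P * (?B x * v x + ?A x * v x)" by (simp add: distrib_left distrib_right)
    finally have "en (?C x * v x) <= en (P * (?B x * v x + ?A x * v x))"
     by (rule ennreal_leI)
    also have "... = en P * (?H x + en (?A x) * en (v x))"
    proof -
     have "0 <= ?B x * v x" using t v_nonneg[of x] by (intro mult_nonneg_nonneg Phi_nonneg) auto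
     thus ?thesis using P v_nonneg[of x] by (simp add: ennreal_mult ennreal_plus)
    qed
    finally show ?thesis using True by simp
   qed simp
  qed
  also have "... = en P * (?I + SI A (%x. en (?A x) * en (v x)))"
   by (subst nn_integral_cmult, measurable, subst nn_integral_add) auto
  also have "... <= en P * (?I + en Ce * ?I)"
  proof (intro mult_left_mono add_left_mono)
   let ?F = "SI A (%x. en (?A x) * en (v x))"
   have "?F <= en Ce * mu A"
    using v_exp[OF b, of "kk A" "xx A"] S_cell[OF A] unfolding d_def by simp
   also have "... <= en Ce * ?I" by (intro mult_left_mono muI) auto
   finally show "?F <= en Ce * ?I" .
  qed auto
  also have "... = ?G P * ?I" using P pars by (simp add: ennreal_mult ennreal_plus distrib_right mult.assoc)
  also have "... = SI A (%x. ?G P * ?H x)"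
   by (subst nn_integral_cmult[symmetric]) (auto simp: mult_ac)
  finally show "?J <= SI A (%x. ?G P * ?H x)" .
 next
  show "(%x. en (Phi j (c * (\<bar>fj k j x\<bar> / t)) * v x)) : LM" by measurable
  show "(%x. en (P * (1 + Ce)) * en (Phi k (\<bar>f x\<bar> / t) * v x)) : LM" by measurable
 qed
 also have "... <= NI (%x. en (P * (1 + Ce)) * (en (Phi k (\<bar>f x\<bar> / t) * v x) * NN us x))"
  by (intro nn_integral_mono) (auto simp: indicator_def mult.assoc)
 also have "... = en (P * (1 + Ce)) * NI (%x. en (Phi k (\<bar>f x\<bar> / t) * v x) * NN us x)"
  by (rule nn_integral_cmult) measurable
 finally show ?thesis .
qed

text \<open>The level \<open>t / 2\<close> is halved: one half goes to the sum of the localized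
  terms, bounded by Chebyshev at exponent 1, the other is distributed over the lower commutators, to
  which the induction hypothesis applies with \<open>us\<close>.\<close>

lemma bad:
 assumes k: "k <= m" and CC: "!!j. j < k ==> 0 < CC j" and P: "!!j. j < k ==> 0 < P j"
  and IH: "!!j f' t'. j < k ==> f' : LM ==> LB (%y. f' y * v y) ==> 0 < t' ==>
   (RSI {x. t' * v x < \<bar>comm T b j (%y. f' y * v y) x\<bar>} (%x. us x * v x))
   <= en (CC j) * NI (%x. en (Phi j (\<bar>f' x\<bar> / t') * v x) * NN us x)"
  and Young: "!!j x y. j < k ==> 0 <= x ==> 0 <= y ==> Phi j ((4 * real k * real (k choose j)) * y ^ (k - j) * (x + Cv)) <= P j * (Phi k x + exp (\<epsilon> * y))"
 shows "RSI {x. t / 2 * v x < \<bar>comm T b k (%y. h y * v y) x\<bar>} (%x. us x * v x)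
  <= en (8 * Ck / t) * NI (%x. en \<bar>f x * v x\<bar> * NN us x)
   + (\<Sum>j<k. en (CC j * (P j * (1 + Ce))) * NI (%x. en (Phi k (\<bar>f x\<bar> / t) * v x) * NN us x))"
proof -
 obtain Q :: "nat => 'a set" where Q: "disjoint_family Q" "(\<Union>n. Q n) = \<Union>S" "!!n. Q n = {} | Q n : S"
  using countable_disjoint_seq[OF stD(1,2)] by blast
 have Qm [measurable]: "Q n : sets lebesgue" for n using Q(3)[of n] stD(8)[of "Q n"] by auto
 define hv where "hv y = h y * v y" for y
 have hvLB: "LB hv" unfolding hv_def by (rule hv_LB)
 define c where "c n = mid \<beta> b (kk (Q n)) (xx (Q n))" for n
 define G where "G n x = \<bar>b x - c n\<bar> ^ k * \<bar>T (%y. indicator (Q n) y * hv y) x\<bar>" for n x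
 define S1 where "S1 x = (\<Sum>n. en (G n x))" for x
 define R where "R j y = (b y - cf y) ^ (k - j) * hv y" for j y
 have R: "R j = (%y. fj k j y * v y)" for j by (rule ext) (simp add: R_def fj_def hv_def mult.assoc)
 have R_LB: "LB (R j)" for j unfolding R by (rule fjv_LB)
 have GL: "LB (%y. indicator (Q n) y * hv y)" for n by (rule LB_indicator[OF hvLB Qm])
 note [measurable] = bmo_bd_meas[OF b] L2_meas[OF T_L2[OF LB_L2[OF GL]]]
 have Gm [measurable]: "G n : LM" for n unfolding G_def by measurable
 have S1m [measurable]: "S1 : LM" unfolding S1_def by measurable
 have dec: "AE x in lebesgue. en \<bar>comm T b k hv x\<bar> <= S1 x + en (\<Sum>j<k. real (k choose j) * \<bar>comm T b j (R j) x\<bar>)"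
  unfolding S1_def G_def R_def
 proof (rule comm_decomp[OF bdm_b LB_L2[OF hvLB] cf_bdm Qm Q(1)])
  show "hv x = 0" if "x ~: (\<Union>n. Q n)" for x using that h_off[of x] unfolding Q(2) by (simp add: hv_def Om_def)
  show "cf y = c n" if "y : Q n" for n y
  proof -
   have "Q n : S" using Q(3)[of n] that by auto
   thus ?thesis using cof_eq[OF _ that] that by (auto simp: cf_def c_def Om_def)
  qed
 qed
 define W where "W x = en (us x * v x)" for x
 have Wm [measurable]: "W : LM" unfolding W_def by measurable
 \<comment> \<open>Makes the \<open>k\<close> lower terms with their binomial weights add up to at
   most \<open>t v / 4\<close> off the sets \<open>E j\<close>.\<close>
 define t' where "t' j = t / (4 * real k * real (k choose j))" for j
 have t': "0 < t' j" if "j < k" for j using that t by (simp add: t'_def)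
 define E where "E j = {x. t' j * v x < \<bar>comm T b j (R j) x\<bar>}" for j
 have Em [measurable]: "E j : sets lebesgue" for j
 proof -
  note [measurable] = comm_meas[OF R_LB, of j]
  show ?thesis unfolding E_def by (rule sets_less_lebesgue) measurable
 qed
 let ?D = "%x. en (us x)"
 let ?F = "%x. en (4 / x)"
 have "SI {x. t / 2 * v x < \<bar>comm T b k hv x\<bar>} W
   <= NI (%x. ?F t * (S1 x * ?D x) + (\<Sum>j<k. W x * indicator (E j) x))"
 proof (rule nn_integral_mono_AE, use dec in eventually_elim)
  case d: (elim x)
  show ?case
  proof (cases "t / 2 * v x < \<bar>comm T b k hv x\<bar>")
   case lt: True
   show ?thesis
   proof (cases "\<exists>j<k. x : E j")
    case True
    then obtain j where j: "j < k" "x : E j" by blast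
    have "W x * indicator {x. t / 2 * v x < \<bar>comm T b k hv x\<bar>} x <= W x * indicator (E j) x" using j by (simp add: indicator_def)
    also have "... <= (\<Sum>j<k. W x * indicator (E j) x)" using j by (intro member_le_sum) auto
    also have "... <= ?F t * (S1 x * ?D x) + ..." by simp
    finally show ?thesis .
   next
    case False
    let ?C = "%x. \<Sum>j<k. real (k choose j) * \<bar>comm T b j (R j) x\<bar>"
    have "(?C x) <= (\<Sum>j<k. t / (4 * real k) * v x)"
    proof (rule sum_mono)
     fix j assume j: "j : {..<k}"
     hence "x ~: E j" using False by auto
     hence "\<bar>comm T b j (R j) x\<bar> <= t' j * v x" by (simp add: E_def not_less)
     hence "real (k choose j) * \<bar>comm T b j (R j) x\<bar> <= real (k choose j) * (t' j * v x)" by (intro mult_left_mono) auto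
     also have "... = t / (4 * real k) * v x" using j by (simp add: t'_def)
     finally show "real (k choose j) * \<bar>comm T b j (R j) x\<bar> <= t / (4 * real k) * v x" .
    qed
    \<comment> \<open>For \<open>k = 0\<close> the sum is empty.\<close>
    also have "... <= t / 4 * v x" using t v_nonneg[of x] by (cases "k = 0") auto
    finally have s: "(?C x) <= t / 4 * v x" .
    have "en (t / 4 * v x) <= S1 x"
    proof (rule ccontr)
     assume "~ ?thesis"
     hence "S1 x + en (?C x) <= en (t / 4 * v x) + en (t / 4 * v x)"
      by (intro add_mono ennreal_leI s) auto
     also have "... = en (t / 2 * v x)" using t v_nonneg[of x] by (simp flip: ennreal_plus)
     finally have "en \<bar>comm T b k hv x\<bar> <= en (t / 2 * v x)" using d by (rule order_trans[rotated])
     thus False using lt by (subst (asm) ennreal_le_iff) (use t v_nonneg[of x] in auto)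
    qed
    hence "?F t * (en (t / 4 * v x) * ?D x) <= ?F t * (S1 x * ?D x)"
     by (intro mult_left_mono mult_right_mono) auto
    moreover have "?F t * (en (t / 4 * v x) * ?D x) = W x"
     using t v_nonneg[of x] us_nonneg[of x] unfolding W_def by (simp add: ennreal_mult[symmetric] mult_ac)
    ultimately show ?thesis using lt by (simp add: add_increasing2)
   qed
  qed simp
 qed
 also have "... = ?F t * NI (%x. S1 x * ?D x) + (\<Sum>j<k. SI (E j) W)"
  by (subst nn_integral_add, measurable, subst nn_integral_cmult, measurable, subst nn_integral_sum) auto
 also have "... <= ?F t * (en (2 * Ck) * NI (%x. en \<bar>f x * v x\<bar> * NN us x))
   + (\<Sum>j<k. en (CC j * (P j * (1 + Ce))) * NI (%x. en (Phi k (\<bar>f x\<bar> / t) * v x) * NN us x))"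
 proof (intro add_mono mult_left_mono sum_mono)
  let ?A = "%x. en \<bar>f x * v x\<bar> * NN us x"
  let ?G = "en (2 * Ck)"
  have "NI (%x. S1 x * ?D x) = NI (%x. (\<Sum>n. en (G n x) * ?D x))"
   by (simp add: S1_def ennreal_suminf_multc)
  also have "... = (\<Sum>n. NI (%x. en (G n x) * ?D x))" by (rule nn_integral_suminf) measurable
  also have "... <= (\<Sum>n. ?G * SI (Q n) ?A)"
  proof (intro suminf_le allI, goal_cases)
   case (1 n)
   show ?case
   proof (cases "Q n : S")
    case True
    show ?thesis using bad_cell[OF True k] by (simp only: G_def c_def hv_def)
   next
    case False
    hence e: "Q n = {}" using Q(3)[of n] by simp
    \<comment> \<open>Padding indices contribute \<open>T\<close> of the zero function, which
      vanishes almost everywhere by linearity.\<close>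
    have "AE x in lebesgue. T (%y. 0 * 0 + 0 * 0) x = 0 * T (%_. 0) x + 0 * T (%_. 0) x"
     by (rule T_lin[OF L2_zero L2_zero])
    hence "AE x in lebesgue. T (%y. 0) x = 0" by simp
    hence "NI (%x. en (G n x) * ?D x) = (\<integral>\<^sup>+x. 0 \<partial>(lebesgue :: 'a measure))"
     by (intro nn_integral_cong_AE) (auto simp: G_def e)
    thus ?thesis by simp
   qed
  qed auto
  also have "... = ?G * (\<Sum>n. SI (Q n) ?A)" by (simp only: ennreal_suminf_cmult)
  also have "(\<Sum>n. SI (Q n) ?A) = NI (%x. (\<Sum>n. en \<bar>f x * v x\<bar> * NN us x * indicator (Q n) x))"
   by (rule nn_integral_suminf[symmetric]) measurable
  also have "... = NI (%x. en \<bar>f x * v x\<bar> * NN us x * indicator (\<Union>n. Q n) x)"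
   by (simp only: ennreal_suminf_cmult suminf_indicator[OF Q(1)])
  also have "... <= NI ?A"
   by (intro nn_integral_mono) (auto simp: indicator_def)
  finally show "NI (%x. S1 x * ?D x) <= ?G * NI ?A"
   by (simp add: mult_left_mono)
 next
  fix j assume "j : {..<k}"
  hence j: "j < k" by simp
  have e: "\<bar>fj k j x\<bar> / t' j = 4 * real k * real (k choose j) * (\<bar>fj k j x\<bar> / t)" for x using t by (simp add: t'_def)
  let ?B = "NI (%x. en (Phi j (4 * real k * real (k choose j) * (\<bar>fj k j x\<bar> / t)) * v x) * NN us x)"
  let ?E = "NI (%x. en (Phi k (\<bar>f x\<bar> / t) * v x) * NN us x)"
  have "SI (E j) W <= en (CC j) * ?B"
   unfolding W_def E_def R e[symmetric] by (rule IH[OF j fj_meas fjv_LB t'[OF j]])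
  also have "en (CC j) * ?B
   <= en (CC j) * (en (P j * (1 + Ce)) * ?E)"
   by (rule mult_left_mono[OF bad_Phi[OF _ P[OF j] Young[OF j]]]) auto
  finally show "SI (E j) W <= en (CC j * (P j * (1 + Ce))) * ?E"
   using CC[OF j] P[OF j] pars by (simp add: ennreal_mult mult.assoc mult_left_mono)
 qed auto
 also have "en (4 / t) * (en (2 * Ck) * NI (%x. en \<bar>f x * v x\<bar> * NN us x)) = en (8 * Ck / t) * NI (%x. en \<bar>f x * v x\<bar> * NN us x)"
  using t pars by (simp add: mult.assoc[symmetric] ennreal_mult[symmetric])
 finally show ?thesis unfolding W_def hv_def .
qed

text \<open>Outside \<open>Os\<close>, where \<open>u = us\<close>, the level is split evenly
  between good and bad part.\<close>

lemma combine:
 assumes k: "k <= m" and C: "0 <= C"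
  and bd: "RSI {x. t / 2 * v x < \<bar>comm T b k (%y. h y * v y) x\<bar>} (%x. us x * v x)
  <= en (8 * Ck / t) * NI (%x. en \<bar>f x * v x\<bar> * NN us x)
   + en C * NI (%x. en (Phi k (\<bar>f x\<bar> / t) * v x) * NN us x)"
 shows "RSI {x. t * v x < \<bar>comm T b k (%y. f y * v y) x\<bar>} (%x. u x * v x)
  <= en (Ct + 2 powr p0 * Cs * Cv powr (p0 - 1) + 8 * Ck + C) * NI (%x. en (Phi k (\<bar>f x\<bar> / t) * v x) * NN u x)"
proof -
 note [measurable] = u_meas[OF u] comm_meas[OF hv_LB, of k] comm_meas[OF gv_LB, of k] Phi_measurable
 let ?I = "NI (%x. en (Phi k (\<bar>f x\<bar> / t) * v x) * NN u x)"
 let ?A = "%y. NI (%x. en \<bar>f x * v x\<bar> * NN y x)"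
 have fI: "en (a / t) * ?A u <= en a * ?I" if a: "0 <= a" for a
 proof -
  let ?D = "%x. Phi k (\<bar>f x\<bar> / t)"
  have "en (a / t) * ?A u = NI (%x. en (a / t) * (en \<bar>f x * v x\<bar> * NN u x))"
   by (rule nn_integral_cmult[symmetric]) measurable
  also have "... <= NI (%x. en a * (en (?D x * v x) * NN u x))"
  proof (rule nn_integral_mono, goal_cases)
   case (1 x)
   have "\<bar>f x\<bar> / t <= ?D x" using t by (intro Phi_ge) auto
   hence "a * (\<bar>f x\<bar> / t * v x) <= a * (?D x * v x)" using a v_nonneg[of x] by (intro mult_left_mono mult_right_mono) auto
   hence "en (a / t * \<bar>f x * v x\<bar>) <= en (a * (?D x * v x))" using t v_nonneg[of x] by (intro ennreal_leI) (simp add: abs_mult)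
   hence "en (a / t) * en \<bar>f x * v x\<bar> <= en a * en (?D x * v x)"
    using a t v_nonneg[of x] by (subst (1 2) ennreal_mult[symmetric]) (auto intro!: mult_nonneg_nonneg Phi_nonneg)
   thus ?case
    unfolding mult.assoc[symmetric] by (rule mult_right_mono) simp
  qed
  also have "... = en a * ?I" by (rule nn_integral_cmult) measurable
  finally show ?thesis .
 qed
 have fs: "?A us <= ?A u"
  by (intro nn_integral_mono mult_left_mono Nus_le) auto
 have Is: "NI (%x. en (Phi k (\<bar>f x\<bar> / t) * v x) * NN us x) <= ?I"
  by (intro nn_integral_mono mult_left_mono Nus_le) auto
 let ?G = "{x. t / 2 * v x < \<bar>comm T b k (%y. g y * v y) x\<bar>}" and ?H = "{x. t / 2 * v x < \<bar>comm T b k (%y. h y * v y) x\<bar>}"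
 have mG [measurable]: "?G : sets lebesgue" by (rule sets_less_lebesgue) measurable
 have mH [measurable]: "?H : sets lebesgue" by (rule sets_less_lebesgue) measurable
 let ?B = "%x. %y. x y * v y"
 have "(?B f) = (%y. 1 * (g y * v y) + 1 * (h y * v y))" by (rule ext) (simp add: g_def algebra_simps)
 hence lin: "AE x in lebesgue. comm T b k (?B f) x = 1 * comm T b k (?B g) x + 1 * comm T b k (?B h) x"
  using comm_lin[OF bdm_b LB_L2[OF gv_LB] LB_L2[OF hv_LB], of k 1 1] by simp
 let ?C = "%y. %x. y x * v x"
 have "RSI {x. t * v x < \<bar>comm T b k (?B f) x\<bar>} (?C u)
   <= NI (%x. en (u x * v x) * indicator Os x + (en (us x * v x) * indicator ?G x + en (us x * v x) * indicator ?H x))"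
 proof (rule nn_integral_mono_AE, use lin in eventually_elim)
  case l: (elim x)
  show ?case
  proof (cases "x : Os | ~ t * v x < \<bar>comm T b k (?B f) x\<bar>")
   case False
   hence "us x = u x" by (simp add: us_def)
   have "t / 2 * v x < \<bar>comm T b k (?B g) x\<bar> | t / 2 * v x < \<bar>comm T b k (?B h) x\<bar>"
   proof (rule ccontr)
    assume "~ ?thesis"
    moreover have "t * v x = t / 2 * v x + t / 2 * v x" by simp
    ultimately show False using False l by linarith
   qed
   thus ?thesis using \<open>us x = u x\<close> by (auto simp: indicator_def simp del: comm.simps)
  qed (auto simp: indicator_def)
 qed
 also have "... = RSI Os (?C u) + (RSI ?G (?C us) + RSI ?H (?C us))"
  by (subst nn_integral_add, measurable, subst nn_integral_add) measurable
 also have "... <= en Ct * ?I + (en (2 powr p0 * Cs * Cv powr (p0 - 1)) * ?I + (en (8 * Ck) * ?I + en C * ?I))"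
 proof (intro add_mono)
  show "RSI Os (?C u) <= en Ct * ?I"
   using tent fI[of Ct] pars by (auto intro: order_trans)
  let ?E = "en (2 powr p0 * Cs * Cv powr (p0 - 1))"
  have "RSI ?G (?C us) <= en (2 powr p0 * Cs * Cv powr (p0 - 1) / t) * ?A u"
   by (rule order_trans[OF good[OF k]]) (intro mult_left_mono fs, simp)
  also have "... <= ?E * ?I" using pars by (intro fI) auto
  finally show "RSI ?G (?C us) <= ?E * ?I" .
  have "en (8 * Ck / t) * ?A us <= en (8 * Ck / t) * ?A u"
   by (intro mult_left_mono fs) simp
  also have "... <= en (8 * Ck) * ?I" using pars by (intro fI) auto
  finally show "RSI ?H (?C us) <= en (8 * Ck) * ?I + en C * ?I"
   by (intro order_trans[OF bd] add_mono mult_left_mono Is) auto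
 qed
 also have "... = en (Ct + 2 powr p0 * Cs * Cv powr (p0 - 1) + 8 * Ck + C) * ?I"
  using pars C by (simp add: ennreal_plus distrib_right add.assoc)
 finally show ?thesis .
qed

end

section \<open>The weak bound by induction on the order\<close>

context czw begin

text \<open>Lower orders are applied to \<open>us\<close>, to the functions \<open>fj\<close> and to
  the levels \<open>t'\<close>, so the induction quantifies over all of them; \<open>UU\<close> is
  closed under restriction for this purpose.\<close>

theorem weak_comm:
 assumes "k <= m"
 shows "\<exists>C>0. ALL b u f t. bmo_bd \<beta> b --> u : UU --> f : LM --> LB (%y. f y * v y) --> 0 < t -->
  (RSI {x. t * v x < \<bar>comm T b k (%y. f y * v y) x\<bar>} (%x. u x * v x))
   <= en C * NI (%x. en (Phi k (\<bar>f x\<bar> / t) * v x) * NN u x)"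
 using assms
proof (induction k rule: less_induct)
 case (less k)
 let ?A = "%x. %y. x y * v y"
 let ?C = "%y. %x. y x * v x"
 have "ALL j. EX C. j < k --> 0 < C & (ALL b u f t. bmo_bd \<beta> b --> u : UU --> f : LM --> LB (?A f) --> 0 < t -->
  (RSI {x. t * v x < \<bar>comm T b j (?A f) x\<bar>} (?C u))
   <= en C * NI (%x. en (Phi j (\<bar>f x\<bar> / t) * v x) * NN u x))"
 proof
  fix j
  show "EX C. j < k --> 0 < C & (ALL b u f t. bmo_bd \<beta> b --> u : UU --> f : LM --> LB (?A f) --> 0 < t -->
  (RSI {x. t * v x < \<bar>comm T b j (?A f) x\<bar>} (?C u))
   <= en C * NI (%x. en (Phi j (\<bar>f x\<bar> / t) * v x) * NN u x))"
  proof (cases "j < k")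
   case True
   hence "j <= m" using less.prems by simp
   from less.IH[OF True this] show ?thesis by blast
  qed simp
 qed
 from choice[OF this] obtain CC where CC: "!!j. j < k ==> 0 < CC j"
  and IH: "!!j b u f t. j < k ==> bmo_bd \<beta> b ==> u : UU ==> f : LM ==> LB (?A f) ==> 0 < t ==>
  (RSI {x. t * v x < \<bar>comm T b j (?A f) x\<bar>} (?C u))
   <= en (CC j) * NI (%x. en (Phi j (\<bar>f x\<bar> / t) * v x) * NN u x)"
  by blast
 let ?D = "%x. 4 * real k * real (k choose x)"
 have "ALL j. EX P. j < k --> 0 < P & (\<forall>x\<ge>0. \<forall>y\<ge>0. Phi j ((?D j) * y ^ (k - j) * (x + Cv)) <= P * (Phi k x + exp (\<epsilon> * y)))"
 proof
  fix j
  show "EX P. j < k --> 0 < P & (\<forall>x\<ge>0. \<forall>y\<ge>0. Phi j ((?D j) * y ^ (k - j) * (x + Cv)) <= P * (Phi k x + exp (\<epsilon> * y)))"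
  proof (cases "j < k")
   case True
   from Phi_exp_Young[OF True, of "4 * real k * real (k choose j)" Cv \<epsilon>] show ?thesis using pars by auto
  qed simp
 qed
 from choice[OF this] obtain P where P: "!!j. j < k ==> 0 < P j"
  and Young: "!!j x y. j < k ==> 0 <= x ==> 0 <= y ==> Phi j ((?D j) * y ^ (k - j) * (x + Cv)) <= P j * (Phi k x + exp (\<epsilon> * y))"
  by blast
 define C where "C = (\<Sum>j<k. CC j * (P j * (1 + Ce)))"
 have C: "0 <= C" unfolding C_def using CC P pars by (intro sum_nonneg mult_nonneg_nonneg) (auto intro: less_imp_le)
 define C' where "C' = Ct + 2 powr p0 * Cs * Cv powr (p0 - 1) + 8 * Ck + C"
 have C': "C' > 0" unfolding C'_def using C pars by (simp add: add_pos_nonneg)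
 have "RSI {x. t * v x < \<bar>comm T b k (?A f) x\<bar>} (?C u)
   <= en C' * NI (%x. en (Phi k (\<bar>f x\<bar> / t) * v x) * NN u x)"
  if "bmo_bd \<beta> b" "u : UU" "f : LM" "LB (?A f)" "0 < t" for b u f t
 proof -
  interpret czd T CT K v m J p0 \<beta> \<epsilon> Cv Ce Ct Ck Cs UU NN b u f t by unfold_locales (use that in auto)
  obtain S kk xx where "stops (cz_hot v f t) S kk xx" using hot_stops_ex by blast
  then interpret czs T CT K v m J p0 \<beta> \<epsilon> Cv Ce Ct Ck Cs UU NN b u f t S kk xx by unfold_locales
  show ?thesis unfolding C'_def
  proof (rule combine[OF less.prems C])
   let ?I = "NI (%x. en (Phi k (\<bar>f x\<bar> / t) * v x) * NN us x)"
   let ?B = "%x. en (CC x * (P x * (1 + Ce)))"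
   have "(\<Sum>j<k. ?B j * ?I) = (\<Sum>j<k. ?B j) * ?I"
    by (rule sum_distrib_right[symmetric])
   also have "(\<Sum>j<k. ?B j) = en C" unfolding C_def
    using CC P pars by (intro sum_ennreal mult_nonneg_nonneg) (auto intro: less_imp_le)
   finally have e: "(\<Sum>j<k. ?B j * ?I) = en C * ?I" .
   show "RSI {x. t / 2 * v x < \<bar>comm T b k (?A h) x\<bar>} (?C us)
  <= en (8 * Ck / t) * NI (%x. en \<bar>f x * v x\<bar> * NN us x) + en C * ?I"
    using bad[OF less.prems CC P IH[OF _ b us] Young] unfolding e by blast
  qed
 qed
 thus ?case using C' by blast
qed

end

section \<open>Unweighted bounds for exponents below 2\<close>

lemma borel_measurable_level:
 fixes Y :: "'a::euclidean_space => ennreal"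
 assumes [measurable]: "Y : LM" and R: "Measurable.pred (borel \<Otimes>\<^sub>M lebesgue) (%p. R (fst p) (snd p))"
 shows "(%l::real. SI {x. R l x} Y) : borel_measurable borel"
proof -
 interpret sigma_finite_measure "lebesgue :: 'a measure" by (rule sigma_finite_lebesgue)
 let ?A = "borel \<Otimes>\<^sub>M lebesgue"
 have "{p : space (borel \<Otimes>\<^sub>M lebesgue). R (fst p) (snd p)} : sets ?A" (is "?S : _")
  using R by (simp add: pred_def)
 hence "(%p. Y (snd p) * indicator ?S p) : borel_measurable ?A" by measurable
 hence "(%(l, x). Y x * indicator {x. R l x} x) : borel_measurable ?A"
  by (rule measurable_cong[THEN iffD1, rotated]) (auto simp: space_pair_measure indicator_def)
 thus ?thesis by (rule borel_measurable_nn_integral)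
qed

lemma layer_tail:
 fixes F :: "'a::euclidean_space => real"
 assumes [measurable]: "F : LM" and a: "a < 2"
 shows "(\<integral>\<^sup>+l\<in>{0<..}. en (l powr (a - 3)) * NI (%x. en ((F x)^2) * indicator {x. \<bar>F x\<bar> <= l} x) \<partial>lborel)
   <= en (1 / (2 - a)) * RI (%x. \<bar>F x\<bar> powr a)"
proof -
 let ?B = "%y. NI (%x. en ((F x)^2) * indicator {x. \<bar>F x\<bar> <= y} x)"
 have "(\<integral>\<^sup>+l\<in>{0<..}. en (l powr (a - 3)) * ?B l \<partial>lborel)
  = (\<integral>\<^sup>+l. (en (l powr (a - 3)) * indicator {0<..} l) * ?B l \<partial>lborel)"
  by (intro nn_integral_cong) (auto simp: mult_ac)
 also have "... = NI (%x. en ((F x)^2) * (\<integral>\<^sup>+l. (en (l powr (a - 3)) * indicator {0<..} l) * indicator {l. \<bar>F x\<bar> <= l} l \<partial>lborel))"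
  by (rule nn_integral_level_sets) auto
 also have "... <= NI (%x. en (1 / (2 - a)) * en (\<bar>F x\<bar> powr a))"
 proof (rule nn_integral_mono, goal_cases)
  case (1 x)
  show ?case
  proof (cases "F x = 0")
   case False
   let ?A = "%y. \<integral>\<^sup>+l. (en (l powr (y - 3)) * indicator {0<..} l) * indicator {l. \<bar>F x\<bar> <= l} l \<partial>lborel"
   let ?C = "%y. \<bar>F x\<bar> powr (- (2 - y)) / (2 - y)"
   have "(?A a)
     = (\<integral>\<^sup>+l\<in>{\<bar>F x\<bar>..}. en (l powr (- (2 - a) - 1)) \<partial>lborel)"
    using False by (intro nn_integral_cong) (auto simp: indicator_def)
   also have "... = en (?C a)" using False a by (intro nn_integral_powr_inf) auto
   finally have "en ((F x)^2) * (?A a)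
    = en ((F x)^2 * (?C a))" using a by (simp add: ennreal_mult[symmetric])
   also have "(F x)^2 = \<bar>F x\<bar> powr 2" using False by (subst powr_numeral) auto
   also have "\<bar>F x\<bar> powr 2 * (?C a) = 1 / (2 - a) * \<bar>F x\<bar> powr a"
    by (simp only: powr_add[symmetric] times_divide_eq_right mult_1_left times_divide_eq_left) simp
   finally show ?thesis using a by (simp add: ennreal_mult[symmetric])
  qed simp
 qed
 also have "... = en (1 / (2 - a)) * RI (%x. \<bar>F x\<bar> powr a)" by (rule nn_integral_cmult) measurable
 finally show ?thesis .
qed

text \<open>Marcinkiewicz interpolation between weak \<open>(1,1)\<close> and strong
  \<open>(2,2)\<close>; the hypothesis \<open>w\<close> already contains the splitting of
  \<open>F\<close> at height \<open>l\<close>.\<close>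

lemma Marcinkiewicz_12:
 fixes F h :: "'a::euclidean_space => real"
 assumes [measurable]: "F : LM" "h : LM" and h0: "!!x. 0 <= h x" and a: "1 < a" "a < 2" and C: "0 <= C" "0 <= D"
  and w: "!!l. 0 < l ==> vol {x. l < h x} <= en (C / l) * RSI {x. l < \<bar>F x\<bar>} (%x. \<bar>F x\<bar>)
    + en (D / l\<^sup>2) * RSI {x. \<bar>F x\<bar> <= l} (%x. (F x)^2)"
 shows "RI (%x. h x powr a) <= en (a * (C / (a - 1) + D / (2 - a))) * RI (%x. \<bar>F x\<bar> powr a)"
proof -
 let ?I = "RI (%x. \<bar>F x\<bar> powr a)"
 let ?A = "%l. RSI {x. l < \<bar>F x\<bar>} (%x. \<bar>F x\<bar>)" and ?B = "%l. NI (%x. en ((F x)^2) * indicator {x. \<bar>F x\<bar> <= l} x)"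
 have mA [measurable]: "?A : borel_measurable borel" by (rule borel_measurable_level) measurable
 have mB [measurable]: "?B : borel_measurable borel" by (rule borel_measurable_level) measurable
 have ml: "{x. l < h x} : sets lebesgue" for l by (rule sets_less_lebesgue) auto
 have "en (1 / a) * RI (%x. h x powr a) = NI (%x. 1 * en (h x powr a / a))"
  using a by (subst nn_integral_cmult[symmetric]) (auto simp: ennreal_mult[symmetric])
 also have "... = (\<integral>\<^sup>+l\<in>{0..}. en (l powr (a - 1)) * SI {x. l < h x} (%_. 1) \<partial>lborel)"
  using a h0 by (intro nn_integral_powr_layer[symmetric]) auto
 also have "... <= (\<integral>\<^sup>+l. en C * (en (l powr (a - 1 - 1)) * ?A l * indicator {0..} l) + en D * (en (l powr (a - 3)) * ?B l * indicator {0<..} l) \<partial>lborel)"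
 proof (rule nn_integral_mono, goal_cases)
  case (1 l)
  show ?case
  proof (cases "0 < l")
   case True
   have "en (l powr (a - 1)) * SI {x. l < h x} (%_. 1) <= en (l powr (a - 1)) * (en (C / l) * ?A l + en (D / l\<^sup>2) * ?B l)"
    using w[OF True] ml[of l] by (intro mult_left_mono) (auto simp: nn_integral_indicator)
   also have "... = en (l powr (a - 1) * (C / l)) * ?A l + en (l powr (a - 1) * (D / l\<^sup>2)) * ?B l"
    using C True by (simp only: distrib_left mult.assoc[symmetric] ennreal_mult[symmetric] powr_ge_zero divide_nonneg_pos zero_less_power)
   also have "l powr (a - 1) * (C / l) = C * l powr (a - 1 - 1)" using True by (simp add: powr_diff power2_eq_square)
   also have "l powr (a - 1) * (D / l\<^sup>2) = D * l powr (a - 3)"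
   proof -
    have "l powr (a - 1) = l powr (a - 3) * l powr 2" unfolding powr_add[symmetric] by simp
    thus ?thesis using True by (simp add: powr_numeral)
   qed
   finally show ?thesis using True C by (simp add: ennreal_mult mult.assoc)
  next
   case False
   hence "l = 0 | l < 0" by auto
   thus ?thesis using a by (auto simp: indicator_def)
  qed
 qed
 also have "... = en C * (\<integral>\<^sup>+l\<in>{0..}. en (l powr (a - 1 - 1)) * ?A l \<partial>lborel) + en D * (\<integral>\<^sup>+l\<in>{0<..}. en (l powr (a - 3)) * ?B l \<partial>lborel)"
  by (subst nn_integral_add, measurable, (subst nn_integral_cmult, measurable)+)
 also have "... <= en C * (en (1 / (a - 1)) * ?I) + en D * (en (1 / (2 - a)) * ?I)"
 proof (intro add_mono mult_left_mono layer_tail)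
  let ?C = "\<integral>\<^sup>+l\<in>{0..}. en (l powr (a - 1 - 1)) * ?A l \<partial>lborel"
  let ?D = "en (1 / (a - 1))"
  have "?C = NI (%x. en \<bar>F x\<bar> * en (\<bar>F x\<bar> powr (a - 1) / (a - 1)))"
   using a by (intro nn_integral_powr_layer) auto
  also have "... = NI (%x. ?D * en (\<bar>F x\<bar> powr a))"
  proof (rule nn_integral_cong, goal_cases)
   case (1 x)
   have "\<bar>F x\<bar> * (\<bar>F x\<bar> powr (a - 1) / (a - 1)) = 1 / (a - 1) * \<bar>F x\<bar> powr a" by (cases "F x = 0") (auto simp: powr_diff)
   thus ?case
    using a by (simp add: ennreal_mult[symmetric])
  qed
  also have "... = ?D * ?I" by (rule nn_integral_cmult) measurable
  finally show "?C <= ?D * ?I" by simp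
 qed (use a in auto)
 also have "... = en (C / (a - 1) + D / (2 - a)) * ?I"
  using C a by (simp add: ennreal_plus distrib_right mult.assoc[symmetric] ennreal_mult[symmetric])
 finally have "en a * (en (1 / a) * RI (%x. h x powr a)) <= en a * (en (C / (a - 1) + D / (2 - a)) * ?I)"
  by (rule mult_left_mono) simp
 moreover have "en (a * (C / (a - 1) + D / (2 - a))) = en a * en (C / (a - 1) + D / (2 - a))"
  using a C by (intro ennreal_mult) auto
 moreover have "en a * en (1 / a) = 1" using a by (simp add: ennreal_mult[symmetric])
 ultimately show ?thesis by (simp only: mult.assoc[symmetric] mult_1_left)
qed

locale czk = czo +
 fixes \<xi>t :: "real => real" and m J :: nat and \<beta> r :: real
 assumes \<beta>: "0 < \<beta>" and J: "1 <= J" and r: "1 < r" "r < 2"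
  and sub: "!!a. r < a ==> submult \<xi>t (%x. x powr a)"
  and ker: "!!\<theta>. submult \<xi>t \<theta> ==> \<exists>C>0. kernel_bd K \<beta> m J \<theta> C"
begin

lemma bmo_bd_0: "bmo_bd \<beta> (%x::'a. 0)"
 using \<beta> by (auto simp: bmo_bd_def intro!: exI[of _ 0])

text \<open>The case \<open>v = 1\<close>, \<open>NN = 1\<close>, \<open>m = 0\<close> of the
  decomposition, with the functions \<open>0 \<le> u \<le> 1\<close> as admissible class and
  \<open>p0 = 2\<close>, where the strong bound is the boundedness on
  \<open>L\<^sup>2\<close>.\<close>

lemma weak11: "\<exists>C>0. ALL F t. LB F --> 0 < t --> vol {x. t < \<bar>T F x\<bar>} <= en (C / t) * RI (%x. \<bar>F x\<bar>)"
proof -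
 \<comment> \<open>\<open>\<theta>(x) = x^2\<close> is admissible because \<open>r < 2\<close>; its
   means are at most 1 for \<open>u \<le> 1\<close>.\<close>
 obtain Ck where Ck: "Ck > 0" and kb: "kernel_bd K \<beta> m J (%x. x powr 2) Ck" using ker[OF sub[OF r(2)]] by blast
 obtain \<epsilon> Ce where e: "\<epsilon> > 0" and Ce: "Ce > 0" and JN: "!!(b::'a => real) k x. bmo_bd \<beta> b ==>
   RSI (cell k x) (%y. exp (\<epsilon> * \<bar>b y - mid \<beta> b k x\<bar>)) <= en Ce * vol (cell k x)"
  using John_Nirenberg_cell[OF \<beta>, where 'a='a] by blast
 define UU :: "('a => real) set" where "UU = {u : LM. ALL x. 0 <= u x & u x <= 1}"
 define Ct where "Ct = (3::real) ^ DIM('a) * 2 ^ (J * DIM('a))"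
 have i1: "SI A (%x. en 1) = vol A" if "A : sets lebesgue" for A :: "'a set" using that by (simp add: nn_integral_indicator)
 interpret czw T CT K "%_. 1" 0 J 2 \<beta> \<epsilon> "2 ^ DIM('a)" Ce Ct "Ck * 2" CT UU "%_ _. 1"
 proof
  show "RSI (ball 0 R) (%x::'a. 1\<^sup>2) < \<infinity>" for R
   using emeasure_lborel_ball_finite[of "0::'a" R] by (simp add: nn_integral_indicator emeasure_completion)
  let ?A = "%y. en 1"
  show "0 < SI (cell k x) ?A" for k and x :: 'a
   unfolding i1[OF cell_lebesgue] using vol_facts(1)[of k x] by (simp only: zero_less_iff_neq_zero not_False_eq_True simp_thms)
  show "SI (cell (k - 1) x) ?A <= en (2 ^ DIM('a)) * SI (cell k x) ?A" for k and x :: 'a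
   unfolding i1[OF cell_lebesgue] vol_cell_diff1[of k x x] by simp
  show "EX k0. \<forall>k<k0. ALL x. norm x <= R --> M < SI (cell k x) (%y::'a. en 1)" if "M < \<infinity>" for R M
  proof -
   obtain M' where M': "M = en M'" "0 <= M'" using \<open>M < \<infinity>\<close> by (cases M) auto
   obtain k0 where k0: "!!k. k <= k0 ==> max 1 M' < side k" using side_big by blast
   have "M < vol (cell k x)" if "k < k0" for k and x :: 'a
   proof -
    have s: "max 1 M' < side k" using k0 that by simp
    hence "side k ^ 1 <= side k ^ DIM('a)" by (intro power_increasing) auto
    thus ?thesis using s M' unfolding emeasure_cell by (auto simp: ennreal_less_iff)
   qed
   thus ?thesis unfolding i1[OF cell_lebesgue] by blast
  qed
  show "SI (cell k x) (%y. en (exp (\<epsilon> * \<bar>b y - mid \<beta> b k x\<bar>)) * en 1) <= en Ce * SI (cell k x) ?A"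
   if "bmo_bd \<beta> b" for b k and x :: 'a using JN[OF that, of k x] unfolding i1[OF cell_lebesgue] by simp
  show "(%x. indicator E x * u x) : UU" if "u : UU" "E : sets lebesgue" for u E
   using that by (auto simp: UU_def indicator_def)
  show "RSI (nbhd (l - int J) x) (%w. u w * 1) <= en Ct * SI (cell l x) ?A * 1" if "u : UU" for u l and x :: 'a
  proof -
   have "RSI (nbhd (l - int J) x) (%w. u w * 1) <= SI (nbhd (l - int J) x) (%w. en 1)"
    using that by (intro nn_integral_mono mult_right_mono ennreal_leI) (auto simp: UU_def)
   also have "... = en Ct * vol (cell l x)" unfolding i1[OF nbhd_lebesgue] Ct_def vol_nbhd vol_cell_diff[of l J x x]
    by (simp add: ennreal_mult mult.assoc)
   finally show ?thesis unfolding i1[OF cell_lebesgue] by simp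
  qed
  show "RSI (- nbhd (l - int J) x) (%w. \<bar>K (w - y) - K (w - x)\<bar> * (\<bar>b w - mid \<beta> b l x\<bar> ^ i * u w)) <= en (Ck * 2) * 1"
   if u: "u : UU" and b: "bmo_bd \<beta> b" and i: "i <= 0" and y: "y : cell l x" for u b i l x y
  proof -
   have "RSI (- nbhd (l - int J) x) (%z. \<bar>K (1 *\<^sub>R (z - y)) - K (1 *\<^sub>R (z - x))\<bar> * (\<bar>b z - mid \<beta> b l x\<bar> ^ i * u z)) <= en (Ck * (1 + 1) * 1)"
   proof (rule kernel_bdD[OF kb _ b _ _ _ _ y])
    fix j
    let ?B = "RSI (nbhd j x) (%z. (u z / 1) powr 2)"
    have "?B <= SI (nbhd j x) (%z. en 1)"
    proof (intro nn_integral_mono mult_right_mono ennreal_leI, goal_cases)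
     case (1 z)
     have "(u z / 1) powr 2 <= 1 powr 2" using u by (intro powr_mono2) (auto simp: UU_def)
     thus ?case by simp
    qed auto
    thus "?B <= en 1 * vol (nbhd j x)" unfolding i1[OF nbhd_lebesgue] by simp
   qed (use u i in \<open>auto simp: UU_def\<close>)
   thus ?thesis by simp
  qed
  show "RI (%x. \<bar>comm T b i F x\<bar> powr 2 * (u x * 1 powr (1 - 2))) <= en CT * NI (%x. en (\<bar>F x\<bar> powr 2 * 1 powr (1 - 2)) * 1)"
   if u: "u : UU" and i: "i <= 0" and F: "LB F" for u b i F
  proof -
   have p2: "\<bar>z\<bar> powr 2 = z\<^sup>2" for z :: real by (subst powr_numeral) auto
   have "RI (%x. \<bar>comm T b i F x\<bar> powr 2 * (u x * 1 powr (1 - 2))) <= RI (%x. (T F x)^2)"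
   proof (intro nn_integral_mono ennreal_leI, goal_cases)
    case (1 x)
    have "(T F x)^2 * u x <= (T F x)^2 * 1" using u by (intro mult_left_mono) (auto simp: UU_def)
    thus ?case using i by (simp add: p2)
   qed
   also have "... <= en CT * RI (%x. (F x)^2)" by (rule T_norm[OF LB_L2[OF F]])
   finally show ?thesis by (simp add: p2)
  qed
 qed (use \<beta> e Ce Ck CT in \<open>auto simp: UU_def Ct_def\<close>)
 let ?C = "%x. %y. x y * 1"
 obtain C where C: "C > 0" and w: "!!F t. LB (?C F) ==> 0 < t ==>
   RSI {x. t * 1 < \<bar>comm T (%_. 0) 0 (?C F) x\<bar>} (%x. 1 * 1) <= en C * NI (%x. en (Phi 0 (\<bar>F x\<bar> / t) * 1) * 1)"
 proof -
  from weak_comm[of 0] obtain C where C: "C > 0" and w: "!!b u f t. bmo_bd \<beta> b ==> u : UU ==> f : LM ==> LB (?C f) ==> 0 < t ==>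
   RSI {x. t * 1 < \<bar>comm T b 0 (?C f) x\<bar>} (%x. u x * 1) <= en C * NI (%x. en (Phi 0 (\<bar>f x\<bar> / t) * 1) * 1)"
   by blast
  have "(%_. 1) : UU" by (auto simp: UU_def)
  from that[OF C w[OF bmo_bd_0 this]] show ?thesis using L2_meas[OF LB_L2] by auto
 qed
 have "vol {x. t < \<bar>T F x\<bar>} <= en (C / t) * RI (%x. \<bar>F x\<bar>)" if F: "LB F" and t: "0 < t" for F t
 proof -
  note [measurable] = L2_meas[OF LB_L2[OF F]] L2_meas[OF T_L2[OF LB_L2[OF F]]]
  have ms: "{x. t < \<bar>T F x\<bar>} : sets lebesgue" by (rule sets_less_lebesgue) measurable
  have "vol {x. t < \<bar>T F x\<bar>} = SI {x. t < \<bar>T F x\<bar>} (%x. en 1)" by (rule i1[OF ms, symmetric])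
  also have "... <= en C * RI (%x. \<bar>F x\<bar> / t)" using w[of F t] F t by (simp add: Phi_def)
  also have "... = NI (%x. en (C / t) * en \<bar>F x\<bar>)"
   using C t by (subst nn_integral_cmult[symmetric]) (auto simp: ennreal_mult[symmetric])
  also have "... = en (C / t) * RI (%x. \<bar>F x\<bar>)" by (rule nn_integral_cmult) measurable
  finally show ?thesis .
 qed
 thus ?thesis using C by blast
qed

lemma strong_12:
 assumes a: "1 < a" "a < 2"
 shows "\<exists>C>0. ALL F. LB F --> RI (%x. \<bar>T F x\<bar> powr a) <= en C * RI (%x. \<bar>F x\<bar> powr a)"
proof -
 let ?D = "%y. %x. \<bar>y x\<bar>"
 obtain C where C: "C > 0" and w: "!!F t. LB F ==> 0 < t ==> vol {x. t < \<bar>T F x\<bar>} <= en (C / t) * RI (?D F)"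
  using weak11 by blast
 define D where "D = a * (C / (a - 1) + CT / (2 - a))"
 have D: "D > 0" using a C CT by (simp add: D_def add_pos_pos)
 let ?B = "%y. RI (%x. \<bar>y x\<bar> powr a)"
 have "RI (%x. \<bar>T F x\<bar> powr a) <= en (2 powr a * D) * ?B F" if F: "LB F" for F
 proof -
  note [measurable] = L2_meas[OF LB_L2[OF F]] L2_meas[OF T_L2[OF LB_L2[OF F]]]
  \<comment> \<open>Half of \<open>T F\<close>, so that exceeding \<open>l\<close> forces
    \<open>T\<close> of one of the two pieces of \<open>F\<close> to exceed
    \<open>l\<close>.\<close>
  let ?A = "RI (%x. (\<bar>T F x\<bar> / 2) powr a)"
  have "?A <= en D * ?B F"
   unfolding D_def
  proof (rule Marcinkiewicz_12)
   fix l :: real assume l: "0 < l"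
   let ?F1 = "%x. indicator {x. l < \<bar>F x\<bar>} x * F x" and ?F2 = "%x. indicator {x. \<bar>F x\<bar> <= l} x * F x"
   have s1: "{x. l < \<bar>F x\<bar>} : sets lebesgue" by (rule sets_less_lebesgue) measurable
   have "{x. \<bar>F x\<bar> <= l} = - {x. l < \<bar>F x\<bar>}" by auto
   hence s2: "{x. \<bar>F x\<bar> <= l} : sets lebesgue" using sets.compl_sets[OF s1] by (simp add: Compl_eq_Diff_UNIV)
   have F12: "LB ?F1" "LB ?F2" using LB_indicator[OF F] s1 s2 by auto
   note [measurable] = L2_meas[OF LB_L2[OF F12(1)]] L2_meas[OF LB_L2[OF F12(2)]] L2_meas[OF T_L2[OF LB_L2[OF F12(1)]]] L2_meas[OF T_L2[OF LB_L2[OF F12(2)]]]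
   have "(%y. 1 * ?F1 y + 1 * ?F2 y) = F" by (auto simp: indicator_def)
   hence lin: "AE x in lebesgue. T F x = 1 * T ?F1 x + 1 * T ?F2 x" using T_lin[OF LB_L2[OF F12(1)] LB_L2[OF F12(2)], of 1 1] by simp
   have s3: "{x. l < \<bar>T ?F1 x\<bar>} : sets lebesgue" by (rule sets_less_lebesgue) measurable
   let ?C = "en (1 / l\<^sup>2)"
   let ?E = "vol {x. l < \<bar>T F x\<bar> / 2}"
   have "?E = SI {x. l < \<bar>T F x\<bar> / 2} (%_. 1)"
    by (simp add: nn_integral_indicator sets_less_lebesgue)
   also have "... <= NI (%x. indicator {x. l < \<bar>T ?F1 x\<bar>} x + ?C * en ((T ?F2 x)^2))"
   proof (rule nn_integral_mono_AE, use lin in eventually_elim)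
    case e: (elim x)
    show ?case
    proof (cases "l < \<bar>T F x\<bar> / 2 & ~ l < \<bar>T ?F1 x\<bar>")
     case True
     hence "l <= \<bar>T ?F2 x\<bar>" using e by linarith
     hence "l\<^sup>2 <= (T ?F2 x)^2" using l by (metis abs_le_square_iff abs_of_pos)
     hence "1 <= 1 / l\<^sup>2 * (T ?F2 x)^2" using l by (simp add: field_simps)
     hence "1 <= en (1 / l\<^sup>2 * (T ?F2 x)^2)" by simp
     thus ?thesis using True by (simp add: ennreal_mult[symmetric])
    qed (auto simp: indicator_def)
   qed
   also have "... = vol {x. l < \<bar>T ?F1 x\<bar>} + ?C * RI (%x. (T ?F2 x)^2)"
    using s3 by (subst nn_integral_add) (auto simp: nn_integral_cmult)
   also have "... <= en (C / l) * RI (%x. \<bar>?F1 x\<bar>) + ?C * (en CT * RI (%x. (?F2 x)^2))"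
    by (intro add_mono mult_left_mono w[OF F12(1) l] T_norm[OF LB_L2[OF F12(2)]]) auto
   also have "RI (%x. \<bar>?F1 x\<bar>) = RSI {x. l < \<bar>F x\<bar>} (?D F)" by (intro nn_integral_cong) (auto simp: indicator_def)
   also have "RI (%x. (?F2 x)^2) = RSI {x. \<bar>F x\<bar> <= l} (%x. (F x)^2)" by (intro nn_integral_cong) (auto simp: indicator_def)
   finally show "?E <= en (C / l) * RSI {x. l < \<bar>F x\<bar>} (?D F) + en (CT / l\<^sup>2) * RSI {x. \<bar>F x\<bar> <= l} (%x. (F x)^2)"
    using l CT by (simp add: mult.assoc[symmetric] ennreal_mult[symmetric])
  qed (use a C CT in auto)
  hence "en (2 powr a) * ?A <= en (2 powr a) * (en D * ?B F)"
   by (rule mult_left_mono) simp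
  moreover have "en (2 powr a) * ?A = RI (%x. \<bar>T F x\<bar> powr a)"
   by (subst nn_integral_cmult[symmetric]) (auto simp: ennreal_mult[symmetric] powr_divide)
  ultimately show ?thesis using D by (simp add: ennreal_mult mult.assoc)
 qed
 moreover have "2 powr a * D > 0" using D by simp
 ultimately show ?thesis by blast
qed

end

section \<open>Oscillation of commutators over cells\<close>

lemma prod_le_powr:
 fixes x y a :: real
 assumes "0 <= x" "0 <= y" "1 < a" shows "x * y <= x powr (a / (a - 1)) + y powr a"
proof -
 have p: "1 < a / (a - 1)" using assms by (simp add: less_divide_eq)
 have "x * y <= x powr (a / (a - 1)) / (a / (a - 1)) + y powr a / a"
  using assms p by (intro Youngs_inequality) (auto simp: field_simps)
 also have "... <= x powr (a / (a - 1)) / 1 + y powr a / 1" using assms p by (intro add_mono divide_left_mono) auto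
 finally show ?thesis by simp
qed

lemma sum_powr_le:
 fixes x :: "'i => real"
 assumes "finite I" "!!i. i : I ==> 0 <= x i" "0 < q"
 shows "(\<Sum>i\<in>I. x i) powr q <= real (card I) powr q * (\<Sum>i\<in>I. x i powr q)"
proof (cases "I = {}")
 case False
 define M where "M = Max (x ` I)"
 have "M : x ` I" unfolding M_def using False assms(1) by (intro Max_in) auto
 then obtain i where i: "i : I" "x i = M" by blast
 have "(\<Sum>i\<in>I. x i) <= real (card I) * M" by (rule sum_bounded_above) (use assms in \<open>auto simp: M_def\<close>)
 hence "(\<Sum>i\<in>I. x i) powr q <= (real (card I) * M) powr q" using assms by (intro powr_mono2 sum_nonneg) auto
 also have "... = real (card I) powr q * x i powr q" using i assms(2)[of i] by (simp add: powr_mult)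
 also have "... <= real (card I) powr q * (\<Sum>i\<in>I. x i powr q)" using i assms by (intro mult_left_mono member_le_sum) auto
 finally show ?thesis .
qed simp

lemma LB_powr_finite:
 assumes F: "LB F" and a: "1 <= a" "a <= 2" shows "RI (%x. \<bar>F x\<bar> powr a) < \<infinity>"
proof -
 note [measurable] = L2_meas[OF LB_L2[OF F]]
 have "RI (%x. \<bar>F x\<bar> powr a) <= NI (%x. en \<bar>F x\<bar> + en ((F x)^2))"
 proof (rule nn_integral_mono, goal_cases)
  case (1 x)
  have "\<bar>F x\<bar> powr a <= \<bar>F x\<bar> + (F x)^2"
  proof (cases "\<bar>F x\<bar> <= 1")
   case True
   hence "\<bar>F x\<bar> powr a <= \<bar>F x\<bar> powr 1" using a by (intro powr_mono') auto
   thus ?thesis by (simp add: add_increasing2)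
  next
   case False
   hence "\<bar>F x\<bar> powr a <= \<bar>F x\<bar> powr 2" using a by (intro powr_mono) auto
   thus ?thesis using False by (simp add: powr_numeral)
  qed
  thus ?case by (simp flip: ennreal_plus)
 qed
 also have "... = RI (%x. \<bar>F x\<bar>) + RI (%x. (F x)^2)" by (rule nn_integral_add) auto
 also have "... < \<infinity>" using LB_integral[OF F] L2_finite[OF LB_L2[OF F]] by simp
 finally show ?thesis .
qed

text \<open>The representation holds almost everywhere only, so the reference point
  \<open>y0\<close> is chosen among the points of the cell where it holds.\<close>

lemma (in czo) T_far_osc:
 assumes h: "LB h" and h0: "!!z. z : nbhd (l - int j) x ==> h z = 0"
 shows "\<exists>y0\<in>cell l x. AE y in lebesgue. y : cell l x --> en \<bar>T h y - T h y0\<bar> <= RI (%z. \<bar>K (y - z) - K (y0 - z)\<bar> * \<bar>h z\<bar>)"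
proof -
 let ?P = "%y. integrable lebesgue (%z. K (y - z) * h z) & T h y = (LINT z|lebesgue. K (y - z) * h z)"
 have out: "y ~: supp h" if y: "y : cell l x" for y
 proof
  assume "y : supp h"
  then obtain z where z: "h z ~= 0" "dist z y < side l" unfolding supp_def closure_approachable using side_pos by blast
  hence "z : nbhd l y" by (intro nbhdI_norm) (simp add: dist_norm)
  hence "z : nbhd (l - int j) x" using nbhd_eq[OF y] nbhd_antimono[of "l - int j" l x] by auto
  thus False using z h0 by blast
 qed
 have P: "AE y in lebesgue. y : cell l x --> ?P y" using T_rep[OF h] by eventually_elim (use out in blast)
 have "\<exists>y0\<in>cell l x. ?P y0"
 proof (rule ccontr)
  assume "~ ?thesis"
  hence "AE y in lebesgue. y ~: cell l x" using P by (auto elim: eventually_mono)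
  hence "vol (cell l x) = 0" by (subst (asm) AE_iff_measurable[OF cell_lebesgue]) auto
  thus False using vol_facts(1) by blast
 qed
 then obtain y0 where y0: "y0 : cell l x" "?P y0" by blast
 have "AE y in lebesgue. y : cell l x --> en \<bar>T h y - T h y0\<bar> <= RI (%z. \<bar>K (y - z) - K (y0 - z)\<bar> * \<bar>h z\<bar>)"
  using P
 proof (eventually_elim, intro impI)
  fix y assume "y : cell l x --> ?P y" "y : cell l x"
  hence y: "?P y" by blast
  note i = y[THEN conjunct1] y0(2)[THEN conjunct1]
  let ?A = "RI (%z. \<bar>K (y - z) - K (y0 - z)\<bar> * \<bar>h z\<bar>)"
  have "en \<bar>T h y - T h y0\<bar> = en (norm (LINT z|lebesgue. K (y - z) * h z - K (y0 - z) * h z))"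
   using y y0 Bochner_Integration.integral_diff[OF i] by simp
  also have "... <= RI (%z. norm (K (y - z) * h z - K (y0 - z) * h z))"
   by (rule integral_norm_bound_ennreal[OF Bochner_Integration.integrable_diff[OF i]])
  also have "... = ?A"
   by (simp add: left_diff_distrib[symmetric] abs_mult)
  finally show "en \<bar>T h y - T h y0\<bar> <= ?A" .
 qed
 thus ?thesis using y0 by blast
qed

context czk begin

lemma bdm_bd: "bmo_bd \<beta> b ==> bdm b" by (simp add: bmo_bd_def bdm_def)

text \<open>A qualitative bound, depending on the supremum of \<open>b\<close>; it serves the
  finiteness hypotheses of the Fefferman-Stein estimate.\<close>

lemma comm_powr_finite:
 assumes b: "bdm b" and a: "1 < a" "a < 2"
 shows "LB F ==> RI (%x. \<bar>comm T b k F x\<bar> powr a) < \<infinity>"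
proof (induction k arbitrary: F)
 case 0
 obtain C where "RI (%x. \<bar>T F x\<bar> powr a) <= en C * RI (%x. \<bar>F x\<bar> powr a)" using strong_12[OF a] 0 by blast
 also have "... < \<infinity>" using LB_powr_finite[OF 0, of a] a by (simp add: ennreal_mult_less_top)
 finally show ?case by simp
next
 case (Suc k)
 obtain M where M: "M > 0" "!!x. \<bar>b x\<bar> <= M" using bdmE[OF b] by blast
 have bF: "LB (%y. b y * F y)" by (rule LB_mult_bdm[OF b Suc.prems])
 let ?f = "comm T b k F" and ?g = "comm T b k (%y. b y * F y)"
 note [measurable] = L2_meas[OF L2_comm[OF b LB_L2[OF Suc.prems], of k]] L2_meas[OF L2_comm[OF b LB_L2[OF bF], of k]]
 have "\<bar>comm T b (Suc k) F x\<bar> powr a <= 2 powr a * M powr a * \<bar>?f x\<bar> powr a + 2 powr a * \<bar>?g x\<bar> powr a" for x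
 proof -
  have "\<bar>comm T b (Suc k) F x\<bar> <= \<bar>b x * ?f x\<bar> + \<bar>?g x\<bar>" by simp
  also have "\<bar>b x * ?f x\<bar> <= M * \<bar>?f x\<bar>" unfolding abs_mult by (intro mult_right_mono M) auto
  finally have "\<bar>comm T b (Suc k) F x\<bar> powr a <= (\<Sum>i\<in>{True, False}. if i then M * \<bar>?f x\<bar> else \<bar>?g x\<bar>) powr a"
   using a by (intro powr_mono2) auto
  also have "... <= 2 powr a * ((M * \<bar>?f x\<bar>) powr a + \<bar>?g x\<bar> powr a)"
   using sum_powr_le[of "{True, False}" "%i. if i then M * \<bar>?f x\<bar> else \<bar>?g x\<bar>" a] M a by simp
  finally show ?thesis using M by (simp add: powr_mult algebra_simps)
 qed
 hence "RSI UNIV (%x. \<bar>comm T b (Suc k) F x\<bar> powr a) <= en (2 powr a * M powr a) * RSI UNIV (%x. \<bar>?f x\<bar> powr a) + en (2 powr a) * RSI UNIV (%x. \<bar>?g x\<bar> powr a)"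
  using M by (intro RSI_le_lincomb AE_I2) auto
 hence "RI (%x. \<bar>comm T b (Suc k) F x\<bar> powr a) <= en (2 powr a * M powr a) * RI (%x. \<bar>?f x\<bar> powr a) + en (2 powr a) * RI (%x. \<bar>?g x\<bar> powr a)" by (simp del: comm.simps)
 also have "... < \<infinity>" using Suc.IH[OF Suc.prems] Suc.IH[OF bF] by (simp add: ennreal_mult_less_top)
 finally show ?case .
qed

text \<open>Index shift: entry 0 is \<open>F\<close>, entry \<open>j\<close> the commutator of order
  \<open>j - 1\<close>; up to \<open>k\<close> these are \<open>F\<close> and all orders below
  \<open>k\<close>.\<close>

definition "hh b F j = (if j = 0 then F else comm T b (j - 1) F)"

text \<open>With \<open>B = b - mid\<close>, the expansion of \<open>T (B^k F)\<close> is solved for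
  the commutator of order \<open>k\<close>. The near part of \<open>F\<close> is controlled by the
  strong bound at an exponent \<open>a0 < a\<close>, the far part by the smoothness of the kernel,
  and the lower orders by Young's inequality, since all powers of \<open>B\<close> have bounded
  means.\<close>

lemma sharp:
 assumes a: "r < a" "a < 2" and k: "k <= m"
 shows "\<exists>C>0. \<forall>b F x l \<rho>. bmo_bd \<beta> b --> LB F --> 0 < \<rho> --> Mnbhd (%y. en (\<Sum>j\<le>k. \<bar>hh b F j y\<bar> powr a)) x <= en (\<rho> powr a) -->
   (EX c. RSI (cell l x) (%y. \<bar>comm T b k F y - c\<bar>) <= en (C * \<rho>) * vol (cell l x))"
proof -
 have a1: "1 < a" using a r by simp
 \<comment> \<open>Strictly between 1 and \<open>a\<close>: the gap leaves room to separate
   \<open>B^k\<close> from \<open>F\<close> by Young's inequality.\<close>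
 define a0 where "a0 = (1 + a) / 2"
 have a0: "1 < a0" "a0 < a" "a0 < 2" using a a1 by (auto simp: a0_def)
 define q where "q = a / a0"
 have q: "1 < q" "a0 * q = a" using a0 by (auto simp: q_def)
 define e1 where "e1 = a / (a - 1)"
 define e2 where "e2 = a0 * (q / (q - 1))"
 have e: "0 < e1" "0 < e2" using a1 q a0 by (auto simp: e1_def e2_def)
 \<comment> \<open>Dominates every power of \<open>B\<close> produced below.\<close>
 define N where "N = real m * (e1 + e2) + 1"
 have N: "0 < N" using e by (simp add: N_def add_nonneg_pos)
 obtain A where A: "A > 0" and JN: "!!(b::'a => real) k x. bmo_bd \<beta> b ==>
   RSI (nbhd k x) (%y. (1 + \<bar>b y - mid \<beta> b k x\<bar>) powr N) <= en A * vol (nbhd k x)"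
  using John_Nirenberg_powr[OF \<beta> N, where 'a='a] by blast
 obtain C0 where C0: "C0 > 0" and T0: "!!F. LB F ==> RI (%x. \<bar>T F x\<bar> powr a0) <= en C0 * RI (%x. \<bar>F x\<bar> powr a0)"
  using strong_12[OF a0(1,3)] by blast
 obtain Ck where Ck: "Ck > 0" and kb: "kernel_bd K \<beta> m J (%x. x powr a) Ck" using ker[OF sub[OF a(1)]] by blast
 define D where "D = 1 + real J * ((1 + 2 ^ DIM('a)) * \<beta>)"
 have D: "1 <= D" using \<beta> by (simp add: D_def)
 define V0 where "V0 = (3::real) ^ DIM('a) * 2 ^ (J * DIM('a))"
 have V0: "V0 > 0" by (simp add: V0_def)
 define A' where "A' = D powr N * A + 1"
 have A': "A' > 0" using A by (simp add: A'_def add_nonneg_pos)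
 define C where "C = (1 + 2 ^ k * (A' * V0) + C0 * (A' * V0)) + 2 * Ck"
 have C: "C > 0" using A' V0 C0 Ck by (simp add: C_def add_pos_pos)
 have "EX c. RSI (cell l x) (%y. \<bar>comm T b k F y - c\<bar>) <= en (C * \<rho>) * vol (cell l x)"
  if b: "bmo_bd \<beta> b" and F: "LB F" and \<rho>: "0 < \<rho>" and M: "Mnbhd (%y. en (\<Sum>j\<le>k. \<bar>hh b F j y\<bar> powr a)) x <= en (\<rho> powr a)"
  for b F x l \<rho>
 proof -
  have bb: "bdm b" by (rule bdm_bd[OF b])
  have hhL: "L2 (hh b F j)" for j unfolding hh_def using L2_comm[OF bb LB_L2[OF F]] LB_L2[OF F] by auto
  note [measurable] = L2_meas[OF hhL] L2_meas[OF LB_L2[OF F]] bdm_meas[OF bb]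
  define d where "d = mid \<beta> b l x"
  define B where "B y = b y - d" for y
  have Bb: "bdm B" unfolding B_def[abs_def] by (intro bdm_diff bb bdm_const)
  note [measurable] = bdm_meas[OF Bb]
  define G where "G y = (\<Sum>j\<le>k. (\<bar>hh b F j y\<bar> / \<rho>) powr a)" for y
  have Gm [measurable]: "G : LM" unfolding G_def by measurable
  have G0: "0 <= G y" for y unfolding G_def by (intro sum_nonneg) auto
  have Gj: "j <= k ==> (\<bar>hh b F j y\<bar> / \<rho>) powr a <= G y" for j y unfolding G_def by (intro member_le_sum) auto
  have Gavg: "RSI (nbhd j x) G <= vol (nbhd j x)" for j
  proof -
   let ?g = "%y. en (\<Sum>j\<le>k. \<bar>hh b F j y\<bar> powr a)"
   have "en (\<rho> powr a) * RSI (nbhd j x) G = NI (%y. en (\<rho> powr a) * (en (G y) * indicator (nbhd j x) y))"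
    by (rule nn_integral_cmult[symmetric]) measurable
   also have "... = SI (nbhd j x) ?g"
   proof (rule nn_integral_cong, goal_cases)
    case (1 y)
    have "\<rho> powr a * G y = (\<Sum>j\<le>k. \<bar>hh b F j y\<bar> powr a)" unfolding G_def sum_distrib_left using \<rho> by (simp add: powr_divide)
    thus ?case
     using G0[of y] by (simp add: ennreal_mult[symmetric] mult.assoc[symmetric])
   qed
   also have "... <= en (\<rho> powr a) * vol (nbhd j x)" using M unfolding Mnbhd_le_iff by blast
   finally show ?thesis using \<rho> by (subst (asm) ennreal_mult_le_mult_iff) auto
  qed
  define E where "E = nbhd (l - int J) x"
  have Em [measurable]: "E : sets lebesgue" by (simp add: E_def)
  have QE: "cell l x <= E" using cell_le_nbhd[of l x] nbhd_antimono[of "l - int J" l x] by (auto simp: E_def)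
  have volE: "vol E = en V0 * vol (cell l x)" unfolding E_def V0_def vol_nbhd vol_cell_diff[of l J x x] by (simp add: ennreal_mult mult.assoc)
  let ?M = "%x. 1 + \<bar>B x\<bar>"
  \<comment> \<open>Collects what Young's inequality leaves over: a power of the oscillation of
    \<open>b\<close> and the sum of the normalized \<open>a\<close>-th powers.\<close>
  define H where "H y = (?M y) powr N + G y" for y
  have [measurable]: "H : LM" unfolding H_def by measurable
  have H0: "0 <= H y" for y using G0 by (simp add: H_def)
  have HE: "RSI E H <= en (A' * V0) * vol (cell l x)"
  proof -
   let ?d = "mid \<beta> b (l - int J) x"
   let ?I = "%x. 1 + \<bar>b x - ?d\<bar>"
   have "H y <= D powr N * (?I y) powr N + 1 * G y" for y
   proof -
    have "\<bar>?d - d\<bar> <= D - 1" unfolding d_def D_def using mid_diff_nat[OF b, of l x J] \<beta> by (simp add: abs_minus_commute)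
    hence "1 + \<bar>B y\<bar> <= D + \<bar>b y - ?d\<bar>" unfolding B_def by linarith
    also have "... <= D + D * \<bar>b y - ?d\<bar>" using mult_right_mono[OF D, of "\<bar>b y - ?d\<bar>"] by simp
    finally have "(?M y) powr N <= (D * (?I y)) powr N" using N by (intro powr_mono2) (auto simp: algebra_simps)
    thus ?thesis using D by (simp add: powr_mult H_def)
   qed
   hence "RSI E H <= en (D powr N) * RSI E (%y. (?I y) powr N) + en 1 * RSI E G" by (intro RSI_le_lincomb AE_I2) auto
   also have "... = en (D powr N) * RSI E (%y. (?I y) powr N) + RSI E G" by simp
   also have "... <= en (D powr N) * (en A * vol E) + vol E"
    unfolding E_def by (intro add_mono mult_left_mono JN b Gavg) auto
   also have "... = en A' * vol E"
    using A D by (simp add: A'_def ennreal_plus ennreal_mult distrib_right mult.assoc)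
   finally show ?thesis unfolding volE using A' V0 by (simp add: ennreal_mult mult.assoc)
  qed
  have pw: "(\<bar>B y\<bar> ^ n) powr s <= (?M y) powr N" if "n <= k" "0 < s" "s <= e1 + e2" for n s y
  proof (cases "n = 0 | B y = 0")
   case True
   hence "(\<bar>B y\<bar> ^ n) powr s <= 1" using that by (cases "n = 0") (auto simp: power_0_left)
   also have "1 <= (?M y) powr N" using N by (intro ge_one_powr_ge_zero) auto
   finally show ?thesis .
  next
   case False
   hence "(\<bar>B y\<bar> ^ n) powr s = \<bar>B y\<bar> powr (real n * s)" by (simp add: powr_realpow[symmetric] powr_powr)
   also have "... <= (1 + \<bar>B y\<bar>) powr (real n * s)" using that by (intro powr_mono2) auto
   also have "... <= (1 + \<bar>B y\<bar>) powr N"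
   proof (intro powr_mono)
    have "real n * s <= real m * (e1 + e2)" using that k by (intro mult_mono) auto
    thus "real n * s <= N" by (simp add: N_def)
   qed auto
   finally show ?thesis .
  qed
  define F1 where "F1 y = B y ^ k * (indicator E y * F y)" for y
  define F2 where "F2 y = B y ^ k * (indicator (- E) y * F y)" for y
  have mE [measurable]: "- E : sets lebesgue" unfolding E_def by (rule compl_nbhd)
  have F12: "LB F1" "LB F2" unfolding F1_def[abs_def] F2_def[abs_def] by (intro LB_mult_bdm bdm_power Bb LB_indicator F Em mE)+
  note [measurable] = L2_meas[OF LB_L2[OF F12(1)]] L2_meas[OF LB_L2[OF F12(2)]] L2_meas[OF T_L2[OF LB_L2[OF F12(1)]]] L2_meas[OF T_L2[OF LB_L2[OF F12(2)]]]
  obtain y0 where y0: "y0 : cell l x" and osc: "AE y in lebesgue. y : cell l x --> en \<bar>T F2 y - T F2 y0\<bar> <= RI (%z. \<bar>K (y - z) - K (y0 - z)\<bar> * \<bar>F2 z\<bar>)"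
   using T_far_osc[OF F12(2), of l J x] by (auto simp: F2_def E_def)
  let ?B = "%x. RI (%z. \<bar>K (x - z) - K (y0 - z)\<bar> * \<bar>F2 z\<bar>)"
  have far: "?B y <= en (2 * Ck * \<rho>)" if y: "y : cell l x" for y
  proof -
   have "y : cell l y0" using y cell_eq[OF y0] by simp
   \<comment> \<open>Reflected kernel, \<open>\<Lambda> = \<rho>\<close> and \<open>A0 = 1\<close>:
     the means of \<open>(\<bar>F\<bar> / \<rho>) powr a\<close> are at most 1 by the assumption on
     \<open>Mnbhd\<close>.\<close>
   note kk = kernel_bdD[OF kb _ b _ _ \<rho> _ this k, of "-1" "%z. \<bar>F z\<bar>" 1]
   let ?A = "RSI (- nbhd (l - int J) y0) (%z. \<bar>K ((-1) *\<^sub>R (z - y)) - K ((-1) *\<^sub>R (z - y0))\<bar> * (\<bar>b z - mid \<beta> b l y0\<bar> ^ k * \<bar>F z\<bar>))"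
   have "?A <= en (Ck * (1 + 1) * \<rho>)"
   proof (rule kk)
    fix j assume j: "j <= l"
    have "y0 : cell j x" using y0 cell_antimono[OF j] by blast
    note nb = nbhd_eq[OF this]
    let ?J = "%z. (\<bar>F z\<bar> / \<rho>) powr a"
    have "RSI (nbhd j x) ?J <= RSI (nbhd j x) G"
     using Gj[of 0] by (intro nn_integral_mono mult_right_mono ennreal_leI) (auto simp: hh_def)
    thus "RSI (nbhd j y0) ?J <= en 1 * vol (nbhd j y0)"
     unfolding nb using Gavg[of j] by (simp add: order_trans)
   qed auto
   moreover have "?B y = ?A"
   proof (rule nn_integral_cong, goal_cases)
    case (1 z)
    have "y0 : cell (l - int J) x" using y0 cell_antimono[of "l - int J" l x] by auto
    from nbhd_eq[OF this] mid_eq[OF y0, of \<beta> b]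
    show ?case
     by (auto simp: F2_def B_def d_def E_def abs_mult power_abs indicator_def)
   qed
   ultimately show ?thesis by (simp add: mult_ac)
  qed
  let ?C = "vol (cell l x)"
  have loc: "RSI (cell l x) (%y. (\<bar>T F1 y\<bar> / \<rho>) powr a0) <= en (C0 * (A' * V0)) * ?C"
  proof -
   let ?F = "en (\<rho> powr - a0)"
   have "RSI (cell l x) (%y. (\<bar>T F1 y\<bar> / \<rho>) powr a0) <= NI (%y. ?F * en (\<bar>T F1 y\<bar> powr a0))"
    using \<rho> by (intro nn_integral_mono) (auto simp: indicator_def powr_divide powr_minus_divide ennreal_mult[symmetric])
   also have "... = ?F * RI (%y. \<bar>T F1 y\<bar> powr a0)" by (rule nn_integral_cmult) measurable
   also have "... <= ?F * (en C0 * RI (%y. \<bar>F1 y\<bar> powr a0))" by (intro mult_left_mono T0 F12) auto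
   also have "... = en C0 * NI (%y. ?F * en (\<bar>F1 y\<bar> powr a0))"
    by (subst nn_integral_cmult) (auto simp: mult_ac)
   also have "... <= en C0 * RSI E H"
   proof (intro mult_left_mono nn_integral_mono, goal_cases)
    case (1 y)
    let ?H = "\<bar>F y\<bar> / \<rho>"
    let ?K = "\<bar>B y\<bar> ^ k"
    have "\<rho> powr - a0 * (\<bar>B y\<bar> ^ k * \<bar>F y\<bar>) powr a0 = ?K powr a0 * ?H powr a0"
     using \<rho> by (simp add: powr_mult powr_divide powr_minus_divide)
    also have "... <= (?K powr a0) powr (q / (q - 1)) + (?H powr a0) powr q" by (intro prod_le_powr q) auto
    also have "... = ?K powr e2 + ?H powr a" by (simp add: powr_powr e2_def q)
    also have "... <= H y" unfolding H_def using Gj[of 0 y] e by (intro add_mono pw) (auto simp: hh_def)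
    finally show ?case
     by (auto simp: F1_def indicator_def abs_mult power_abs ennreal_mult[symmetric] intro!: ennreal_leI)
   qed auto
   also have "... <= en C0 * (en (A' * V0) * ?C)" by (intro mult_left_mono HE) auto
   finally show ?thesis using C0 A' V0 by (simp add: ennreal_mult mult.assoc)
  qed
  have sh: "AE y in lebesgue. ALL j. comm T B j F y = comm T b j F y"
   unfolding AE_all_countable B_def[abs_def] using comm_shift[OF bb LB_L2[OF F]] by blast
  let ?E = "%y. B y ^ k * F y"
  have "(%y. 1 * F1 y + 1 * F2 y) = ?E" by (auto simp: F1_def F2_def indicator_def)
  hence lin: "AE y in lebesgue. T ?E y = 1 * T F1 y + 1 * T F2 y"
   using T_lin[OF LB_L2[OF F12(1)] LB_L2[OF F12(2)], of 1 1] by simp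
  \<comment> \<open>The far part at \<open>y0\<close>, with the sign that the top commutator carries
    in the expansion.\<close>
  define c where "c = (-1) ^ k * T F2 y0"
  let ?D = "%y. indicator (cell l x) y"
  have "RSI (cell l x) (%y. \<bar>comm T b k F y - c\<bar>)
    <= NI (%y. en (\<rho> + 2 * Ck * \<rho>) * ?D y + en \<rho> * (en ((\<bar>T F1 y\<bar> / \<rho>) powr a0) * ?D y)
     + en (\<rho> * 2 ^ k) * (en (H y) * indicator E y))"
  proof (rule nn_integral_mono_AE, use sh lin osc in eventually_elim)
   fix y assume sh: "ALL j. comm T B j F y = comm T b j F y" and lin: "T ?E y = 1 * T F1 y + 1 * T F2 y"
    and osc: "y : cell l x --> en \<bar>T F2 y - T F2 y0\<bar> <= ?B y"
   show "en \<bar>comm T b k F y - c\<bar> * ?D y <= en (\<rho> + 2 * Ck * \<rho>) * ?D y + en \<rho> * (en ((\<bar>T F1 y\<bar> / \<rho>) powr a0) * ?D y)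
     + en (\<rho> * 2 ^ k) * (en (H y) * indicator E y)"
   proof (cases "y : cell l x")
    case y: True
    have o: "\<bar>T F2 y - T F2 y0\<bar> <= 2 * Ck * \<rho>"
    proof -
     have "en \<bar>T F2 y - T F2 y0\<bar> <= en (2 * Ck * \<rho>)" using osc far[OF y] y by (auto intro: order_trans)
     thus ?thesis using Ck \<rho> by (subst (asm) ennreal_le_iff) auto
    qed
    have t: "\<bar>T F1 y\<bar> <= \<rho> + \<rho> * (\<bar>T F1 y\<bar> / \<rho>) powr a0"
    proof (cases "\<bar>T F1 y\<bar> <= \<rho>")
     case True thus ?thesis using \<rho> by (simp add: add_increasing2)
    next
     case False
     hence "(\<bar>T F1 y\<bar> / \<rho>) powr 1 <= (\<bar>T F1 y\<bar> / \<rho>) powr a0" using \<rho> a0 by (intro powr_mono) auto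
     hence "\<rho> * (\<bar>T F1 y\<bar> / \<rho>) <= \<rho> * (\<bar>T F1 y\<bar> / \<rho>) powr a0" using \<rho> by (intro mult_left_mono) auto
     thus ?thesis using \<rho> by simp
    qed
    define Sg where "Sg = (\<Sum>j<k. real (k choose j) * ((-1) ^ j * B y ^ (k - j) * comm T b j F y))"
    have "T ?E y = (\<Sum>j\<le>k. real (k choose j) * ((-1) ^ j * B y ^ (k - j) * comm T b j F y))"
     using comm_power_right[of T B 0 k F y] sh by simp
    also have "... = Sg + (-1) ^ k * comm T b k F y" unfolding Sg_def lessThan_Suc_atMost[symmetric] by simp
    finally have id: "(-1) ^ k * comm T b k F y = T F1 y + T F2 y - Sg" using lin by simp
    have Sg: "\<bar>Sg\<bar> <= \<rho> * 2 ^ k * H y"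
    proof -
     let ?L = "\<rho> * H y"
     have "\<bar>Sg\<bar> <= (\<Sum>j<k. real (k choose j) * ?L)" unfolding Sg_def
     proof (intro order_trans[OF sum_abs] sum_mono)
      fix j assume j: "j : {..<k}"
      let ?G = "\<bar>comm T b j F y\<bar> / \<rho>"
      have "\<bar>B y\<bar> ^ (k - j) * ?G <= (\<bar>B y\<bar> ^ (k - j)) powr e1 + ?G powr a"
       unfolding e1_def using \<rho> a1 by (intro prod_le_powr) auto
      also have "... <= H y" unfolding H_def using Gj[of "Suc j" y] j e by (intro add_mono pw) (auto simp: hh_def)
      finally have "\<rho> * (\<bar>B y\<bar> ^ (k - j) * ?G) <= \<rho> * H y" using \<rho> by (intro mult_left_mono) auto
      hence "\<bar>B y\<bar> ^ (k - j) * \<bar>comm T b j F y\<bar> <= \<rho> * H y" using \<rho> by simp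
      thus "\<bar>real (k choose j) * ((-1) ^ j * B y ^ (k - j) * comm T b j F y)\<bar> <= real (k choose j) * ?L"
       by (simp add: abs_mult power_abs mult_left_mono)
     qed
     also have "... = real (\<Sum>j<k. k choose j) * ?L" by (simp add: sum_distrib_right)
     also have "... <= real (2 ^ k) * ?L"
     proof (intro mult_right_mono of_nat_mono)
      have "(\<Sum>j<k. k choose j) <= (\<Sum>j\<le>k. k choose j)" by (intro sum_mono2) auto
      thus "(\<Sum>j<k. k choose j) <= 2 ^ k" by (simp add: choose_row_sum)
     qed (use \<rho> H0 in auto)
     finally show ?thesis by (simp add: mult_ac)
    qed
    have "\<bar>comm T b k F y - c\<bar> = \<bar>(-1) ^ k * (comm T b k F y - c)\<bar>" by (simp add: abs_mult power_abs)
    also have "(-1) ^ k * (comm T b k F y - c) = T F1 y + (T F2 y - T F2 y0) - Sg"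
     unfolding right_diff_distrib id c_def by (simp add: mult.assoc[symmetric] power_add[symmetric] flip: power_mult_distrib)
    also have "\<bar>T F1 y + (T F2 y - T F2 y0) - Sg\<bar> <= (\<rho> + 2 * Ck * \<rho>) + \<rho> * (\<bar>T F1 y\<bar> / \<rho>) powr a0 + \<rho> * 2 ^ k * H y" using o t Sg by linarith
    finally have "en \<bar>comm T b k F y - c\<bar> <= en ((\<rho> + 2 * Ck * \<rho>) + \<rho> * (\<bar>T F1 y\<bar> / \<rho>) powr a0 + \<rho> * 2 ^ k * H y)" by (rule ennreal_leI)
    thus ?thesis using y QE \<rho> Ck H0[of y] by (simp add: ennreal_plus ennreal_mult subset_iff)
   qed simp
  qed
  also have "... = en (\<rho> + 2 * Ck * \<rho>) * ?C + en \<rho> * RSI (cell l x) (%y. (\<bar>T F1 y\<bar> / \<rho>) powr a0) + en (\<rho> * 2 ^ k) * RSI E H"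
  proof -
   have m [measurable]: "(%y. en ((\<bar>T F1 y\<bar> / \<rho>) powr a0) * ?D y) : LM" "(%y. en (H y) * indicator E y) : LM" by measurable
   have "NI (%y. c1 * indicator Q y + c2 * q2 y + c3 * q3 y) = c1 * vol Q + c2 * NI q2 + c3 * NI q3"
    if [measurable]: "q2 : LM" "q3 : LM" "Q : sets lebesgue" for q2 q3 Q and c1 c2 c3 :: ennreal
    by (subst nn_integral_add, measurable, subst nn_integral_add, measurable) (simp add: nn_integral_cmult nn_integral_cmult_indicator del: emeasure_completion)
   from this[OF m cell_lebesgue] show ?thesis .
  qed
  also have "... <= en (\<rho> + 2 * Ck * \<rho>) * ?C + en \<rho> * (en (C0 * (A' * V0)) * ?C) + en (\<rho> * 2 ^ k) * (en (A' * V0) * ?C)"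
   by (rule add_mono[OF add_mono[OF order_refl mult_left_mono[OF loc]] mult_left_mono[OF HE]]) (rule zero_le)+
  also have "... = (en (\<rho> + 2 * Ck * \<rho>) + en (\<rho> * (C0 * (A' * V0))) + en (\<rho> * 2 ^ k * (A' * V0))) * ?C"
   using \<rho> C0 A' V0 by (simp add: ennreal_mult distrib_right mult.assoc)
  also have "... = en (C * \<rho>) * ?C"
  proof -
   have "C * \<rho> = (\<rho> + 2 * Ck * \<rho>) + \<rho> * (C0 * (A' * V0)) + \<rho> * 2 ^ k * (A' * V0)" by (simp add: C_def algebra_simps)
   moreover have "0 <= \<rho> + 2 * Ck * \<rho>" "0 <= \<rho> * (C0 * (A' * V0))" "0 <= \<rho> * 2 ^ k * (A' * V0)" using \<rho> C0 A' V0 Ck by auto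
   ultimately show ?thesis by (simp only: ennreal_plus add_nonneg_nonneg)
  qed
  finally show ?thesis by blast
 qed
 thus ?thesis using C by blast
qed

end

section \<open>The weighted strong bound\<close>

context czk begin

definition "Wt \<kappa> U x = en (enn2real (Mnbhd (%y. en (U y powr \<kappa>)) x) powr (1 / \<kappa>))"

lemma Mnbhd_bounded:
 assumes "!!y. 0 <= U y & U y <= M" and \<kappa>: "1 < \<kappa>"
 shows "Mnbhd (%y. en (U y powr \<kappa>)) x <= en (M powr \<kappa>)"
 unfolding Mnbhd_le_iff
proof
 fix k
 have "RSI (nbhd k x) (%y. U y powr \<kappa>) <= RSI (nbhd k x) (%y. M powr \<kappa>)"
  using assms by (intro nn_integral_mono mult_right_mono ennreal_leI powr_mono2) auto
 thus "RSI (nbhd k x) (%y. U y powr \<kappa>) <= en (M powr \<kappa>) * vol (nbhd k x)"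
  by (simp add: nn_integral_cmult_indicator del: emeasure_completion)
qed

text \<open>Fefferman-Stein with the weight \<open>Wt\<close>, which is \<open>A\<^sub>1\<close>
  with constants independent of \<open>U\<close>. The sharp estimate brings in the lower
  commutators, and the induction returns them to \<open>F\<close>.\<close>

lemma strong_bounded:
 assumes p0: "r < p0" and \<kappa>: "1 < \<kappa>" and k: "k <= m"
 shows "\<exists>C>0. ALL b F U. bmo_bd \<beta> b --> LB F --> U : LM --> (EX M. ALL x. 0 <= U x & U x <= M) -->
   NI (%x. en (\<bar>comm T b k F x\<bar> powr p0) * Wt \<kappa> U x) <= en C * NI (%x. en (\<bar>F x\<bar> powr p0) * Wt \<kappa> U x)"
 using k
proof (induction k rule: less_induct)
 case (less k)
 \<comment> \<open>Above \<open>r\<close> for the kernel, below 2 for the unweighted bound, below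
   \<open>p0\<close> for the Fefferman-Stein estimate.\<close>
 define a where "a = (r + min p0 2) / 2"
 have a: "r < a" "a < 2" "1 < a" "a < p0" using p0 r by (auto simp: a_def)
 obtain C3 where C3: "C3 > 0" and sh: "!!b F x l \<rho>. bmo_bd \<beta> b ==> LB F ==> 0 < \<rho> ==> Mnbhd (%y. en (\<Sum>j\<le>k. \<bar>hh b F j y\<bar> powr a)) x <= en (\<rho> powr a) ==>
   (EX c. RSI (cell l x) (%y. \<bar>comm T b k F y - c\<bar>) <= en (C3 * \<rho>) * vol (cell l x))"
  using sharp[OF a(1,2) less.prems] by blast
 obtain C1 C2 where C12: "C1 > 0" "C2 > 0" and A1: "!!G::'a => ennreal. G : LM ==> (ALL x. Mnbhd G x < \<infinity>) ==>
  A1w C1 (%x. en (enn2real (Mnbhd G x) powr (1 / \<kappa>))) & Ainf (1 - 1 / \<kappa>) C2 (%x. en (enn2real (Mnbhd G x) powr (1 / \<kappa>)))"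
  using Mnbhd_powr_A1w[of "1 / \<kappa>", where 'a='a] \<kappa> by auto
 have pr: "1 <= a" "a < p0" "0 < 1 - 1 / \<kappa>" using a \<kappa> by auto
 obtain L where L: "L > 0" and FS: "!!(f::'a => real) g W B. f : LM ==> g : LM ==>
   W : LM ==> (ALL x. 0 <= g x) ==> RI g < \<infinity> ==>
   RI (%x. \<bar>f x\<bar> powr a) < \<infinity> ==> A1w C1 W ==> Ainf (1 - 1 / \<kappa>) C2 W ==> (ALL x. W x <= en B) ==>
   (ALL x k r. 0 < r --> Mnbhd (%x. en (g x)) x <= en (r powr a) -->
    (EX c. RSI (cell k x) (%y. \<bar>f y - c\<bar>) <= en (C3 * r) * vol (cell k x))) ==>
   NI (%x. en (\<bar>f x\<bar> powr p0) * W x) <= en L * NI (%x. en (g x powr (p0 / a)) * W x)"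
  using Fefferman_Stein[OF C12 C3 pr, where 'a='a] by blast
 let ?A = "%y. EX M. ALL x. 0 <= y x & y x <= M"
 have "ALL j. EX C. j <= k --> 0 < C & (ALL b F U. bmo_bd \<beta> b --> LB F --> U : LM --> (?A U) -->
   NI (%x. en (\<bar>hh b F j x\<bar> powr p0) * Wt \<kappa> U x) <= en C * NI (%x. en (\<bar>F x\<bar> powr p0) * Wt \<kappa> U x))"
 proof
  fix j
  show "EX C. j <= k --> 0 < C & (ALL b F U. bmo_bd \<beta> b --> LB F --> U : LM --> (?A U) -->
   NI (%x. en (\<bar>hh b F j x\<bar> powr p0) * Wt \<kappa> U x) <= en C * NI (%x. en (\<bar>F x\<bar> powr p0) * Wt \<kappa> U x))"
  proof (cases "j = 0 | ~ j <= k")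
   case True
   thus ?thesis by (intro exI[of _ 1]) (auto simp: hh_def)
  next
   case False
   hence "j - 1 < k" "j - 1 <= m" using less.prems by auto
   from less.IH[OF this] show ?thesis using False unfolding hh_def by auto
  qed
 qed
 from choice[OF this] obtain CC where CC: "!!j. j <= k ==> 0 < CC j" and IH: "!!j b F U. j <= k ==> bmo_bd \<beta> b ==> LB F ==> U : LM ==> (?A U) ==>
   NI (%x. en (\<bar>hh b F j x\<bar> powr p0) * Wt \<kappa> U x) <= en (CC j) * NI (%x. en (\<bar>F x\<bar> powr p0) * Wt \<kappa> U x)"
  by blast
 define D where "D = real (card {..k}) powr (p0 / a)"
 let ?B = "\<Sum>j\<le>k. CC j"
 define C where "C = L * (D * ?B)"
 have Cs: "0 < ?B" using CC by (intro sum_pos) auto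
 have D: "D > 0" unfolding D_def by simp
 have C: "C > 0" using L Cs D by (simp add: C_def)
 have "NI (%x. en (\<bar>comm T b k F x\<bar> powr p0) * Wt \<kappa> U x) <= en C * NI (%x. en (\<bar>F x\<bar> powr p0) * Wt \<kappa> U x)"
  if b: "bmo_bd \<beta> b" and F: "LB F" and U [measurable]: "U : LM" and M: "EX M. ALL x. 0 <= U x & U x <= M" for b F U
 proof -
  let ?R = "NI (%x. en (\<bar>F x\<bar> powr p0) * Wt \<kappa> U x)"
  have bb: "bdm b" by (rule bdm_bd[OF b])
  have hhL: "L2 (hh b F j)" for j unfolding hh_def using L2_comm[OF bb LB_L2[OF F]] LB_L2[OF F] by auto
  note [measurable] = L2_meas[OF hhL] L2_meas[OF L2_comm[OF bb LB_L2[OF F]]]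
  obtain M where M': "!!x. 0 <= U x & U x <= M" using M by blast
  have Mb: "Mnbhd (%y. en (U y powr \<kappa>)) x <= en (M powr \<kappa>)" for x by (rule Mnbhd_bounded[OF M' \<kappa>])
  have fin: "ALL x. Mnbhd (%y. en (U y powr \<kappa>)) x < \<infinity>" using le_less_trans[OF Mb] by simp
  have Wm [measurable]: "Wt \<kappa> U : LM" unfolding Wt_def[abs_def] by measurable
  have AA: "A1w C1 (Wt \<kappa> U)" "Ainf (1 - 1 / \<kappa>) C2 (Wt \<kappa> U)"
   using A1[OF _ fin] unfolding Wt_def[abs_def] by auto
  let ?D = "%x. Wt \<kappa> U x"
  have WB: "?D x <= en ((M powr \<kappa>) powr (1 / \<kappa>))" for x
   unfolding Wt_def using Mb[of x] \<kappa> by (intro ennreal_leI powr_mono2) (auto simp: enn2real_leI)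
  define g where "g x = (\<Sum>j\<le>k. \<bar>hh b F j x\<bar> powr a)" for x
  have gm [measurable]: "g : LM" unfolding g_def[abs_def] by measurable
  have g0: "0 <= g x" for x unfolding g_def by (intro sum_nonneg) auto
  have gfin: "RI g < \<infinity>"
  proof -
   have "RI g = NI (%x. \<Sum>j\<le>k. en (\<bar>hh b F j x\<bar> powr a))"
    unfolding g_def by (intro nn_integral_cong sum_ennreal[symmetric]) auto
   also have "... = (\<Sum>j\<le>k. RI (%x. \<bar>hh b F j x\<bar> powr a))" by (rule nn_integral_sum) measurable
   also have "... < \<infinity>"
    using comm_powr_finite[OF bb a(3,2) F] LB_powr_finite[OF F, of a] a by (auto simp: hh_def less_top[symmetric])
   finally show ?thesis .
  qed
  let ?E = "%x. en (g x powr (p0 / a))"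
  have "NI (%x. en (\<bar>comm T b k F x\<bar> powr p0) * ?D x) <= en L * NI (%x. ?E x * ?D x)"
   using g0 gfin comm_powr_finite[OF bb a(3,2) F] AA WB sh[OF b F, folded g_def] by (intro FS) auto
  also have "... <= en L * NI (%x. en D * (\<Sum>j\<le>k. en (\<bar>hh b F j x\<bar> powr p0) * ?D x))"
  proof (intro mult_left_mono nn_integral_mono, goal_cases)
   case (1 x)
   let ?C = "\<Sum>j\<le>k. en (\<bar>hh b F j x\<bar> powr p0)"
   have "g x powr (p0 / a) <= D * (\<Sum>j\<le>k. (\<bar>hh b F j x\<bar> powr a) powr (p0 / a))"
    unfolding g_def D_def using a by (intro sum_powr_le) auto
   hence "?E x <= en (D * (\<Sum>j\<le>k. \<bar>hh b F j x\<bar> powr p0))" using a by (intro ennreal_leI) (simp add: powr_powr)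
   also have "... = en D * ?C"
    using D by (simp add: ennreal_mult sum_nonneg sum_ennreal)
   finally have "?E x * ?D x <= (en D * ?C) * ?D x" by (rule mult_right_mono) simp
   thus ?case
    by (simp only: mult.assoc sum_distrib_right)
  qed auto
  also have "... = en L * (en D * (\<Sum>j\<le>k. NI (%x. en (\<bar>hh b F j x\<bar> powr p0) * ?D x)))"
   by (subst nn_integral_cmult, measurable, subst nn_integral_sum) auto
  also have "... <= en L * (en D * (\<Sum>j\<le>k. en (CC j) * ?R))"
   by (intro mult_left_mono sum_mono IH b F U M) auto
  also have "(\<Sum>j\<le>k. en (CC j) * ?R) = en ?B * ?R"
   unfolding sum_distrib_right[symmetric] using CC by (subst sum_ennreal) (auto intro: less_imp_le)
  also have "en L * (en D * (en ?B * ?R)) = en C * ?R"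
   using L D Cs unfolding C_def by (simp add: ennreal_mult mult.assoc)
  finally show ?thesis .
 qed
 thus ?case using C by blast
qed

text \<open>\<open>X\<close> is any function that dominates
  \<open>(M U\<^sup>\<kappa>)\<^sup>1\<^sup>/\<^sup>\<kappa>\<close> where it is finite. This form
  accepts a Luxemburg maximal function in place of that weight.\<close>

definition "strong_bd \<kappa> p0 k C \<longleftrightarrow> (ALL b F U X. bmo_bd \<beta> b --> LB F --> U : LM --> (ALL x. 0 <= U x) --> X : LM -->
   (AE x in lebesgue. X x < \<infinity> --> (ALL j. RSI (nbhd j x) (%y. U y powr \<kappa>) <= en (enn2real (X x) powr \<kappa>) * vol (nbhd j x))) -->
   RI (%x. \<bar>comm T b k F x\<bar> powr p0 * U x) <= en C * NI (%x. en (\<bar>F x\<bar> powr p0) * X x))"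

lemmas strong_bdD = strong_bd_def[THEN iffD1, rule_format]

text \<open>Boundedness of \<open>U\<close> is removed by truncation: the constants do not depend on
  the bound, and monotone convergence applies.\<close>

theorem strong_type:
 assumes p0: "r < p0" and \<kappa>: "1 < \<kappa>" and k: "k <= m"
 shows "\<exists>C>0. strong_bd \<kappa> p0 k C"
proof -
 obtain C where C: "C > 0" and sb: "!!b F U. bmo_bd \<beta> b ==> LB F ==> U : LM ==> (EX M. ALL x. 0 <= U x & U x <= M) ==>
   NI (%x. en (\<bar>comm T b k F x\<bar> powr p0) * Wt \<kappa> U x) <= en C * NI (%x. en (\<bar>F x\<bar> powr p0) * Wt \<kappa> U x)"
  using strong_bounded[OF assms] by blast
 let ?H = "%x. en (3 ^ DIM('a) * x)"
 have "RI (%x. \<bar>comm T b k F x\<bar> powr p0 * U x) <= ?H C * NI (%x. en (\<bar>F x\<bar> powr p0) * X x)"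
  if b: "bmo_bd \<beta> b" and F: "LB F" and U [measurable]: "U : LM" and U0: "!!x. 0 <= U x" and X [measurable]: "X : LM"
   and XU: "AE x in lebesgue. X x < \<infinity> --> (ALL j. RSI (nbhd j x) (%y. U y powr \<kappa>) <= en (enn2real (X x) powr \<kappa>) * vol (nbhd j x))" for b F U X
 proof -
  let ?c = "comm T b k F"
  note [measurable] = L2_meas[OF L2_comm[OF bdm_bd[OF b] LB_L2[OF F], of k]] L2_meas[OF LB_L2[OF F]]
  define Ut where "Ut n x = min (U x) (real n)" for n :: nat and x
  have Um [measurable]: "Ut n : LM" for n unfolding Ut_def[abs_def] by measurable
  have Ut0: "0 <= Ut n x & Ut n x <= real n" for n x using U0[of x] by (auto simp: Ut_def)
  let ?C = "NI (%x. en (\<bar>F x\<bar> powr p0) * X x)"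
  let ?E = "%y. RI (%x. \<bar>?c x\<bar> powr p0 * Ut y x)"
  have each: "?E n <= ?H C * ?C" for n
  proof -
   let ?G = "%y. en (Ut n y powr \<kappa>)"
   have Wm [measurable]: "Wt \<kappa> (Ut n) : LM" unfolding Wt_def[abs_def] by measurable
   have fin: "Mnbhd ?G x < \<infinity>" for x by (rule le_less_trans[OF Mnbhd_bounded[where U = "Ut n", OF Ut0 \<kappa>]]) simp
   let ?A = "en (3 ^ DIM('a))"
   let ?B = "%x. Wt \<kappa> (Ut n) x"
   \<comment> \<open>By differentiation \<open>U\<close> is below its own maximal function; the
     factor \<open>3^n\<close> compares cell and neighbourhood.\<close>
   have UW: "AE x in lebesgue. en (Ut n x) <= ?A * ?B x"
   proof (rule eventually_mono[OF AE_le_Mcell[of ?G]])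
    show "?G : LM" by measurable
    fix x assume "?G x <= Mcell ?G x"
    also have "Mcell ?G x <= ?A * Mnbhd ?G x"
     unfolding Mcell_le_iff
    proof
     fix j
     have "SI (cell j x) ?G <= SI (nbhd j x) ?G" by (rule set_nn_integral_subset[OF cell_le_nbhd])
     also have "... <= Mnbhd ?G x * vol (nbhd j x)" by (rule Mnbhd_ge)
     finally show "SI (cell j x) ?G <= ?A * Mnbhd ?G x * vol (cell j x)" unfolding vol_nbhd by (simp only: mult_ac)
    qed
    also have "Mnbhd ?G x = en (enn2real (Mnbhd ?G x))" using fin[of x] by simp
    finally have "Ut n x powr \<kappa> <= 3 ^ DIM('a) * enn2real (Mnbhd ?G x)"
     by (subst (asm) ennreal_mult[symmetric]) auto
    hence "(Ut n x powr \<kappa>) powr (1 / \<kappa>) <= (3 ^ DIM('a) * enn2real (Mnbhd ?G x)) powr (1 / \<kappa>)" using \<kappa> by (intro powr_mono2) auto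
    hence "Ut n x <= (3 ^ DIM('a)) powr (1 / \<kappa>) * enn2real (Mnbhd ?G x) powr (1 / \<kappa>)"
     using \<kappa> Ut0[of n x] by (simp add: powr_powr powr_mult)
    also have "... <= 3 ^ DIM('a) * enn2real (Mnbhd ?G x) powr (1 / \<kappa>)"
    proof (rule mult_right_mono)
     have "((3::real) ^ DIM('a)) powr (1 / \<kappa>) <= (3 ^ DIM('a)) powr 1" using \<kappa> by (intro powr_mono) auto
     thus "((3::real) ^ DIM('a)) powr (1 / \<kappa>) <= 3 ^ DIM('a)" by simp
    qed auto
    finally show "en (Ut n x) <= ?A * ?B x"
     unfolding Wt_def by (subst ennreal_mult[symmetric]) (auto intro!: ennreal_leI)
   qed
   have WX: "AE x in lebesgue. ?B x <= X x"
    using XU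
   proof (rule eventually_mono)
    fix x assume XU: "X x < \<infinity> --> (ALL j. RSI (nbhd j x) (%y. U y powr \<kappa>) <= en (enn2real (X x) powr \<kappa>) * vol (nbhd j x))"
    show "?B x <= X x"
    proof (cases "X x < \<infinity>")
     case True
     let ?F = "enn2real (X x) powr \<kappa>"
     have "Mnbhd ?G x <= en ?F"
      unfolding Mnbhd_le_iff
     proof
      fix j
      have "SI (nbhd j x) ?G <= RSI (nbhd j x) (%y. U y powr \<kappa>)"
       using \<kappa> Ut0 by (intro nn_integral_mono mult_right_mono ennreal_leI powr_mono2) (auto simp: Ut_def U0)
      thus "SI (nbhd j x) ?G <= en ?F * vol (nbhd j x)" using XU True by (auto intro: order_trans)
     qed
     hence "enn2real (Mnbhd ?G x) <= enn2real (X x) powr \<kappa>" by (rule enn2real_leI[rotated]) simp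
     hence "enn2real (Mnbhd ?G x) powr (1 / \<kappa>) <= ?F powr (1 / \<kappa>)" using \<kappa> by (intro powr_mono2) auto
     hence "?B x <= en (enn2real (X x))" unfolding Wt_def using \<kappa> by (intro ennreal_leI) (simp add: powr_powr)
     thus ?thesis using True by simp
    next
     case False
     hence "X x = top" by (simp add: less_top[symmetric])
     thus ?thesis by simp
    qed
   qed
   let ?D = "%x. en (\<bar>?c x\<bar> powr p0)"
   have "?E n <= NI (%x. ?A * (?D x * ?B x))"
   proof (rule nn_integral_mono_AE, use UW in eventually_elim)
    fix x assume "en (Ut n x) <= ?A * ?B x"
    hence "?D x * en (Ut n x) <= ?D x * (?A * ?B x)" by (rule mult_left_mono) simp
    thus "en (\<bar>?c x\<bar> powr p0 * Ut n x) <= ?A * (?D x * ?B x)"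
     using Ut0[of n x] by (simp only: ennreal_mult powr_ge_zero mult.left_commute)
   qed
   also have "... = ?A * NI (%x. ?D x * ?B x)" by (rule nn_integral_cmult) measurable
   also have "... <= ?A * (en C * NI (%x. en (\<bar>F x\<bar> powr p0) * ?B x))"
    using Ut0 by (intro mult_left_mono sb b F Um) auto
   also have "... <= ?A * (en C * ?C)"
    by (intro mult_left_mono nn_integral_mono_AE) (use WX in \<open>auto elim!: eventually_mono intro: mult_left_mono\<close>)
   finally show ?thesis using C by (simp add: ennreal_mult mult.assoc)
  qed
  have "en (\<bar>?c x\<bar> powr p0 * U x) <= (SUP n. en (\<bar>?c x\<bar> powr p0 * Ut n x))" for x
  proof -
   obtain n :: nat where "U x <= real n" using real_arch_simple by blast
   hence "Ut n x = U x" by (simp add: Ut_def)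
   thus ?thesis by (metis (no_types, lifting) SUP_upper UNIV_I)
  qed
  hence "RI (%x. \<bar>?c x\<bar> powr p0 * U x) <= NI (%x. SUP n. en (\<bar>?c x\<bar> powr p0 * Ut n x))" by (intro nn_integral_mono)
  also have "... = (SUP n. ?E n)"
   by (rule nn_integral_monotone_convergence_SUP) (auto simp: incseq_def le_fun_def Ut_def intro!: ennreal_leI mult_left_mono)
  also have "... <= ?H C * ?C" by (rule SUP_least[OF each])
  finally show ?thesis .
 qed
 moreover have "3 ^ DIM('a) * C > 0" using C by simp
 ultimately show ?thesis unfolding strong_bd_def by blast
qed

end

section \<open>The weight \<open>v\<close> and its power \<open>w\<close>\<close>

definition cube_of :: "int => 'a::euclidean_space => 'a set" where
 "cube_of k x = cbox (corner k x - side k *\<^sub>R One) (corner k x - side k *\<^sub>R One + (3 * side k) *\<^sub>R One)"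

lemma is_cube_of: "is_cube (cube_of k x)" unfolding cube_of_def by (rule nbhd_cube)

lemma cube_of_AE: "AE y in lebesgue. y : nbhd k x \<longleftrightarrow> y : cube_of k x"
 unfolding cube_of_def nbhd_hbox by (rule hbox_AE)

lemma cube_of_self: "x : cube_of k x"
 using in_nbhd_self[of x k] hbox_sub_cbox unfolding cube_of_def nbhd_hbox by blast

lemma SI_cube_of: "SI (cube_of k x) f = SI (nbhd k x) f"
 by (rule nn_integral_cong_AE) (use cube_of_AE[of k x] in \<open>auto elim!: eventually_mono simp: indicator_def\<close>)

lemma avg_cube_of: "avg (cube_of k x) g = RSI (nbhd k x) g / vol (nbhd k x)"
proof -
 have "vol (cube_of k x) = SI (cube_of k x) (%_. 1)" by (simp add: cube_of_def nn_integral_indicator)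
 also have "... = vol (nbhd k x)" unfolding SI_cube_of by (simp add: nn_integral_indicator del: emeasure_completion)
 finally show ?thesis unfolding avg_def SI_cube_of by simp
qed

text \<open>Each neighbourhood comes with its own null set, but there are countably many, so one
  null set serves all scales.\<close>

lemma AE_all_nbhd:
 assumes "!!k x. AE y in lebesgue. y : nbhd k x --> P k x y" and "!!k x y. y : cell k x ==> P k x y ==> P k y y"
 shows "AE y in lebesgue. ALL k. P k (y::'a::euclidean_space) y"
 unfolding AE_all_countable
proof
 fix k
 have "AE y in lebesgue. \<forall>A\<in>range (cell k :: 'a => 'a set). y : A --> P k (SOME x. cell k x = A) y"
 proof (rule AE_ball_countable'[rotated, OF countable_cells])
  fix A :: "'a set" assume "A : range (cell k)"
  then obtain x where "cell k x = A" by auto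
  hence "cell k (SOME x. cell k x = A) = A" by (rule someI)
  hence "A <= nbhd k (SOME x. cell k x = A)" using cell_le_nbhd by blast
  thus "AE y in lebesgue. y : A --> P k (SOME x. cell k x = A) y"
   using assms(1)[of k "SOME x. cell k x = A"] by (auto elim: eventually_mono)
 qed
 thus "AE y in lebesgue. P k y y"
 proof eventually_elim
  case (elim y)
  let ?A = "cell k (SOME x. cell k x = cell k y)"
  have "?A = cell k y" by (rule someI) (rule refl)
  hence "y : ?A" by simp
  thus ?case using elim assms(2) by blast
 qed
qed

definition mm :: "int => 'a::euclidean_space itself => real" where
 "mm k _ = 3 ^ DIM('a) * side k ^ DIM('a)"

lemma vol_mm: "vol (nbhd k (x::'a::euclidean_space)) = en (mm k TYPE('a))" and mm_pos: "0 < mm k TYPE('a::euclidean_space)"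
 by (simp_all add: mm_def emeasure_nbhd del: emeasure_completion)

text \<open>Here \<open>e = q - 1\<close>, so \<open>- 1 / e = 1 - q'\<close>. The conditions on
  cubes are recorded for the neighbourhoods of the grid.\<close>

locale wt =
 fixes v :: "'a::euclidean_space => real" and e C1 C2 :: real
 assumes vm [measurable]: "v : LM" and v0: "!!x. 0 <= v x" and vp: "AE x in lebesgue. 0 < v x"
  and par: "0 < e" "0 < C1" "0 < C2"
  and vfin: "!!k x. RSI (nbhd k x) v < \<infinity>" and wfin: "!!k x. RSI (nbhd k x) (%y. v y powr (- 1 / e)) < \<infinity>"
  and RH: "!!k x. AE z in lebesgue. z : nbhd k x --> en (v z) <= en C1 * (RSI (nbhd k x) v / vol (nbhd k x))"
  and Aq: "!!k x. enn2real (RSI (nbhd k x) v / vol (nbhd k x)) * enn2real (RSI (nbhd k x) (%y. v y powr (- 1 / e)) / vol (nbhd k x)) powr e <= C2"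

lemma wtI:
 fixes v :: "'a::euclidean_space => real"
 assumes w: "weight v" and RH: "RHinf v" and A: "Aq (1 + e) v" and e: "0 < e"
 shows "EX C1 C2. wt v e C1 C2"
proof -
 obtain C1 where C1: "!!Q. is_cube Q ==> (AE x in lebesgue. x : Q --> en (v x) <= en C1 * avg Q v)"
  using RH unfolding RHinf_def by blast
 have ex: "1 - (1 + e) / (1 + e - 1) = - 1 / e" using e by (simp add: field_simps)
 let ?B = "%x. v x powr (- 1 / e)"
 obtain C2 where C2: "!!Q. is_cube Q ==> avg Q v < \<infinity> & avg Q ?B < \<infinity> &
   enn2real (avg Q v) * enn2real (avg Q ?B) powr e <= C2"
  using A unfolding Aq_def ex by auto
 have fin: "RSI (nbhd k x) g < \<infinity>" if "avg (cube_of k x) g < \<infinity>" for g and k and x :: 'a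
 proof (rule ccontr)
  assume "~ ?thesis"
  hence "RSI (nbhd k x) g = top" by (simp add: less_top[symmetric])
  thus False using that by (simp add: avg_cube_of ennreal_top_divide del: emeasure_completion)
 qed
 \<comment> \<open>The maximum makes the constants positive.\<close>
 have "wt v e (max 1 C1) (max 1 C2)"
 proof
  show "v : LM" "!!x. 0 <= v x" "AE x in lebesgue. 0 < v x" using w by (auto simp: weight_def locint_def)
  let ?C = "%y. v y powr (- 1 / e)"
  show "RSI (nbhd k x) v < \<infinity>" "RSI (nbhd k x) ?C < \<infinity>" for k x
   by (intro fin, use C2[OF is_cube_of] in blast)+
  show "AE y in lebesgue. y : nbhd k x --> en (v y) <= en (max 1 C1) * (RSI (nbhd k x) v / vol (nbhd k x))" for k x
   using C1[OF is_cube_of[of k x]] cube_of_AE[of k x] unfolding avg_cube_of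
  proof eventually_elim
   case (elim y)
   let ?A = "RSI (nbhd k x) v / vol (nbhd k x)"
   have "en C1 * ?A <= en (max 1 C1) * ?A"
    by (intro mult_right_mono ennreal_leI) auto
   thus ?case using elim by (blast intro: order_trans)
  qed
  show "enn2real (RSI (nbhd k x) v / vol (nbhd k x)) * enn2real (RSI (nbhd k x) ?C / vol (nbhd k x)) powr e <= max 1 C2" for k x
   using C2[OF is_cube_of[of k x]] unfolding avg_cube_of by linarith
 qed (use e in auto)
 thus ?thesis by blast
qed

context wt begin

definition w where "w x = v x powr (- 1 / e)"
definition V where "V k x = enn2real (RSI (nbhd k x) v)"
definition W where "W k x = enn2real (RSI (nbhd k x) w)"

lemma wm [measurable]: "w : LM" unfolding w_def by measurable
lemma V_eq: "RSI (nbhd k x) v = en (V k x)" unfolding V_def using vfin[of k x] by simp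
lemma W_eq: "RSI (nbhd k x) w = en (W k x)" unfolding W_def using wfin[of k x] by (simp add: w_def)

lemma SI_pos:
 assumes [measurable]: "g : LM" and "AE x in lebesgue. 0 < g x" and A [measurable]: "A : sets lebesgue" and "vol A ~= 0"
 shows "0 < RSI A g"
proof (rule ccontr)
 assume "~ ?thesis"
 hence "RSI A g = 0" by simp
 hence "AE y in lebesgue. en (g y) * indicator A y = 0" by (subst (asm) nn_integral_0_iff_AE) auto
 hence "AE y in lebesgue. y ~: A" using assms(2) by eventually_elim (auto simp: indicator_def ennreal_eq_0_iff)
 hence "vol A = 0" by (subst (asm) AE_iff_measurable[OF A]) auto
 thus False using assms by blast
qed

lemma V_pos: "0 < V k x" and W_pos: "0 < W k x"
proof -
 have "AE x in lebesgue. 0 < w x" using vp by eventually_elim (simp add: w_def)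
 from SI_pos[OF wm this nbhd_lebesgue vol_facts(3), of k x] SI_pos[OF vm vp nbhd_lebesgue vol_facts(3), of k x]
 show "0 < V k x" "0 < W k x" unfolding V_eq W_eq by simp_all
qed

lemma VW: "V k x * (W k x / mm k TYPE('a)) powr e <= C2 * mm k TYPE('a)"
proof -
 have "V k x / mm k TYPE('a) * (W k x / mm k TYPE('a)) powr e <= C2"
  using Aq[of k x] V_pos[of k x] W_pos[of k x] mm_pos[of k, where 'a='a]
  unfolding V_eq W_eq[unfolded w_def] vol_mm by (simp add: divide_ennreal)
 thus ?thesis using mm_pos[of k, where 'a='a] by (simp add: field_simps)
qed

lemma RH': "AE z in lebesgue. z : nbhd k x --> v z * mm k TYPE('a) <= C1 * V k x"
 using RH[of k x]
proof eventually_elim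
 case (elim z)
 show ?case
 proof
  assume "z : nbhd k x"
  hence "en (v z) <= en (C1 * (V k x / mm k TYPE('a)))"
   using elim V_pos[of k x] mm_pos[of k, where 'a='a] par unfolding V_eq vol_mm by (subst ennreal_mult) (auto simp: divide_ennreal)
  hence "v z <= C1 * (V k x / mm k TYPE('a))" using par V_pos[of k x] mm_pos[of k, where 'a='a] by (subst (asm) ennreal_le_iff) auto
  thus "v z * mm k TYPE('a) <= C1 * V k x" using mm_pos[of k, where 'a='a] by (simp add: field_simps)
 qed
qed

text \<open>The reverse Hoelder condition on a single large neighbourhood of the origin.\<close>

lemma v_locally_bounded: "EX c. AE x in lebesgue. norm x <= R --> v x <= c"
proof -
 obtain k0 where k0: "!!k. k <= k0 ==> R < side k" using side_big by blast
 have sub: "x : nbhd k0 0" if "norm x <= R" for x :: 'a using that k0[of k0] by (auto intro!: nbhdI_norm)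
 have "AE x in lebesgue. norm x <= R --> v x <= C1 * V k0 0 / mm k0 TYPE('a)"
  using RH'[of k0 0] by eventually_elim (use sub mm_pos[of k0, where 'a='a] in \<open>auto simp: pos_le_divide_eq\<close>)
 thus ?thesis by blast
qed

definition "Cw = (C1 * C2) powr (1 / e)"
lemma Cw: "0 < Cw" using par by (simp add: Cw_def)

text \<open>\<open>RH'\<close> puts \<open>v(z)\<close> in place of the mean of \<open>v\<close> in
  the \<open>A\<^sub>q\<close> condition; the root of order \<open>e\<close> then bounds the mean of
  \<open>w\<close> by \<open>Cw w(z)\<close>, which explains
  \<open>Cw = (C1 C2) powr (1 / e)\<close>.\<close>

lemma A1: "AE z in lebesgue. z : nbhd k x --> W k x <= Cw * w z * mm k TYPE('a)"
 using RH'[of k x] vp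
proof eventually_elim
 case (elim z)
 show ?case
 proof
  assume z: "z : nbhd k x"
  note pos = V_pos[of k x] W_pos[of k x] mm_pos[of k, where 'a='a] par elim(2)
  have "v z * mm k TYPE('a) * (W k x / mm k TYPE('a)) powr e <= C1 * V k x * (W k x / mm k TYPE('a)) powr e"
   using elim(1) z by (intro mult_right_mono) auto
  also have "... <= C1 * (C2 * mm k TYPE('a))" using VW[of k x] pos by (simp add: mult.assoc)
  finally have "(W k x / mm k TYPE('a)) powr e <= C1 * C2 / v z" using pos by (simp add: field_simps)
  hence "((W k x / mm k TYPE('a)) powr e) powr (1 / e) <= (C1 * C2 / v z) powr (1 / e)" using pos by (intro powr_mono2) auto
  also have "... = Cw * w z" using pos by (simp add: Cw_def w_def powr_divide powr_minus_divide)
  finally show "W k x <= Cw * w z * mm k TYPE('a)" using pos by (simp add: powr_powr field_simps)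
 qed
qed

text \<open>Here \<open>3^n 2^(i n)\<close> is the volume ratio between the neighbourhood
  \<open>i\<close> scales up and the cell; the factors 2 come from passing to half of the
  cell.\<close>

definition "Cd i = 2 * C2 * 2 powr e * (3 ^ DIM('a) * 2 ^ (i * DIM('a))) powr (1 + e)" for i :: nat

lemma Cd_pos: "0 < Cd i" using par by (simp add: Cd_def)

text \<open>Half of the cell carries values of \<open>w\<close> at most twice the average, so \<open>v\<close> is not small there.\<close>

lemma doubling: "en (V (l - int i) x) <= en (Cd i) * RSI (cell l x) v"
proof -
 let ?k = "l - int i" and ?E = "cell l x"
 define D where "D = (3::real) ^ DIM('a) * 2 ^ (i * DIM('a))"
 define u where "u = side l ^ DIM('a)"
 have D: "0 < D" and u: "0 < u" and mk: "mm ?k TYPE('a) = D * u"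
  by (auto simp: D_def u_def mm_def side_diff_nat power_mult_distrib power_mult)
 have Eu: "vol ?E = en u" unfolding u_def by (rule emeasure_cell)
 have EQ: "?E <= nbhd ?k x" using cell_le_nbhd[of l x] nbhd_antimono[of ?k l x] by auto
 define a where "a = 2 * W ?k x / u"
 have a: "0 < a" using W_pos[of ?k x] u by (simp add: a_def)
 define G where "G = ?E \<inter> {y. w y <= a}"
 define H where "H = ?E \<inter> {y. a < w y}"
 have Hs: "{y. a < w y} : sets lebesgue" by (rule sets_less_lebesgue) measurable
 have Hm [measurable]: "H : sets lebesgue" unfolding H_def using Hs by (intro sets.Int cell_lebesgue)
 have "G = ?E - H" by (auto simp: G_def H_def)
 hence Gm [measurable]: "G : sets lebesgue" by auto
 let ?A = "en (u / 2)"
 have "en a * vol H = NI (%y. en a * indicator H y)" by (simp add: nn_integral_cmult_indicator del: emeasure_completion)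
 also have "... <= RSI (nbhd ?k x) w"
  using EQ by (intro nn_integral_mono) (auto simp: indicator_def H_def intro!: ennreal_leI)
 also have "... = en (a * (u / 2))" unfolding W_eq a_def using u by simp
 also have "... = en a * ?A" using a u by (intro ennreal_mult) auto
 finally have vH: "vol H <= ?A" using a by (subst (asm) ennreal_mult_le_mult_iff) auto
 have "en u = vol G + vol H" unfolding Eu[symmetric]
  by (subst plus_emeasure) (auto simp: G_def H_def not_le intro: arg_cong[where f = vol] simp del: emeasure_completion)
 also have "... <= vol G + ?A" by (intro add_left_mono vH)
 finally have vG: "?A <= vol G"
 proof (cases "vol G")
  case (real g)
  thus "en u <= vol G + ?A ==> ?A <= vol G"
   using u by (simp add: ennreal_plus[symmetric] del: ennreal_plus)
 qed simp
 let ?B = "a powr - e * (u / 2)"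
 have "en (V ?k x) <= en (Cd i * ?B)"
 proof (rule ennreal_leI)
  let ?C = "2 powr e * D powr e"
  have "(W ?k x / mm ?k TYPE('a)) powr e = (a / (2 * D)) powr e" using u D by (simp add: a_def mk field_simps)
  also have "... = a powr e / ?C" using a D by (simp add: powr_divide powr_mult)
  finally have "V ?k x * (a powr e / ?C) <= C2 * (D * u)" using VW[of ?k x] by (simp add: mk)
  hence "V ?k x <= C2 * (D * u) * ?C / a powr e" using a D by (simp add: field_simps)
  also have "... = Cd i * ?B"
   using a D unfolding Cd_def D_def[symmetric] by (simp add: powr_add powr_minus_divide)
  finally show "V ?k x <= Cd i * ?B" .
 qed
 also have "... = en (Cd i) * (en (a powr - e) * ?A)"
  using Cd_pos[of i] u by (subst ennreal_mult, simp, simp, subst ennreal_mult) auto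
 also have "... <= en (Cd i) * (en (a powr - e) * vol G)" by (intro mult_left_mono vG) auto
 also have "en (a powr - e) * vol G = NI (%y. en (a powr - e) * indicator G y)" by (simp add: nn_integral_cmult_indicator del: emeasure_completion)
 also have "... <= RSI ?E v"
 proof (rule nn_integral_mono_AE, use vp in eventually_elim)
  case v: (elim y)
  show ?case
  proof (cases "y : G")
   case True
   hence "a powr - e <= w y powr - e" using v par by (intro powr_mono2') (auto simp: G_def w_def)
   also have "... = v y" using v par by (simp add: w_def powr_powr)
   finally show ?thesis using True by (simp add: G_def ennreal_leI)
  qed simp
 qed
 finally show ?thesis by (simp add: mult_left_mono)
qed

lemma W_nbhd_eq: "y : cell k x ==> W k y = W k x"
 by (simp add: W_def nbhd_eq)

lemma A1_all: "AE z in lebesgue. ALL k. W k z <= Cw * w z * mm k TYPE('a)"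
 by (rule AE_all_nbhd[where P = "%k x z. W k x <= Cw * w z * mm k TYPE('a)", OF A1]) (simp add: W_nbhd_eq)

end

section \<open>The Luxemburg maximal operator \<open>NN\<close>\<close>

text \<open>A Luxemburg norm is accessible through the levels above it; this converts an estimate
  for all such levels into one for the norm itself.\<close>

lemma ennreal_le_multI:
 assumes "!!\<tau>. N < en \<tau> ==> X <= en (c * \<tau>)" and c: "0 < c"
 shows "X <= en c * N"
proof (cases N)
 case (real n)
 have "X <= en (c * n) + en \<epsilon>" if "0 < \<epsilon>" for \<epsilon>
 proof -
  have "N < en (n + \<epsilon> / c)" unfolding real using that c real by (intro ennreal_lessI) (auto intro: add_nonneg_pos)
  from assms(1)[OF this] show ?thesis using c real that by (simp add: distrib_left ennreal_plus)
 qed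
 hence "X <= en (c * n)" by (rule ennreal_le_epsilon)
 thus ?thesis using c real by (simp add: ennreal_mult)
next
 case top
 thus ?thesis using c by (simp add: ennreal_mult_top)
qed

lemma lux_less:
 assumes mono: "!!x y. 0 <= x ==> x <= y ==> \<theta> x <= \<theta> y" and w: "!!x. 0 <= w x" and l: "lux \<theta> w E u < en \<tau>"
 shows "0 < \<tau>" "RSI E (%x. \<theta> (\<bar>u x\<bar> / \<tau>) * w x) <= RSI E w"
proof -
 obtain \<mu> where m: "0 < \<mu>" "RSI E (%x. \<theta> (\<bar>u x\<bar> / \<mu>) * w x) <= RSI E w" "en \<mu> < en \<tau>"
  using l unfolding lux_def INF_less_iff by blast
 have ml: "\<mu> < \<tau>" using m by (simp add: ennreal_less_iff)
 thus l0: "0 < \<tau>" using m by simp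
 let ?A = "RSI E (%x. \<theta> (\<bar>u x\<bar> / \<tau>) * w x)"
 have "?A <= RSI E (%x. \<theta> (\<bar>u x\<bar> / \<mu>) * w x)"
  using m(1) ml l0 w by (intro nn_integral_mono mult_right_mono ennreal_leI mono divide_left_mono) auto
 thus "?A <= RSI E w" using m(2) by (rule order_trans)
qed

text \<open>\<open>\<theta>\<close> stands for \<open>\<phi>(x powr (1/p))\<close>; the relation
  between \<open>p0\<close>, \<open>\<kappa>\<close> and \<open>e\<close> says that
  \<open>(v powr (1 - p0)) powr \<kappa> = w\<close>.\<close>

locale czv = czk T CT K \<xi>t m J \<beta> r + wt v e C1 C2
 for T :: "('a::euclidean_space => real) => ('a => real)" and CT K \<xi>t m J \<beta> r and v :: "'a => real" and e C1 C2 +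
 fixes \<theta> :: "real => real" and \<kappa> p0 Ch :: real
 assumes th: "submult \<xi>t \<theta>" "\<theta> 0 = 0" and th_ge: "!!x. 0 <= x ==> x powr \<kappa> <= Ch * (1 + \<theta> x)"
  and ka: "1 < \<kappa>" "r < p0" "0 < Ch" "(1 - p0) * \<kappa> = - 1 / e"
begin

definition "NN u x = (SUP k. lux \<theta> w (nbhd k x) u)"
definition "UU = {u : LM. ALL x. 0 <= (u x :: real)}"

lemma th_mono: "0 <= x ==> x <= y ==> \<theta> x <= \<theta> y" and th_nonneg: "0 <= x ==> 0 <= \<theta> x"
 using th(1) unfolding submult_def by blast+

lemma w_nonneg: "0 <= w x" by (simp add: w_def)

lemma th_meas: "u : UU ==> 0 < \<tau> ==> (%x. \<theta> (u x / \<tau>)) : LM"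
 by (rule mono_pos_measurable[OF th_mono]) (auto simp: UU_def)

lemma NN_feas:
 assumes u: "u : UU" and l: "NN u x < en \<tau>"
 shows "0 < \<tau>" "RSI (nbhd k x) (%y. \<theta> (u y / \<tau>) * w y) <= en (W k x)"
proof -
 have "lux \<theta> w (nbhd k x) u < en \<tau>" for k using l unfolding NN_def by (rule le_less_trans[OF SUP_upper, rotated]) simp
 from lux_less[OF th_mono w_nonneg this]
 show "0 < \<tau>" "RSI (nbhd k x) (%y. \<theta> (u y / \<tau>) * w y) <= en (W k x)"
  using u unfolding W_eq[symmetric] by (auto simp: UU_def)
qed

text \<open>As \<open>w\<close> is an \<open>A\<^sub>1\<close> weight, weighted averages dominate unweighted ones.\<close>

lemma NN_av:
 assumes u: "u : UU" and l: "NN u z < en \<tau>"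
 shows "RSI (nbhd k z) (%y. \<theta> (u y / \<tau>)) <= en Cw * vol (nbhd k z)"
proof -
 note f = NN_feas[OF u l]
 note [measurable] = th_meas[OF u f(1)]
 let ?m = "mm k TYPE('a)"
 have m: "0 < ?m" by (rule mm_pos)
 let ?A = "%x. \<theta> (u x / \<tau>)"
 have "en (W k z) * RSI (nbhd k z) (%y. ?A y) = NI (%y. en (W k z) * (en (?A y) * indicator (nbhd k z) y))"
  by (rule nn_integral_cmult[symmetric]) measurable
 also have "... <= NI (%y. en (Cw * ?m) * (en (?A y * w y) * indicator (nbhd k z) y))"
 proof (rule nn_integral_mono_AE, use A1[of k z] in eventually_elim)
  case a: (elim y)
  have t0: "0 <= ?A y" using u f(1) by (intro th_nonneg) (auto simp: UU_def)
  show ?case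
  proof (cases "y : nbhd k z")
   case True
   hence "W k z * ?A y <= Cw * w y * ?m * ?A y" using a t0 by (intro mult_right_mono) auto
   hence "en (W k z * ?A y) <= en (Cw * ?m * (?A y * w y))" by (intro ennreal_leI) (simp add: mult_ac)
   thus ?thesis using True t0 W_pos[of k z] Cw m w_nonneg[of y] by (simp add: ennreal_mult mult.assoc)
  qed simp
 qed
 also have "... = en (Cw * ?m) * RSI (nbhd k z) (%y. ?A y * w y)" by (rule nn_integral_cmult) measurable
 also have "... <= en (Cw * ?m) * en (W k z)" by (intro mult_left_mono f(2)) auto
 also have "... = en (W k z) * (en Cw * vol (nbhd k z))" unfolding vol_mm using Cw m by (simp add: ennreal_mult mult_ac)
 finally show ?thesis using W_pos[of k z] by (subst (asm) ennreal_mult_le_mult_iff) auto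
qed

text \<open>At scales up to \<open>l\<close> the points share their neighbourhoods; at finer scales
  the neighbourhoods lie where \<open>u = 0\<close>, and the norm vanishes since
  \<open>\<theta> 0 = 0\<close>.\<close>

lemma NN_eq_const:
 assumes u0: "!!w. w : nbhd (l - int J) x ==> u w = 0" and y: "y : cell l x" and z: "z : cell l x"
 shows "NN u y = NN u z"
 unfolding NN_def
proof (rule SUP_cong)
 fix k
 show "lux \<theta> w (nbhd k y) u = lux \<theta> w (nbhd k z) u"
 proof (cases "k <= l")
  case True
  hence "y : cell k x" "z : cell k x" using y z cell_antimono[OF True] by auto
  thus ?thesis by (simp add: nbhd_eq)
 next
  case False
  let ?A = "%x. lux \<theta> w (nbhd k x) u"
  have z0: "?A y = 0" if "y : cell l x" for y
  proof -
   have "nbhd k y <= nbhd l x" using nbhd_antimono[of l k y] nbhd_eq[OF that] False by simp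
   hence "u q = 0" if "q : nbhd k y" for q using that u0 nbhd_antimono[of "l - int J" l x] by auto
   hence "RSI (nbhd k y) (%x. \<theta> (\<bar>u x\<bar> / \<tau>) * w x) = NI (%_::'a. 0)" for \<tau>
    using th(2) by (intro nn_integral_cong) (auto simp: indicator_def)
   hence "?A y <= en c" if "0 < c" for c
    unfolding lux_def using that by (intro INF_lower) simp
   hence "?A y <= 0 + en c" if "0 < c" for c using that by simp
   hence "?A y <= 0" by (rule ennreal_le_epsilon)
   thus ?thesis by simp
  qed
  show ?thesis unfolding z0[OF y] z0[OF z] ..
 qed
qed simp

lemma NN_measurable: "NN u : LM"
proof -
 have "(%x. lux \<theta> w (nbhd k x) u) : borel_measurable borel" for k
  by (rule measurable_cell_const[of k]) (simp add: nbhd_eq)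
 hence "(%x. lux \<theta> w (nbhd k x) u) : LM" for k by (rule borel_measurable_lebesgueI)
 thus ?thesis unfolding NN_def[abs_def] by measurable
qed

lemma NN_restrict: "NN (%x. indicator E x * u x) x <= NN u x"
 unfolding NN_def
proof (rule SUP_mono', unfold lux_def, rule INF_superset_mono, intro subsetI CollectI)
 fix k \<tau> assume l: "\<tau> : {lam. 0 < lam & RSI (nbhd k x) (%x. \<theta> (\<bar>u x\<bar> / lam) * w x) <= RSI (nbhd k x) w}"
 hence l0: "0 < \<tau>" by simp
 let ?A = "%x. RSI (nbhd k x) (%x. \<theta> (\<bar>indicator E x * u x\<bar> / \<tau>) * w x)"
 have "?A x <= RSI (nbhd k x) (%x. \<theta> (\<bar>u x\<bar> / \<tau>) * w x)"
  using l0 w_nonneg by (intro nn_integral_mono mult_right_mono ennreal_leI th_mono) (auto simp: indicator_def divide_right_mono)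
 thus "0 < \<tau> & ?A x <= RSI (nbhd k x) w"
  using l by (auto intro: order_trans)
qed simp

lemma le_powr_ka: "0 <= x ==> x <= (1 + Ch) + Ch * \<theta> x"
proof -
 assume x: "0 <= x"
 have "x <= 1 + x powr \<kappa>"
 proof (cases "x <= 1")
  case False
  hence "x powr 1 <= x powr \<kappa>" using ka by (intro powr_mono) auto
  thus ?thesis using False by simp
 qed (simp add: add_increasing2)
 thus ?thesis using th_ge[OF x] by (simp add: algebra_simps)
qed

definition "Ct = C1 * ((1 + Ch) + Ch * Cw) * Cd J"

lemma Ct_pos: "0 < Ct" unfolding Ct_def using par ka Cw Cd_pos by (intro mult_pos_pos add_pos_pos) auto

text \<open>The reverse Hoelder condition replaces \<open>v\<close> by its mean, the mean of
  \<open>u\<close> is at most a multiple of \<open>NN u\<close>, and doubling returns from the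
  neighbourhood to the cell.\<close>

lemma NN_tent:
 assumes u: "u : UU" and z: "z : cell l x"
 shows "RSI (nbhd (l - int J) x) (%w. u w * v w) <= en Ct * RSI (cell l x) v * NN u z"
proof -
 let ?k = "l - int J" and ?v = "RSI (cell l x) v"
 let ?m = "mm ?k TYPE('a)"
 have u0: "0 <= u x" and um [measurable]: "u : LM" for x using u by (auto simp: UU_def)
 have m: "0 < ?m" by (rule mm_pos)
 have zz: "z : cell ?k x" using z cell_antimono[of ?k l x] by auto
 have vf: "?v < \<infinity>"
  by (rule le_less_trans[OF set_nn_integral_subset[OF cell_le_nbhd] vfin])
 define c where "c = Ct * enn2real ?v"
 have v_eq: "?v = en (enn2real ?v)" using vf by simp
 have vpos: "0 < ?v" by (rule SI_pos[OF vm vp cell_lebesgue vol_facts(1)])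
 have cp: "0 < c" unfolding c_def Ct_def using par ka Cw Cd_pos vpos vf by (intro mult_pos_pos add_pos_pos) (auto simp: enn2real_positive_iff)
 let ?A = "%x. RSI (nbhd ?k x) (%w. u w * v w)"
 have "?A x <= en c * NN u z"
 proof (rule ennreal_le_multI[OF _ cp])
  fix \<tau> assume l: "NN u z < en \<tau>"
  note f = NN_feas(1)[OF u l] NN_av[OF u l, of ?k, unfolded nbhd_eq[OF zz]]
  note [measurable] = th_meas[OF u f(1)]
  let ?B = "%x. \<theta> (u x / \<tau>)"
  have tn: "0 <= ?B y" for y using u0 f(1) by (intro th_nonneg) auto
  let ?C = "%x. en (C1 * V ?k x * \<tau>)"
  let ?D = "en (1 + Ch)"
  have "en ?m * ?A x = NI (%w. en ?m * (en (u w * v w) * indicator (nbhd ?k x) w))"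
   by (rule nn_integral_cmult[symmetric]) measurable
  also have "... <= NI (%w. ?C x * (?D * indicator (nbhd ?k x) w + en Ch * (en (?B w) * indicator (nbhd ?k x) w)))"
  proof (rule nn_integral_mono_AE, use RH'[of ?k x] in eventually_elim)
   case a: (elim y)
   show ?case
   proof (cases "y : nbhd ?k x")
    case True
    have "?m * (u y * v y) = \<tau> * (u y / \<tau>) * (v y * ?m)" using f(1) by simp
    also have "... <= \<tau> * ((1 + Ch) + Ch * ?B y) * (C1 * V ?k x)"
     using a True f(1) u0 v0[of y] m ka tn[of y] by (intro mult_mono[of _ _ "v y * ?m"] mult_left_mono le_powr_ka) auto
    finally have "en (?m * (u y * v y)) <= en (C1 * V ?k x * \<tau> * ((1 + Ch) + Ch * ?B y))" by (intro ennreal_leI) (simp add: mult_ac)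
    thus ?thesis using True m u0[of y] v0[of y] par V_pos[of ?k x] f(1) ka tn[of y] by (simp add: ennreal_mult ennreal_plus)
   qed simp
  qed
  also have "... = ?C x * (?D * vol (nbhd ?k x) + en Ch * RSI (nbhd ?k x) (%w. ?B w))"
   by (subst nn_integral_cmult, measurable, subst nn_integral_add, measurable, subst nn_integral_cmult, measurable) (simp add: nn_integral_cmult_indicator del: emeasure_completion)
  also have "... <= ?C x * (?D * vol (nbhd ?k x) + en Ch * (en Cw * vol (nbhd ?k x)))"
   by (intro mult_left_mono add_left_mono f(2)) auto
  also have "... = en ?m * (en (C1 * ((1 + Ch) + Ch * Cw) * \<tau>) * en (V ?k x))"
   unfolding vol_mm using par ka Cw m f(1) V_pos[of ?k x]
   by (simp add: ennreal_mult[symmetric] ennreal_plus[symmetric] del: ennreal_plus) (simp add: algebra_simps)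
  finally have "?A x <= en (C1 * ((1 + Ch) + Ch * Cw) * \<tau>) * en (V ?k x)"
   using m by (subst (asm) ennreal_mult_le_mult_iff) auto
  also have "... <= en (C1 * ((1 + Ch) + Ch * Cw) * \<tau>) * (en (Cd J) * en (enn2real ?v))"
   unfolding v_eq[symmetric] by (intro mult_left_mono doubling) auto
  also have "... = en (c * \<tau>)"
   unfolding c_def Ct_def using par ka Cw f(1) Cd_pos[of J]
   by (simp add: ennreal_mult[symmetric])
  finally show "?A x <= en (c * \<tau>)" .
 qed
 moreover have "en c = en Ct * ?v" unfolding c_def using par ka Cw Cd_pos[of J] by (subst v_eq, subst ennreal_mult) (auto simp: Ct_def)
 ultimately show ?thesis by simp
qed

text \<open>Since \<open>(u v\<^sup>1\<^sup>-\<^sup>p\<^sup>0)\<^sup>\<kappa> = u\<^sup>\<kappa>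
  w\<close>, the bound \<open>th_ge\<close> and any level above \<open>NN u\<close> estimate the
  left-hand mean by a multiple of the mean of \<open>w\<close>, hence of \<open>w(x)\<close> by
  \<open>A\<^sub>1\<close>; and \<open>w(x)\<close> is the \<open>\<kappa>\<close>-th power of
  \<open>v(x)\<^sup>1\<^sup>-\<^sup>p\<^sup>0\<close>.\<close>

lemma NN_strong_cond:
 assumes u: "u : UU"
 shows "AE x in lebesgue. NN u x < \<infinity> --> (ALL j. RSI (nbhd j x) (%y. (u y * v y powr (1 - p0)) powr \<kappa>)
   <= en (((2 * Ch * Cw) powr (1 / \<kappa>) * v x powr (1 - p0) * enn2real (NN u x)) powr \<kappa>) * vol (nbhd j x))"
 using A1_all vp
proof (eventually_elim, intro impI allI)
 fix x j assume a: "ALL k. W k x <= Cw * w x * mm k TYPE('a)" and vx: "0 < v x" and fin: "NN u x < \<infinity>"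
 have um [measurable]: "u : LM" and u0: "0 <= u y" for y using u by (auto simp: UU_def)
 let ?m = "mm j TYPE('a)" and ?n = "enn2real (NN u x)"
 have m: "0 < ?m" by (rule mm_pos)
 have ww: "(u y * v y powr (1 - p0)) powr \<kappa> = u y powr \<kappa> * w y" for y
  using u0[of y] v0[of y] ka(4) by (simp add: powr_mult powr_powr w_def)
 define A where "A = 2 * Ch * Cw * w x"
 have A: "0 < A" using ka Cw vx by (simp add: A_def w_def)
 let ?A = "RSI (nbhd j x) (%y. u y powr \<kappa> * w y)"
 have each: "?A <= en (\<tau> powr \<kappa> * (A * ?m))" if l: "NN u x < en \<tau>" for \<tau>
 proof -
  note f = NN_feas(1)[OF u l] NN_feas(2)[OF u l, of j]
  note [measurable] = th_meas[OF u f(1)]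
  let ?D = "%x. \<theta> (u x / \<tau>)"
  have tn: "0 <= ?D y" for y using u0 f(1) by (intro th_nonneg) auto
  let ?B = "\<tau> powr \<kappa> * Ch"
  have "u y powr \<kappa> * w y <= ?B * w y + ?B * (?D y * w y)" for y
  proof -
   have "u y powr \<kappa> * w y = \<tau> powr \<kappa> * (u y / \<tau>) powr \<kappa> * w y" using f(1) u0[of y] by (simp add: powr_divide)
   also have "... <= \<tau> powr \<kappa> * (Ch * (1 + ?D y)) * w y"
    using f(1) u0[of y] w_nonneg by (intro mult_right_mono mult_left_mono th_ge) auto
   finally show ?thesis by (simp add: algebra_simps)
  qed
  hence "?A <= en ?B * RSI (nbhd j x) w + en ?B * RSI (nbhd j x) (%y. ?D y * w y)"
   using ka by (intro RSI_le_lincomb AE_I2) auto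
  also have "... <= en ?B * en (W j x) + en ?B * en (W j x)" unfolding W_eq by (intro mult_left_mono add_left_mono f(2)) auto
  also have "... = en (\<tau> powr \<kappa> * Ch * (2 * W j x))" using ka W_pos[of j x] by (simp add: ennreal_mult[symmetric] ennreal_plus[symmetric] del: ennreal_plus)
  also have "... <= en (\<tau> powr \<kappa> * Ch * (2 * (Cw * w x * ?m)))" using a ka by (intro ennreal_leI mult_left_mono) auto
  also have "\<tau> powr \<kappa> * Ch * (2 * (Cw * w x * ?m)) = \<tau> powr \<kappa> * (A * ?m)" by (simp add: A_def)
  finally show ?thesis .
 qed
 obtain y where y: "?A = en y" "0 <= y"
 proof -
  have "NN u x < en (?n + 1)" using fin by (cases "NN u x") (auto simp: ennreal_less_iff)
  from le_less_trans[OF each[OF this]] have "?A < top" by simp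
  thus ?thesis using that by (cases "?A") auto
 qed
 let ?C = "1 / \<kappa>"
 let ?F = "y / (A * ?m)"
 \<comment> \<open>Levels above \<open>NN u x\<close> are reached by adding \<open>\<delta>\<close>;
   taking the root makes the bound linear in the level, so \<open>\<delta>\<close> can tend to
   0.\<close>
 have "?F powr ?C <= ?n"
 proof (rule field_le_epsilon)
  fix \<delta> :: real assume d: "0 < \<delta>"
  let ?E = "?n + \<delta>"
  have "NN u x < en ?E" using fin d by (cases "NN u x") (auto simp: ennreal_less_iff)
  from each[OF this] have "y <= ?E powr \<kappa> * (A * ?m)" unfolding y using A m by (subst (asm) ennreal_le_iff) auto
  hence "y / (A * ?m) <= ?E powr \<kappa>" using A m by (simp add: divide_le_eq)
  hence "?F powr ?C <= (?E powr \<kappa>) powr ?C" using y A m ka by (intro powr_mono2) auto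
  also have "... = ?n + \<delta>" using ka d by (simp add: powr_powr)
  finally show "?F powr ?C <= ?n + \<delta>" .
 qed
 hence "(?F powr ?C) powr \<kappa> <= ?n powr \<kappa>" using ka by (intro powr_mono2) auto
 hence "y / (A * ?m) <= ?n powr \<kappa>" using y A m ka by (simp add: powr_powr)
 hence "y <= ?n powr \<kappa> * A * ?m" using A m by (simp add: divide_le_eq mult.assoc)
 also have "A = ((2 * Ch * Cw) powr ?C * v x powr (1 - p0)) powr \<kappa>"
  using ka Cw vx by (simp add: A_def w_def powr_mult powr_powr)
 finally have "y <= ((2 * Ch * Cw) powr ?C * v x powr (1 - p0) * ?n) powr \<kappa> * ?m"
  using ka Cw by (simp add: powr_mult mult_ac)
 thus "RSI (nbhd j x) (%y. (u y * v y powr (1 - p0)) powr \<kappa>)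
   <= en (((2 * Ch * Cw) powr ?C * v x powr (1 - p0) * ?n) powr \<kappa>) * vol (nbhd j x)"
  unfolding ww y vol_mm using m by (simp add: ennreal_mult[symmetric] ennreal_leI)
qed

end

context czv begin
theorem weighted_weak_comm:
 "\<exists>C>0. ALL b u f t. bmo_bd \<beta> b --> u : UU --> f : LM --> LB (%y. f y * v y) --> 0 < t -->
  RSI {x. t * v x < \<bar>comm T b m (%y. f y * v y) x\<bar>} (%x. u x * v x)
   <= en C * NI (%x. en (Phi m (\<bar>f x\<bar> / t) * v x) * NN u x)"
proof -
 obtain Ck where Ck: "Ck > 0" and kb: "kernel_bd K \<beta> m J \<theta> Ck" using ker[OF th(1)] by blast
 obtain \<epsilon> Ce where e: "\<epsilon> > 0" and Ce: "Ce > 0" and JN: "!!(b::'a => real) k x. bmo_bd \<beta> b ==>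
   RSI (cell k x) (%y. exp (\<epsilon> * \<bar>b y - mid \<beta> b k x\<bar>)) <= en Ce * vol (cell k x)"
  using John_Nirenberg_cell[OF \<beta>, where 'a='a] by blast
 have "ALL i. EX C. i <= m --> 0 < C & strong_bd \<kappa> p0 i C" using strong_type[OF ka(2,1)] by blast
 from choice[OF this] obtain SS where SS: "!!i. i <= m ==> 0 < SS i" and st: "!!i. i <= m ==> strong_bd \<kappa> p0 i (SS i)" by blast
 define C5 where "C5 = (2 * Ch * Cw) powr (1 / \<kappa>)"
 have C5: "0 < C5" using ka Cw by (simp add: C5_def)
 define SM where "SM = (\<Sum>i\<le>m. SS i)"
 have SM: "SS i <= SM" if "i <= m" for i unfolding SM_def using that SS by (intro member_le_sum) (auto intro: less_imp_le)
 have SM0: "0 < SM" using SS[of 0] SM[of 0] by simp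
 let ?Ce = "Ce * C1 * Cd 0"
 have Vc: "en (V l x) <= en (Cd 0) * RSI (cell l x) v" for l x using doubling[of l 0 x] by simp
 interpret czw T CT K v m J p0 \<beta> \<epsilon> "max 1 (Cd 1)" ?Ce Ct "Ck * (1 + Cw)" "SM * C5" UU NN
 proof
  show "RSI (ball 0 R) (%x. (v x)^2) < \<infinity>" for R
  proof -
   obtain c where c: "AE x in lebesgue. norm x <= R --> v x <= c" using v_locally_bounded by blast
   have "RSI (ball 0 R) (%x. (v x)^2) <= NI (%x. en (c\<^sup>2) * indicator (ball 0 R) (x::'a))"
    by (rule nn_integral_mono_AE, use c in eventually_elim) (auto simp: indicator_def v0 intro!: ennreal_leI power_mono)
   also have "... < \<infinity>" by (simp add: nn_integral_cmult_indicator ennreal_mult_less_top emeasure_bounded_finite[OF bounded_ball, simplified])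
   finally show ?thesis .
  qed
  show "0 < RSI (cell k x) v" for k x by (rule SI_pos[OF vm vp cell_lebesgue vol_facts(1)])
  show "RSI (cell (k - 1) x) v <= en (max 1 (Cd 1)) * RSI (cell k x) v" for k x
  proof -
   have "RSI (cell (k - 1) x) v <= en (V (k - int 1) x)" unfolding V_eq[symmetric] by (simp add: set_nn_integral_subset[OF cell_le_nbhd])
   also have "... <= en (Cd 1) * RSI (cell k x) v" by (rule doubling)
   also have "... <= en (max 1 (Cd 1)) * RSI (cell k x) v" by (intro mult_right_mono ennreal_leI) auto
   finally show ?thesis .
  qed
  \<comment> \<open>A large cell of small \<open>v\<close>-mass would, by doubling and the reverse
    Hoelder condition, make \<open>v\<close> on the fixed unit cell at the origin too small for its
    positive mass.\<close>
  show "EX k0. \<forall>k<k0. ALL x. norm x <= R --> M < RSI (cell k x) v" if M: "M < \<infinity>" for R M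
  proof -
   obtain M' where M': "M = en M'" "0 <= M'" using M by (cases M) auto
   define c where "c = enn2real (RSI (cell 0 0) v)"
   have cf: "RSI (cell 0 0) v < \<infinity>" by (rule le_less_trans[OF set_nn_integral_subset[OF cell_le_nbhd] vfin])
   have c: "0 < c" unfolding c_def using SI_pos[OF vm vp cell_lebesgue vol_facts(1), of 0 0] cf by (simp add: enn2real_positive_iff)
   have ceq: "RSI (cell 0 0) v = en c" unfolding c_def using cf by simp
   obtain k0 where k0: "!!k. k <= k0 ==> max (max 1 (real DIM('a) + R)) (Cd 0 * M' * C1 / c) < side k" using side_big by blast
   have "M < RSI (cell k x) v" if k: "k < k0" and x: "norm x <= R" for k x
   proof (rule ccontr)
    assume "~ ?thesis"
    hence "en (V k x) <= en (Cd 0) * M" using Vc[of k x] by (meson mult_left_mono not_le order_trans zero_le)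
    hence le: "V k x <= Cd 0 * M'" using Cd_pos[of 0] M' by (simp add: ennreal_mult[symmetric])
    have s: "1 <= side k" "real DIM('a) + R < side k" "Cd 0 * M' * C1 / c < side k" using k0[of k] k by auto
    have sub: "cell 0 0 <= nbhd k x"
    proof
     fix y :: 'a assume "y : cell 0 0"
     hence "norm (y - 0) <= DIM('a) * side 0" by (rule cell_norm_le)
     hence "norm y <= DIM('a)" by (simp add: side_def)
     hence "norm (y - x) <= side k" using norm_triangle_ineq4[of y x] x s by linarith
     thus "y : nbhd k x" by (rule nbhdI_norm)
    qed
    have "en (mm k TYPE('a)) * en c = NI (%y. en (mm k TYPE('a)) * (en (v y) * indicator (cell 0 (0::'a)) y))"
     unfolding ceq[symmetric] by (rule nn_integral_cmult[symmetric]) measurable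
    also have "... <= NI (%y. en (C1 * V k x) * indicator (cell 0 (0::'a)) y)"
    proof (rule nn_integral_mono_AE, use RH'[of k x] in eventually_elim)
     case (elim y)
     thus ?case using sub mm_pos[of k, where 'a='a] v0[of y]
      by (auto simp: ennreal_mult[symmetric] mult.commute intro!: ennreal_leI split: split_indicator)
    qed
    also have "... = en (C1 * V k x)" by (simp add: nn_integral_cmult_indicator emeasure_cell side_def del: emeasure_completion)
    finally have "mm k TYPE('a) * c <= C1 * V k x"
     using mm_pos[of k, where 'a='a] c par V_pos[of k x] by (simp add: ennreal_mult[symmetric])
    also have "... <= C1 * (Cd 0 * M')" using le par by (intro mult_left_mono) auto
    finally have "mm k TYPE('a) <= Cd 0 * M' * C1 / c" using c by (simp add: field_simps)
    moreover have "side k <= mm k TYPE('a)"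
    proof -
     have "side k ^ 1 <= side k ^ DIM('a)" using s by (intro power_increasing) auto
     also have "... <= 3 ^ DIM('a) * side k ^ DIM('a)" using s by (simp add: mult_le_cancel_right1)
     finally show ?thesis by (simp add: mm_def)
    qed
    ultimately show False using s by simp
   qed
   thus ?thesis by blast
  qed
  \<comment> \<open>The reverse Hoelder condition bounds \<open>v\<close> by a multiple of its mean
    over the neighbourhood, which reduces the claim to Lebesgue measure.\<close>
  show "SI (cell k x) (%y. en (exp (\<epsilon> * \<bar>b y - mid \<beta> b k x\<bar>)) * en (v y)) <= en ?Ce * RSI (cell k x) v" if b: "bmo_bd \<beta> b" for b k x
  proof -
   let ?m = "mm k TYPE('a)"
   note [measurable] = bmo_bd_meas[OF b]
   have m: "0 < ?m" by (rule mm_pos)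
   have "AE y in lebesgue. y : cell k x --> exp (\<epsilon> * \<bar>b y - mid \<beta> b k x\<bar>) * v y <= C1 * V k x / ?m * exp (\<epsilon> * \<bar>b y - mid \<beta> b k x\<bar>)"
    using RH'[of k x] by eventually_elim (use cell_le_nbhd[of k x] m in \<open>auto simp: mult.commute pos_le_divide_eq intro!: mult_right_mono\<close>)
   from RSI_le_cmult[OF _ _ _ this]
   have "SI (cell k x) (%y. en (exp (\<epsilon> * \<bar>b y - mid \<beta> b k x\<bar>)) * en (v y)) <= en (C1 * V k x / ?m) * RSI (cell k x) (%y. exp (\<epsilon> * \<bar>b y - mid \<beta> b k x\<bar>))"
    using m par V_pos[of k x] v0 by (simp add: ennreal_mult)
   also have "... <= en (C1 * V k x / ?m) * (en Ce * en ?m)"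
   proof (intro mult_left_mono order_trans[OF JN[OF b]])
    show "vol (cell k x) <= en ?m" unfolding vol_mm[of k x, symmetric] by (intro emeasure_mono cell_le_nbhd) simp
   qed auto
   also have "... = en (Ce * C1) * en (V k x)" using m Ce par V_pos[of k x] by (simp add: ennreal_mult[symmetric])
   also have "... <= en (Ce * C1) * (en (Cd 0) * RSI (cell k x) v)" by (intro mult_left_mono Vc) auto
   also have "... = en ?Ce * RSI (cell k x) v" using Ce par Cd_pos[of 0] by (simp add: ennreal_mult mult.assoc)
   finally show ?thesis .
  qed
  show "RSI (- nbhd (l - int J) x) (%w. \<bar>K (w - y) - K (w - x)\<bar> * (\<bar>b w - mid \<beta> b l x\<bar> ^ i * u w)) <= en (Ck * (1 + Cw)) * NN u z"
   if u: "u : UU" and b: "bmo_bd \<beta> b" and i: "i <= m" and y: "y : cell l x" and z: "z : cell l x" for u b i l x y z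
  proof (rule ennreal_le_multI)
   fix \<tau> assume l: "NN u z < en \<tau>"
   \<comment> \<open>Any level above \<open>NN u z\<close> bounds the \<open>\<theta>\<close>-means
     over all ancestors by \<open>Cw\<close>, the input of the kernel bound with
     \<open>\<Lambda> = \<tau>\<close>.\<close>
   have av: "RSI (nbhd j x) (%y. \<theta> (u y / \<tau>)) <= en Cw * vol (nbhd j x)" if "j <= l" for j
    using NN_av[OF u l, of j] nbhd_nested[OF z that] by simp
   from kernel_bdD[OF kb _ b _ _ _ _ y i av, of 1] NN_feas(1)[OF u l] u Cw
   show "RSI (- nbhd (l - int J) x) (%w. \<bar>K (w - y) - K (w - x)\<bar> * (\<bar>b w - mid \<beta> b l x\<bar> ^ i * u w)) <= en (Ck * (1 + Cw) * \<tau>)"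
    by (auto simp: UU_def)
  qed (use Ck Cw in simp)
  show "RI (%x. \<bar>comm T b i F x\<bar> powr p0 * (u x * v x powr (1 - p0)))
    <= en (SM * C5) * NI (%x. en (\<bar>F x\<bar> powr p0 * v x powr (1 - p0)) * NN u x)"
   if u: "u : UU" and b: "bmo_bd \<beta> b" and i: "i <= m" and F: "LB F" for u b i F
  proof -
   have um [measurable]: "u : LM" and u0: "0 <= u y" for y using u by (auto simp: UU_def)
   have [measurable]: "F : LM" using F by (simp add: LB_def L2_def)
   note [measurable] = NN_measurable[of u]
   \<comment> \<open>By \<open>NN_strong_cond\<close> this dominates the maximal function that
     \<open>strong_bd\<close> asks for.\<close>
   let ?X = "%x. en (C5 * v x powr (1 - p0)) * NN u x"
   let ?A = "%y. (u y * v y powr (1 - p0)) powr \<kappa>"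
   have "AE x in lebesgue. ?X x < \<infinity> --> (ALL j. RSI (nbhd j x) ?A <= en (enn2real (?X x) powr \<kappa>) * vol (nbhd j x))"
    using NN_strong_cond[OF u] vp
   proof (eventually_elim, intro impI)
    fix x assume a: "NN u x < \<infinity> --> (ALL j. RSI (nbhd j x) ?A
      <= en (((2 * Ch * Cw) powr (1 / \<kappa>) * v x powr (1 - p0) * enn2real (NN u x)) powr \<kappa>) * vol (nbhd j x))" and v: "0 < v x" and X: "?X x < \<infinity>"
    have "NN u x < \<infinity>" using X v C5 by (auto simp: ennreal_mult_less_top)
    thus "ALL j. RSI (nbhd j x) ?A <= en (enn2real (?X x) powr \<kappa>) * vol (nbhd j x)"
     using a C5 by (simp add: C5_def enn2real_mult)
   qed
   from strong_bdD[OF st[OF i] b F _ _ _ this] u0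
   have "RI (%x. \<bar>comm T b i F x\<bar> powr p0 * (u x * v x powr (1 - p0))) <= en (SS i) * NI (%x. en (\<bar>F x\<bar> powr p0) * ?X x)"
    by simp
   also have "... <= en SM * NI (%x. en (\<bar>F x\<bar> powr p0) * ?X x)" by (intro mult_right_mono ennreal_leI SM i) auto
   also have "NI (%x. en (\<bar>F x\<bar> powr p0) * ?X x) = NI (%x. en C5 * (en (\<bar>F x\<bar> powr p0 * v x powr (1 - p0)) * NN u x))"
    using C5 by (simp add: ennreal_mult mult_ac)
   also have "... = en C5 * NI (%x. en (\<bar>F x\<bar> powr p0 * v x powr (1 - p0)) * NN u x)" by (rule nn_integral_cmult) measurable
   finally show ?thesis using SM0 C5 by (simp add: ennreal_mult mult.assoc)
  qed
  show "1 < p0" "0 < \<epsilon>" "1 <= max 1 (Cd 1)" "0 < ?Ce" "0 < Ct" "0 < Ck * (1 + Cw)" "0 < SM * C5" "0 < \<beta>"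
   using ka r e Ce par Cd_pos[of 0] Ct_pos Ck Cw SM0 C5 \<beta> by auto
  show "u : LM" "0 <= u x" "NN u : LM" if "u : UU" for u x using that NN_measurable by (auto simp: UU_def)
  show "(%x. indicator E x * u x) : UU" if "u : UU" "E : sets lebesgue" for u E using that by (auto simp: UU_def)
  show "NN (%x. indicator E x * u x) x <= NN u x" for E u x by (rule NN_restrict)
  show "NN u y = NN u z" if "!!w. w : nbhd (l - int J) x ==> u w = 0" "y : cell l x" "z : cell l x" for u l x y z
   by (rule NN_eq_const[OF that])
 qed (use vm v0 vp NN_tent in auto)
 show ?thesis using weak_comm[OF order_refl] by blast
qed

end

section \<open>Consequences of the hypotheses on the Young functions\<close>

lemma young_divide_le:
 assumes "young \<phi>" "0 <= x" "1 <= A" shows "\<phi> (x / A) <= \<phi> x / A"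
proof -
 have "convex_on {0..} \<phi>" using assms(1) by (simp add: young_def)
 from convex_onD[OF this, of "1 / A" 0 x] show ?thesis using assms young_0[OF assms(1)] by (simp add: field_simps)
qed

text \<open>Convexity moves a multiplicative constant into the argument, which brings the inequality
  into the normal form of \<open>submult\<close>.\<close>

lemma submultI:
 assumes y: "young \<xi>t" and \<theta>: "!!x y. 0 <= x ==> x <= y ==> 0 <= \<theta> x & \<theta> x <= \<theta> y" and pos: "0 < C" "0 < N" "0 <= A"
  and le: "!!x y. 0 <= x ==> 0 <= y ==> \<xi>t (x * y / C) <= A * (\<theta> x + y powr N + 1)"
 shows "submult \<xi>t \<theta>"
proof -
 let ?B = "max 1 A" let ?D = "(C + 1) * ?B"
 have D: "1 <= ?D" using pos mult_mono[of 1 "C + 1" 1 ?B] by simp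
 have "\<xi>t (x * y / ?D) <= \<theta> x + y powr N + ?D" if xy: "0 <= x" "0 <= y" for x y
 proof -
  have \<theta>0: "0 <= \<theta> x" using \<theta>[OF xy(1) order_refl] by simp
  have "\<xi>t (x * y / ?D) = \<xi>t (x * y / (C + 1) / ?B)" by simp
  also have "... <= \<xi>t (x * y / (C + 1)) / ?B" using xy pos by (intro young_divide_le[OF y]) auto
  also have "... <= \<xi>t (x * y / C) / ?B" using xy pos by (intro divide_right_mono young_mono[OF y] divide_left_mono) auto
  also have "... <= ?B * (\<theta> x + y powr N + 1) / ?B" using le[OF xy] \<theta>0 by (intro divide_right_mono order_trans[OF le[OF xy] mult_right_mono]) auto
  finally show ?thesis using D by (simp split: if_splits)
 qed
 thus ?thesis using \<theta> D pos(2) unfolding submult_def by (intro conjI exI[of _ ?D] exI[of _ N]) auto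
qed

text \<open>Upper type at \<open>t = 1\<close> gives growth of order \<open>r\<close>; Young's
  inequality with exponent \<open>a / r > 1\<close> then separates the product.\<close>

lemma upper_type_submult:
 assumes y: "young \<xi>t" and ut: "upper_type \<xi>t r" and r: "0 < r" "r < a"
 shows "submult \<xi>t (%x. x powr a)"
proof -
 obtain C where C: "!!s t. 1 <= s ==> 0 <= t ==> \<xi>t (s * t) <= C * s powr r * \<xi>t t" using ut by (auto simp: upper_type_def)
 define N where "N = r * (a / r / (a / r - 1))"
 have N: "0 < N" using r by (simp add: N_def field_simps)
 let ?A = "(\<bar>C\<bar> + 1) * \<xi>t 1"
 have x1: "0 <= \<xi>t 1" by (rule young_nonneg[OF y]) simp
 show ?thesis
 proof (rule submultI[OF y, of _ 1 N ?A])
  fix x y' :: real assume xy: "0 <= x" "0 <= y'"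
  have "\<xi>t (x * y') <= ?A * (1 + (x * y') powr r)"
  proof (cases "1 <= x * y'")
   case True
   have "\<xi>t (x * y') <= C * (x * y') powr r * \<xi>t 1" using C[OF True, of 1] by simp
   also have "... <= (\<bar>C\<bar> + 1) * (1 + (x * y') powr r) * \<xi>t 1" using x1 by (intro mult_right_mono mult_mono) auto
   finally show ?thesis by (simp add: mult_ac)
  next
   case False
   hence "\<xi>t (x * y') <= \<xi>t 1" using xy by (intro young_mono[OF y]) auto
   also have "... = 1 * \<xi>t 1 * 1" by simp
   also have "... <= ?A * (1 + (x * y') powr r)" using x1 by (intro mult_mono) auto
   finally show ?thesis .
  qed
  also have "... <= ?A * (1 + (x powr a + y' powr N))"
   using x1 prod_le_powr[of "y' powr r" "x powr r" "a / r"] r xy by (intro mult_left_mono add_left_mono) (auto simp: powr_mult powr_powr N_def mult.commute)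
  finally show "\<xi>t (x * y' / 1) <= ?A * (x powr a + y' powr N + 1)" using x1 by (simp add: add_ac)
 qed (use r N x1 in \<open>auto intro: powr_mono2\<close>)
qed

text \<open>A convex function is continuous on the open half-line, and continuity at 0 follows from
  \<open>0 \<le> \<phi> x \<le> x \<phi> 1\<close> for small \<open>x\<close>.\<close>

lemma young_surj:
 assumes y: "young \<phi>" and l: "0 <= l" shows "\<exists>x\<ge>0. \<phi> x = l"
proof -
 have cv: "convex_on {0..} \<phi>" and lim: "filterlim \<phi> at_top at_top" using y by (auto simp: young_def)
 have "eventually (%x. l <= \<phi> x & 1 <= x) at_top" using lim by (auto simp: filterlim_at_top eventually_ge_at_top intro: eventually_conj)
 then obtain b where b: "l <= \<phi> b" "1 <= b" unfolding eventually_at_top_linorder by blast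
 have "convex_on {0<..} \<phi>" using cv by (rule convex_on_subset) auto
 hence c1: "continuous_on {0<..} \<phi>" using convex_on_continuous[of "{0<..}" \<phi>] by simp
 have "(\<phi> \<longlongrightarrow> \<phi> 0) (at_right 0)"
 proof (rule tendsto_sandwich[of "%_. 0" _ _ "%x. x * \<phi> 1"])
  show "\<forall>\<^sub>F x in at_right 0. 0 <= \<phi> x" by (rule eventually_mono[OF eventually_at_right_less]) (use young_nonneg[OF y] in auto)
  show "\<forall>\<^sub>F x in at_right 0. \<phi> x <= x * \<phi> 1"
   unfolding eventually_at_right_field
  proof (intro exI[of _ 1] conjI allI impI)
   show "\<phi> x <= x * \<phi> 1" if "0 < x" "x < 1" for x using young_divide_le[OF y, of 1 "1 / x"] that by (simp add: mult.commute)
  qed simp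
  show "((%x. x * \<phi> 1) \<longlongrightarrow> \<phi> 0) (at_right 0)" using young_0[OF y] by (auto intro!: tendsto_eq_intros)
 qed (use young_0[OF y] in simp)
 hence c0: "continuous (at 0 within {0..}) \<phi>" by (simp add: continuous_within at_within_Ici_at_right)
 have "continuous_on {0..} \<phi>"
  unfolding continuous_on_eq_continuous_within
 proof
  fix x :: real assume "x : {0..}"
  show "continuous (at x within {0..}) \<phi>"
  proof (cases "x = 0")
   case False
   hence "isCont \<phi> x" using c1 \<open>x : {0..}\<close> by (simp add: continuous_on_eq_continuous_at)
   thus ?thesis by (rule continuous_at_imp_continuous_at_within)
  qed (use c0 in simp)
 qed
 hence "continuous_on {0..b} \<phi>" by (rule continuous_on_subset) auto
 from IVT'[OF _ b(1) _ this] show ?thesis using young_0[OF y] l b by auto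
qed

lemma yinv:
 assumes y: "young \<phi>" and l: "0 <= l"
 shows yinv_nonneg: "0 <= yinv \<phi> l" and yinv_right: "\<phi> (yinv \<phi> l) = l" and yinv_ge: "0 <= x ==> \<phi> x <= l ==> x <= yinv \<phi> l"
proof -
 have sm: "strict_mono_on {0..} \<phi>" using y by (simp add: young_def)
 have inj: "inj_on \<phi> {0..}" by (rule strict_mono_on_imp_inj_on[OF sm])
 have l': "l : \<phi> ` {0..}" using young_surj[OF y l] by auto
 show 0: "0 <= yinv \<phi> l" using the_inv_into_into[OF inj l' order_refl] by (simp add: yinv_def)
 show e: "\<phi> (yinv \<phi> l) = l" unfolding yinv_def by (rule f_the_inv_into_f[OF inj l'])
 show "x <= yinv \<phi> l" if "0 <= x" "\<phi> x <= l"
  using strict_mono_onD[OF sm, of "yinv \<phi> l" x] that 0 e by force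
qed

text \<open>Monotonicity of \<open>\<eta>\<close> on \<open>[t, 2 t]\<close> turns convergence of
  the integral into a pointwise bound.\<close>

lemma B_cond_growth:
 assumes y: "young \<eta>" and B: "B_cond P \<eta>" and P: "0 < P"
 shows "\<exists>A>0. \<forall>x\<ge>0. \<eta> x <= A * (x powr P + 1)"
proof -
 obtain c where c: "0 < c" and I: "(\<integral>\<^sup>+t\<in>{c..}. en (\<eta> t / t powr P / t) \<partial>lborel) < \<infinity>" using B unfolding B_cond_def by blast
 then obtain i where i: "(\<integral>\<^sup>+t\<in>{c..}. en (\<eta> t / t powr P / t) \<partial>lborel) = en i" "0 <= i" by (cases "\<integral>\<^sup>+t\<in>{c..}. en (\<eta> t / t powr P / t) \<partial>lborel") auto
 have big: "\<eta> t <= 2 * i * 2 powr P * t powr P" if t: "c <= t" for t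
 proof -
  have t0: "0 < t" using t c by simp
  have "en (\<eta> t / (2 * t) powr P / (2 * t) * t) = \<integral>\<^sup>+s. en (\<eta> t / (2 * t) powr P / (2 * t)) * indicator {t..2 * t} s \<partial>lborel"
   using t0 young_nonneg[OF y, of t] by (simp add: nn_integral_cmult_indicator ennreal_mult[symmetric])
  also have "... <= (\<integral>\<^sup>+s\<in>{c..}. en (\<eta> s / s powr P / s) \<partial>lborel)"
  proof (rule nn_integral_mono, goal_cases)
   case (1 s)
   have "\<eta> t / (2 * t) powr P / (2 * t) <= \<eta> s / s powr P / s" if s: "t <= s" "s <= 2 * t"
    using s t0 P young_nonneg[OF y, of t] young_mono[OF y _ s(1)] by (intro frac_le divide_nonneg_nonneg powr_mono2) auto
   thus ?case
    using t by (auto split: split_indicator intro: ennreal_leI)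
  qed
  finally have "\<eta> t / (2 * t) powr P / (2 * t) * t <= i" unfolding i using i(2) by simp
  thus ?thesis using t0 by (simp add: powr_mult field_simps)
 qed
 have e0: "0 <= \<eta> c" using c by (intro young_nonneg[OF y]) simp
 have "\<eta> x <= (2 * i * 2 powr P + \<eta> c + 1) * (x powr P + 1)" if x: "0 <= x" for x
 proof (cases "c <= x")
  case True
  have "\<eta> x <= (2 * i * 2 powr P) * x powr P" by (rule big[OF True])
  also have "... <= (2 * i * 2 powr P + \<eta> c + 1) * (x powr P + 1)" using e0 i(2) by (intro mult_mono) auto
  finally show ?thesis .
 next
  case False
  hence "\<eta> x <= \<eta> c * 1" using x young_mono[OF y x, of c] by simp
  also have "... <= (2 * i * 2 powr P + \<eta> c + 1) * (x powr P + 1)" using e0 i(2) by (intro mult_mono) auto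
  finally show ?thesis .
 qed
 moreover have "0 < 2 * i * 2 powr P + \<eta> c + 1" using e0 i(2) by (simp add: add_nonneg_pos)
 ultimately show ?thesis by blast
qed

text \<open>The inequality between the inverses bounds \<open>\<xi>t(X Y / C0)\<close> by a multiple
  of \<open>\<phi>(X) + Y^P + 1\<close> with \<open>P = p'\<close>. Lower type \<open>s\<close>
  bounds \<open>\<xi>t\<close> from below by the power \<open>s\<close>; taking for \<open>Y\<close>
  a small multiple of \<open>X^(s/(P - s))\<close> absorbs \<open>Y^P\<close> and bounds
  \<open>X^E\<close> by a multiple of \<open>\<phi>(X) + 1\<close>, where
  \<open>E = s P / (P - s)\<close>. As \<open>p P = p + P\<close>, the condition
  \<open>E > p\<close> says exactly \<open>s > 1\<close>. For \<open>submult\<close>,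
  \<open>x\<close> is factored as \<open>x^(1/p) x^(1/P)\<close>.\<close>

lemma theta_bounds:
 assumes yt: "young \<xi>t" and ye: "young \<eta>" and yp: "young \<phi>" and lt: "lower_type \<xi>t s"
  and sr: "1 < s" "s < r" and p: "r < p" "p < r / (r - 1)" and B: "B_cond (p / (p - 1)) \<eta>"
  and inv: "EX C. \<forall>lam\<ge>lam0. yinv \<eta> lam * yinv \<phi> lam <= C * yinv \<xi>t lam"
 shows "\<exists>\<kappa> Ch. 1 < \<kappa> & \<kappa> <= r & 0 < Ch & (\<forall>x\<ge>0. x powr \<kappa> <= Ch * (1 + \<phi> (x powr (1 / p)))) & submult \<xi>t (%x. \<phi> (x powr (1 / p)))"
proof -
 define P where "P = p / (p - 1)"
 have p1: "1 < p" using sr p by linarith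
 hence P1: "1 < P" by (simp add: P_def less_divide_eq)
 have pP: "p * P = p + P" using p1 by (simp add: P_def field_simps)
 \<comment> \<open>From \<open>p < r'\<close> it follows that \<open>r < p'\<close>, hence
   \<open>s < P\<close>.\<close>
 have "p * (r - 1) < r" using p sr by (simp add: field_simps)
 hence "r * (p - 1) < p" by (simp add: algebra_simps)
 moreover have "s * (p - 1) < r * (p - 1)" using sr p1 by (intro mult_strict_right_mono) auto
 ultimately have "s * (p - 1) < p" by linarith
 hence Ps: "s < P" using p1 by (simp add: P_def less_divide_eq)
 obtain A1 where A1: "0 < A1" "!!x. 0 <= x ==> \<eta> x <= A1 * (x powr P + 1)" using B_cond_growth[OF ye B] P1 unfolding P_def by auto
 obtain C where C: "!!lam. lam0 <= lam ==> yinv \<eta> lam * yinv \<phi> lam <= C * yinv \<xi>t lam" using inv by blast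
 define C0 where "C0 = max 1 C"
 define A where "A = 1 + A1 + \<bar>lam0\<bar>"
 have A: "0 < A" and C0: "0 < C0" using A1 by (simp_all add: A_def C0_def)
 have G: "\<xi>t (X * Y / C0) <= A * (\<phi> X + Y powr P + 1)" if XY: "0 <= X" "0 <= Y" for X Y
 proof -
  note n = young_nonneg[OF yp XY(1)] young_nonneg[OF ye XY(2)]
  \<comment> \<open>One level above both \<open>\<phi> X\<close> and \<open>\<eta> Y\<close>, and
    above \<open>lam0\<close>, where the inequality between the inverses is valid.\<close>
  let ?l = "\<phi> X + \<eta> Y + \<bar>lam0\<bar>"
  have l: "0 <= ?l" using n by simp
  let ?B = "yinv \<xi>t ?l"
  have "X * Y <= yinv \<eta> ?l * yinv \<phi> ?l"
   unfolding mult.commute[of X] using XY n yinv_ge[OF ye l, of Y] yinv_ge[OF yp l, of X] yinv_nonneg[OF ye l] by (intro mult_mono) auto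
  also have "... <= C * ?B" using n by (intro C) linarith
  also have "... <= C0 * ?B" unfolding C0_def using yinv_nonneg[OF yt l] by (intro mult_right_mono) auto
  finally have "X * Y / C0 <= ?B" using C0 by (simp add: divide_le_eq mult.commute)
  hence "\<xi>t (X * Y / C0) <= ?l" using young_mono[OF yt, of "X * Y / C0" "?B"] XY C0 yinv_right[OF yt l] by simp
  also have "... <= \<phi> X + A1 * (Y powr P + 1) + \<bar>lam0\<bar>" using A1(2)[OF XY(2)] by simp
  also have "... <= A * \<phi> X + A * (Y powr P + 1)"
   using n A1(1) mult_nonneg_nonneg[of A1 "\<phi> X"] mult_nonneg_nonneg[of "\<bar>lam0\<bar>" "\<phi> X"] mult_nonneg_nonneg[of "\<bar>lam0\<bar>" "Y powr P"] powr_ge_zero[of Y P]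
   by (simp add: A_def algebra_simps del: powr_ge_zero)
  finally show ?thesis by (simp add: distrib_left)
 qed
 obtain c where c: "!!a t. 0 <= a ==> a <= 1 ==> 0 <= t ==> \<xi>t (a * t) <= c * a powr s * \<xi>t t" using lt by (auto simp: lower_type_def)
 have x1: "0 < \<xi>t 1" using yt young_0[OF yt] strict_mono_onD[of "{0..}" \<xi>t 0 1] by (simp add: young_def)
 define L where "L = \<bar>c\<bar> / \<xi>t 1 + 1"
 have L: "1 <= L" using x1 by (simp add: L_def)
 have low: "z powr s <= L * (\<xi>t z + 1)" if z: "0 <= z" for z
 proof (cases "1 <= z")
  case True
  note nz = young_nonneg[OF yt z]
  have "\<xi>t 1 <= c * (1 / z) powr s * \<xi>t z" using c[of "1 / z" z] True by simp
  also have "... <= \<bar>c\<bar> * (1 / z) powr s * \<xi>t z" using nz by (intro mult_right_mono) auto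
  finally have "z powr s <= \<bar>c\<bar> / \<xi>t 1 * \<xi>t z" using True x1 by (simp add: powr_divide field_simps)
  also have "... <= L * (\<xi>t z + 1)" unfolding L_def using nz x1 by (intro mult_mono) auto
  finally show ?thesis .
 next
  case False
  have "z powr s <= 1 powr s" using False z sr by (intro powr_mono2) auto
  also have "... <= L * (\<xi>t z + 1)" using L young_nonneg[OF yt z] mult_mono[of 1 L 1 "\<xi>t z + 1"] by simp
  finally show ?thesis .
 qed
 define B where "B = C0 powr s * L * (A + 1)"
 have B: "0 < B" using C0 L A by (simp add: B_def)
 have XYs: "(X * Y) powr s <= B * (\<phi> X + Y powr P + 1)" if XY: "0 <= X" "0 <= Y" for X Y
 proof -
  have "(X * Y) powr s = C0 powr s * (X * Y / C0) powr s" using C0 XY by (simp add: powr_divide)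
  also have "... <= C0 powr s * (L * (A * (\<phi> X + Y powr P + 1) + 1))"
   using low[of "X * Y / C0"] G[OF XY] XY C0 L by (intro mult_left_mono order_trans[OF low] add_right_mono) auto
  also have "... <= C0 powr s * (L * ((A + 1) * (\<phi> X + Y powr P + 1)))"
   using L young_nonneg[OF yp XY(1)] by (intro mult_left_mono) (auto simp: distrib_right)
  finally show ?thesis by (simp add: B_def mult_ac)
 qed
 \<comment> \<open>Chosen so that \<open>B \<epsilon>^P = \<epsilon>^s / 2\<close>, which lets the
   term with \<open>Y^P\<close> be absorbed into half of the left-hand side.\<close>
 define \<epsilon> where "\<epsilon> = (1 / (2 * B)) powr (1 / (P - s))"
 have e: "0 < \<epsilon>" using B by (simp add: \<epsilon>_def)
 have "\<epsilon> powr (P - s) = 1 / (2 * B)" using B Ps by (simp add: \<epsilon>_def powr_powr)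
 hence eP: "B * \<epsilon> powr P = \<epsilon> powr s / 2" using B e by (simp add: powr_diff field_simps)
 define E where "E = s * P / (P - s)"
 have E: "s + s * s / (P - s) = E" "s * P / (P - s) = E" using Ps by (auto simp: E_def field_simps)
 have XE: "X powr E <= 2 * B / \<epsilon> powr s * (\<phi> X + 1)" if X: "0 <= X" for X
 proof -
  let ?Y = "\<epsilon> * X powr (s / (P - s))"
  have "(X * ?Y) powr s = \<epsilon> powr s * X powr E" "?Y powr P = \<epsilon> powr P * X powr E"
   using e X by (simp_all add: powr_mult powr_powr powr_add[symmetric] E mult.left_commute)
  hence "\<epsilon> powr s * X powr E <= B * (\<phi> X + 1) + (B * \<epsilon> powr P) * X powr E" using XYs[OF X, of ?Y] e by (simp add: algebra_simps)
  thus ?thesis unfolding eP using e by (simp add: field_simps)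
 qed
 \<comment> \<open>The cap at \<open>r\<close> is what later gives \<open>p0 > r\<close>.\<close>
 define \<kappa> where "\<kappa> = min r (E / p)"
 have "P * p < s * (P + p)" using sr p1 P1 pP by (simp add: mult.commute add.commute)
 hence k: "1 < \<kappa>" "\<kappa> <= r" "\<kappa> <= E / p" using sr p1 P1 Ps by (auto simp: \<kappa>_def E_def field_simps)
 let ?\<theta> = "%x. \<phi> (x powr (1 / p))"
 define Ch where "Ch = 2 * B / \<epsilon> powr s + 1"
 have Ch: "0 < Ch" "1 <= Ch" using B by (simp_all add: Ch_def add_nonneg_pos)
 have th0: "0 <= ?\<theta> x" for x by (rule young_nonneg[OF yp]) simp
 have xk: "x powr \<kappa> <= Ch * (1 + ?\<theta> x)" if x: "0 <= x" for x
 proof -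
  have "x powr \<kappa> <= 1 + x powr (E / p)"
  proof (cases "1 <= x")
   case True
   thus ?thesis using powr_mono[OF k(3) True] by simp
  next
   case False
   hence "x powr \<kappa> <= 1 powr \<kappa>" using x k by (intro powr_mono2) auto
   thus ?thesis by (simp add: add_increasing2)
  qed
  also have "... = 1 + (x powr (1 / p)) powr E" by (simp add: powr_powr)
  also have "... <= 1 + 2 * B / \<epsilon> powr s * (?\<theta> x + 1)" by (intro add_left_mono XE) simp
  also have "... <= Ch * (1 + ?\<theta> x)" using th0[of x] by (simp add: Ch_def distrib_right add.commute)
  finally show ?thesis .
 qed
 have "submult \<xi>t ?\<theta>"
 proof (rule submultI[OF yt _ C0, of _ "P * (\<kappa> / (\<kappa> - 1))" "A * (1 + Ch)"])
  show "0 <= ?\<theta> x & ?\<theta> x <= ?\<theta> y" if "0 <= x" "x <= y" for x y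
   using that p1 by (intro conjI th0 young_mono[OF yp] powr_mono2) auto
  fix x y :: real assume x: "0 <= x" and y: "0 <= y"
  let ?A = "\<kappa> / (\<kappa> - 1)"
  \<comment> \<open>The second factor of \<open>x\<close> joins \<open>y\<close>, so that the
    \<open>P\<close>-th power is \<open>x y^P\<close>; Young's inequality puts the exponent
    \<open>\<kappa>\<close> on \<open>x\<close>, where \<open>xk\<close> applies.\<close>
  let ?C = "x powr (1 / P) * y"
  let ?D = "\<xi>t (x * y / C0)"
  let ?E = "?\<theta> x + y powr (P * ?A) + 1"
  have "x powr (1 / p) * x powr (1 / P) = x" using x p1 P1 pP by (simp add: powr_add[symmetric] add_divide_eq_iff field_simps)
  hence "?D = \<xi>t (x powr (1 / p) * ?C / C0)" by (simp add: mult.assoc[symmetric])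
  also have "... <= A * (?\<theta> x + ?C powr P + 1)" using y by (intro G) auto
  also have "?C powr P = y powr P * x" using x y P1 by (simp add: powr_mult powr_powr mult.commute)
  also have "... <= (y powr P) powr ?A + x powr \<kappa>" using x k by (intro prod_le_powr) auto
  also have "... <= y powr (P * ?A) + Ch * (1 + ?\<theta> x)" using xk[OF x] by (simp add: powr_powr)
  finally have "?D <= A * (?\<theta> x + (y powr (P * ?A) + Ch * (1 + ?\<theta> x)) + 1)" using A by (simp add: mult_left_mono)
  also have "... <= A * ((1 + Ch) * ?E)" using A Ch th0[of x] by (intro mult_left_mono) (auto simp: algebra_simps)
  finally show "?D <= A * (1 + Ch) * ?E" by (simp add: mult.assoc)
 qed (use P1 k A Ch in auto)
 thus ?thesis using k Ch xk by blast
qed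

section \<open>Truncation of \<open>b\<close>\<close>

definition trunc :: "nat => real => real" where "trunc n x = max (- real n) (min (real n) x)"

lemma trunc_lipschitz: "\<bar>trunc n x - trunc n y\<bar> <= \<bar>x - y\<bar>" and trunc_le: "\<bar>trunc n x\<bar> <= \<bar>x\<bar>" and trunc_bounded: "\<bar>trunc n x\<bar> <= real n"
 and trunc_eq: "\<bar>x\<bar> <= real n ==> trunc n x = x"
 by (auto simp: trunc_def)

lemma trunc_LIMSEQ: "(%n. trunc n x) \<longlonglongrightarrow> x"
proof -
 obtain N where "\<bar>x\<bar> <= real N" using real_arch_simple by blast
 hence "eventually (%n. trunc n x = x) sequentially" by (auto intro!: eventually_sequentiallyI[of N] trunc_eq)
 thus ?thesis by (rule tendsto_eventually)
qed

lemma trunc_measurable [measurable]: "b : borel_measurable M ==> (%x. trunc n (b x)) : borel_measurable M"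
 unfolding trunc_def by (intro borel_measurable_max borel_measurable_min borel_measurable_const)

text \<open>Truncation is 1-Lipschitz, so the oscillation about the truncated mean does not
  increase.\<close>

lemma trunc_bmo_bd:
 fixes b :: "'a::euclidean_space => real"
 assumes b: "in_BMO b" and n: "bmo_norm b <= en \<beta>" shows "bmo_bd \<beta> (%x. trunc n (b x))"
 unfolding bmo_bd_def
proof (intro conjI allI)
 have [measurable]: "b : LM" using b by (simp add: in_BMO_def locint_def)
 show "(%x. trunc n (b x)) : LM" by measurable
 show "EX M. ALL x. \<bar>trunc n (b x)\<bar> <= M" using trunc_bounded by blast
 fix k and x :: 'a
 define c where "c = (LINT y:cube_of k x|lebesgue. b y) / measure lebesgue (cube_of k x)"
 let ?A = "%y. \<bar>b y - c\<bar>"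
 have "RSI (nbhd k x) (%y. \<bar>trunc n (b y) - trunc n c\<bar>) <= RSI (nbhd k x) ?A"
  by (intro nn_integral_mono mult_right_mono ennreal_leI trunc_lipschitz) auto
 also have "avg (cube_of k x) ?A <= bmo_norm b" unfolding bmo_norm_def c_def by (rule SUP_upper) (simp add: is_cube_of)
 hence "RSI (nbhd k x) ?A <= en \<beta> * vol (nbhd k x)"
  using order_trans[OF _ n] unfolding avg_cube_of by (subst ennreal_divide_le_iff[symmetric]) (auto simp del: emeasure_completion)
 finally show "EX c. RSI (nbhd k x) (%y. \<bar>trunc n (b y) - c\<bar>) <= en \<beta> * vol (nbhd k x)" by blast
qed

text \<open>John-Nirenberg holds uniformly for the truncations, their centres stay bounded because
  \<open>b\<close> is locally integrable, and Fatou's lemma passes to \<open>b\<close>.\<close>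

lemma BMO_power_finite:
 fixes b :: "'a::euclidean_space => real"
 assumes b: "in_BMO b" shows "RSI (nbhd k x) (%y. \<bar>b y\<bar> ^ N) < \<infinity>"
proof -
 have bm [measurable]: "b : LM" using b by (simp add: in_BMO_def locint_def)
 obtain \<beta> where "bmo_norm b = en \<beta>" using b by (cases "bmo_norm b") (auto simp: in_BMO_def)
 hence \<beta>: "0 < max 1 \<beta>" "bmo_norm b <= en (max 1 \<beta>)" by (auto intro: ennreal_leI)
 note bd = trunc_bmo_bd[OF b \<beta>(2)]
 let ?G = "max 1 \<beta>"
 obtain A where A: "A > 0" and JN: "!!(b::'a => real) k x. bmo_bd ?G b ==> RSI (nbhd k x) (%y. (1 + \<bar>b y - mid ?G b k x\<bar>) powr (real N + 1)) <= en A * vol (nbhd k x)"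
  using John_Nirenberg_powr[OF \<beta>(1), of "real N + 1", where 'a='a] by auto
 let ?c = "%n. mid ?G (%x. trunc n (b x)) k x"
 have m: "0 < mm k TYPE('a)" by (rule mm_pos)
 let ?A = "RSI (nbhd k x) (%y. \<bar>b y\<bar>)"
 obtain I where I: "?A = en I" "0 <= I"
 proof -
  have "set_integrable lebesgue (cube_of k x) b" using b by (simp add: in_BMO_def locint_def cube_of_def)
  hence "RI (%y. \<bar>indicator (cube_of k x) y * b y\<bar>) < \<infinity>" by (simp add: set_integrable_def integrable_iff_bounded)
  also have "RI (%y. \<bar>indicator (cube_of k x) y * b y\<bar>) = RSI (cube_of k x) (%y. \<bar>b y\<bar>)" by (intro nn_integral_cong) (auto simp: indicator_def)
  finally show ?thesis using that unfolding SI_cube_of by (cases "?A") auto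
 qed
 define D where "D = max 1 \<beta> + I / mm k TYPE('a)"
 have D: "0 <= D" using I m by (simp add: D_def)
 have mid: "\<bar>?c n\<bar> <= D" for n
 proof -
  have mid_le: "\<bar>?c n\<bar> <= \<bar>trunc n (b y) - ?c n\<bar> + \<bar>b y\<bar>" for y using trunc_le[of n "b y"] by linarith
  let ?D = "RSI (nbhd k x) (%y. \<bar>trunc n (b y) - ?c n\<bar>)"
  have "en (\<bar>?c n\<bar> * mm k TYPE('a)) = RSI (nbhd k x) (%_. \<bar>?c n\<bar>)"
   using m by (simp add: nn_integral_cmult_indicator vol_mm ennreal_mult del: emeasure_completion)
  also have "... <= en 1 * ?D + en 1 * ?A"
   using mid_le by (intro RSI_le_lincomb AE_I2) auto
  also have "... = ?D + ?A" by simp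
  also have "... <= en ?G * vol (nbhd k x) + en I" unfolding I by (intro add_right_mono mid_osc bd)
  also have "... = en (D * mm k TYPE('a))" unfolding vol_mm using m I by (simp add: ennreal_mult[symmetric] ennreal_plus[symmetric] D_def distrib_right del: ennreal_plus)
  finally show ?thesis using m D by simp
 qed
 let ?B = "en ((1 + D) powr (real N + 1))"
 let ?C = "%z. RSI (nbhd k x) (%y. \<bar>trunc z (b y)\<bar> ^ N)"
 let ?F = "en A * vol (nbhd k x)"
 have each: "?C n <= ?B * ?F" for n
 proof -
  have "\<bar>trunc n (b y)\<bar> ^ N <= (1 + D) powr (real N + 1) * (1 + \<bar>trunc n (b y) - ?c n\<bar>) powr (real N + 1)" for y
  proof -
   let ?e = "\<bar>trunc n (b y) - ?c n\<bar>"
   have "\<bar>trunc n (b y)\<bar> <= ?e + D" using mid[of n] by linarith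
   also have "... <= (1 + D) * (1 + ?e)" using D by (simp add: algebra_simps)
   finally have "\<bar>trunc n (b y)\<bar> ^ N <= ((1 + D) * (1 + ?e)) ^ N" by (intro power_mono) auto
   also have "... <= ((1 + D) * (1 + ?e)) ^ (N + 1)" using D mult_mono[of 1 "1 + D" 1 "1 + ?e"] by (intro power_increasing) auto
   finally show ?thesis
    using D by (simp add: powr_add powr_realpow power_mult_distrib add_pos_nonneg mult_ac)
  qed
  hence "?C n <= ?B * RSI (nbhd k x) (%y. (1 + \<bar>trunc n (b y) - ?c n\<bar>) powr (real N + 1))"
   by (intro RSI_le_cmult AE_I2) auto
  also have "... <= ?B * ?F" by (intro mult_left_mono JN bd) simp
  finally show ?thesis .
 qed
 let ?E = "%y. %n. en (\<bar>trunc n (b y)\<bar> ^ N) * indicator (nbhd k x) y"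
 have lim: "(?E y) \<longlonglongrightarrow> en (\<bar>b y\<bar> ^ N) * indicator (nbhd k x) y" for y
  by (cases "y : nbhd k x") (auto intro!: tendsto_ennrealI tendsto_power tendsto_rabs trunc_LIMSEQ)
 have "RSI (nbhd k x) (%y. \<bar>b y\<bar> ^ N) = NI (%y. liminf (?E y))"
  by (intro nn_integral_cong) (simp add: lim_imp_Liminf[OF _ lim])
 also have "... <= liminf (%n. ?C n)" by (rule nn_integral_liminf) measurable
 also have "... <= ?B * ?F" by (intro Liminf_le always_eventually allI each) simp
 also have "... < \<infinity>" by (simp add: vol_mm ennreal_mult_less_top del: emeasure_completion)
 finally show ?thesis .
qed

context wt begin

text \<open>Makes every \<open>T (b^j f v)\<close> in the expansion of the commutator a value at a
  square integrable function, even for unbounded \<open>b\<close>.\<close>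

lemma LB_BMO_power:
 assumes b: "in_BMO b" and f: "f : LM" "!!x. \<bar>f x\<bar> <= M" "!!x. R < norm x ==> f x = 0"
 shows "LB (%y. b y ^ j * (f y * v y))"
proof -
 have [measurable]: "b : LM" "f : LM" using b f by (auto simp: in_BMO_def locint_def)
 obtain c where c: "AE x in lebesgue. norm x <= R --> v x <= c" using v_locally_bounded by blast
 obtain k0 where k0: "!!k. k <= k0 ==> R < side k" using side_big by blast
 have sub: "x : nbhd k0 0" if "norm x <= R" for x :: 'a using that k0[of k0] by (auto intro!: nbhdI_norm)
 have "RI (%y. (b y ^ j * (f y * v y))^2) <= NI (%y. en ((M * c)^2) * (en (\<bar>b y\<bar> ^ (2 * j)) * indicator (nbhd k0 0) y))"
 proof (rule nn_integral_mono_AE, use c in eventually_elim)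
  case (elim y)
  show ?case
  proof (cases "norm y <= R")
   case True
   have "(\<bar>f y\<bar> * v y)^2 <= (M * c)^2" using f(2)[of y] v0[of y] elim True by (intro power_mono mult_mono) auto
   hence "\<bar>b y\<bar> ^ (2 * j) * (\<bar>f y\<bar> * v y)^2 <= \<bar>b y\<bar> ^ (2 * j) * (M * c)^2" by (intro mult_left_mono) auto
   hence "(b y ^ j * (f y * v y))^2 <= (M * c)^2 * \<bar>b y\<bar> ^ (2 * j)" by (simp add: power_mult_distrib power_mult[symmetric] power_even_abs mult.commute)
   thus ?thesis using sub[OF True] by (auto simp: ennreal_mult[symmetric] intro!: ennreal_leI)
  qed (use f(3)[of y] in simp)
 qed
 also have "... = en ((M * c)^2) * RSI (nbhd k0 0) (%y. \<bar>b y\<bar> ^ (2 * j))" by (rule nn_integral_cmult) measurable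
 also have "... < \<infinity>" using BMO_power_finite[OF b] by (simp add: ennreal_mult_less_top)
 finally show ?thesis using f(3) by (auto simp: LB_def L2_iff)
qed

end

context L2_op begin

lemma T_norm_integral: assumes f: "L2 f" shows "(LINT x|lebesgue. (T f x)^2) <= CT * (LINT x|lebesgue. (f x)^2)"
proof -
 have "integrable lebesgue (%x. (f x)^2)" "integrable lebesgue (%x. (T f x)^2)" using f T_L2[OF f] by (auto simp: L2_def)
 thus ?thesis using T_norm[OF f] CT by (simp add: nn_integral_eq_integral ennreal_mult[symmetric])
qed

text \<open>With \<open>b\<close> truncated in \<open>b^j F\<close>, the values of \<open>T\<close>
  converge in \<open>L\<^sup>2\<close> by dominated convergence. Summing the squared errors over
  \<open>j\<close> yields one subsequence along which all of them converge almost everywhere, and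
  \<open>comm_expansion\<close> carries this over to the commutator.\<close>

lemma comm_trunc_subseq:
 assumes bm [measurable]: "b : LM" and F: "!!j. L2 (%y. b y ^ j * F y)"
 shows "\<exists>\<rho>::nat => nat. AE x in lebesgue. (%n. comm T (%y. trunc (\<rho> n) (b y)) m F x) \<longlonglongrightarrow> comm T b m F x"
proof -
 have Fm [measurable]: "F : LM" using L2_meas[OF F[of 0]] by simp
 define B where "B n j y = trunc n (b y) ^ j * F y" for n j y
 have Bm [measurable]: "B n j : LM" for n j unfolding B_def by measurable
 have B_le: "\<bar>B n j y\<bar> <= 1 * \<bar>b y ^ j * F y\<bar>" for n j y
  unfolding B_def using power_mono[OF trunc_le[of n "b y"], of j] by (auto simp: abs_mult power_abs intro!: mult_right_mono)
 have B2: "L2 (B n j)" for n j by (rule L2_dominated[OF F Bm B_le])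
 define d where "d n j y = 1 * B n j y + (-1) * (b y ^ j * F y)" for n j y
 have d2: "L2 (d n j)" for n j unfolding d_def by (intro L2_add B2 F)
 note [measurable] = L2_meas[OF d2] L2_meas[OF T_L2[OF d2]] L2_meas[OF F]
 have lim: "(%n. LINT x|lebesgue. (T (d n j) x)^2) \<longlonglongrightarrow> 0" for j
 proof -
  have "(%n. LINT x|lebesgue. (d n j x)^2) \<longlonglongrightarrow> (\<integral>x. 0 \<partial>(lebesgue::'a measure))"
  proof (rule integral_dominated_convergence[where w = "%x. 4 * (b x ^ j * F x)^2"])
   show "integrable lebesgue (%x. 4 * (b x ^ j * F x)^2)" using F[of j] by (simp add: L2_def)
   show "AE x in lebesgue. (%n. (d n j x)^2) \<longlonglongrightarrow> 0"
    unfolding d_def B_def by (auto intro!: AE_I2 tendsto_eq_intros trunc_LIMSEQ)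
   show "AE x in lebesgue. norm ((d n j x)^2) <= 4 * (b x ^ j * F x)^2" for n
   proof (rule AE_I2, goal_cases)
    case (1 x)
    have "\<bar>d n j x\<bar> <= 2 * \<bar>b x ^ j * F x\<bar>" using B_le[of n j x] unfolding d_def by linarith
    hence "\<bar>d n j x\<bar>\<^sup>2 <= (2 * \<bar>b x ^ j * F x\<bar>)^2" by (rule power_mono) simp
    thus ?case by (simp add: power_mult_distrib)
   qed
  qed auto
  hence "(%n. CT * (LINT x|lebesgue. (d n j x)^2)) \<longlonglongrightarrow> 0" by (auto intro: tendsto_mult_right_zero)
  from tendsto_sandwich[OF _ _ tendsto_const this] show ?thesis
   by this (auto intro!: T_norm_integral d2 always_eventually)
 qed
 have i2: "integrable lebesgue (%x. (T (d n j) x)^2)" for n j using T_L2[OF d2] by (simp add: L2_def)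
 let ?G = "%n x. \<Sum>j\<le>m. (T (d n j) x)^2"
 have "(%n. LINT x|lebesgue. norm (?G n x)) = (%n. \<Sum>j\<le>m. LINT x|lebesgue. (T (d n j) x)^2)"
  using i2 by (simp add: sum_nonneg)
 moreover have "(%n. \<Sum>j\<le>m. LINT x|lebesgue. (T (d n j) x)^2) \<longlonglongrightarrow> (\<Sum>j\<le>m. 0)" by (intro tendsto_sum lim)
 ultimately obtain \<rho> where \<rho>: "strict_mono (\<rho>::nat => nat)" "AE x in lebesgue. (%n. ?G (\<rho> n) x) \<longlonglongrightarrow> 0"
  using tendsto_L1_AE_subseq[of lebesgue ?G] i2 by auto
 let ?A = "%x. %y. b y ^ x * F y"
 have lin: "AE x in lebesgue. T (d n j) x = 1 * T (B n j) x + (-1) * T (?A j) x" for n j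
  unfolding d_def by (rule T_lin[OF B2 F])
 have "AE x in lebesgue. ALL n j. T (d n j) x = 1 * T (B n j) x + (-1) * T (?A j) x"
  unfolding AE_all_countable using lin by blast
 with \<rho>(2) have "AE x in lebesgue. (%n. comm T (%y. trunc (\<rho> n) (b y)) m F x) \<longlonglongrightarrow> comm T b m F x"
 proof eventually_elim
  case (elim x)
  have T: "(%n. T (B (\<rho> n) j) x) \<longlonglongrightarrow> T (?A j) x" if "j <= m" for j
  proof -
   have "(%n. (T (d (\<rho> n) j) x)^2) \<longlonglongrightarrow> 0"
    by (rule tendsto_sandwich[OF _ _ tendsto_const elim(1)]) (use that in \<open>auto intro!: always_eventually member_le_sum[of j "{..m}" "%j. (T (d _ j) x)^2"]\<close>)
   from tendsto_real_sqrt[OF this] have "(%n. T (d (\<rho> n) j) x) \<longlonglongrightarrow> 0" by (simp add: tendsto_rabs_zero_iff)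
   from tendsto_add[OF this tendsto_const[of "T (?A j) x"]] show ?thesis using elim(2) by simp
  qed
  have r: "(%n. trunc (\<rho> n) (b x)) \<longlonglongrightarrow> b x" using LIMSEQ_subseq_LIMSEQ[OF trunc_LIMSEQ \<rho>(1)] by (simp add: o_def)
  show ?case unfolding comm_expansion using T r by (intro tendsto_intros) (auto simp: B_def[abs_def])
 qed
 thus ?thesis by blast
qed

text \<open>\<open>T (b f)\<close> agrees with \<open>c T f\<close>, so already the first commutator
  vanishes; this serves the case of zero BMO norm.\<close>

lemma comm_AE_const:
 assumes b: "AE x in lebesgue. b x = c" and bm [measurable]: "b : LM" and f: "L2 f"
 shows "AE x in lebesgue. comm T b (Suc k) f x = 0"
proof -
 have bf: "L2 (%y. b y * f y)" "AE x in lebesgue. T (%y. b y * f y) x = c * T f x" if f: "L2 f" for f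
 proof -
  have [measurable]: "f : LM" by (rule L2_meas[OF f])
  have cf: "L2 (%y. c * f y + 0 * f y)" by (intro L2_add f)
  have "RI (%x. (b x * f x)^2) = RI (%x. (c * f x + 0 * f x)^2)" by (rule nn_integral_cong_AE) (use b in \<open>auto elim: eventually_mono\<close>)
  thus bf: "L2 (%y. b y * f y)" using cf by (simp add: L2_iff)
  have "AE x in lebesgue. T (%y. b y * f y) x = T (%y. c * f y + 0 * f y) x" by (rule T_AE_cong[OF bf cf]) (use b in \<open>auto elim: eventually_mono\<close>)
  thus "AE x in lebesgue. T (%y. b y * f y) x = c * T f x" using T_lin[OF f f, of c 0] by eventually_elim simp
 qed
 show ?thesis using f
 proof (induction k arbitrary: f)
  case 0
  show ?case using bf(2)[OF 0] b by eventually_elim simp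
 next
  case (Suc k)
  show ?case using Suc.IH[OF Suc.prems] Suc.IH[OF bf(1)[OF Suc.prems]] by eventually_elim simp
 qed
qed

end

section \<open>Degenerate norms, Borel representatives and the final assembly\<close>

text \<open>\<open>b\<close> is constant on each neighbourhood of the origin; the constants agree
  because these sets are nested. Neighbourhoods exhaust the space, whereas the cells of the origin
  never leave one orthant.\<close>

lemma bmo_norm_0_const:
 assumes b: "in_BMO b" and n: "bmo_norm b = 0" shows "EX c. AE x in lebesgue. b (x::'a::euclidean_space) = c"
proof -
 have [measurable]: "b : LM" using b by (simp add: in_BMO_def locint_def)
 define c where "c k = (LINT y:cube_of (- int k) 0|lebesgue. b y) / measure lebesgue (cube_of (- int k) (0::'a))" for k
 have AEk: "AE x in lebesgue. x : nbhd (- int k) 0 --> b x = c k" for k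
 proof -
  let ?A = "%y. \<bar>b y - c k\<bar>"
  have "avg (cube_of (- int k) 0) ?A <= bmo_norm b" unfolding bmo_norm_def c_def by (rule SUP_upper) (simp add: is_cube_of)
  hence "RSI (nbhd (- int k) 0) ?A = 0" using n mm_pos[of "- int k", where 'a='a] ennreal_divide_le_iff[of "vol (nbhd (- int k) (0::'a))" _ 0]
   by (simp add: avg_cube_of vol_mm del: emeasure_completion)
  thus ?thesis by (subst (asm) nn_integral_0_iff_AE) (auto simp: indicator_def elim: eventually_mono)
 qed
 have ck: "c k = c 0" for k
 proof (rule ccontr)
  assume "c k ~= c 0"
  hence "AE x in lebesgue. x ~: nbhd 0 (0::'a)" using AEk[of k] AEk[of 0] nbhd_antimono[of "- int k" 0 "0::'a"] by (auto elim!: eventually_elim2)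
  hence "vol (nbhd 0 (0::'a)) = 0" by (subst (asm) AE_iff_measurable[OF nbhd_lebesgue]) auto
  thus False by (simp del: emeasure_completion)
 qed
 have "AE x in lebesgue. ALL k. x : nbhd (- int k) 0 --> b x = c k" unfolding AE_all_countable using AEk by blast
 hence "AE x in lebesgue. b x = c 0"
 proof eventually_elim
  case (elim x)
  obtain k0 where k0: "!!k. k <= k0 ==> norm x < side k" using side_big by blast
  have "x : nbhd (- int (nat (- k0))) 0" using k0[of "- int (nat (- k0))"] by (intro nbhdI_norm) auto
  thus ?case using elim ck by metis
 qed
 thus ?thesis by blast
qed

lemma AE_affine:
 fixes P :: "'a::euclidean_space => bool"
 assumes "AE x in lebesgue. f x = g x" and [measurable]: "f : LM" "g : borel_measurable borel" and \<sigma>: "\<sigma> = 1 | \<sigma> = -1"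
 shows "AE x in lebesgue. f (y + \<sigma> *\<^sub>R x) = (g (y + \<sigma> *\<^sub>R x) :: real)"
proof -
 have [measurable]: "g : LM" by (rule borel_measurable_lebesgueI) fact
 have m: "(%x. en \<bar>f x - g x\<bar>) : LM" by measurable
 have "RI (%x. \<bar>f (y + \<sigma> *\<^sub>R x) - g (y + \<sigma> *\<^sub>R x)\<bar>) = RI (%x. \<bar>f x - g x\<bar>)" by (rule nn_integral_affine_lebesgue[OF \<sigma> m])
 also have "... = 0" using assms(1) by (subst nn_integral_0_iff_AE) (auto elim: eventually_mono)
 finally show ?thesis
  using measurable_compose[OF measurable_affine_lebesgue[OF \<sigma>] m] by (subst (asm) nn_integral_0_iff_AE) (auto elim: eventually_mono)
qed

text \<open>The Luxemburg norms see \<open>K\<close> only up to null sets, so a Borel representative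
  inherits the condition.\<close>

lemma hormander_AE_cong:
 fixes K K' :: "'a::euclidean_space => real"
 assumes "AE x in lebesgue. K x = K' x" "K : LM" "K' : borel_measurable borel" "hormander \<xi> m K"
 shows "hormander \<xi> m K'"
proof -
 have "lux_ann \<xi> s (%x. K (x - y) - K x) = lux_ann \<xi> s (%x. K' (x - y) - K' x)" for s y
 proof -
  have ae: "AE x in lebesgue. K (x - y) - K x = K' (x - y) - K' x"
   using AE_affine[OF assms(1-3) disjI1[OF refl], of "- y"] assms(1) by eventually_elim simp
  have "RSI (ball 0 (2 * s)) (%x. \<xi> (\<bar>indicator {x. s < norm x & norm x <= 2 * s} x * (K (x - y) - K x)\<bar> / l) * 1)
    = RSI (ball 0 (2 * s)) (%x. \<xi> (\<bar>indicator {x. s < norm x & norm x <= 2 * s} x * (K' (x - y) - K' x)\<bar> / l) * 1)" for l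
   by (rule nn_integral_cong_AE) (use ae in \<open>eventually_elim, simp\<close>)
  thus ?thesis unfolding lux_ann_def lux_def by simp
 qed
 thus ?thesis using assms(4) unfolding hormander_def by simp
qed

text \<open>Below 1 the exponent \<open>p' + 1 - q'\<close> is at most 1 as
  \<open>p' \<le> q'\<close>; from 1 on the exponent \<open>p'\<close> is at least 1.\<close>

lemma Psi_ge: "0 <= x ==> p / (p - 1) <= q / (q - 1) ==> 1 < p ==> x <= Psi p q x"
proof (cases "x < 1")
 case True
 assume "0 <= x" "p / (p - 1) <= q / (q - 1)"
 hence "x powr 1 <= x powr (p / (p - 1) + 1 - q / (q - 1))" using True by (cases "x = 0") (simp, intro powr_mono', auto)
 thus ?thesis using True \<open>0 <= x\<close> by (simp add: Psi_def)
next
 case False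
 assume "1 < p"
 hence "x powr 1 <= x powr (p / (p - 1))" using False by (intro powr_mono) (auto simp: le_divide_eq)
 thus ?thesis using False by (simp add: Psi_def)
qed

text \<open>The source of the factor with \<open>Mmax\<close>: the reverse Hoelder condition bounds
  \<open>v\<close> by its mean over a cube, and \<open>v\<close> is at most
  \<open>\<Psi> (v)\<close>.\<close>

lemma (in wt) v_le_Mmax:
 assumes "!!y. v y <= \<Psi> (v y)"
 shows "AE x in lebesgue. en (v x) <= en C1 * Mmax (%y. \<Psi> (v y)) x"
proof -
 have "AE x in lebesgue. ALL k. en (v x) <= en C1 * (RSI (nbhd k x) v / vol (nbhd k x))"
  by (rule AE_all_nbhd[where P = "%k x z. en (v z) <= en C1 * (RSI (nbhd k x) v / vol (nbhd k x))", OF RH]) (simp add: nbhd_eq)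
 thus ?thesis
 proof eventually_elim
  case (elim x)
  have "RSI (nbhd 0 x) v / vol (nbhd 0 x) = avg (cube_of 0 x) v" by (simp add: avg_cube_of)
  also have "... <= avg (cube_of 0 x) (%y. \<bar>\<Psi> (v y)\<bar>)"
   unfolding avg_def using assms by (intro divide_right_mono_ennreal nn_integral_mono mult_right_mono ennreal_leI order_trans[OF assms abs_ge_self]) auto
  also have "... <= Mmax (%y. \<Psi> (v y)) x" unfolding Mmax_def by (rule SUP_upper) (simp add: is_cube_of cube_of_self)
  finally show ?case using elim by (meson mult_left_mono order_trans zero_le)
 qed
qed

lemma (in czv) NN_le_Mlux: "NN u x <= Mlux \<theta> w u x"
 unfolding NN_def
proof (rule SUP_least, goal_cases)
 case (1 k)
 have "lux \<theta> w (nbhd k x) u = lux \<theta> w (cube_of k x) u" unfolding lux_def SI_cube_of ..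
 also have "... <= Mlux \<theta> w u x" unfolding Mlux_def by (rule SUP_upper) (simp add: is_cube_of cube_of_self)
 finally show ?case .
qed

theorem theorem1p2:
  fixes m :: nat
    and \<xi> \<zeta> \<xi>t \<eta> \<phi> :: "real \<Rightarrow> real"
    and r s p lam0 :: real
    and T :: "('a::euclidean_space \<Rightarrow> real) \<Rightarrow> ('a \<Rightarrow> real)"
    and K u v b :: "'a \<Rightarrow> real"
  assumes young_xi: "young \<xi>" and young_zeta: "young \<zeta>"
    and young_xit: "young \<xi>t" and xit_def: "\<forall>t\<ge>0. ereal (\<xi>t t) = ytilde \<xi> t"
    and upper: "upper_type \<xi>t r" and lower: "lower_type \<xi>t s"
    and sr: "1 < s" "s < r" "r < 2"
    and lam0: "lam0 \<ge> exp 1"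
    and xi_zeta: "\<exists>C. \<forall>lam\<ge>lam0. yinv \<xi>t lam * yinv \<zeta> lam * (ln lam) ^ m \<le> C * lam"
    and T_bdd: "\<exists>C. \<forall>f. L2 f \<longrightarrow> L2 (T f) \<and>
                  (\<integral>x. (T f x)\<^sup>2 \<partial>lebesgue) \<le> C * (\<integral>x. (f x)\<^sup>2 \<partial>lebesgue)"
    and T_lin: "\<forall>f g a c. L2 f \<longrightarrow> L2 g \<longrightarrow>
                  (AE x in lebesgue. T (\<lambda>y. a * f y + c * g y) x = a * T f x + c * T g x)"
    and K_meas: "K \<in> borel_measurable lebesgue"
    and T_rep: "\<forall>f. L2 f \<and> compact (supp f) \<longrightarrow>
                  (AE x in lebesgue. x \<notin> supp f \<longrightarrow>
                     integrable lebesgue (\<lambda>y. K (x - y) * f y) \<and>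
                     T f x = (\<integral>y. K (x - y) * f y \<partial>lebesgue))"
    and K_H: "hormander \<zeta> 0 K" "hormander \<xi> m K"
    and p: "r < p" "p < r / (r - 1)"
    and young_eta: "young \<eta>" and young_phi: "young \<phi>"
    and eta_B: "B_cond (p / (p - 1)) \<eta>"
    and eta_phi: "\<exists>C. \<forall>lam\<ge>lam0. yinv \<eta> lam * yinv \<phi> lam \<le> C * yinv \<xi>t lam"
    and u: "locint u" "\<forall>x. 0 \<le> u x"
    and v: "weight v" "RHinf v" "Aq (1 + (p - 1) / r) v"
    and b: "in_BMO b"
  shows "\<exists>C>0. \<forall>t>0. \<forall>f. f \<in> borel_measurable lebesgue \<and> bounded (range f) \<and> compact (supp f) \<longrightarrow>
     (\<integral>\<^sup>+x\<in>{x. \<bar>comm T b m (\<lambda>y. f y * v y) x\<bar> / v x > t}. ennreal (u x * v x) \<partial>lebesgue)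
     \<le> ennreal C * (\<integral>\<^sup>+x. ennreal (Phi m (enn2real (bmo_norm b) ^ m * \<bar>f x\<bar> / t))
            * Mlux (\<lambda>lam. \<phi> (lam powr (1 / p)))
                   (\<lambda>y. v y powr (1 - (1 + (p - 1) / r) / ((1 + (p - 1) / r) - 1))) u x
            * Mmax (\<lambda>y. Psi p (1 + (p - 1) / r) (v y)) x \<partial>lebesgue)"
proof -
 define e where "e = (p - 1) / r"
 \<comment> \<open>At least 1, hence positive even when the BMO norm vanishes.\<close>
 define \<beta> where "\<beta> = max 1 (enn2real (bmo_norm b))"
 have e: "0 < e" using sr p by (simp add: e_def)
 have "bmo_norm b = en (enn2real (bmo_norm b))" using b by (simp add: in_BMO_def)
 also have "... <= en \<beta>" unfolding \<beta>_def by (intro ennreal_leI) simp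
 finally have \<beta>: "0 < \<beta>" "bmo_norm b <= en \<beta>" by (simp_all add: \<beta>_def)
 obtain C1 C2 where "wt v e C1 C2" using wtI[OF v(1,2) v(3)[folded e_def] e] by blast
 then interpret W: wt v e C1 C2 .
 let ?D = "%y. LINT x|lebesgue. (T y x)^2"
 obtain CT where CT: "!!f. L2 f ==> L2 (T f) & (?D f) <= CT * (LINT x|lebesgue. (f x)^2)" using T_bdd by blast
 \<comment> \<open>A Borel representative of the kernel; the representation and the Hoermander
   condition carry over because only null sets change.\<close>
 obtain K' where K'_lborel: "K' : borel_measurable lborel" "AE x in lborel. K x = K' x"
  using completion_ex_borel_measurable_real[OF K_meas] by blast
 hence K': "K' : borel_measurable borel" "AE x in lebesgue. K x = K' x" by (simp, intro AE_completion)
 have K'_H: "hormander \<xi> m K'" by (rule hormander_AE_cong[OF K'(2) K_meas K'(1) K_H(2)])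
 have yi: "t * s <= \<xi> s + \<xi>t t" if "0 <= s" "0 <= t" for s t
 proof -
  have "ereal (t * s - \<xi> s) <= ytilde \<xi> t" unfolding ytilde_def using that by (intro SUP_upper) auto
  also have "ytilde \<xi> t = ereal (\<xi>t t)" using xit_def that by simp
  finally show ?thesis by simp
 qed
 obtain J where J: "1 <= J" and ker: "!!\<theta>. submult \<xi>t \<theta> ==> \<exists>C>0. kernel_bd K' \<beta> m J \<theta> C"
  using kernel_bmo[OF K'(1) K'_H young_xi young_xit yi \<beta>(1)] by blast
 obtain \<kappa> Ch where ka: "1 < \<kappa>" "\<kappa> <= r" "0 < Ch" and xk: "!!x. 0 <= x ==> x powr \<kappa> <= Ch * (1 + \<phi> (x powr (1 / p)))" and sm: "submult \<xi>t (%x. \<phi> (x powr (1 / p)))"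
  using theta_bounds[OF young_xit young_eta young_phi lower sr(1,2) p eta_B eta_phi] by blast
 \<comment> \<open>Solves \<open>(1 - p0) \<kappa> = - 1 / e\<close>. Then \<open>p0 > r\<close>
   amounts to \<open>(r - 1) (p - 1) \<kappa> < r\<close>, which follows from \<open>p < r'\<close>
   and \<open>\<kappa> \<le> r\<close>.\<close>
 define p0 where "p0 = 1 + 1 / (e * \<kappa>)"
 have "(r - 1) * (p - 1) < 1"
  using p sr by (simp add: field_simps)
 hence "(r - 1) * (p - 1) * \<kappa> < r" using ka sr p mult_less_le_imp_less[of "(r - 1) * (p - 1)" 1 \<kappa> r] by simp
 hence p0: "r < p0" using sr p ka by (simp add: p0_def e_def field_simps)
 interpret Z: czv T "max 1 CT" K' \<xi>t m J \<beta> r v e C1 C2 "%x. \<phi> (x powr (1 / p))" \<kappa> p0 Ch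
 proof
  show "L2 (T f)" if "L2 f" for f using CT[OF that] by simp
  show "RI (%x. (T f x)^2) <= en (max 1 CT) * RI (%x. (f x)^2)" if f: "L2 f" for f
  proof -
   have "(?D f) <= max 1 CT * (LINT x|lebesgue. (f x)^2)"
    by (rule order_trans[OF conjunct2[OF CT[OF f]] mult_right_mono]) auto
   moreover have "integrable lebesgue (%x. (f x)^2)" "integrable lebesgue (%x. (T f x)^2)" using f CT[OF f] by (auto simp: L2_def)
   ultimately show ?thesis by (simp add: nn_integral_eq_integral ennreal_mult[symmetric] ennreal_leI)
  qed
  show "AE x in lebesgue. x ~: supp f --> integrable lebesgue (%y. K' (x - y) * f y) & T f x = (LINT y|lebesgue. K' (x - y) * f y)" if f: "LB f" for f
  proof -
   obtain R where R: "!!x. R < norm x ==> f x = 0" using f by (auto simp: LB_def)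
   have [measurable]: "f : LM" using f by (simp add: LB_def L2_def)
   have "{x. f x ~= 0} <= cball 0 R" using R by (auto simp: not_less[symmetric])
   hence "compact (supp f)" unfolding supp_def compact_closure by (rule bounded_subset[OF bounded_cball])
   hence "AE x in lebesgue. x ~: supp f --> integrable lebesgue (%y. K (x - y) * f y) & T f x = (LINT y|lebesgue. K (x - y) * f y)"
    using T_rep LB_L2[OF f] by blast
   thus ?thesis
   proof eventually_elim
    case (elim x)
    have ae: "AE y in lebesgue. K (x - y) * f y = K' (x - y) * f y"
     using AE_affine[OF K'(2) K_meas K'(1) disjI2[OF refl], of x] by eventually_elim simp
    have "(%y. K' (x - y)) : LM" by (rule borel_measurable_lebesgueI, rule measurable_compose[OF _ K'(1)]) measurable
    hence m: "(%y. K' (x - y) * f y) : LM" by measurable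
    have "integrable lebesgue (%y. K' (x - y) * f y) & (LINT y|lebesgue. K (x - y) * f y) = (LINT y|lebesgue. K' (x - y) * f y)"
     if i: "integrable lebesgue (%y. K (x - y) * f y)"
     using integrable_cong_AE_imp[OF i m] integral_cong_AE[OF borel_measurable_integrable[OF i] m ae] ae by (auto elim: eventually_mono)
    thus ?case using elim by simp
   qed
  qed
  show "submult \<xi>t (%x. x powr a)" if "r < a" for a by (rule upper_type_submult[OF young_xit upper _ that]) (use sr in simp)
 qed (use T_lin K' \<beta> J sr ker sm xk ka p0 e young_0[OF young_phi] in \<open>auto simp: p0_def\<close>)
 have [measurable]: "b : LM" and um [measurable]: "u : LM" using b u by (auto simp: in_BMO_def locint_def)
 have uU: "u : Z.UU" using u um by (simp add: Z.UU_def)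
 define D where "D = enn2real (bmo_norm b) ^ m"
 have ex: "1 - (1 + (p - 1) / r) / (1 + (p - 1) / r - 1) = - 1 / e" using e by (simp add: e_def[symmetric] field_simps)
 let ?\<Psi> = "Psi p (1 + (p - 1) / r)"
 let ?N = "Mlux (%lam. \<phi> (lam powr (1 / p))) W.w u" and ?M = "Mmax (%y. ?\<Psi> (v y))"
 have vM: "AE x in lebesgue. en (v x) <= en C1 * ?M x"
 proof (rule W.v_le_Mmax)
  have "p / (p - 1) = 1 + 1 / (p - 1)" "(1 + (p - 1) / r) / (1 + (p - 1) / r - 1) = 1 + r / (p - 1)"
   using sr p by (simp_all add: field_simps)
  thus "v y <= ?\<Psi> (v y)" for y using sr p by (intro Psi_ge W.v0) (auto simp: divide_right_mono)
 qed
 have LBf: "EX M R. (ALL x. \<bar>f x\<bar> <= M) & (ALL x. R < norm x --> f x = 0)" if f: "bounded (range f)" "compact (supp f)" for f :: "'a => real"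
 proof -
  obtain M where M: "!!x. \<bar>f x\<bar> <= M" using f(1) by (auto simp: bounded_iff)
  obtain R where "!!x. x : supp f ==> norm x <= R" using f(2) compact_imp_bounded by (metis bounded_iff)
  hence "f x = 0" if "R < norm x" for x using that closure_subset[of "{x. f x ~= 0}"] by (force simp: supp_def)
  thus ?thesis using M by blast
 qed
 show ?thesis
 proof (cases "0 < D")
  \<comment> \<open>Here \<open>m > 0\<close> and the BMO norm is 0, so \<open>b\<close> is constant
    almost everywhere and the left-hand side vanishes.\<close>
  case False
  have D: "enn2real (bmo_norm b) = 0" using False zero_less_power[of "enn2real (bmo_norm b)" m] enn2real_nonneg[of "bmo_norm b"] unfolding D_def by linarith
  have m: "m ~= 0" using False unfolding D_def by (intro notI) simp
  have "bmo_norm b = 0" using D b by (auto simp: in_BMO_def enn2real_eq_0_iff)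
  from bmo_norm_0_const[OF b this] obtain c where c: "AE x in lebesgue. b x = c" by blast
  have "(\<integral>\<^sup>+x\<in>{x. \<bar>comm T b m (%y. f y * v y) x\<bar> / v x > t}. en (u x * v x) \<partial>lebesgue) = 0"
   if t: "0 < t" and f: "f : LM" "bounded (range f)" "compact (supp f)" for t f
  proof -
   obtain M R where MR: "!!x. \<bar>f x\<bar> <= M" "!!x. R < norm x ==> f x = 0" using LBf[OF f(2,3)] by blast
   let ?C = "%y. f y * v y"
   have "L2 ?C" using LB_L2[OF W.LB_BMO_power[where M = M and R = R and j = 0, OF b f(1) MR]] by simp
   from Z.comm_AE_const[OF c _ this, of "m - 1"] have "AE x in lebesgue. comm T b m ?C x = 0" using m by simp
   hence "AE x in lebesgue. en (u x * v x) * indicator {x. \<bar>comm T b m ?C x\<bar> / v x > t} x = 0"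
    by eventually_elim (use t in simp)
   from nn_integral_cong_AE[OF this] show ?thesis by simp
  qed
  thus ?thesis by (intro exI[of _ 1]) simp
 next
  case True
  obtain C where C: "C > 0" and weak: "!!b u f t. bmo_bd \<beta> b ==> u : Z.UU ==> f : LM ==> LB (%y. f y * v y) ==> 0 < t ==>
    RSI {x. t * v x < \<bar>comm T b m (%y. f y * v y) x\<bar>} (%x. u x * v x) <= en C * NI (%x. en (Phi m (\<bar>f x\<bar> / t) * v x) * Z.NN u x)"
   using Z.weighted_weak_comm by blast
  \<comment> \<open>The weak bound has no norm of \<open>b\<close> inside \<open>Phi\<close>; as
    \<open>D\<close> is fixed and positive, it is inserted at the price of a constant.\<close>
  obtain C3 where C3: "C3 > 0" "!!x. 0 <= x ==> Phi m (max 1 (1 / D) * x) <= C3 * Phi m x" using Phi_scale[of "max 1 (1 / D)" m] by auto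
  let ?B = "%x. en (u x * v x)"
  have "(\<integral>\<^sup>+x\<in>{x. \<bar>comm T b m (%y. f y * v y) x\<bar> / v x > t}. ?B x \<partial>lebesgue)
     <= en (C * C3 * C1) * NI (%x. en (Phi m (D * \<bar>f x\<bar> / t)) * ?N x * ?M x)"
   if t: "0 < t" and f: "f : LM" "bounded (range f)" "compact (supp f)" for t f
  proof -
   obtain M R where MR: "!!x. \<bar>f x\<bar> <= M" "!!x. R < norm x ==> f x = 0" using LBf[OF f(2,3)] by blast
   let ?F = "%y. f y * v y"
   have L: "LB (%y. b y ^ j * ?F y)" for j by (rule W.LB_BMO_power[OF b f(1) MR])
   have LF: "LB ?F" using L[of 0] by simp
   note [measurable] = f(1) W.vm Z.NN_measurable[of u]
   let ?A = "%x. Phi m (D * \<bar>f x\<bar> / t)"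
   have [measurable]: "(%x. ?A x) : LM" by (intro Phi_measurable) measurable
   obtain \<rho> :: "nat => nat" where \<rho>: "AE x in lebesgue. (%n. comm T (%y. trunc (\<rho> n) (b y)) m ?F x) \<longlonglongrightarrow> comm T b m ?F x"
    using Z.comm_trunc_subseq[where F = ?F and m = m, OF _ LB_L2[OF L]] by auto
   \<comment> \<open>Level sets of the truncated commutators. A strict inequality in the limit
     persists eventually along the subsequence, so Fatou's lemma transfers the weak bound to
     \<open>b\<close>.\<close>
   define S where "S n = {x. t * v x < \<bar>comm T (%y. trunc (\<rho> n) (b y)) m ?F x\<bar>}" for n
   have bd: "bmo_bd \<beta> (%x. trunc n (b x))" for n by (rule trunc_bmo_bd[OF b \<beta>(2)])
   have [measurable]: "S n : sets lebesgue" for n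
    unfolding S_def by (intro sets_less_lebesgue borel_measurable_times borel_measurable_abs W.vm borel_measurable_const L2_meas[OF Z.L2_comm] Z.bdm_bd[OF bd] LB_L2 LF)
   have "(\<integral>\<^sup>+x\<in>{x. \<bar>comm T b m ?F x\<bar> / v x > t}. ?B x \<partial>lebesgue) <= NI (%x. liminf (%n. ?B x * indicator (S n) x))"
   proof (rule nn_integral_mono_AE, use \<rho> W.vp in eventually_elim)
    case (elim x)
    show ?case
    proof (cases "\<bar>comm T b m ?F x\<bar> / v x > t")
     case True
     hence "t * v x < \<bar>comm T b m ?F x\<bar>" using elim(2) by (simp add: less_divide_eq)
     from order_tendstoD(1)[OF tendsto_rabs[OF elim(1)] this] have "\<forall>\<^sub>F n in sequentially. ?B x <= ?B x * indicator (S n) x"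
      by eventually_elim (simp add: S_def)
     thus ?thesis using True by (simp add: Liminf_bounded)
    qed simp
   qed
   also have "... <= liminf (%n. RSI (S n) (%x. u x * v x))" by (rule nn_integral_liminf) (use W.vm in measurable)
   also have "... <= en C * NI (%x. en (Phi m (\<bar>f x\<bar> / t) * v x) * Z.NN u x)"
    unfolding S_def by (intro Liminf_le always_eventually allI weak bd uU f LF t) simp
   also have "... <= en C * NI (%x. en (C3 * C1) * (en (?A x * (v x / C1)) * Z.NN u x))"
   proof (intro mult_left_mono nn_integral_mono, goal_cases)
    case (1 x)
    have "Phi m (\<bar>f x\<bar> / t) <= Phi m (max 1 (1 / D) * (D * \<bar>f x\<bar> / t))"
     using True t mult_right_mono[of "1 / D" "max 1 (1 / D)" "D * \<bar>f x\<bar> / t"] by (intro Phi_mono) auto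
    also have "... <= C3 * ?A x" using True t by (intro C3) auto
    finally have "Phi m (\<bar>f x\<bar> / t) * v x <= C3 * ?A x * v x" by (intro mult_right_mono W.v0)
    also have "... = C3 * C1 * (?A x * (v x / C1))" using W.par by simp
    finally show ?case
     using C3(1) W.par by (simp only: mult.assoc[symmetric] ennreal_mult'[symmetric] mult_nonneg_nonneg less_imp_le) (intro mult_right_mono ennreal_leI, auto)
   qed simp
   also have "... = en (C * C3 * C1) * NI (%x. en (?A x * (v x / C1)) * Z.NN u x)"
    using C C3(1) W.par by (subst nn_integral_cmult, measurable) (simp add: ennreal_mult mult.assoc)
   also have "... <= en (C * C3 * C1) * NI (%x. en (?A x) * ?N x * ?M x)"
   proof (intro mult_left_mono nn_integral_mono_AE, use vM in eventually_elim)
    case (elim x)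
    have n: "0 <= ?A x" using t True by (auto intro!: Phi_nonneg)
    have "en (v x / C1) <= ?M x" using elim W.par W.v0[of x]
     by (simp add: divide_ennreal[symmetric] ennreal_divide_le_iff mult.commute)
    hence "en (?A x) * en (v x / C1) * Z.NN u x <= en (?A x) * ?M x * ?N x"
     by (intro mult_mono mult_left_mono Z.NN_le_Mlux) auto
    thus ?case using n W.par W.v0[of x] by (subst ennreal_mult) (auto simp: mult_ac)
   qed simp
   finally show ?thesis .
  qed
  thus ?thesis using C C3 W.par unfolding D_def W.w_def[abs_def] ex by (intro exI[of _ "C * C3 * C1"]) auto
 qed
qed

end
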